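(* Let $R>0$ be fixed. There exist constants $\Omega>0$ and $\varepsilon>0$ depending only on $R$ such that, for every $(Q,h,H)\in\mathcal P_R$ and every choice of spectral data $\{\lambda_u,v_u\}_{u\in J}$ of the problem $\mathcal L(Q,h,H)$, with $\rho_u=\sqrt{\lambda_u}$ and with $V_n$ the $(m\times m)$ matrix with columns $v_{n1},\dots,v_{nm}$, the following hold. (1) $\rho_{nk}=n-1+\dfrac{\varkappa_{nk}}{n}$ and $V_n^*V_n=\dfrac{2}{\pi}I_m+\dfrac{K_n}{n}$ for $n\ge1$, $k=1,\dots,m$, where $\|\{\varkappa_{nk}\}\|_{l_2}\le\Omega$ and $\|\{K_n\}\|_{l_2(\mathbb C^{m\times m})}\le\Omega$. (2) $\{v_u\cos(\rho_u x)\}_{u\in J}$ is a Riesz basis in $L_2((0,\pi);\mathbb C^m)$ and, for any $\{a_u\}_{u\in J}\in l_2$, $$\Bigl\|\sum_{u\in J}a_uv_u\cos(\rho_ux)\Bigr\|_{L_2}\ge\varepsilon\,\|\{a_u\}\|_{l_2}.$$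
   Context: Fix an integer $m\ge1$ (constants may depend on $m$). $\mathbb C^{m\times m}$ carries the operator norm. $L_2((0,\pi);\mathbb C^m)$ is the usual Hilbert space; for matrix functions $A=[a_{jk}]$, $\|A\|_{L_2}=\sum_{j,k}\|a_{jk}\|_{L_2(0,\pi)}$. For matrix sequences, $\|\{K_n\}\|_{l_2(\mathbb C^{m\times m})}=(\sum_{n\ge1}\|K_n\|^2)^{1/2}$. $\mathcal L(Q,h,H)$ is the boundary value problem $-Y''+Q(x)Y=\lambda Y$, $x\in(0,\pi)$, $Y'(0)-hY(0)=0$, $Y'(\pi)+HY(\pi)=0$, for column vector functions $Y$ of size $m$. $\mathcal P$ is the set of triples $(Q,h,H)\in L_2((0,\pi);\mathbb C^{m\times m})\times\mathbb C^{m\times m}\times\mathbb C^{m\times m}$ with $Q(x)=Q^*(x)$ a.e., $h=h^*$, $H=H^*$, and $h+H+\frac12\int_0^\pi Q(x)\,dx=0_m$. $\mathcal P_R$ is the set of $(Q,h,H)\in\mathcal P$ with $\|Q\|_{L_2}+\|h\|+\|H\|\le R$. $J=\{(n,k):n\in\mathbb N,\ k=1,\dots,m\}$ is ordered lexicographically. For $(Q,h,H)\in\mathcal P$ the problem is self-adjoint with a countable set of real eigenvalues, numbered with multiplicities in non-decreasing order as $\{\lambda_u\}_{u\in J}$ ($\lambda_u\le\lambda_w$ if $u<w$). Let $\{Y_u\}_{u\in J}$ be an orthonormal basis of $L_2((0,\pi);\mathbb C^m)$ consisting of eigenfunctions, $Y_u$ corresponding to $\lambda_u$; the norming vectors are $v_u:=Y_u(0)\in\mathbb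 C^m$ (for any such choice of basis). $\{\lambda_u,v_u\}_J$ are called the spectral data of the problem. The square root branch is $\arg\sqrt\lambda\in(-\frac\pi2,\frac\pi2]$. *)

theory Defs
  imports "HOL-Analysis.Analysis" "HOL-Library.Function_Algebras"
begin

text \<open>
  The size \<open>m \<ge> 1\<close> of the problem is \<open>CARD('n)\<close>, where \<open>'n :: {finite, linorder}\<close> plays the
  role of the ordered index set \<open>{1, ..., m}\<close>; vectors are \<open>complex^'n\<close> (with the Euclidean norm)
  and matrices \<open>complex^'n^'n\<close>. Elements of \<open>L\<^sub>2\<close> are represented by functions on the reals that
  are only looked at on the open interval \<open>(0, pi)\<close>, and equality in \<open>L\<^sub>2\<close> is equality almost
  everywhere.
\<close>

subsection \<open>Matrices\<close>

type_synonym 'n cvec = "(complex, 'n) vec"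
type_synonym 'n cmat = "'n cvec^'n"

definition adjoint_mat :: "complex^'n^'n \<Rightarrow> complex^'n^'n" where
  "adjoint_mat A = map_matrix cnj (transpose A)"

definition op_norm :: "complex^'n^'n \<Rightarrow> real" where
  "op_norm A = onorm (\<lambda>x. A *v x)"

subsection \<open>The spaces \<open>l\<^sub>2\<close> and \<open>L\<^sub>2(0, pi)\<close>\<close>

definition in_l2 :: "('i \<Rightarrow> 'a::real_normed_vector) \<Rightarrow> 'i set \<Rightarrow> bool" where
  "in_l2 a I \<longleftrightarrow> (\<lambda>i. (norm (a i))\<^sup>2) summable_on I"

definition l2_norm :: "('i \<Rightarrow> 'a::real_normed_vector) \<Rightarrow> 'i set \<Rightarrow> real" where
  "l2_norm a I = sqrt (\<Sum>\<^sub>\<infinity>i\<in>I. (norm (a i))\<^sup>2)"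

abbreviation M_pi :: "real measure" where
  "M_pi \<equiv> lebesgue_on {0<..<pi}"

definition in_L2 :: "(real \<Rightarrow> 'a::real_normed_vector) \<Rightarrow> bool" where
  "in_L2 f \<longleftrightarrow> f \<in> borel_measurable M_pi
     \<and> integrable M_pi (\<lambda>x. (norm (f x))\<^sup>2)"

definition L2_norm :: "(real \<Rightarrow> 'a::real_normed_vector) \<Rightarrow> real" where
  "L2_norm f = sqrt (\<integral>x. (norm (f x))\<^sup>2 \<partial>M_pi)"

definition L2_eq :: "(real \<Rightarrow> 'a) \<Rightarrow> (real \<Rightarrow> 'a) \<Rightarrow> bool" where
  "L2_eq f g \<longleftrightarrow> (AE x in M_pi. f x = g x)"

definition L2_inner :: "(real \<Rightarrow> complex^'n) \<Rightarrow> (real \<Rightarrow> complex^'n) \<Rightarrow> complex" where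
  "L2_inner f g = (\<integral>x. (\<Sum>i\<in>UNIV. cnj (f x $ i) * (g x $ i)) \<partial>M_pi)"

definition L2_mat_norm :: "(real \<Rightarrow> complex^'n^'n) \<Rightarrow> real" where
  "L2_mat_norm A = (\<Sum>j\<in>UNIV. \<Sum>k\<in>UNIV. L2_norm (\<lambda>x. A x $ j $ k))"

text \<open>Unconditional convergence of a series in the norm of \<open>L\<^sub>2\<close>.\<close>

definition L2_has_sum ::
    "('i \<Rightarrow> real \<Rightarrow> 'a::real_normed_vector) \<Rightarrow> (real \<Rightarrow> 'a) \<Rightarrow> 'i set \<Rightarrow> bool" where
  "L2_has_sum f S I \<longleftrightarrow> in_L2 S \<and> (\<forall>i\<in>I. in_L2 (f i))
     \<and> ((\<lambda>F. L2_norm (\<lambda>x. S x - (\<Sum>i\<in>F. f i x))) \<longlongrightarrow> 0) (finite_subsets_at_top I)"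

definition L2_orthonormal_basis :: "('i \<Rightarrow> real \<Rightarrow> complex^'n) \<Rightarrow> 'i set \<Rightarrow> bool" where
  "L2_orthonormal_basis e I \<longleftrightarrow> (\<forall>i\<in>I. in_L2 (e i))
     \<and> (\<forall>i\<in>I. \<forall>j\<in>I. L2_inner (e i) (e j) = (if i = j then 1 else 0))
     \<and> (\<forall>f. in_L2 f \<longrightarrow> L2_has_sum (\<lambda>i x. L2_inner (e i) f *s e i x) f I)"

text \<open>
  Bounded linear operators in \<open>L\<^sub>2\<close>. Linearity and boundedness force \<open>T\<close> to respect
  equality almost everywhere.
\<close>

definition L2_operator :: "((real \<Rightarrow> complex^'n) \<Rightarrow> real \<Rightarrow> complex^'n) \<Rightarrow> bool" where
  "L2_operator T \<longleftrightarrow> (\<forall>f. in_L2 f \<longrightarrow> in_L2 (T f))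
     \<and> (\<forall>f g a b. in_L2 f \<longrightarrow> in_L2 g \<longrightarrow>
          L2_eq (T (\<lambda>x. a *s f x + b *s g x)) (\<lambda>x. a *s T f x + b *s T g x))
     \<and> (\<exists>C. \<forall>f. in_L2 f \<longrightarrow> L2_norm (T f) \<le> C * L2_norm f)"

definition L2_invertible_operator ::
    "((real \<Rightarrow> complex^'n) \<Rightarrow> real \<Rightarrow> complex^'n) \<Rightarrow> bool" where
  "L2_invertible_operator T \<longleftrightarrow> L2_operator T
     \<and> (\<exists>S. L2_operator S \<and> (\<forall>f. in_L2 f \<longrightarrow> L2_eq (S (T f)) f \<and> L2_eq (T (S f)) f))"

text \<open>A Riesz basis is the image of an orthonormal basis under a boundedly invertible operator.\<close>

definition Riesz_basis :: "('i \<Rightarrow> real \<Rightarrow> complex^'n) \<Rightarrow> 'i set \<Rightarrow> bool" where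
  "Riesz_basis f I \<longleftrightarrow> (\<forall>i\<in>I. in_L2 (f i))
     \<and> (\<exists>e T. L2_orthonormal_basis e I \<and> L2_invertible_operator T
          \<and> (\<forall>i\<in>I. L2_eq (f i) (T (e i))))"

subsection \<open>The boundary value problem\<close>

text \<open>
  \<open>f\<close> belongs to the Sobolev space \<open>W\<^sub>2\<^sup>1\<close> on \<open>[0, pi]\<close> and \<open>g\<close> is its derivative: \<open>f\<close> is the
  (absolutely continuous) primitive of the square-integrable function \<open>g\<close>.
\<close>

definition has_L2_derivative :: "(real \<Rightarrow> complex^'n) \<Rightarrow> (real \<Rightarrow> complex^'n) \<Rightarrow> bool" where
  "has_L2_derivative f g \<longleftrightarrow> in_L2 g
     \<and> (\<forall>x\<in>{0..pi}. f x = f 0 + (\<integral>t. g t \<partial>lebesgue_on {0<..<x}))"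

text \<open>
  Solutions are taken in \<open>W\<^sub>2\<^sup>2\<close>: below, \<open>Z\<close> is the classical derivative \<open>Y'\<close> on \<open>[0, pi]\<close>
  (one-sided at the end points) and \<open>W\<close> is \<open>Y''\<close>.
\<close>

definition bvp_solution ::
    "(real \<Rightarrow> complex^'n^'n) \<Rightarrow> complex^'n^'n \<Rightarrow> complex^'n^'n \<Rightarrow> complex
      \<Rightarrow> (real \<Rightarrow> complex^'n) \<Rightarrow> bool" where
  "bvp_solution Q h H \<mu> Y \<longleftrightarrow> (\<exists>Z W.
     (\<forall>x\<in>{0..pi}. (Y has_vector_derivative Z x) (at x within {0..pi}))
     \<and> has_L2_derivative Z W
     \<and> (AE x in M_pi. - W x + Q x *v Y x = \<mu> *s Y x)
     \<and> Z 0 - h *v Y 0 = 0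
     \<and> Z pi + H *v Y pi = 0)"

definition eigenfunction ::
    "(real \<Rightarrow> complex^'n^'n) \<Rightarrow> complex^'n^'n \<Rightarrow> complex^'n^'n \<Rightarrow> complex
      \<Rightarrow> (real \<Rightarrow> complex^'n) \<Rightarrow> bool" where
  "eigenfunction Q h H \<mu> Y \<longleftrightarrow> bvp_solution Q h H \<mu> Y \<and> (\<exists>x\<in>{0..pi}. Y x \<noteq> 0)"

definition fun_scale :: "complex \<Rightarrow> (real \<Rightarrow> complex^'n) \<Rightarrow> real \<Rightarrow> complex^'n" where
  "fun_scale c f = (\<lambda>x. c *s f x)"

lemma vector_space_fun_scale: "vector_space (fun_scale :: _ \<Rightarrow> _ \<Rightarrow> real \<Rightarrow> complex^'n)"
  by unfold_locales
     (auto simp: fun_scale_def fun_eq_iff vec_eq_iff algebra_simps)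

text \<open>
  The complex dimension of the eigenspace (0 if \<open>\<mu>\<close> is not an eigenvalue). The normalization
  outside \<open>[0, pi]\<close> identifies solutions that agree on \<open>[0, pi]\<close>.
\<close>

definition eigenvalue_multiplicity ::
    "(real \<Rightarrow> complex^'n^'n) \<Rightarrow> complex^'n^'n \<Rightarrow> complex^'n^'n \<Rightarrow> complex \<Rightarrow> nat" where
  "eigenvalue_multiplicity Q h H \<mu> = vector_space.dim fun_scale
     {Y. bvp_solution Q h H \<mu> Y \<and> (\<forall>x. x \<notin> {0..pi} \<longrightarrow> Y x = 0)}"

subsection \<open>The classes \<open>P\<close> and \<open>P\<^sub>R\<close>\<close>

definition class_P ::
    "((real \<Rightarrow> complex^'n^'n) \<times> (complex^'n^'n) \<times> (complex^'n^'n)) set" where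
  "class_P = {(Q, h, H).
     (\<forall>j k. in_L2 (\<lambda>x. Q x $ j $ k))
     \<and> (AE x in M_pi. Q x = adjoint_mat (Q x))
     \<and> h = adjoint_mat h \<and> H = adjoint_mat H
     \<and> h + H + (1/2) *\<^sub>R (\<integral>x. Q x \<partial>M_pi) = 0}"

definition class_PR ::
    "real \<Rightarrow> ((real \<Rightarrow> complex^'n^'n) \<times> (complex^'n^'n) \<times> (complex^'n^'n)) set" where
  "class_PR R = {(Q, h, H) \<in> class_P. L2_mat_norm Q + op_norm h + op_norm H \<le> R}"

subsection \<open>Spectral data\<close>

definition index_J :: "(nat \<times> 'n::{finite,linorder}) set" where
  "index_J = {1..} \<times> UNIV"

definition lex_less :: "nat \<times> 'n::{finite,linorder} \<Rightarrow> nat \<times> 'n \<Rightarrow> bool" where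
  "lex_less u w \<longleftrightarrow> fst u < fst w \<or> fst u = fst w \<and> snd u < snd w"

definition eigenvalue_numbering ::
    "(real \<Rightarrow> 'n cmat) \<Rightarrow> 'n cmat \<Rightarrow> 'n cmat
      \<Rightarrow> (nat \<times> 'n::{finite,linorder} \<Rightarrow> real) \<Rightarrow> bool" where
  "eigenvalue_numbering Q h H lam \<longleftrightarrow>
     (\<forall>\<mu>. card {u \<in> index_J. complex_of_real (lam u) = \<mu>} = eigenvalue_multiplicity Q h H \<mu>)
     \<and> (\<forall>u\<in>index_J. \<forall>w\<in>index_J. lex_less u w \<longrightarrow> lam u \<le> lam w)"

definition spectral_data ::
    "(real \<Rightarrow> 'n cmat) \<Rightarrow> 'n cmat \<Rightarrow> 'n cmat
      \<Rightarrow> (nat \<times> 'n::{finite,linorder} \<Rightarrow> real) \<Rightarrow> (nat \<times> 'n \<Rightarrow> 'n cvec) \<Rightarrow> bool" where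
  "spectral_data Q h H lam v \<longleftrightarrow> eigenvalue_numbering Q h H lam
     \<and> (\<exists>Y. L2_orthonormal_basis Y index_J
          \<and> (\<forall>u\<in>index_J. eigenfunction Q h H (complex_of_real (lam u)) (Y u) \<and> v u = Y u 0))"

text \<open>\<open>V\<^sub>n\<close>, the matrix with columns \<open>v (n, k)\<close>.\<close>

definition V_mat :: "(nat \<times> 'n \<Rightarrow> complex^'n) \<Rightarrow> nat \<Rightarrow> complex^'n^'n" where
  "V_mat v n = (\<chi> i k. v (n, k) $ i)"

text \<open>
  Square roots are taken with \<open>csqrt\<close>, whose values have argument in \<open>(- pi/2, pi/2]\<close>; they are
  complex, since finitely many eigenvalues may be negative.
\<close>

definition rho :: "(nat \<times> 'n \<Rightarrow> real) \<Rightarrow> nat \<times> 'n \<Rightarrow> complex" where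
  "rho lam u = csqrt (complex_of_real (lam u))"

definition cos_system ::
    "(nat \<times> 'n \<Rightarrow> real) \<Rightarrow> (nat \<times> 'n \<Rightarrow> complex^'n) \<Rightarrow> nat \<times> 'n \<Rightarrow> real \<Rightarrow> complex^'n" where
  "cos_system lam v u = (\<lambda>x. cos (rho lam u * complex_of_real x) *s v u)"

end

theory Submission
  imports Defs
begin

text \<open>
  The Volterra integral equation and d'Alembert's formula compare a finite combination \<open>g\<close> of the
  eigenfunctions \<open>Y u\<close> with the same combination \<open>f\<close> of the functions \<open>cos (rho u * x) Y u 0\<close>:
  pointwise, \<open>\<bar>g x - f x\<bar>\<close> is at most a constant times the \<open>L\<^sub>2\<close> norm of \<open>g\<close> on \<open>[0, x]\<close>. In a
  norm with an exponential weight the two systems are therefore so close that a Neumann series gives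
  the invertible operator mapping one to the other, with a uniform lower bound; no transformation
  kernel is needed. The same comparison bounds the norming vectors and, with Green's formula, the
  eigenvalues from below.

  The number of eigenvalues below \<open>(N + 1/2)\<^sup>2\<close> is found by two dimension counts. A combination of
  the corresponding eigenfunctions that is orthogonal to \<open>cos (j x)\<close> for all \<open>j \<le> N\<close> has cosine
  coefficients of size \<open>O(1/j)\<close> for \<open>j > N\<close>, hence is too small by Parseval's identity; conversely a
  cosine polynomial of degree \<open>N\<close> orthogonal to these eigenfunctions is too small by Parseval's
  identity for the eigenfunctions. Testing the equation with \<open>cos (j x)\<close> and \<open>(x - pi) sin (j x)\<close>
  then expresses the remainders through Fourier coefficients of \<open>Q\<close>, which are square summable by
  Bessel's inequality.
\<close>

subsection \<open>The seminormed space of square-integrable functions\<close>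

text \<open>Uniformity over the class shapes the proof: every estimate carries an explicit constant
  in \<open>R\<close> and the dimension. The numbering of the eigenvalues is global, so the index
  \<open>(n, k)\<close> belongs to the frequency \<open>n - 1\<close> only if the number of
  eigenvalues below \<open>(N + 1/2)\<^sup>2\<close> is known exactly for every \<open>N\<close>
  beyond a threshold that depends on \<open>R\<close> and the dimension alone. Both counts are
  therefore quantitative. The finitely many indices below the threshold need nothing but bounds, and
  this is the purpose of the lower bound for the eigenvalues. A second obstacle is accuracy. An
  eigenfunction near the frequency \<open>j\<close> agrees with \<open>cos (j * x)\<close> times its
  initial value only up to order \<open>1 / j\<close>. Such an error makes the rescaled remainders
  bounded, which is not enough for square summability. They are extracted from moment identities
  instead, in which the approximation error is multiplied by a further small factor and the leading
  terms cancel by the condition on \<open>h\<close>, \<open>H\<close> and the mean of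
  \<open>Q\<close>.\<close>

lemma in_L2_measurable: "in_L2 f \<Longrightarrow> f \<in> borel_measurable M_pi"
  by (simp add: in_L2_def)

lemma in_L2_integrable: "in_L2 f \<Longrightarrow> integrable M_pi (\<lambda>x. (norm (f x))\<^sup>2)"
  by (simp add: in_L2_def)

lemma L2_norm_nonneg [simp]: "0 \<le> L2_norm f"
  by (simp add: L2_norm_def)

lemma L2_norm_power2: "(L2_norm f)\<^sup>2 = (\<integral>x. (norm (f x))\<^sup>2 \<partial>M_pi)"
  by (simp add: L2_norm_def integral_nonneg_AE)

lemma in_L2_mono:
  fixes f :: "real \<Rightarrow> 'a::euclidean_space" and g :: "real \<Rightarrow> 'b::euclidean_space"
  assumes "in_L2 g" "f \<in> borel_measurable M_pi" "\<And>x. x \<in> {0<..<pi} \<Longrightarrow> norm (f x) \<le> norm (g x)"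
  shows "in_L2 f"
  unfolding in_L2_def
proof (intro conjI assms(2))
  show "integrable M_pi (\<lambda>x. (norm (f x))\<^sup>2)"
    by (rule Bochner_Integration.integrable_bound[OF in_L2_integrable[OF assms(1)]])
       (use assms in \<open>auto intro!: AE_I2 power_mono\<close>)
qed

lemma L2_norm_mono:
  fixes f :: "real \<Rightarrow> 'a::euclidean_space" and g :: "real \<Rightarrow> 'b::euclidean_space"
  assumes "in_L2 g" "in_L2 f" "\<And>x. x \<in> {0<..<pi} \<Longrightarrow> norm (f x) \<le> norm (g x)"
  shows "L2_norm f \<le> L2_norm g"
  unfolding L2_norm_def
  by (intro real_sqrt_le_mono integral_mono_AE in_L2_integrable assms AE_I2)
     (use assms in \<open>auto intro!: power_mono\<close>)

lemma L2_norm_cong_AE: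
  assumes "AE x in M_pi. norm (f x) = norm (g x)" "f \<in> borel_measurable M_pi" "g \<in> borel_measurable M_pi"
  shows "L2_norm f = L2_norm g"
proof -
  have "(\<integral>x. (norm (f x))\<^sup>2 \<partial>M_pi) = (\<integral>x. (norm (g x))\<^sup>2 \<partial>M_pi)"
    by (rule integral_cong_AE) (use assms in auto)
  then show ?thesis by (simp add: L2_norm_def)
qed

lemma integrable_norm_mult:
  fixes f :: "real \<Rightarrow> 'a::euclidean_space" and g :: "real \<Rightarrow> 'b::euclidean_space"
  assumes "in_L2 f" "in_L2 g"
  shows "integrable M_pi (\<lambda>x. norm (f x) * norm (g x))"
proof (rule Bochner_Integration.integrable_bound)
  show "integrable M_pi (\<lambda>x. (norm (f x))\<^sup>2 + (norm (g x))\<^sup>2)"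
    using assms by (auto intro: in_L2_integrable)
  show "(\<lambda>x. norm (f x) * norm (g x)) \<in> borel_measurable M_pi"
    using in_L2_measurable[OF assms(1)] in_L2_measurable[OF assms(2)] by measurable
  have "a * b \<le> a\<^sup>2 + b\<^sup>2" if "a \<ge> 0" "b \<ge> 0" for a b :: real
    using sum_squares_bound[of a b] that mult_nonneg_nonneg[of a b] by linarith
  then show "AE x in M_pi. norm (norm (f x) * norm (g x)) \<le> norm ((norm (f x))\<^sup>2 + (norm (g x))\<^sup>2)"
    by (auto intro!: AE_I2 simp: abs_mult)
qed

text \<open>Nonnegativity of a quadratic in \<open>s\<close>. Since \<open>L2_norm\<close> is only a
  seminorm on functions, the cases of norm zero are excluded by special choices of
  \<open>s\<close>.\<close>

lemma L2_Cauchy_Schwarz: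
  fixes f :: "real \<Rightarrow> 'a::euclidean_space" and g :: "real \<Rightarrow> 'b::euclidean_space"
  assumes "in_L2 f" "in_L2 g"
  shows "(\<integral>x. norm (f x) * norm (g x) \<partial>M_pi) \<le> L2_norm f * L2_norm g"
proof -
  let ?I = "\<integral>x. norm (f x) * norm (g x) \<partial>M_pi"
  have I0: "0 \<le> ?I" by (intro integral_nonneg_AE) auto
  have quad: "2 * s * ?I \<le> s\<^sup>2 * (L2_norm f)\<^sup>2 + (L2_norm g)\<^sup>2" for s
  proof -
    have "2 * s * ?I = (\<integral>x. 2 * s * (norm (f x) * norm (g x)) \<partial>M_pi)" by simp
    also have "\<dots> \<le> (\<integral>x. s\<^sup>2 * (norm (f x))\<^sup>2 + (norm (g x))\<^sup>2 \<partial>M_pi)"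
    proof (intro integral_mono_AE AE_I2)
      show "integrable M_pi (\<lambda>x. 2 * s * (norm (f x) * norm (g x)))"
        using integrable_norm_mult[OF assms] by simp
      show "integrable M_pi (\<lambda>x. s\<^sup>2 * (norm (f x))\<^sup>2 + (norm (g x))\<^sup>2)"
        using assms by (simp add: in_L2_integrable)
      show "2 * s * (norm (f x) * norm (g x)) \<le> s\<^sup>2 * (norm (f x))\<^sup>2 + (norm (g x))\<^sup>2" for x
        using sum_squares_bound[of "s * norm (f x)" "norm (g x)"] by (simp add: power_mult_distrib algebra_simps)
    qed
    also have "\<dots> = s\<^sup>2 * (L2_norm f)\<^sup>2 + (L2_norm g)\<^sup>2"
      using assms by (simp add: L2_norm_power2 in_L2_integrable)
    finally show ?thesis .
  qed
  show ?thesis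
  proof (cases "L2_norm f = 0")
    case True
    have "?I \<le> 0"
    proof (rule ccontr)
      assume "\<not> ?I \<le> 0"
      \<comment> \<open>With \<open>L2_norm f = 0\<close> the right side of \<open>quad\<close> does
        not depend on \<open>s\<close>, so a large \<open>s\<close> contradicts it; this one makes
        the left side twice \<open>(L2_norm g)\<^sup>2 + 1\<close>.\<close>
      then have "2 * (((L2_norm g)\<^sup>2 + 1) / ?I) * ?I = 2 * ((L2_norm g)\<^sup>2 + 1)" by simp
      with quad[of "((L2_norm g)\<^sup>2 + 1) / ?I"] True have "2 * ((L2_norm g)\<^sup>2 + 1) \<le> (L2_norm g)\<^sup>2" by simp
      then show False by (smt (verit) zero_le_power2)
    qed
    then show ?thesis using True by simp
  next
    case False
    then have pos: "L2_norm f > 0" using L2_norm_nonneg[of f] by linarith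
    have "?I * (2 * (L2_norm g / L2_norm f)) \<le> 2 * (L2_norm g)\<^sup>2"
      using quad[of "L2_norm g / L2_norm f"] pos by (simp add: power_divide mult_ac)
    show ?thesis
    proof (cases "L2_norm g = 0")
      case True
      have "?I \<le> 0"
      proof (rule ccontr)
        assume "\<not> ?I \<le> 0"
        then have Ip: "?I > 0" by simp
        \<comment> \<open>For \<open>L2_norm g = 0\<close> this is the minimum point of the right
          side of \<open>quad\<close> minus the left side.\<close>
        define s where "s = ?I / (L2_norm f)\<^sup>2"
        have sp: "s > 0" unfolding s_def using Ip pos by simp
        have "2 * s * ?I \<le> s * (s * (L2_norm f)\<^sup>2)" using quad[of s] True by (simp add: power2_eq_square mult_ac)
        moreover have "s * (L2_norm f)\<^sup>2 = ?I" using pos by (simp add: s_def)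
        ultimately have "2 * s * ?I \<le> s * ?I" by simp
        moreover have "s * ?I > 0" using sp Ip by simp
        ultimately show False by linarith
      qed
      then show ?thesis using True by simp
    next
      case False
      then have gpos: "L2_norm g > 0" using L2_norm_nonneg[of g] by linarith
      from \<open>?I * (2 * (L2_norm g / L2_norm f)) \<le> 2 * (L2_norm g)\<^sup>2\<close> pos
      have "?I * L2_norm g \<le> (L2_norm f * L2_norm g) * L2_norm g"
        by (simp add: field_simps power2_eq_square)
      then show ?thesis using gpos by simp
    qed
  qed
qed

lemma in_L2_add:
  fixes f g :: "real \<Rightarrow> 'a::euclidean_space"
  assumes "in_L2 f" "in_L2 g"
  shows "in_L2 (\<lambda>x. f x + g x)"
  unfolding in_L2_def
proof
  show "(\<lambda>x. f x + g x) \<in> borel_measurable M_pi"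
    using in_L2_measurable[OF assms(1)] in_L2_measurable[OF assms(2)] by measurable
  have int: "integrable M_pi (\<lambda>x. (norm (f x))\<^sup>2 + 2 * (norm (f x) * norm (g x)) + (norm (g x))\<^sup>2)"
    using assms integrable_norm_mult[OF assms] by (simp add: in_L2_integrable)
  show "integrable M_pi (\<lambda>x. (norm (f x + g x))\<^sup>2)"
  proof (rule Bochner_Integration.integrable_bound[OF int])
    show "(\<lambda>x. (norm (f x + g x))\<^sup>2) \<in> borel_measurable M_pi"
      using in_L2_measurable[OF assms(1)] in_L2_measurable[OF assms(2)] by measurable
    have "(norm (f x + g x))\<^sup>2 \<le> (norm (f x))\<^sup>2 + 2 * (norm (f x) * norm (g x)) + (norm (g x))\<^sup>2" for x
      using power_mono[OF norm_triangle_ineq[of "f x" "g x"], of 2] by (simp add: power2_sum)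
    then show "AE x in M_pi. norm ((norm (f x + g x))\<^sup>2)
        \<le> norm ((norm (f x))\<^sup>2 + 2 * (norm (f x) * norm (g x)) + (norm (g x))\<^sup>2)"
      by (auto intro!: AE_I2)
  qed
qed

lemma L2_norm_triangle:
  fixes f g :: "real \<Rightarrow> 'a::euclidean_space"
  assumes "in_L2 f" "in_L2 g"
  shows "L2_norm (\<lambda>x. f x + g x) \<le> L2_norm f + L2_norm g"
proof (rule power2_le_imp_le)
  have int: "integrable M_pi (\<lambda>x. (norm (f x))\<^sup>2 + 2 * (norm (f x) * norm (g x)) + (norm (g x))\<^sup>2)"
    using assms integrable_norm_mult[OF assms] by (simp add: in_L2_integrable)
  have "(L2_norm (\<lambda>x. f x + g x))\<^sup>2
      \<le> (\<integral>x. (norm (f x))\<^sup>2 + 2 * (norm (f x) * norm (g x)) + (norm (g x))\<^sup>2 \<partial>M_pi)"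
    unfolding L2_norm_power2
  proof (intro integral_mono_AE AE_I2 int)
    show "integrable M_pi (\<lambda>x. (norm (f x + g x))\<^sup>2)"
      using in_L2_add[OF assms] by (rule in_L2_integrable)
    show "(norm (f x + g x))\<^sup>2 \<le> (norm (f x))\<^sup>2 + 2 * (norm (f x) * norm (g x)) + (norm (g x))\<^sup>2" for x
      using power_mono[OF norm_triangle_ineq[of "f x" "g x"], of 2] by (simp add: power2_sum)
  qed
  also have "\<dots> = (L2_norm f)\<^sup>2 + 2 * (\<integral>x. norm (f x) * norm (g x) \<partial>M_pi) + (L2_norm g)\<^sup>2"
    using assms integrable_norm_mult[OF assms] by (simp add: L2_norm_power2 in_L2_integrable)
  also have "\<dots> \<le> (L2_norm f + L2_norm g)\<^sup>2"
    using L2_Cauchy_Schwarz[OF assms] by (simp add: power2_sum)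
  finally show "(L2_norm (\<lambda>x. f x + g x))\<^sup>2 \<le> (L2_norm f + L2_norm g)\<^sup>2" .
qed simp

lemma in_L2_zero [simp]: "in_L2 (\<lambda>x. 0)"
  by (simp add: in_L2_def)

lemma L2_norm_zero [simp]: "L2_norm (\<lambda>x. 0) = 0"
  by (simp add: L2_norm_def)

section \<open>Scalar multiples, differences and sums of square-integrable functions\<close>

lemma norm_vector_scalar_mult: "norm (c *s (v :: complex^'n)) = cmod c * norm v"
  by (simp add: norm_vec_def L2_set_def norm_mult power_mult_distrib real_sqrt_mult flip: sum_distrib_left)

lemma bounded_linear_vector_scalar_mult: "bounded_linear (\<lambda>v. c *s (v :: complex^'n))"
  by (rule bounded_linear_intro[where K = "cmod c"])
     (simp_all add: norm_vector_scalar_mult vec_eq_iff algebra_simps)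

lemma borel_measurable_vector_scalar_mult [measurable]:
  assumes [measurable]: "c \<in> borel_measurable M" "f \<in> borel_measurable M"
  shows "(\<lambda>x. c x *s (f x :: complex^'n)) \<in> borel_measurable M"
proof -
  have "continuous_on UNIV (\<lambda>p :: complex \<times> (complex^'n). fst p *s snd p)"
    unfolding vector_scalar_mult_def by (intro continuous_intros)
  then have [measurable]: "(\<lambda>p :: complex \<times> (complex^'n). fst p *s snd p) \<in> borel_measurable borel"
    by (rule borel_measurable_continuous_onI)
  have "(\<lambda>x. (c x, f x)) \<in> borel_measurable M" by (rule borel_measurable_Pair; measurable)
  then have "(\<lambda>x. (\<lambda>p. fst p *s snd p) (c x, f x)) \<in> borel_measurable M" by measurable
  then show ?thesis by simp
qed

lemma in_L2_scale:
  fixes f :: "real \<Rightarrow> complex^'n"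
  assumes "in_L2 f"
  shows "in_L2 (\<lambda>x. c *s f x)"
  using assms unfolding in_L2_def
  by (auto simp: norm_vector_scalar_mult power_mult_distrib)

lemma L2_norm_scale: "L2_norm (\<lambda>x. c *s (f x :: complex^'n)) = cmod c * L2_norm f"
  by (simp add: L2_norm_def norm_vector_scalar_mult power_mult_distrib real_sqrt_mult)

lemma in_L2_scaleR:
  fixes f :: "real \<Rightarrow> 'a::euclidean_space"
  assumes "in_L2 f"
  shows "in_L2 (\<lambda>x. c *\<^sub>R f x)"
  using assms unfolding in_L2_def by (auto simp: power_mult_distrib)

lemma L2_norm_scaleR: "L2_norm (\<lambda>x. c *\<^sub>R f x) = \<bar>c\<bar> * L2_norm f"
  by (simp add: L2_norm_def power_mult_distrib real_sqrt_mult)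

lemma in_L2_uminus:
  fixes f :: "real \<Rightarrow> 'a::euclidean_space"
  shows "in_L2 f \<Longrightarrow> in_L2 (\<lambda>x. - f x)"
  using in_L2_scaleR[of f "-1"] by simp

lemma in_L2_diff:
  fixes f g :: "real \<Rightarrow> 'a::euclidean_space"
  assumes "in_L2 f" "in_L2 g"
  shows "in_L2 (\<lambda>x. f x - g x)"
  using in_L2_add[OF assms(1) in_L2_uminus[OF assms(2)]] by simp

lemma L2_norm_minus_commute: "L2_norm (\<lambda>x. f x - g x) = L2_norm (\<lambda>x. g x - f x)"
  by (simp add: L2_norm_def norm_minus_commute)

lemma L2_norm_triangle_diff:
  fixes f g h :: "real \<Rightarrow> 'a::euclidean_space"
  assumes "in_L2 f" "in_L2 g" "in_L2 h"
  shows "L2_norm (\<lambda>x. f x - h x) \<le> L2_norm (\<lambda>x. f x - g x) + L2_norm (\<lambda>x. g x - h x)"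
  using L2_norm_triangle[OF in_L2_diff[OF assms(1,2)] in_L2_diff[OF assms(2,3)]] by simp

lemma L2_norm_triangle_diff2:
  fixes f g :: "real \<Rightarrow> 'a::euclidean_space"
  assumes "in_L2 f" "in_L2 g"
  shows "L2_norm f \<le> L2_norm g + L2_norm (\<lambda>x. f x - g x)"
  using L2_norm_triangle[OF assms(2) in_L2_diff[OF assms]] by simp

lemma in_L2_sum:
  fixes f :: "'i \<Rightarrow> real \<Rightarrow> 'a::euclidean_space"
  assumes "\<And>i. i \<in> F \<Longrightarrow> in_L2 (f i)"
  shows "in_L2 (\<lambda>x. \<Sum>i\<in>F. f i x)"
  using assms by (induction F rule: infinite_finite_induct) (auto intro: in_L2_add)

lemma L2_norm_sum_le:
  fixes f :: "'i \<Rightarrow> real \<Rightarrow> 'a::euclidean_space"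
  assumes "\<And>i. i \<in> F \<Longrightarrow> in_L2 (f i)"
  shows "L2_norm (\<lambda>x. \<Sum>i\<in>F. f i x) \<le> (\<Sum>i\<in>F. L2_norm (f i))"
  using assms
proof (induction F rule: infinite_finite_induct)
  case (insert i F)
  have "L2_norm (\<lambda>x. f i x + (\<Sum>i\<in>F. f i x)) \<le> L2_norm (f i) + L2_norm (\<lambda>x. \<Sum>i\<in>F. f i x)"
    by (rule L2_norm_triangle) (use insert in \<open>auto intro: in_L2_sum\<close>)
  also have "\<dots> \<le> L2_norm (f i) + (\<Sum>i\<in>F. L2_norm (f i))" using insert by simp
  finally show ?case using insert by simp
qed auto

lemma L2_eq_iff:
  fixes f g :: "real \<Rightarrow> 'a::euclidean_space"
  assumes "in_L2 f" "in_L2 g"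
  shows "L2_eq f g \<longleftrightarrow> L2_norm (\<lambda>x. f x - g x) = 0"
proof -
  have "L2_norm (\<lambda>x. f x - g x) = 0 \<longleftrightarrow> (AE x in M_pi. (norm (f x - g x))\<^sup>2 = 0)"
    unfolding L2_norm_def
    by (simp add: integral_nonneg_eq_0_iff_AE[OF in_L2_integrable[OF in_L2_diff[OF assms]]])
  then show ?thesis by (simp add: L2_eq_def)
qed

lemma L2_norm_cong_L2_eq:
  fixes f g :: "real \<Rightarrow> 'a::euclidean_space"
  assumes "in_L2 f" "in_L2 g" "L2_eq f g"
  shows "L2_norm f = L2_norm g"
  using assms unfolding L2_eq_def
  by (intro L2_norm_cong_AE in_L2_measurable) auto

text \<open>Riesz-Fischer for absolutely convergent series: monotone convergence makes the sum
  \<open>G\<close> of the norms square integrable, and \<open>G\<close> dominates all tails. The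
  limit is written as a series at every point; its value on the null set of divergence does not
  matter.\<close>

lemma L2_complete:
  fixes f :: "nat \<Rightarrow> real \<Rightarrow> 'a::euclidean_space"
  assumes L2: "\<And>n. in_L2 (f n)" and summ: "summable (\<lambda>n. L2_norm (f n))"
  obtains S where "in_L2 S" "(\<lambda>N. L2_norm (\<lambda>x. S x - (\<Sum>n<N. f n x))) \<longlonglongrightarrow> 0"
proof -
  have [measurable]: "f n \<in> borel_measurable M_pi" for n using L2 by (rule in_L2_measurable)
  define B where "B = (\<Sum>n. L2_norm (f n))"
  define g where "g N x = (\<Sum>n<N. norm (f n x))" for N x
  have gL2: "in_L2 (g N)" for N
  proof -
    have "in_L2 (\<lambda>x. norm (f n x))" for n using L2[of n] by (auto simp: in_L2_def)
    then show ?thesis unfolding g_def by (intro in_L2_sum) auto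
  qed
  have gB: "L2_norm (g N) \<le> B" for N
  proof -
    have "in_L2 (\<lambda>x. norm (f n x))" for n using L2[of n] by (auto simp: in_L2_def)
    then have "L2_norm (g N) \<le> (\<Sum>n<N. L2_norm (\<lambda>x. norm (f n x)))"
      unfolding g_def by (intro L2_norm_sum_le) auto
    also have "\<dots> = (\<Sum>n<N. L2_norm (f n))" by (simp add: L2_norm_def)
    also have "\<dots> \<le> B" unfolding B_def by (rule sum_le_suminf[OF summ]) auto
    finally show ?thesis .
  qed
  have gmono: "g M x \<le> g N x" if "M \<le> N" for M N x
    unfolding g_def using that by (intro sum_mono2) auto
  have g0: "0 \<le> g N x" for N x unfolding g_def by (intro sum_nonneg) auto
  have [measurable]: "g N \<in> borel_measurable M_pi" for N using gL2 by (rule in_L2_measurable)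
  have nn: "(\<integral>\<^sup>+x. ennreal ((g N x)\<^sup>2) \<partial>M_pi) \<le> ennreal (B\<^sup>2)" for N
  proof -
    have "(\<integral>\<^sup>+x. ennreal ((g N x)\<^sup>2) \<partial>M_pi) = ennreal (\<integral>x. (g N x)\<^sup>2 \<partial>M_pi)"
      using in_L2_integrable[OF gL2[of N]] by (intro nn_integral_eq_integral) auto
    also have "(\<integral>x. (g N x)\<^sup>2 \<partial>M_pi) = (L2_norm (g N))\<^sup>2" by (simp add: L2_norm_power2)
    also have "ennreal ((L2_norm (g N))\<^sup>2) \<le> ennreal (B\<^sup>2)"
      by (intro ennreal_leI power_mono gB) auto
    finally show ?thesis .
  qed
  have "(\<integral>\<^sup>+x. (SUP N. ennreal ((g N x)\<^sup>2)) \<partial>M_pi) = (SUP N. \<integral>\<^sup>+x. ennreal ((g N x)\<^sup>2) \<partial>M_pi)"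
    by (rule nn_integral_monotone_convergence_SUP)
       (auto simp: incseq_def le_fun_def intro!: ennreal_leI power_mono gmono g0)
  also have "\<dots> \<le> ennreal (B\<^sup>2)" by (intro SUP_least nn)
  finally have fin: "(\<integral>\<^sup>+x. (SUP N. ennreal ((g N x)\<^sup>2)) \<partial>M_pi) \<le> ennreal (B\<^sup>2)" .
  then have "(\<integral>\<^sup>+x. (SUP N. ennreal ((g N x)\<^sup>2)) \<partial>M_pi) < \<infinity>"
    by (rule le_less_trans) simp
  then have ae_fin: "AE x in M_pi. (SUP N. ennreal ((g N x)\<^sup>2)) \<noteq> \<infinity>"
    by (intro nn_integral_noteq_infinite) (auto simp: less_top)
  define G where "G x = (\<Sum>n. norm (f n x))" for x
  define S where "S x = (\<Sum>n. f n x)" for x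
  have [measurable]: "G \<in> borel_measurable M_pi" "S \<in> borel_measurable M_pi"
    unfolding G_def S_def by measurable
  have ae: "AE x in M_pi. summable (\<lambda>n. norm (f n x))
      \<and> ennreal ((G x)\<^sup>2) \<le> (SUP N. ennreal ((g N x)\<^sup>2))"
    using ae_fin
  proof (eventually_elim)
    case (elim x)
    let ?s = "SUP N. ennreal ((g N x)\<^sup>2)"
    obtain r where r: "?s = ennreal r" "r \<ge> 0" using elim by (cases ?s) auto
    have le: "(g N x)\<^sup>2 \<le> r" for N
    proof -
      have "ennreal ((g N x)\<^sup>2) \<le> ennreal r" unfolding r(1)[symmetric] by (rule SUP_upper) auto
      then show ?thesis using r(2) by simp
    qed
    then have gr: "g N x \<le> sqrt r" for N using real_le_rsqrt by blast
    have s: "summable (\<lambda>n. norm (f n x))"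
      by (rule summableI_nonneg_bounded[of _ "sqrt r"]) (use gr in \<open>auto simp: g_def\<close>)
    have "G x \<le> sqrt r"
      unfolding G_def by (rule suminf_le_const[OF s]) (use gr in \<open>auto simp: g_def\<close>)
    moreover have "G x \<ge> 0" unfolding G_def by (rule suminf_nonneg[OF s]) auto
    ultimately have "(G x)\<^sup>2 \<le> (sqrt r)\<^sup>2" by (intro power_mono)
    then have "(G x)\<^sup>2 \<le> r" using r(2) by simp
    then have "ennreal ((G x)\<^sup>2) \<le> ?s" unfolding r(1) by (rule ennreal_leI)
    with s show ?case by blast
  qed
  have Gint: "integrable M_pi (\<lambda>x. (G x)\<^sup>2)"
  proof (rule integrableI_bounded)
    have "(\<integral>\<^sup>+x. ennreal (norm ((G x)\<^sup>2)) \<partial>M_pi) \<le> (\<integral>\<^sup>+x. (SUP N. ennreal ((g N x)\<^sup>2)) \<partial>M_pi)"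
      by (intro nn_integral_mono_AE) (use ae in auto)
    also have "\<dots> < \<infinity>" using fin by (rule le_less_trans) simp
    finally show "(\<integral>\<^sup>+x. ennreal (norm ((G x)\<^sup>2)) \<partial>M_pi) < \<infinity>" .
  qed measurable
  have bound: "AE x in M_pi. \<forall>N. norm (S x - (\<Sum>n<N. f n x)) \<le> G x"
    using ae
  proof eventually_elim
    case (elim x)
    then have s: "summable (\<lambda>n. norm (f n x))" by simp
    show ?case
    proof
      fix N
      have "S x - (\<Sum>n<N. f n x) = (\<Sum>n. f (n + N) x)"
        unfolding S_def using suminf_minus_initial_segment[OF summable_norm_cancel[OF s], of N] by simp
      also have "norm \<dots> \<le> (\<Sum>n. norm (f (n + N) x))"
        by (rule summable_norm) (rule summable_ignore_initial_segment[OF s])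
      also have "\<dots> = G x - g N x"
        unfolding G_def g_def using suminf_minus_initial_segment[OF s, of N] by simp
      also have "\<dots> \<le> G x" using g0[of N x] by simp
      finally show "norm (S x - (\<Sum>n<N. f n x)) \<le> G x" .
    qed
  qed
  have SL2: "in_L2 S" unfolding in_L2_def
  proof
    show "integrable M_pi (\<lambda>x. (norm (S x))\<^sup>2)"
    proof (rule Bochner_Integration.integrable_bound[OF Gint])
      show "AE x in M_pi. norm ((norm (S x))\<^sup>2) \<le> norm ((G x)\<^sup>2)"
        using bound
      proof eventually_elim
        case (elim x)
        from spec[OF this, of 0] show ?case by (simp add: power_mono)
      qed
    qed measurable
  qed measurable
  have "(\<lambda>N. \<integral>x. (norm (S x - (\<Sum>n<N. f n x)))\<^sup>2 \<partial>M_pi) \<longlonglongrightarrow> (\<integral>x. 0 \<partial>M_pi)"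
  proof (rule integral_dominated_convergence[OF _ _ Gint])
    show "AE x in M_pi. (\<lambda>N. (norm (S x - (\<Sum>n<N. f n x)))\<^sup>2) \<longlonglongrightarrow> 0"
      using ae
    proof eventually_elim
      case (elim x)
      have "summable (\<lambda>n. f n x)" by (rule summable_norm_cancel[OF conjunct1[OF elim]])
      then have "(\<lambda>n. f n x) sums S x" unfolding S_def by (rule summable_sums)
      then have "(\<lambda>N. \<Sum>n<N. f n x) \<longlonglongrightarrow> S x" by (simp add: sums_def)
      then have "(\<lambda>N. (norm (S x - (\<Sum>n<N. f n x)))\<^sup>2) \<longlonglongrightarrow> (norm (S x - S x))\<^sup>2"
        by (intro tendsto_intros)
      then show ?case by simp
    qed
    show "AE x in M_pi. norm ((norm (S x - (\<Sum>n<N. f n x)))\<^sup>2) \<le> (G x)\<^sup>2" for N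
      using bound
    proof eventually_elim
      case (elim x)
      from power_mono[OF spec[OF elim, of N] norm_ge_zero, of 2] show ?case by simp
    qed
  qed measurable
  then have "(\<lambda>N. L2_norm (\<lambda>x. S x - (\<Sum>n<N. f n x))) \<longlonglongrightarrow> sqrt 0"
    unfolding L2_norm_def by (intro tendsto_real_sqrt) simp
  then show ?thesis using that SL2 by simp
qed

subsection \<open>Orthonormal systems\<close>

definition cdot :: "complex^'n \<Rightarrow> complex^'n \<Rightarrow> complex" where
  "cdot x y = (\<Sum>i\<in>UNIV. cnj (x $ i) * y $ i)"

lemma L2_inner_cdot: "L2_inner f g = (\<integral>x. cdot (f x) (g x) \<partial>M_pi)"
  by (simp add: L2_inner_def cdot_def)

lemma norm_cdot_le: "cmod (cdot x y) \<le> norm x * norm y"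
proof -
  have "cmod (cdot x y) \<le> (\<Sum>i\<in>UNIV. \<bar>cmod (x $ i)\<bar> * \<bar>cmod (y $ i)\<bar>)"
    unfolding cdot_def by (rule order_trans[OF norm_sum]) (simp add: norm_mult)
  also have "\<dots> \<le> norm x * norm y"
    unfolding norm_vec_def by (rule L2_set_mult_ineq)
  finally show ?thesis .
qed

lemma cnj_mult_self: "cnj z * z = of_real ((cmod z)\<^sup>2)"
  using complex_norm_square[of z] by (simp only: of_real_power mult.commute)

lemma cdot_self: "cdot x x = of_real ((norm x)\<^sup>2)"
proof -
  have "cdot x x = (\<Sum>i\<in>UNIV. of_real ((cmod (x $ i))\<^sup>2))"
    unfolding cdot_def by (simp only: cnj_mult_self)
  then show ?thesis by (simp add: norm_vec_def L2_set_def sum_nonneg)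
qed

lemma cdot_add_right: "cdot x (y + z) = cdot x y + cdot x z"
  by (simp add: cdot_def algebra_simps sum.distrib)

lemma cdot_add_left: "cdot (y + z) x = cdot y x + cdot z x"
  by (simp add: cdot_def algebra_simps sum.distrib)

lemma cdot_diff_right: "cdot x (y - z) = cdot x y - cdot x z"
  by (simp add: cdot_def algebra_simps sum_subtractf)

lemma cdot_scale_right: "cdot x (c *s y) = c * cdot x y"
  by (simp add: cdot_def sum_distrib_left mult_ac)

lemma cdot_scale_left: "cdot (c *s x) y = cnj c * cdot x y"
  by (simp add: cdot_def sum_distrib_left mult_ac)

lemma cdot_scaleR_right: "cdot x (c *\<^sub>R y) = c *\<^sub>R cdot x y"
  by (simp add: cdot_def scaleR_sum_right)

lemma cdot_scaleR_left: "cdot (c *\<^sub>R x) y = c *\<^sub>R cdot x y"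
  by (simp add: cdot_def scaleR_sum_right)

lemma cdot_zero_right [simp]: "cdot x 0 = 0"
  by (simp add: cdot_def)

lemma cdot_zero_left [simp]: "cdot 0 x = 0"
  by (simp add: cdot_def)

lemma cdot_cnj: "cnj (cdot x y) = cdot y x"
  by (simp add: cdot_def mult.commute)

lemma bounded_linear_cdot_right: "bounded_linear (cdot x)"
  by (rule bounded_linear_intro[where K = "norm x"])
     (simp_all add: cdot_add_right cdot_scaleR_right norm_cdot_le mult.commute[of _ "norm x"])

lemma borel_measurable_cdot [measurable]:
  assumes [measurable]: "f \<in> borel_measurable M" "g \<in> borel_measurable M"
  shows "(\<lambda>x. cdot (f x :: complex^'n) (g x)) \<in> borel_measurable M"
proof -
  have "continuous_on UNIV (\<lambda>p :: (complex^'n) \<times> (complex^'n). cdot (fst p) (snd p))"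
    unfolding cdot_def by (intro continuous_intros)
  then have [measurable]: "(\<lambda>p :: (complex^'n) \<times> (complex^'n). cdot (fst p) (snd p)) \<in> borel_measurable borel"
    by (rule borel_measurable_continuous_onI)
  have "(\<lambda>x. (f x, g x)) \<in> borel_measurable M" by (rule borel_measurable_Pair; measurable)
  then have "(\<lambda>x. (\<lambda>p. cdot (fst p) (snd p)) (f x, g x)) \<in> borel_measurable M" by measurable
  then show ?thesis by simp
qed

lemma integrable_cdot:
  fixes f g :: "real \<Rightarrow> complex^'n"
  assumes "in_L2 f" "in_L2 g"
  shows "integrable M_pi (\<lambda>x. cdot (f x) (g x))"
proof (rule Bochner_Integration.integrable_bound[OF integrable_norm_mult[OF assms]])
  show "(\<lambda>x. cdot (f x) (g x)) \<in> borel_measurable M_pi"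
    using in_L2_measurable[OF assms(1)] in_L2_measurable[OF assms(2)] by measurable
qed (auto intro!: AE_I2 norm_cdot_le simp: abs_mult)

lemma L2_inner_add_right:
  "in_L2 f \<Longrightarrow> in_L2 g \<Longrightarrow> in_L2 h \<Longrightarrow> L2_inner f (\<lambda>x. g x + h x) = L2_inner f g + L2_inner f h"
  by (simp add: L2_inner_cdot cdot_add_right integrable_cdot)

lemma L2_inner_add_left:
  "in_L2 f \<Longrightarrow> in_L2 g \<Longrightarrow> in_L2 h \<Longrightarrow> L2_inner (\<lambda>x. g x + h x) f = L2_inner g f + L2_inner h f"
  by (simp add: L2_inner_cdot cdot_add_left integrable_cdot)

lemma L2_inner_diff_right:
  "in_L2 f \<Longrightarrow> in_L2 g \<Longrightarrow> in_L2 h \<Longrightarrow> L2_inner f (\<lambda>x. g x - h x) = L2_inner f g - L2_inner f h"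
  by (simp add: L2_inner_cdot cdot_diff_right integrable_cdot)

lemma L2_inner_scale_right: "L2_inner f (\<lambda>x. c *s g x) = c * L2_inner f g"
  by (simp add: L2_inner_cdot cdot_scale_right)

lemma L2_inner_scale_left: "L2_inner (\<lambda>x. c *s g x) f = cnj c * L2_inner g f"
  by (simp add: L2_inner_cdot cdot_scale_left)

lemma L2_inner_zero_right [simp]: "L2_inner f (\<lambda>x. 0) = 0"
  by (simp add: L2_inner_cdot)

lemma L2_inner_zero_left [simp]: "L2_inner (\<lambda>x. 0) f = 0"
  by (simp add: L2_inner_cdot)

lemma L2_inner_sum_right:
  assumes "in_L2 f" "\<And>i. i \<in> F \<Longrightarrow> in_L2 (g i)"
  shows "L2_inner f (\<lambda>x. \<Sum>i\<in>F. g i x) = (\<Sum>i\<in>F. L2_inner f (g i))"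
  using assms(2)
  by (induction F rule: infinite_finite_induct) (simp_all add: assms(1) L2_inner_add_right in_L2_sum)

lemma L2_inner_sum_left:
  assumes "in_L2 f" "\<And>i. i \<in> F \<Longrightarrow> in_L2 (g i)"
  shows "L2_inner (\<lambda>x. \<Sum>i\<in>F. g i x) f = (\<Sum>i\<in>F. L2_inner (g i) f)"
  using assms(2)
  by (induction F rule: infinite_finite_induct) (simp_all add: assms(1) L2_inner_add_left in_L2_sum)

lemma L2_inner_self: "L2_inner f f = of_real ((L2_norm f)\<^sup>2)"
  by (simp add: L2_inner_cdot cdot_self L2_norm_power2 flip: of_real_power)

lemma L2_inner_cnj: "cnj (L2_inner f g) = L2_inner g f"
  by (simp add: L2_inner_cdot cdot_cnj flip: Bochner_Integration.integral_cnj)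

lemma norm_L2_inner_le:
  assumes "in_L2 f" "in_L2 g"
  shows "cmod (L2_inner f g) \<le> L2_norm f * L2_norm g"
proof -
  have "cmod (L2_inner f g) \<le> (\<integral>x. norm (cdot (f x) (g x)) \<partial>M_pi)"
    unfolding L2_inner_cdot by (rule integral_norm_bound)
  also have "\<dots> \<le> (\<integral>x. norm (f x) * norm (g x) \<partial>M_pi)"
    by (intro integral_mono integrable_norm integrable_cdot integrable_norm_mult assms norm_cdot_le)
  also have "\<dots> \<le> L2_norm f * L2_norm g" by (rule L2_Cauchy_Schwarz[OF assms])
  finally show ?thesis .
qed

definition L2_orthonormal :: "('i \<Rightarrow> real \<Rightarrow> complex^'n) \<Rightarrow> 'i set \<Rightarrow> bool" where
  "L2_orthonormal e I \<longleftrightarrow> (\<forall>i\<in>I. in_L2 (e i))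
     \<and> (\<forall>i\<in>I. \<forall>j\<in>I. L2_inner (e i) (e j) = (if i = j then 1 else 0))"

lemma L2_orthonormal_basis_imp: "L2_orthonormal_basis e I \<Longrightarrow> L2_orthonormal e I"
  by (simp add: L2_orthonormal_basis_def L2_orthonormal_def)

lemma L2_orthonormal_in_L2: "L2_orthonormal e I \<Longrightarrow> i \<in> I \<Longrightarrow> in_L2 (e i)"
  by (simp add: L2_orthonormal_def)

lemma L2_orthonormal_norm: "L2_orthonormal e I \<Longrightarrow> i \<in> I \<Longrightarrow> L2_norm (e i) = 1"
proof -
  assume "L2_orthonormal e I" "i \<in> I"
  then have "(1 :: complex) = of_real ((L2_norm (e i))\<^sup>2)"
    unfolding L2_inner_self[symmetric] by (simp add: L2_orthonormal_def)
  then have "(L2_norm (e i))\<^sup>2 = 1" by (metis of_real_eq_1_iff)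
  then show ?thesis using L2_norm_nonneg[of "e i"] by (simp add: power2_eq_1_iff)
qed

lemma L2_orthonormal_inner_sum:
  assumes "L2_orthonormal e I" "finite F" "F \<subseteq> I" "i \<in> I"
  shows "L2_inner (e i) (\<lambda>x. \<Sum>j\<in>F. a j *s e j x) = (if i \<in> F then a i else 0)"
proof -
  have "L2_inner (e i) (\<lambda>x. \<Sum>j\<in>F. a j *s e j x) = (\<Sum>j\<in>F. L2_inner (e i) (\<lambda>x. a j *s e j x))"
    using assms by (intro L2_inner_sum_right in_L2_scale) (auto intro: L2_orthonormal_in_L2)
  also have "\<dots> = (\<Sum>j\<in>F. if j = i then a i else 0)"
    using assms unfolding L2_inner_scale_right
    by (intro sum.cong refl) (auto simp: L2_orthonormal_def)
  finally show ?thesis using assms(2) by simp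
qed

lemma L2_norm_sum_orthonormal:
  assumes "L2_orthonormal e I" "finite F" "F \<subseteq> I"
  shows "(L2_norm (\<lambda>x. \<Sum>i\<in>F. a i *s e i x))\<^sup>2 = (\<Sum>i\<in>F. (cmod (a i))\<^sup>2)"
proof -
  let ?S = "\<lambda>x. \<Sum>i\<in>F. a i *s e i x"
  have S: "in_L2 ?S" using assms by (intro in_L2_sum in_L2_scale) (auto intro: L2_orthonormal_in_L2)
  have "of_real ((L2_norm ?S)\<^sup>2) = L2_inner ?S ?S" by (simp only: L2_inner_self)
  also have "\<dots> = (\<Sum>i\<in>F. L2_inner (\<lambda>x. a i *s e i x) ?S)"
    using assms by (intro L2_inner_sum_left S in_L2_scale) (auto intro: L2_orthonormal_in_L2)
  also have "\<dots> = (\<Sum>i\<in>F. cnj (a i) * a i)"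
    using assms unfolding L2_inner_scale_left
    by (intro sum.cong refl arg_cong2[where f = "(*)"], subst L2_orthonormal_inner_sum[where I = I]) auto
  also have "\<dots> = of_real (\<Sum>i\<in>F. (cmod (a i))\<^sup>2)"
    by (simp only: of_real_sum cnj_mult_self)
  finally show ?thesis by (simp only: of_real_eq_iff)
qed

text \<open>Pythagoras for the projection onto a finite span. The equality serves twice: the sign of
  the remainder is Bessel's inequality, its convergence to zero is Parseval's identity.\<close>

lemma L2_norm_orthonormal_remainder:
  assumes e: "L2_orthonormal e I" "finite F" "F \<subseteq> I" and g: "in_L2 g"
  shows "(L2_norm (\<lambda>x. g x - (\<Sum>i\<in>F. L2_inner (e i) g *s e i x)))\<^sup>2
         = (L2_norm g)\<^sup>2 - (\<Sum>i\<in>F. (cmod (L2_inner (e i) g))\<^sup>2)"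
proof -
  let ?c = "\<lambda>i. L2_inner (e i) g" and ?S = "\<lambda>x. \<Sum>i\<in>F. L2_inner (e i) g *s e i x"
  have S: "in_L2 ?S" using e by (intro in_L2_sum in_L2_scale) (auto intro: L2_orthonormal_in_L2)
  have Sg: "L2_inner ?S g = of_real (\<Sum>i\<in>F. (cmod (?c i))\<^sup>2)"
  proof -
    have "L2_inner ?S g = (\<Sum>i\<in>F. L2_inner (\<lambda>x. ?c i *s e i x) g)"
      using e by (intro L2_inner_sum_left g in_L2_scale) (auto intro: L2_orthonormal_in_L2)
    also have "\<dots> = (\<Sum>i\<in>F. cnj (?c i) * ?c i)" by (simp add: L2_inner_scale_left)
    also have "\<dots> = of_real (\<Sum>i\<in>F. (cmod (?c i))\<^sup>2)"
      by (simp only: of_real_sum cnj_mult_self)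
    finally show ?thesis .
  qed
  then have gS: "L2_inner g ?S = of_real (\<Sum>i\<in>F. (cmod (?c i))\<^sup>2)"
    using L2_inner_cnj[of ?S g] by (simp only: complex_cnj_complex_of_real)
  let ?D = "\<lambda>x. g x - ?S x"
  have D: "in_L2 ?D" using in_L2_diff[OF g S] .
  have left: "L2_inner ?D k = L2_inner g k - L2_inner ?S k" if "in_L2 k" for k
    using arg_cong[OF L2_inner_diff_right[OF that g S], of cnj]
    by (simp only: complex_cnj_diff L2_inner_cnj)
  have "of_real ((L2_norm ?D)\<^sup>2) = L2_inner ?D ?D" by (simp only: L2_inner_self)
  also have "\<dots> = L2_inner g g - L2_inner g ?S - (L2_inner ?S g - L2_inner ?S ?S)"
    by (simp only: left[OF D] L2_inner_diff_right[OF g g S] L2_inner_diff_right[OF S g S])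
  also have "\<dots> = of_real ((L2_norm g)\<^sup>2 - (\<Sum>i\<in>F. (cmod (?c i))\<^sup>2))"
    by (simp only: gS Sg L2_inner_self L2_norm_sum_orthonormal[OF e] of_real_diff)
       simp
  finally show ?thesis by (simp only: of_real_eq_iff)
qed

lemma L2_Bessel:
  assumes "L2_orthonormal e I" "finite F" "F \<subseteq> I" "in_L2 g"
  shows "(\<Sum>i\<in>F. (cmod (L2_inner (e i) g))\<^sup>2) \<le> (L2_norm g)\<^sup>2"
proof -
  have "0 \<le> (L2_norm g)\<^sup>2 - (\<Sum>i\<in>F. (cmod (L2_inner (e i) g))\<^sup>2)"
    by (subst L2_norm_orthonormal_remainder[OF assms, symmetric]) simp
  then show ?thesis by simp
qed

lemma L2_Parseval:
  assumes e: "L2_orthonormal_basis e I" and g: "in_L2 g"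
  shows "((\<lambda>i. (cmod (L2_inner (e i) g))\<^sup>2) has_sum (L2_norm g)\<^sup>2) I"
proof -
  have "L2_has_sum (\<lambda>i x. L2_inner (e i) g *s e i x) g I"
    using assms by (simp add: L2_orthonormal_basis_def)
  then have "((\<lambda>F. L2_norm (\<lambda>x. g x - (\<Sum>i\<in>F. L2_inner (e i) g *s e i x))) \<longlongrightarrow> 0) (finite_subsets_at_top I)"
    by (simp add: L2_has_sum_def)
  then have "((\<lambda>F. (L2_norm g)\<^sup>2 - (L2_norm (\<lambda>x. g x - (\<Sum>i\<in>F. L2_inner (e i) g *s e i x)))\<^sup>2)
      \<longlongrightarrow> (L2_norm g)\<^sup>2 - 0\<^sup>2) (finite_subsets_at_top I)"
    by (intro tendsto_intros)
  then have "((\<lambda>F. (L2_norm g)\<^sup>2 - (L2_norm (\<lambda>x. g x - (\<Sum>i\<in>F. L2_inner (e i) g *s e i x)))\<^sup>2)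
      \<longlongrightarrow> (L2_norm g)\<^sup>2) (finite_subsets_at_top I)"
    by simp
  then show ?thesis unfolding has_sum_def
  proof (rule Lim_transform_eventually)
    show "\<forall>\<^sub>F F in finite_subsets_at_top I.
        (L2_norm g)\<^sup>2 - (L2_norm (\<lambda>x. g x - (\<Sum>i\<in>F. L2_inner (e i) g *s e i x)))\<^sup>2
        = (\<Sum>i\<in>F. (cmod (L2_inner (e i) g))\<^sup>2)"
      by (rule eventually_finite_subsets_at_top_weakI)
         (subst L2_norm_orthonormal_remainder[OF L2_orthonormal_basis_imp[OF e] _ _ g], auto)
  qed
qed

lemma L2_norm_tendsto:
  fixes S :: "real \<Rightarrow> 'a::euclidean_space"
  assumes "in_L2 S" "\<forall>\<^sub>F i in \<F>. in_L2 (s i)" "((\<lambda>i. L2_norm (\<lambda>x. S x - s i x)) \<longlongrightarrow> 0) \<F>"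
  shows "((\<lambda>i. L2_norm (s i)) \<longlongrightarrow> L2_norm S) \<F>"
proof (rule LIM_zero_cancel, rule Lim_null_comparison[OF _ assms(3)])
  show "\<forall>\<^sub>F i in \<F>. norm (L2_norm (s i) - L2_norm S) \<le> L2_norm (\<lambda>x. S x - s i x)"
    using assms(2)
  proof eventually_elim
    case (elim i)
    then show ?case
      using L2_norm_triangle_diff2[OF assms(1) elim] L2_norm_triangle_diff2[OF elim assms(1)]
        L2_norm_minus_commute[of S "s i"] by simp
  qed
qed

lemma L2_has_sum_in_L2_partial:
  fixes f :: "'i \<Rightarrow> real \<Rightarrow> 'a::euclidean_space"
  assumes "L2_has_sum f S I"
  shows "\<forall>\<^sub>F F in finite_subsets_at_top I. in_L2 (\<lambda>x. \<Sum>i\<in>F. f i x)"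
  by (rule eventually_finite_subsets_at_top_weakI)
     (use assms in \<open>auto simp: L2_has_sum_def intro!: in_L2_sum\<close>)

lemma L2_has_sum_norm_tendsto:
  fixes f :: "'i \<Rightarrow> real \<Rightarrow> 'a::euclidean_space"
  assumes "L2_has_sum f S I"
  shows "((\<lambda>F. L2_norm (\<lambda>x. \<Sum>i\<in>F. f i x)) \<longlongrightarrow> L2_norm S) (finite_subsets_at_top I)"
  by (rule L2_norm_tendsto)
     (use assms L2_has_sum_in_L2_partial[OF assms] in \<open>auto simp: L2_has_sum_def\<close>)

section \<open>Unconditional convergence over arbitrary index sets\<close>

lemma summable_on_small_tail:
  fixes b :: "'i \<Rightarrow> real"
  assumes b0: "\<And>i. i \<in> I \<Longrightarrow> 0 \<le> b i" and summ: "b summable_on I" and "\<epsilon> > 0"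
  obtains F where "finite F" "F \<subseteq> I"
    "\<And>G. finite G \<Longrightarrow> G \<subseteq> I \<Longrightarrow> G \<inter> F = {} \<Longrightarrow> sum b G \<le> \<epsilon>"
proof -
  have "((\<lambda>F. sum b F) \<longlongrightarrow> infsum b I) (finite_subsets_at_top I)"
    using summ by (rule infsum_tendsto)
  then have "\<forall>\<^sub>F F in finite_subsets_at_top I. infsum b I - \<epsilon> < sum b F"
    by (rule order_tendstoD) (use \<open>\<epsilon> > 0\<close> in simp)
  then obtain F where "finite F \<and> F \<subseteq> I \<and> (\<forall>Y. finite Y \<and> F \<subseteq> Y \<and> Y \<subseteq> I \<longrightarrow> infsum b I - \<epsilon> < sum b Y)"
    unfolding eventually_finite_subsets_at_top by (elim exE)
  then have F: "finite F" "F \<subseteq> I"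
    "\<And>Y. finite Y \<Longrightarrow> F \<subseteq> Y \<Longrightarrow> Y \<subseteq> I \<Longrightarrow> infsum b I - \<epsilon> < sum b Y"
    by simp_all
  show ?thesis
  proof (rule that[OF F(1,2)])
    fix G assume G: "finite G" "G \<subseteq> I" "G \<inter> F = {}"
    have "sum b F + sum b G = sum b (F \<union> G)"
      using G F(1) by (intro sum.union_disjoint[symmetric]) auto
    also have "\<dots> \<le> infsum b I"
      using G F b0 summ by (intro finite_sum_le_infsum) auto
    finally show "sum b G \<le> \<epsilon>" using F(3)[OF F(1) subset_refl F(2)] by simp
  qed
qed

text \<open>Convergence is along all finite subsets, while completeness is available for sequences.
  Finite sets outside which \<open>b\<close> has small sums give partial sums with geometrically
  decaying increments; every larger finite set then stays close to their limit.\<close>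

lemma L2_has_sum_exists:
  fixes f :: "'i \<Rightarrow> real \<Rightarrow> 'a::euclidean_space"
  assumes f: "\<And>i. i \<in> I \<Longrightarrow> in_L2 (f i)"
    and b: "\<And>i. i \<in> I \<Longrightarrow> 0 \<le> b i" "b summable_on I" and M: "M \<ge> 0"
    and bound: "\<And>F. finite F \<Longrightarrow> F \<subseteq> I \<Longrightarrow> L2_norm (\<lambda>x. \<Sum>i\<in>F. f i x) \<le> M * sqrt (sum b F)"
  obtains S where "L2_has_sum f S I"
proof -
  \<comment> \<open>Powers of \<open>1/4\<close>, because the square root in \<open>bound\<close>
    turns them into the summable powers of \<open>1/2\<close>.\<close>
  have "\<exists>F. finite F \<and> F \<subseteq> I \<and> (\<forall>G. finite G \<longrightarrow> G \<subseteq> I \<longrightarrow> G \<inter> F = {} \<longrightarrow> sum b G \<le> (1/4) ^ k)" for k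
    using summable_on_small_tail[of I b "(1/4)^k"] b by (metis zero_less_divide_1_iff zero_less_numeral zero_less_power)
  then obtain F0 where F0: "\<And>k. finite (F0 k)" "\<And>k. F0 k \<subseteq> I"
    "\<And>k G. finite G \<Longrightarrow> G \<subseteq> I \<Longrightarrow> G \<inter> F0 k = {} \<Longrightarrow> sum b G \<le> (1/4) ^ k" by metis
  \<comment> \<open>Unions make the finite sets increasing, so that consecutive differences
    telescope.\<close>
  define G where "G k = (\<Union>i\<le>k. F0 i)" for k
  have G: "finite (G k)" "G k \<subseteq> I" "F0 k \<subseteq> G k" "G k \<subseteq> G (Suc k)" for k
    using F0(1,2) by (auto simp: G_def intro: le_SucI)
  have small: "L2_norm (\<lambda>x. \<Sum>i\<in>X. f i x) \<le> M * (1/2) ^ k" if "finite X" "X \<subseteq> I" "X \<inter> G k = {}" for X k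
  proof -
    have "sum b X \<le> (1/4) ^ k" using that G(3)[of k] by (intro F0) auto
    then have "sqrt (sum b X) \<le> sqrt ((1/4)^k)" by (rule real_sqrt_le_mono)
    also have "(1/4 :: real) ^ k = ((1/2)^k)\<^sup>2" by (simp add: power2_eq_square flip: power_mult_distrib)
    also have "sqrt (((1/2 :: real)^k)\<^sup>2) = (1/2)^k" by simp
    finally have "sqrt (sum b X) \<le> (1/2)^k" .
    with bound[OF that(1,2)] M show ?thesis by (meson mult_left_mono order_trans)
  qed
  define d where "d k x = (\<Sum>i\<in>G (Suc k) - G k. f i x)" for k x
  have dL2: "in_L2 (d k)" for k unfolding d_def by (intro in_L2_sum f) (use G(2) in blast)
  have dn: "L2_norm (d k) \<le> M * (1/2)^k" for k unfolding d_def by (intro small) (use G(1,2) in blast)+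
  have "summable (\<lambda>k. L2_norm (d k))"
    by (rule summable_comparison_test'[where g = "\<lambda>k. M * (1/2)^k" and N = 0])
       (use dn in \<open>auto intro!: summable_mult summable_geometric\<close>)
  from L2_complete[OF dL2 this] obtain S' where S': "in_L2 S'"
    "(\<lambda>N. L2_norm (\<lambda>x. S' x - (\<Sum>n<N. d n x))) \<longlonglongrightarrow> 0" by blast
  define S where "S x = S' x + (\<Sum>i\<in>G 0. f i x)" for x
  have fG: "in_L2 (\<lambda>x. \<Sum>i\<in>X. f i x)" if "X \<subseteq> I" for X using f that by (intro in_L2_sum) auto
  have SL2: "in_L2 S" unfolding S_def using S'(1) fG[OF G(2)] by (rule in_L2_add)
  have part: "(\<Sum>i\<in>G N. f i x) = (\<Sum>n<N. d n x) + (\<Sum>i\<in>G 0. f i x)" for N x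
  proof (induction N)
    case (Suc N)
    have "(\<Sum>i\<in>G (Suc N). f i x) = d N x + (\<Sum>i\<in>G N. f i x)"
      unfolding d_def by (rule sum.subset_diff[OF G(4) G(1)])
    then show ?case using Suc by simp
  qed simp
  have SG: "(\<lambda>N. L2_norm (\<lambda>x. S x - (\<Sum>i\<in>G N. f i x))) \<longlonglongrightarrow> 0"
  proof -
    have "S x - (\<Sum>i\<in>G N. f i x) = S' x - (\<Sum>n<N. d n x)" for N x
      unfolding S_def by (subst part) simp
    then show ?thesis using S'(2) by presburger
  qed
  have "((\<lambda>F. L2_norm (\<lambda>x. S x - (\<Sum>i\<in>F. f i x))) \<longlongrightarrow> 0) (finite_subsets_at_top I)"
  proof (rule tendstoI)
    fix e :: real assume "e > 0"
    have "(\<lambda>N. L2_norm (\<lambda>x. S x - (\<Sum>i\<in>G N. f i x)) + M * (1/2)^N) \<longlonglongrightarrow> 0 + M * 0"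
      by (intro tendsto_intros SG) (simp add: LIMSEQ_power_zero)
    then have "\<forall>\<^sub>F N in sequentially. L2_norm (\<lambda>x. S x - (\<Sum>i\<in>G N. f i x)) + M * (1/2)^N < e"
      by (rule order_tendstoD) (use \<open>e > 0\<close> in simp)
    then obtain N where N: "L2_norm (\<lambda>x. S x - (\<Sum>i\<in>G N. f i x)) + M * (1/2)^N < e"
      unfolding eventually_sequentially by (meson order_refl)
    show "\<forall>\<^sub>F F in finite_subsets_at_top I. dist (L2_norm (\<lambda>x. S x - (\<Sum>i\<in>F. f i x))) 0 < e"
      unfolding eventually_finite_subsets_at_top
    proof (intro exI[of _ "G N"] conjI G allI impI)
      fix Y assume Y: "finite Y \<and> G N \<subseteq> Y \<and> Y \<subseteq> I"
      have "L2_norm (\<lambda>x. S x - (\<Sum>i\<in>Y. f i x)) \<le> L2_norm (\<lambda>x. S x - (\<Sum>i\<in>G N. f i x))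
          + L2_norm (\<lambda>x. (\<Sum>i\<in>G N. f i x) - (\<Sum>i\<in>Y. f i x))"
        using Y G by (intro L2_norm_triangle_diff SL2 fG) auto
      also have "L2_norm (\<lambda>x. (\<Sum>i\<in>G N. f i x) - (\<Sum>i\<in>Y. f i x)) = L2_norm (\<lambda>x. \<Sum>i\<in>Y - G N. f i x)"
        using Y by (subst L2_norm_minus_commute) (simp add: sum_diff)
      also have "\<dots> \<le> M * (1/2)^N" using Y by (intro small) auto
      finally show "dist (L2_norm (\<lambda>x. S x - (\<Sum>i\<in>Y. f i x))) 0 < e" using N by simp
    qed
  qed
  then show ?thesis using that SL2 f by (auto simp: L2_has_sum_def)
qed

subsection \<open>A Riesz basis criterion\<close>

lemma L2_eq_sym: "L2_eq f g \<Longrightarrow> L2_eq g f"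
  by (auto simp: L2_eq_def)

lemma L2_eq_trans: "L2_eq f g \<Longrightarrow> L2_eq g h \<Longrightarrow> L2_eq f h"
  unfolding L2_eq_def by (auto elim: AE_mp)

lemma L2_has_sum_cong:
  assumes "L2_has_sum f S I" "\<And>i. i \<in> I \<Longrightarrow> f i = g i"
  shows "L2_has_sum g S I"
proof -
  have "\<forall>\<^sub>F F in finite_subsets_at_top I. L2_norm (\<lambda>x. S x - (\<Sum>i\<in>F. f i x)) = L2_norm (\<lambda>x. S x - (\<Sum>i\<in>F. g i x))"
  proof (rule eventually_finite_subsets_at_top_weakI)
    fix F assume "finite F" "F \<subseteq> I"
    then have "(\<Sum>i\<in>F. f i x) = (\<Sum>i\<in>F. g i x)" for x using assms(2) by (intro sum.cong) auto
    then show "L2_norm (\<lambda>x. S x - (\<Sum>i\<in>F. f i x)) = L2_norm (\<lambda>x. S x - (\<Sum>i\<in>F. g i x))" by simp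
  qed
  from tendsto_cong[OF this] assms show ?thesis by (simp add: L2_has_sum_def)
qed

lemma L2_has_sum_unique:
  fixes S S' :: "real \<Rightarrow> 'a::euclidean_space"
  assumes "L2_has_sum f S I" "L2_has_sum f S' I"
  shows "L2_eq S S'"
proof -
  have S: "in_L2 S" "in_L2 S'" using assms by (auto simp: L2_has_sum_def)
  have "((\<lambda>F. L2_norm (\<lambda>x. S x - S' x)) \<longlongrightarrow> 0) (finite_subsets_at_top I)"
  proof (rule Lim_null_comparison)
    show "\<forall>\<^sub>F F in finite_subsets_at_top I. norm (L2_norm (\<lambda>x. S x - S' x))
       \<le> L2_norm (\<lambda>x. S x - (\<Sum>i\<in>F. f i x)) + L2_norm (\<lambda>x. S' x - (\<Sum>i\<in>F. f i x))"
      using L2_has_sum_in_L2_partial[OF assms(1)]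
    proof eventually_elim
      case (elim F)
      from L2_norm_triangle_diff[OF S(1) elim S(2)] show ?case
        by (simp add: L2_norm_minus_commute[of S'])
    qed
    show "((\<lambda>F. L2_norm (\<lambda>x. S x - (\<Sum>i\<in>F. f i x)) + L2_norm (\<lambda>x. S' x - (\<Sum>i\<in>F. f i x))) \<longlongrightarrow> 0)
       (finite_subsets_at_top I)"
      using assms unfolding L2_has_sum_def by (auto intro!: tendsto_add_zero)
  qed
  then have "L2_norm (\<lambda>x. S x - S' x) = 0"
    by (simp add: tendsto_const_iff)
  then show ?thesis using L2_eq_iff[OF S] by simp
qed

lemma L2_has_sum_add:
  fixes S T :: "real \<Rightarrow> 'a::euclidean_space"
  assumes "L2_has_sum f S I" "L2_has_sum g T I"
  shows "L2_has_sum (\<lambda>i x. f i x + g i x) (\<lambda>x. S x + T x) I"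
proof -
  have S: "in_L2 S" "in_L2 T" using assms by (auto simp: L2_has_sum_def)
  have "((\<lambda>F. L2_norm (\<lambda>x. S x + T x - (\<Sum>i\<in>F. f i x + g i x))) \<longlongrightarrow> 0) (finite_subsets_at_top I)"
  proof (rule Lim_null_comparison)
    show "\<forall>\<^sub>F F in finite_subsets_at_top I. norm (L2_norm (\<lambda>x. S x + T x - (\<Sum>i\<in>F. f i x + g i x)))
       \<le> L2_norm (\<lambda>x. S x - (\<Sum>i\<in>F. f i x)) + L2_norm (\<lambda>x. T x - (\<Sum>i\<in>F. g i x))"
      using L2_has_sum_in_L2_partial[OF assms(1)] L2_has_sum_in_L2_partial[OF assms(2)]
    proof eventually_elim
      case (elim F)
      from L2_norm_triangle[OF in_L2_diff[OF S(1) elim(1)] in_L2_diff[OF S(2) elim(2)]] show ?case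
        by (simp add: sum.distrib algebra_simps)
    qed
    show "((\<lambda>F. L2_norm (\<lambda>x. S x - (\<Sum>i\<in>F. f i x)) + L2_norm (\<lambda>x. T x - (\<Sum>i\<in>F. g i x))) \<longlongrightarrow> 0)
       (finite_subsets_at_top I)"
      using assms unfolding L2_has_sum_def by (auto intro!: tendsto_add_zero)
  qed
  then show ?thesis using assms S by (auto simp: L2_has_sum_def intro: in_L2_add)
qed

lemma L2_has_sum_scale:
  assumes "L2_has_sum f S I"
  shows "L2_has_sum (\<lambda>i x. c *s f i x) (\<lambda>x. c *s (S x :: complex^'n)) I"
proof -
  have "(\<lambda>F. L2_norm (\<lambda>x. c *s S x - (\<Sum>i\<in>F. c *s f i x)))
      = (\<lambda>F. cmod c * L2_norm (\<lambda>x. S x - (\<Sum>i\<in>F. f i x)))"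
    by (simp add: L2_norm_scale[symmetric] vec.scale_right_diff_distrib vec.scale_sum_right)
  moreover have "((\<lambda>F. cmod c * L2_norm (\<lambda>x. S x - (\<Sum>i\<in>F. f i x))) \<longlongrightarrow> cmod c * 0) (finite_subsets_at_top I)"
    using assms unfolding L2_has_sum_def by (intro tendsto_intros) auto
  ultimately show ?thesis using assms by (auto simp: L2_has_sum_def intro: in_L2_scale)
qed

lemma L2_has_sum_diff:
  fixes S T :: "real \<Rightarrow> complex^'n"
  assumes "L2_has_sum f S I" "L2_has_sum g T I"
  shows "L2_has_sum (\<lambda>i x. f i x - g i x) (\<lambda>x. S x - T x) I"
proof -
  have [simp]: "-1 *s v = - v" for v :: "complex^'n" by (simp add: vec_eq_iff)
  show ?thesis using L2_has_sum_add[OF assms(1) L2_has_sum_scale[OF assms(2), of "-1"]] by simp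
qed

lemma L2_has_sum_single:
  assumes "i \<in> I" "\<And>j. j \<in> I \<Longrightarrow> in_L2 (f j)" "\<And>j x. j \<in> I \<Longrightarrow> j \<noteq> i \<Longrightarrow> f j x = 0"
  shows "L2_has_sum f (f i) I"
proof -
  have neut: "(\<Sum>j\<in>Y. f j x) = f i x" if "finite Y" "i \<in> Y" "Y \<subseteq> I" for Y x
  proof -
    have "(\<Sum>j\<in>Y - {i}. f j x) = 0" by (rule sum.neutral) (use that assms(3) in blast)
    with sum.remove[OF that(1,2), of "\<lambda>j. f j x"] show ?thesis by simp
  qed
  have "\<forall>\<^sub>F F in finite_subsets_at_top I. L2_norm (\<lambda>x. f i x - (\<Sum>j\<in>F. f j x)) = 0"
    unfolding eventually_finite_subsets_at_top
  proof (intro exI[of _ "{i}"] conjI allI impI)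
    fix Y assume Y: "finite Y \<and> {i} \<subseteq> Y \<and> Y \<subseteq> I"
    then have "(\<Sum>j\<in>Y. f j x) = f i x" for x by (intro neut) auto
    then show "L2_norm (\<lambda>x. f i x - (\<Sum>j\<in>Y. f j x)) = 0" by simp
  qed (use assms in auto)
  then show ?thesis using assms by (auto simp: L2_has_sum_def intro!: tendsto_eventually)
qed

text \<open>
  The weight makes the difference of the two systems a strict contraction, so that the operator
  mapping \<open>Y i\<close> to \<open>W i\<close> is inverted by a Neumann series.
\<close>

locale weighted_close_systems =
  fixes I :: "'i set" and Y W :: "'i \<Rightarrow> real \<Rightarrow> complex^'n" and w :: "real \<Rightarrow> real" and w0 :: real
  assumes onb: "L2_orthonormal_basis Y I"
    and W_L2: "i \<in> I \<Longrightarrow> in_L2 (W i)"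
    and w_meas [measurable]: "w \<in> borel_measurable M_pi"
    and w0: "0 < w0"
    and w_ge: "x \<in> {0<..<pi} \<Longrightarrow> w0 \<le> w x"
    and w_le: "x \<in> {0<..<pi} \<Longrightarrow> w x \<le> 1"
    and close: "finite F \<Longrightarrow> F \<subseteq> I \<Longrightarrow>
      L2_norm (\<lambda>x. w x *\<^sub>R (\<Sum>i\<in>F. a i *s (Y i x - W i x)))
        \<le> 1 / 2 * L2_norm (\<lambda>x. w x *\<^sub>R (\<Sum>i\<in>F. a i *s Y i x))"
begin

text \<open>The contraction factor \<open>1/2\<close> is available for this weighted seminorm;
  passing back to \<open>L2_norm\<close> costs the factor \<open>w0\<close>.\<close>

definition p :: "(real \<Rightarrow> complex^'n) \<Rightarrow> real" where
  "p f = L2_norm (\<lambda>x. w x *\<^sub>R f x)"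

lemma in_L2_weight:
  assumes "in_L2 f"
  shows "in_L2 (\<lambda>x. w x *\<^sub>R (f x :: complex^'n))"
proof (rule in_L2_mono[OF assms])
  from in_L2_measurable[OF assms] show "(\<lambda>x. w x *\<^sub>R f x) \<in> borel_measurable M_pi" by measurable
  fix x :: real assume "x \<in> {0<..<pi}"
  then have "0 \<le> w x" "w x \<le> 1" using w0 w_ge[of x] w_le[of x] by simp_all
  then show "norm (w x *\<^sub>R f x) \<le> norm (f x)" by (simp add: mult_left_le_one_le)
qed

lemma p_le: "in_L2 f \<Longrightarrow> p f \<le> L2_norm f"
  unfolding p_def
proof (rule L2_norm_mono)
  fix x :: real assume "x \<in> {0<..<pi}"
  then have "0 \<le> w x" "w x \<le> 1" using w0 w_ge[of x] w_le[of x] by simp_all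
  then show "norm (w x *\<^sub>R f x) \<le> norm (f x)" by (simp add: mult_left_le_one_le)
qed (auto intro: in_L2_weight)

lemma p_ge: "in_L2 f \<Longrightarrow> w0 * L2_norm f \<le> p f"
proof -
  assume f: "in_L2 f"
  have "L2_norm (\<lambda>x. w0 *\<^sub>R f x) \<le> p f" unfolding p_def
  proof (rule L2_norm_mono)
    fix x :: real assume "x \<in> {0<..<pi}"
    then have "w0 \<le> w x" using w_ge by auto
    then show "norm (w0 *\<^sub>R f x) \<le> norm (w x *\<^sub>R f x)" using w0 by (simp add: mult_right_mono)
  qed (use f in \<open>auto intro: in_L2_weight in_L2_scaleR\<close>)
  then show ?thesis using w0 by (simp add: L2_norm_scaleR)
qed

lemma p_triangle_diff: "in_L2 f \<Longrightarrow> in_L2 g \<Longrightarrow> p f \<le> p g + p (\<lambda>x. f x - g x)"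
  unfolding p_def using L2_norm_triangle_diff2[of "\<lambda>x. w x *\<^sub>R f x" "\<lambda>x. w x *\<^sub>R g x"]
  by (simp add: in_L2_weight scaleR_diff_right)

lemma orth: "L2_orthonormal Y I" using onb by (rule L2_orthonormal_basis_imp)

lemma Y_L2: "i \<in> I \<Longrightarrow> in_L2 (Y i)" using orth by (rule L2_orthonormal_in_L2)

lemma in_L2_Y_sum: "F \<subseteq> I \<Longrightarrow> in_L2 (\<lambda>x. \<Sum>i\<in>F. a i *s Y i x)"
  by (intro in_L2_sum in_L2_scale Y_L2) auto

lemma in_L2_W_sum: "F \<subseteq> I \<Longrightarrow> in_L2 (\<lambda>x. \<Sum>i\<in>F. a i *s W i x)"
  by (intro in_L2_sum in_L2_scale W_L2) auto

lemma close':
  assumes "finite F" "F \<subseteq> I"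
  shows "p (\<lambda>x. (\<Sum>i\<in>F. a i *s Y i x) - (\<Sum>i\<in>F. a i *s W i x)) \<le> 1/2 * p (\<lambda>x. \<Sum>i\<in>F. a i *s Y i x)"
  using close[OF assms, of a]
  by (simp add: p_def vec.scale_right_diff_distrib sum_subtractf)

lemma norm_Y_sum:
  assumes "finite F" "F \<subseteq> I"
  shows "L2_norm (\<lambda>x. \<Sum>i\<in>F. a i *s Y i x) = sqrt (\<Sum>i\<in>F. (cmod (a i))\<^sup>2)"
  using arg_cong[OF L2_norm_sum_orthonormal[OF orth assms, of a], of sqrt] by simp

text \<open>Half of \<open>p\<close> of the \<open>Y\<close> sum is absorbed on the left, so the
  \<open>W\<close> sum keeps the other half. The constant \<open>w0 / 2\<close> becomes the
  \<epsilon> of the theorem.\<close>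

lemma W_sum_lower:
  assumes F: "finite F" "F \<subseteq> I"
  shows "w0 / 2 * sqrt (\<Sum>i\<in>F. (cmod (a i))\<^sup>2) \<le> L2_norm (\<lambda>x. \<Sum>i\<in>F. a i *s W i x)"
proof -
  have "p (\<lambda>x. \<Sum>i\<in>F. a i *s Y i x) \<le> 2 * p (\<lambda>x. \<Sum>i\<in>F. a i *s W i x)"
    using p_triangle_diff[OF in_L2_Y_sum in_L2_W_sum, OF F(2,2), of a a] close'[OF F, of a] by simp
  also have "\<dots> \<le> 2 * L2_norm (\<lambda>x. \<Sum>i\<in>F. a i *s W i x)"
    using p_le[OF in_L2_W_sum[OF F(2)]] by simp
  finally show ?thesis using p_ge[OF in_L2_Y_sum[OF F(2)], of a] norm_Y_sum[OF F, of a] by simp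
qed

lemma W_sum_upper:
  assumes F: "finite F" "F \<subseteq> I"
  shows "L2_norm (\<lambda>x. \<Sum>i\<in>F. a i *s W i x) \<le> (1 + 1 / (2 * w0)) * sqrt (\<Sum>i\<in>F. (cmod (a i))\<^sup>2)"
proof -
  let ?y = "\<lambda>x. \<Sum>i\<in>F. a i *s Y i x" and ?w = "\<lambda>x. \<Sum>i\<in>F. a i *s W i x"
  note y = in_L2_Y_sum[OF F(2), of a] and ww = in_L2_W_sum[OF F(2), of a]
  have "w0 * L2_norm (\<lambda>x. ?y x - ?w x) \<le> 1/2 * L2_norm ?y"
    using p_ge[OF in_L2_diff[OF y ww]] close'[OF F, of a] p_le[OF y] by simp
  then have "L2_norm (\<lambda>x. ?y x - ?w x) \<le> 1 / (2 * w0) * L2_norm ?y"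
    using w0 by (simp add: field_simps)
  then show ?thesis
    using L2_norm_triangle_diff2[OF ww y] norm_Y_sum[OF F, of a] L2_norm_minus_commute[of ?w ?y]
    by (simp add: algebra_simps)
qed

lemma W_has_sum:
  assumes "in_l2 a I"
  obtains S where "L2_has_sum (\<lambda>i x. a i *s W i x) S I"
  by (rule L2_has_sum_exists[of I "\<lambda>i x. a i *s W i x" "\<lambda>i. (cmod (a i))\<^sup>2" "1 + 1 / (2 * w0)"])
     (use assms w0 in \<open>auto intro!: in_L2_scale W_L2 W_sum_upper simp: in_l2_def\<close>)

lemma l2_norm_tendsto:
  assumes "in_l2 a I"
  shows "((\<lambda>F. sqrt (\<Sum>i\<in>F. (cmod (a i))\<^sup>2)) \<longlongrightarrow> l2_norm a I) (finite_subsets_at_top I)"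
  unfolding l2_norm_def using assms by (intro tendsto_real_sqrt infsum_tendsto) (simp add: in_l2_def)

lemma W_has_sum_lower:
  assumes "in_l2 a I" "L2_has_sum (\<lambda>i x. a i *s W i x) S I"
  shows "w0 / 2 * l2_norm a I \<le> L2_norm S"
proof (rule tendsto_le[OF _ L2_has_sum_norm_tendsto[OF assms(2)]])
  show "((\<lambda>F. w0 / 2 * sqrt (\<Sum>i\<in>F. (cmod (a i))\<^sup>2)) \<longlongrightarrow> w0 / 2 * l2_norm a I) (finite_subsets_at_top I)"
    by (intro tendsto_intros l2_norm_tendsto assms)
  show "\<forall>\<^sub>F F in finite_subsets_at_top I. w0 / 2 * sqrt (\<Sum>i\<in>F. (cmod (a i))\<^sup>2)
      \<le> L2_norm (\<lambda>x. \<Sum>i\<in>F. a i *s W i x)"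
    by (intro eventually_finite_subsets_at_top_weakI W_sum_lower)
qed simp

text \<open>A sum in the seminorm is determined only up to a null set, so a representative is
  chosen; linearity of \<open>T\<close> accordingly holds in the sense of
  \<open>L2_eq\<close>.\<close>

definition T :: "(real \<Rightarrow> complex^'n) \<Rightarrow> real \<Rightarrow> complex^'n" where
  "T g = (SOME S. L2_has_sum (\<lambda>i x. L2_inner (Y i) g *s W i x) S I)"

lemma in_l2_coeffs: "in_L2 g \<Longrightarrow> in_l2 (\<lambda>i. L2_inner (Y i) g) I"
  using L2_Parseval[OF onb, of g] by (auto simp: in_l2_def summable_on_def)

lemma l2_norm_coeffs: "in_L2 g \<Longrightarrow> l2_norm (\<lambda>i. L2_inner (Y i) g) I = L2_norm g"
  using L2_Parseval[OF onb, of g] by (simp add: l2_norm_def infsumI)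

lemma T_has_sum:
  assumes "in_L2 g"
  shows "L2_has_sum (\<lambda>i x. L2_inner (Y i) g *s W i x) (T g) I"
proof -
  obtain S where "L2_has_sum (\<lambda>i x. L2_inner (Y i) g *s W i x) S I"
    by (rule W_has_sum[OF in_l2_coeffs[OF assms]])
  then have "\<exists>S. L2_has_sum (\<lambda>i x. L2_inner (Y i) g *s W i x) S I" by blast
  from someI_ex[OF this] show ?thesis unfolding T_def .
qed

lemma T_in_L2: "in_L2 g \<Longrightarrow> in_L2 (T g)"
  using T_has_sum by (auto simp: L2_has_sum_def)

lemma Y_has_sum: "in_L2 g \<Longrightarrow> L2_has_sum (\<lambda>i x. L2_inner (Y i) g *s Y i x) g I"
  using onb by (auto simp: L2_orthonormal_basis_def)

lemma T_lower: "in_L2 g \<Longrightarrow> w0 / 2 * L2_norm g \<le> L2_norm (T g)"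
  using W_has_sum_lower[OF in_l2_coeffs T_has_sum, of g] by (simp add: l2_norm_coeffs)

lemma T_upper:
  assumes "in_L2 g"
  shows "L2_norm (T g) \<le> (1 + 1 / (2 * w0)) * L2_norm g"
proof (rule tendsto_le[OF _ _ L2_has_sum_norm_tendsto[OF T_has_sum[OF assms]]])
  show "((\<lambda>F. (1 + 1 / (2 * w0)) * sqrt (\<Sum>i\<in>F. (cmod (L2_inner (Y i) g))\<^sup>2))
      \<longlongrightarrow> (1 + 1 / (2 * w0)) * L2_norm g) (finite_subsets_at_top I)"
    using l2_norm_tendsto[OF in_l2_coeffs[OF assms]] l2_norm_coeffs[OF assms]
    by (intro tendsto_intros) simp
  show "\<forall>\<^sub>F F in finite_subsets_at_top I. L2_norm (\<lambda>x. \<Sum>i\<in>F. L2_inner (Y i) g *s W i x)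
      \<le> (1 + 1 / (2 * w0)) * sqrt (\<Sum>i\<in>F. (cmod (L2_inner (Y i) g))\<^sup>2)"
    by (intro eventually_finite_subsets_at_top_weakI W_sum_upper)
qed simp

lemma p_tendsto:
  assumes "L2_has_sum f S I"
  shows "((\<lambda>F. p (\<lambda>x. \<Sum>i\<in>F. f i x)) \<longlongrightarrow> p S) (finite_subsets_at_top I)"
  unfolding p_def
proof (rule L2_norm_tendsto)
  have S: "in_L2 S" using assms by (simp add: L2_has_sum_def)
  then show "in_L2 (\<lambda>x. w x *\<^sub>R S x)" by (rule in_L2_weight)
  show "\<forall>\<^sub>F F in finite_subsets_at_top I. in_L2 (\<lambda>x. w x *\<^sub>R (\<Sum>i\<in>F. f i x))"
    using L2_has_sum_in_L2_partial[OF assms] by eventually_elim (rule in_L2_weight)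
  show "((\<lambda>F. L2_norm (\<lambda>x. w x *\<^sub>R S x - w x *\<^sub>R (\<Sum>i\<in>F. f i x))) \<longlongrightarrow> 0) (finite_subsets_at_top I)"
  proof (rule Lim_null_comparison)
    show "((\<lambda>F. L2_norm (\<lambda>x. S x - (\<Sum>i\<in>F. f i x))) \<longlongrightarrow> 0) (finite_subsets_at_top I)"
      using assms by (simp add: L2_has_sum_def)
    show "\<forall>\<^sub>F F in finite_subsets_at_top I. norm (L2_norm (\<lambda>x. w x *\<^sub>R S x - w x *\<^sub>R (\<Sum>i\<in>F. f i x)))
        \<le> L2_norm (\<lambda>x. S x - (\<Sum>i\<in>F. f i x))"
      using L2_has_sum_in_L2_partial[OF assms]
    proof eventually_elim
      case (elim F)
      from p_le[OF in_L2_diff[OF S elim]] show ?case by (simp add: p_def scaleR_diff_right)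
    qed
  qed
qed

text \<open>Continuity of \<open>p\<close> carries the closeness from finite sums to all functions;
  this is the contraction behind the Neumann series.\<close>

lemma T_close:
  assumes "in_L2 g"
  shows "p (\<lambda>x. g x - T g x) \<le> 1/2 * p g"
proof (rule tendsto_le)
  show "((\<lambda>F. p (\<lambda>x. \<Sum>i\<in>F. L2_inner (Y i) g *s Y i x - L2_inner (Y i) g *s W i x)) \<longlongrightarrow> p (\<lambda>x. g x - T g x))
      (finite_subsets_at_top I)"
    by (rule p_tendsto[OF L2_has_sum_diff[OF Y_has_sum T_has_sum]]) (use assms in auto)
  show "((\<lambda>F. 1/2 * p (\<lambda>x. \<Sum>i\<in>F. L2_inner (Y i) g *s Y i x)) \<longlongrightarrow> 1/2 * p g) (finite_subsets_at_top I)"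
    by (intro tendsto_intros p_tendsto Y_has_sum assms)
  show "\<forall>\<^sub>F F in finite_subsets_at_top I. p (\<lambda>x. \<Sum>i\<in>F. L2_inner (Y i) g *s Y i x - L2_inner (Y i) g *s W i x)
      \<le> 1/2 * p (\<lambda>x. \<Sum>i\<in>F. L2_inner (Y i) g *s Y i x)"
    using close' by (intro eventually_finite_subsets_at_top_weakI) (simp add: sum_subtractf)
qed simp

lemma T_linear:
  assumes "in_L2 f" "in_L2 g"
  shows "L2_eq (T (\<lambda>x. a *s f x + b *s g x)) (\<lambda>x. a *s T f x + b *s T g x)"
proof (rule L2_has_sum_unique)
  let ?k = "\<lambda>x. a *s f x + b *s g x"
  have k: "in_L2 ?k" by (intro in_L2_add in_L2_scale assms)
  show "L2_has_sum (\<lambda>i x. L2_inner (Y i) ?k *s W i x) (T ?k) I" by (rule T_has_sum[OF k])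
  have "L2_has_sum (\<lambda>i x. a *s (L2_inner (Y i) f *s W i x) + b *s (L2_inner (Y i) g *s W i x))
      (\<lambda>x. a *s T f x + b *s T g x) I"
    by (intro L2_has_sum_add L2_has_sum_scale T_has_sum assms)
  moreover have "L2_inner (Y i) ?k *s W i x
      = a *s (L2_inner (Y i) f *s W i x) + b *s (L2_inner (Y i) g *s W i x)" if "i \<in> I" for i x
  proof -
    have "L2_inner (Y i) ?k = a * L2_inner (Y i) f + b * L2_inner (Y i) g"
      using Y_L2[OF that] assms by (simp add: L2_inner_add_right in_L2_scale L2_inner_scale_right)
    then show ?thesis by (simp add: vec_eq_iff algebra_simps)
  qed
  ultimately show "L2_has_sum (\<lambda>i x. L2_inner (Y i) ?k *s W i x) (\<lambda>x. a *s T f x + b *s T g x) I"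
    by (auto elim!: L2_has_sum_cong)
qed

lemma T_L2_operator: "L2_operator T"
  unfolding L2_operator_def using T_in_L2 T_linear T_upper by blast

lemma T_Y: "i \<in> I \<Longrightarrow> L2_eq (W i) (T (Y i))"
proof (rule L2_has_sum_unique)
  assume i: "i \<in> I"
  show "L2_has_sum (\<lambda>j x. L2_inner (Y j) (Y i) *s W j x) (T (Y i)) I"
    by (rule T_has_sum[OF Y_L2[OF i]])
  have ij: "L2_inner (Y j) (Y i) = (if j = i then 1 else 0)" if "j \<in> I" for j
    using orth i that by (simp add: L2_orthonormal_def)
  have "L2_has_sum (\<lambda>j x. L2_inner (Y j) (Y i) *s W j x) (\<lambda>x. L2_inner (Y i) (Y i) *s W i x) I"
    by (rule L2_has_sum_single[OF i]) (use W_L2 in \<open>auto simp: ij intro: in_L2_scale\<close>)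
  then show "L2_has_sum (\<lambda>j x. L2_inner (Y j) (Y i) *s W j x) (W i) I" by (simp add: ij i)
qed

lemma T_add: "in_L2 f \<Longrightarrow> in_L2 g \<Longrightarrow> L2_eq (T (\<lambda>x. f x + g x)) (\<lambda>x. T f x + T g x)"
  using T_linear[of f g 1 1] by simp

lemma T_diff: "in_L2 f \<Longrightarrow> in_L2 g \<Longrightarrow> L2_eq (T (\<lambda>x. f x - g x)) (\<lambda>x. T f x - T g x)"
proof -
  have [simp]: "-1 *s v = - v" for v :: "complex^'n" by (simp add: vec_eq_iff)
  show "in_L2 f \<Longrightarrow> in_L2 g \<Longrightarrow> ?thesis" using T_linear[of f g 1 "-1"] by simp
qed

lemma T_inj:
  assumes "in_L2 f" "in_L2 g" "L2_eq (T f) (T g)"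
  shows "L2_eq f g"
proof -
  have "L2_norm (T (\<lambda>x. f x - g x)) = L2_norm (\<lambda>x. T f x - T g x)"
    using assms by (intro L2_norm_cong_L2_eq T_diff T_in_L2 in_L2_diff)
  also have "\<dots> = 0" using assms by (subst L2_eq_iff[symmetric]) (auto intro: T_in_L2)
  finally have "w0 / 2 * L2_norm (\<lambda>x. f x - g x) \<le> 0" using T_lower[OF in_L2_diff[OF assms(1,2)]] by simp
  then have "L2_norm (\<lambda>x. f x - g x) \<le> 0" using w0 by (simp add: mult_le_0_iff)
  then show ?thesis using L2_norm_nonneg[of "\<lambda>x. f x - g x"] by (simp add: L2_eq_iff[OF assms(1,2)])
qed

text \<open>Iterating the map from \<open>k\<close> to \<open>k - T k\<close> gives residuals that
  decay like \<open>(1/2) ^ n\<close> in \<open>p\<close>. Their sum solves the equation, since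
  \<open>T (r n)\<close> equals \<open>r n - r (Suc n)\<close> and the images of the partial sums
  collapse to \<open>g - r N\<close>, up to null sets.\<close>

lemma T_surj:
  assumes g: "in_L2 g"
  shows "\<exists>f. in_L2 f \<and> L2_eq (T f) g"
proof -
  define r where "r n = ((\<lambda>k x. k x - T k x) ^^ n) g" for n
  have r0: "r 0 = g" and rS: "r (Suc n) = (\<lambda>x. r n x - T (r n) x)" for n by (simp_all add: r_def)
  have rL2: "in_L2 (r n)" for n by (induction n) (auto simp: r0 rS g intro!: in_L2_diff T_in_L2)
  have rp: "p (r n) \<le> (1/2)^n * p g" for n
  proof (induction n)
    case (Suc n)
    then show ?case using T_close[OF rL2[of n]] by (simp add: rS)
  qed (simp add: r0)
  have rn: "L2_norm (r n) \<le> p g / w0 * (1/2)^n" for n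
  proof -
    have "w0 * L2_norm (r n) \<le> (1/2)^n * p g" using p_ge[OF rL2[of n]] rp[of n] by linarith
    then show ?thesis using w0 by (simp add: field_simps)
  qed
  have "summable (\<lambda>n. L2_norm (r n))"
    by (rule summable_comparison_test'[where g = "\<lambda>n. p g / w0 * (1/2)^n" and N = 0])
       (use rn in \<open>auto intro!: summable_mult summable_geometric\<close>)
  from L2_complete[OF rL2 this] obtain f where f: "in_L2 f"
    "(\<lambda>N. L2_norm (\<lambda>x. f x - (\<Sum>n<N. r n x))) \<longlonglongrightarrow> 0" by blast
  let ?s = "\<lambda>N x. \<Sum>n<N. r n x"
  have sL2: "in_L2 (?s N)" for N by (intro in_L2_sum rL2)
  have Ts: "L2_eq (T (?s N)) (\<lambda>x. g x - r N x)" for N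
  proof (induction N)
    case 0
    have "L2_norm (T (\<lambda>x. 0)) = 0" using T_upper[of "\<lambda>x. 0"] L2_norm_nonneg[of "T (\<lambda>x. 0)"] by simp
    then show ?case using L2_eq_iff[of "T (\<lambda>x. 0)" "\<lambda>x. 0"] by (simp add: T_in_L2 r0)
  next
    case (Suc N)
    have "L2_eq (T (\<lambda>x. ?s N x + r N x)) (\<lambda>x. T (?s N) x + T (r N) x)" by (intro T_add sL2 rL2)
    with Suc show ?case unfolding L2_eq_def by (auto simp: rS)
  qed
  have Tf: "in_L2 (T f)" using f by (intro T_in_L2)
  have bound: "L2_norm (\<lambda>x. T f x - g x) \<le>
      (1 + 1 / (2 * w0)) * L2_norm (\<lambda>x. f x - ?s N x) + p g / w0 * (1/2)^N" for N
  proof -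
    have "L2_norm (\<lambda>x. T f x - g x) \<le> L2_norm (\<lambda>x. T f x - T (?s N) x) + L2_norm (\<lambda>x. T (?s N) x - g x)"
      by (intro L2_norm_triangle_diff Tf T_in_L2 sL2 g)
    also have "L2_norm (\<lambda>x. T f x - T (?s N) x) = L2_norm (T (\<lambda>x. f x - ?s N x))"
      by (intro L2_norm_cong_L2_eq L2_eq_sym[OF T_diff] in_L2_diff T_in_L2 sL2 f)
    also have "\<dots> \<le> (1 + 1 / (2 * w0)) * L2_norm (\<lambda>x. f x - ?s N x)"
      by (intro T_upper in_L2_diff sL2 f)
    also have "L2_norm (\<lambda>x. T (?s N) x - g x) = L2_norm (r N)"
    proof (rule L2_norm_cong_AE)
      show "AE x in M_pi. norm (T (?s N) x - g x) = norm (r N x)"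
        using Ts[of N] unfolding L2_eq_def by eventually_elim simp
    qed (intro in_L2_measurable in_L2_diff T_in_L2 sL2 g rL2)+
    also note rn[of N]
    finally show ?thesis by simp
  qed
  have "(\<lambda>N. (1 + 1 / (2 * w0)) * L2_norm (\<lambda>x. f x - ?s N x) + p g / w0 * (1/2)^N)
      \<longlonglongrightarrow> (1 + 1 / (2 * w0)) * 0 + p g / w0 * 0"
    by (intro tendsto_intros f LIMSEQ_power_zero) simp
  then have "L2_norm (\<lambda>x. T f x - g x) \<le> (1 + 1 / (2 * w0)) * 0 + p g / w0 * 0"
    by (rule LIMSEQ_le_const) (intro exI[of _ 0] allI impI bound)
  then have "L2_norm (\<lambda>x. T f x - g x) = 0" using L2_norm_nonneg[of "\<lambda>x. T f x - g x"] by simp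
  then have "L2_eq (T f) g" using L2_eq_iff[OF Tf g] by simp
  with f(1) show ?thesis by (intro exI conjI)
qed

text \<open>The inverse is chosen function by function; its linearity follows from injectivity of
  \<open>T\<close>, its bound from the lower bound for \<open>T\<close>.\<close>

lemma T_invertible: "L2_invertible_operator T"
proof -
  define S where "S g = (SOME f. in_L2 f \<and> L2_eq (T f) g)" for g
  have S: "in_L2 (S g)" "L2_eq (T (S g)) g" if "in_L2 g" for g
    using someI_ex[OF T_surj[OF that]] unfolding S_def by blast+
  have inv: "L2_eq (S (T f)) f" if "in_L2 f" for f
    by (rule T_inj[OF S(1)[OF T_in_L2[OF that]] that S(2)[OF T_in_L2[OF that]]])
  have lin: "L2_eq (S (\<lambda>x. a *s f x + b *s g x)) (\<lambda>x. a *s S f x + b *s S g x)"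
    if f: "in_L2 f" and g: "in_L2 g" for f g a b
  proof (rule T_inj)
    show "in_L2 (S (\<lambda>x. a *s f x + b *s g x))" by (intro S in_L2_add in_L2_scale f g)
    show "in_L2 (\<lambda>x. a *s S f x + b *s S g x)" by (intro S in_L2_add in_L2_scale f g)
    have "L2_eq (\<lambda>x. a *s f x + b *s g x) (\<lambda>x. a *s T (S f) x + b *s T (S g) x)"
      using S(2)[OF f] S(2)[OF g] unfolding L2_eq_def by eventually_elim simp
    then show "L2_eq (T (S (\<lambda>x. a *s f x + b *s g x))) (T (\<lambda>x. a *s S f x + b *s S g x))"
      using S(2)[OF in_L2_add[OF in_L2_scale[OF f] in_L2_scale[OF g]], of a b]
        T_linear[OF S(1)[OF f] S(1)[OF g], of a b]
      by (meson L2_eq_sym L2_eq_trans)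
  qed
  have "L2_norm (S g) \<le> 2 / w0 * L2_norm g" if g: "in_L2 g" for g
  proof -
    have "w0 / 2 * L2_norm (S g) \<le> L2_norm g"
      using T_lower[OF S(1)[OF g]] L2_norm_cong_L2_eq[OF T_in_L2[OF S(1)[OF g]] g S(2)[OF g]] by simp
    then show ?thesis using w0 by (simp add: field_simps)
  qed
  then have "L2_operator S" unfolding L2_operator_def using S(1) lin by blast
  then show ?thesis unfolding L2_invertible_operator_def using T_L2_operator S inv by blast
qed

theorem W_Riesz_basis: "Riesz_basis W I"
  unfolding Riesz_basis_def using W_L2 onb T_invertible T_Y by blast

end

subsection \<open>Integrals over subintervals of \<open>[0, pi]\<close>\<close>

lemma in_L2_integrable_M:
  fixes f :: "real \<Rightarrow> 'a::euclidean_space"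
  assumes "in_L2 f"
  shows "integrable M_pi f"
proof -
  interpret finite_measure M_pi
    by (rule finite_measure_lebesgue_on) (simp add: lmeasurable_box flip: box_real)
  have "integrable M_pi (\<lambda>x. 1 + (norm (f x))\<^sup>2)"
    using in_L2_integrable[OF assms] by simp
  then show ?thesis
  proof (rule Bochner_Integration.integrable_bound)
    have "a \<le> 1 + a\<^sup>2" for a :: real
    proof -
      have "2 * a \<le> 1 + a\<^sup>2" using sum_squares_bound[of 1 a] by simp
      moreover have "0 \<le> a\<^sup>2" by simp
      ultimately show ?thesis by linarith
    qed
    then show "AE x in M_pi. norm (f x) \<le> norm (1 + (norm (f x))\<^sup>2)" by (intro AE_I2) (simp add: add_nonneg_nonneg)
  qed (use assms in_L2_measurable in auto)
qed

lemma absolutely_integrable_M_pi: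
  fixes f :: "real \<Rightarrow> 'a::euclidean_space"
  assumes "integrable M_pi f"
  shows "f absolutely_integrable_on {0..pi}" "(\<integral>x. f x \<partial>M_pi) = integral {0..pi} f"
proof -
  have "f absolutely_integrable_on {0<..<pi}"
    using assms by (simp add: set_integrable_def integrable_restrict_space)
  then show "f absolutely_integrable_on {0..pi}"
    using absolutely_integrable_on_open_interval[of 0 pi f] by simp
  show "(\<integral>x. f x \<partial>M_pi) = integral {0..pi} f"
    using lebesgue_integral_eq_integral[OF assms] by (simp add: integral_open_interval_real)
qed

lemma integrable_M_pi_iff:
  fixes f :: "real \<Rightarrow> 'a::euclidean_space"
  shows "integrable M_pi f \<longleftrightarrow> f absolutely_integrable_on {0..pi}"
proof
  assume "f absolutely_integrable_on {0..pi}"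
  then have "f absolutely_integrable_on {0<..<pi}"
    using absolutely_integrable_on_open_interval[of 0 pi f] by simp
  then show "integrable M_pi f" by (simp add: set_integrable_def integrable_restrict_space)
qed (rule absolutely_integrable_M_pi)

lemma continuous_L2:
  fixes f :: "real \<Rightarrow> 'a::euclidean_space"
  assumes "continuous_on {0..pi} f"
  shows "in_L2 f" "(L2_norm f)\<^sup>2 = integral {0..pi} (\<lambda>x. (norm (f x))\<^sup>2)"
proof -
  have c: "continuous_on {0..pi} (\<lambda>x. (norm (f x))\<^sup>2)" using assms by (intro continuous_intros)
  have int: "integrable M_pi (\<lambda>x. (norm (f x))\<^sup>2)" unfolding integrable_M_pi_iff
    using c by (rule absolutely_integrable_continuous_real)
  have "integrable M_pi f" unfolding integrable_M_pi_iff
    using assms by (rule absolutely_integrable_continuous_real)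
  then show "in_L2 f" using int by (simp add: in_L2_def)
  show "(L2_norm f)\<^sup>2 = integral {0..pi} (\<lambda>x. (norm (f x))\<^sup>2)"
    unfolding L2_norm_power2 by (rule absolutely_integrable_M_pi(2)[OF int])
qed

lemma integrable_on_subinterval_pi:
  fixes f :: "real \<Rightarrow> 'a::euclidean_space"
  assumes "f absolutely_integrable_on {0..pi}" "x \<le> pi"
  shows "f absolutely_integrable_on {0..x}"
  by (rule set_integrable_subset[OF assms(1)]) (use assms(2) in auto)

text \<open>Extension by zero lets the Cauchy-Schwarz inequality of the full interval serve on
  \<open>{0..x}\<close>.\<close>

lemma continuous_restrict_L2:
  fixes g :: "real \<Rightarrow> real"
  assumes "continuous_on {0..x} g" "x \<le> pi"
  shows "in_L2 (\<lambda>t. if t \<in> {0..x} then g t else 0)"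
    "(L2_norm (\<lambda>t. if t \<in> {0..x} then g t else 0))\<^sup>2 = integral {0..x} (\<lambda>t. (g t)\<^sup>2)"
proof -
  let ?g = "\<lambda>t. if t \<in> {0..x} then g t else 0"
  have restr: "(\<lambda>t. if t \<in> {0..x} then k t else 0) absolutely_integrable_on {0..pi}"
    if "continuous_on {0..x} k" for k :: "real \<Rightarrow> real"
  proof -
    have "k absolutely_integrable_on {0..x}" using that by (rule absolutely_integrable_continuous_real)
    moreover have "indicator {0..pi} t *\<^sub>R (if t \<in> {0..x} then k t else 0) = indicator {0..x} t *\<^sub>R k t" for t
      using assms(2) by (auto simp: indicator_def)
    ultimately show ?thesis unfolding set_integrable_def by simp
  qed
  have sq: "(norm (?g t))\<^sup>2 = (if t \<in> {0..x} then (g t)\<^sup>2 else 0)" for t by simp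
  have int: "integrable M_pi (\<lambda>t. (norm (?g t))\<^sup>2)" unfolding integrable_M_pi_iff sq
    by (intro restr continuous_intros assms)
  moreover have "integrable M_pi ?g" unfolding integrable_M_pi_iff by (intro restr assms)
  ultimately show "in_L2 ?g" by (simp add: in_L2_def)
  have "(L2_norm ?g)\<^sup>2 = integral {0..pi} (\<lambda>t. (norm (?g t))\<^sup>2)"
    unfolding L2_norm_power2 by (rule absolutely_integrable_M_pi(2)[OF int])
  also have "\<dots> = integral ({0..x} \<inter> {0..pi}) (\<lambda>t. (g t)\<^sup>2)"
    unfolding sq by (rule integral_restrict_Int)
  also have "{0..x} \<inter> {0..pi} = {0..x}" using assms by auto
  finally show "(L2_norm ?g)\<^sup>2 = integral {0..x} (\<lambda>t. (g t)\<^sup>2)" .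
qed

lemma L2_Cauchy_Schwarz_interval:
  fixes f :: "real \<Rightarrow> 'a::euclidean_space" and g :: "real \<Rightarrow> real"
  assumes f: "in_L2 f" and g: "continuous_on {0..x} g" "\<And>t. t \<in> {0..x} \<Longrightarrow> 0 \<le> g t" and "x \<le> pi"
  shows "(\<lambda>t. norm (f t) * g t) integrable_on {0..x}"
    "integral {0..x} (\<lambda>t. norm (f t) * g t) \<le> L2_norm f * sqrt (integral {0..x} (\<lambda>t. (g t)\<^sup>2))"
proof -
  let ?g = "\<lambda>t. if t \<in> {0..x} then g t else 0"
  note gL2 = continuous_restrict_L2[OF g(1) \<open>x \<le> pi\<close>]
  have eq: "norm (f t) * norm (?g t) = (if t \<in> {0..x} then norm (f t) * g t else 0)" for t
    using g(2)[of t] by auto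
  have cap: "{0..x} \<inter> {0..pi} = {0..x}" using assms by auto
  note int = integrable_norm_mult[OF f gL2(1)]
  from absolutely_integrable_M_pi[OF int]
  have "(\<lambda>t. if t \<in> {0..x} then norm (f t) * g t else 0) integrable_on {0..pi}"
    unfolding eq by (auto simp: absolutely_integrable_on_def)
  then show "(\<lambda>t. norm (f t) * g t) integrable_on {0..x}"
    unfolding integrable_restrict_Int cap .
  have "integral {0..x} (\<lambda>t. norm (f t) * g t) = (\<integral>t. norm (f t) * norm (?g t) \<partial>M_pi)"
    unfolding absolutely_integrable_M_pi(2)[OF int] unfolding eq integral_restrict_Int cap ..
  also have "\<dots> \<le> L2_norm f * L2_norm ?g" by (rule L2_Cauchy_Schwarz[OF f gL2(1)])
  also have "L2_norm ?g = sqrt (integral {0..x} (\<lambda>t. (g t)\<^sup>2))"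
    using arg_cong[OF gL2(2), of sqrt] by simp
  finally show "integral {0..x} (\<lambda>t. norm (f t) * g t) \<le> L2_norm f * sqrt (integral {0..x} (\<lambda>t. (g t)\<^sup>2))" .
qed

text \<open>The hypothesis says that \<open>exp (- (k * x))\<close> times the right side has a
  nonpositive derivative.\<close>

lemma Gronwall:
  fixes E :: "real \<Rightarrow> real"
  assumes E: "continuous_on {0..X} E" and k: "0 \<le> k"
    and le: "\<And>x. x \<in> {0..X} \<Longrightarrow> E x \<le> a + k * integral {0..x} E" and x: "x \<in> {0..X}"
  shows "E x \<le> a * exp (k * x)"
proof -
  define G where "G x = exp (- (k * x)) * (a + k * integral {0..x} E)" for x
  have der: "(G has_real_derivative exp (- (k * y)) * k * (E y - (a + k * integral {0..y} E))) (at y within {0..X})"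
    if "y \<in> {0..X}" for y
  proof -
    have "((\<lambda>x. integral {0..x} E) has_real_derivative E y) (at y within {0..X})"
      using integral_has_vector_derivative[OF E that] by (simp add: has_real_derivative_iff_has_vector_derivative)
    then show ?thesis unfolding G_def
      by (auto intro!: derivative_eq_intros simp: algebra_simps)
  qed
  have "G x \<le> G 0"
  proof (rule DERIV_nonpos_imp_decreasing_open[where f = G and a = 0 and b = x])
    have "continuous_on {0..X} G"
      using der by (meson DERIV_continuous continuous_on_eq_continuous_within)
    then show "continuous_on {0..x} G" by (rule continuous_on_subset) (use x in auto)
    fix y assume y: "0 < y" "y < x"
    then have yX: "y \<in> {0..X}" and "y \<in> interior {0..X}" using x by auto
    then have "at y within {0..X} = at y" by (intro at_within_interior)
    with der[OF yX]
    have d: "(G has_real_derivative exp (- (k * y)) * k * (E y - (a + k * integral {0..y} E))) (at y)" by simp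
    have "exp (- (k * y)) * k * (E y - (a + k * integral {0..y} E)) \<le> 0"
      using le[OF yX] k by (intro mult_nonneg_nonpos) auto
    with d show "\<exists>y'. DERIV G y :> y' \<and> y' \<le> 0" by blast
  qed (use x in auto)
  then have "exp (- (k * x)) * (a + k * integral {0..x} E) \<le> a" by (simp add: G_def)
  then have "a + k * integral {0..x} E \<le> a * exp (k * x)"
    by (simp add: exp_minus field_simps)
  with le[OF x] show ?thesis by linarith
qed

subsection \<open>Integration by parts against a primitive\<close>

text \<open>As \<open>W\<close> is only integrable, \<open>Z\<close> need not have the derivative
  \<open>W\<close> at every point, so the product rule cannot be integrated directly. Exchanging the
  order of integration over a triangle takes its place.\<close>

lemma primitive_by_parts:
  fixes W Z :: "real \<Rightarrow> 'a::euclidean_space" and c c' :: "real \<Rightarrow> real"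
  assumes W: "W absolutely_integrable_on {0..b}" and b: "0 \<le> b"
    and Z: "\<And>x. x \<in> {0..b} \<Longrightarrow> Z x = Z 0 + integral {0..x} W"
    and c: "\<And>x. (c has_real_derivative c' x) (at x)" and c': "continuous_on UNIV c'"
  shows "(\<lambda>t. c t *\<^sub>R W t) absolutely_integrable_on {0..b}"
    "integral {0..b} (\<lambda>t. c t *\<^sub>R W t) = c b *\<^sub>R Z b - c 0 *\<^sub>R Z 0 - integral {0..b} (\<lambda>t. c' t *\<^sub>R Z t)"
proof -
  let ?M = "lebesgue_on {0..b}"
  have cc: "continuous_on UNIV c"
    using c by (meson DERIV_isCont continuous_at_imp_continuous_on)
  have Mfin: "finite_measure ?M" by (rule finite_measure_lebesgue_on) simp
  have cont_meas: "k \<in> borel_measurable ?M" if "continuous_on UNIV k" for k :: "real \<Rightarrow> real"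
    by (intro continuous_imp_measurable_on_sets_lebesgue continuous_on_subset[OF that]) auto
  have cW: "(\<lambda>t. c t *\<^sub>R W t) absolutely_integrable_on {0..b}"
  proof (rule absolutely_integrable_bounded_measurable_product[OF _ cont_meas[OF cc] _ _ W])
    show "bilinear ((*\<^sub>R) :: real \<Rightarrow> 'a \<Rightarrow> 'a)"
      by (rule bilinear_conv_bounded_bilinear[THEN iffD2]) (rule bounded_bilinear_scaleR)
    show "bounded (c ` {0..b})"
      by (intro compact_imp_bounded compact_continuous_image continuous_on_subset[OF cc]) auto
  qed auto
  then show "(\<lambda>t. c t *\<^sub>R W t) absolutely_integrable_on {0..b}" .
  interpret finite_measure ?M by (rule Mfin)
  interpret pair_sigma_finite ?M ?M by unfold_locales
  have Wint: "integrable ?M W" using W by (rule absolutely_integrable_imp_integrable) simp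
  have Wm [measurable]: "W \<in> borel_measurable ?M" using Wint by auto
  have c'm [measurable]: "c' \<in> borel_measurable ?M" by (rule cont_meas[OF c'])
  have idm [measurable]: "(\<lambda>x. x) \<in> borel_measurable ?M" by (rule cont_meas) simp
  have "bounded (c' ` {0..b})"
    by (intro compact_imp_bounded compact_continuous_image continuous_on_subset[OF c']) auto
  then obtain K where K: "K > 0" "\<And>s. s \<in> {0..b} \<Longrightarrow> \<bar>c' s\<bar> \<le> K"
    unfolding bounded_pos by auto
  \<comment> \<open>Integration in \<open>t\<close> first produces \<open>Z s - Z 0\<close>,
    integration in \<open>s\<close> first produces \<open>c b - c t\<close>.\<close>
  define f where "f t s = (if t \<le> s then c' s *\<^sub>R W t else 0)" for t s
  have fm [measurable]: "case_prod f \<in> borel_measurable (?M \<Otimes>\<^sub>M ?M)"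
    unfolding f_def by measurable
  have fint: "integrable (?M \<Otimes>\<^sub>M ?M) (case_prod f)"
  proof (rule Bochner_Integration.integrable_bound)
    show "integrable (?M \<Otimes>\<^sub>M ?M) (\<lambda>(t, s). K * norm (W t))"
    proof (rule Fubini_integrable)
      show "integrable ?M (\<lambda>x. \<integral>y. norm (case (x, y) of (t, s) \<Rightarrow> K * norm (W t)) \<partial>?M)"
        using Wint K by (simp add: abs_mult)
    qed auto
    show "AE x in ?M \<Otimes>\<^sub>M ?M. norm (case x of (t, s) \<Rightarrow> f t s) \<le> norm (case x of (t, s) \<Rightarrow> K * norm (W t))"
      by (rule AE_I2) (use K in \<open>auto simp: f_def space_pair_measure abs_mult intro!: mult_right_mono\<close>)
  qed measurable
  have i1: "integral\<^sup>L ?M (\<lambda>t. f t s) = c' s *\<^sub>R (Z s - Z 0)" if s: "s \<in> {0..b}" for s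
  proof -
    have "integrable ?M (\<lambda>t. f t s)"
    proof (rule Bochner_Integration.integrable_bound[of _ "\<lambda>t. K * norm (W t)"])
      show "AE x in ?M. norm (f x s) \<le> norm (K * norm (W x))"
        by (rule AE_I2) (use K s in \<open>auto simp: f_def abs_mult intro!: mult_right_mono\<close>)
    qed (use Wint in \<open>simp_all add: f_def\<close>)
    then have "integral\<^sup>L ?M (\<lambda>t. f t s) = integral {0..b} (\<lambda>t. f t s)"
      by (rule lebesgue_integral_eq_integral) simp
    also have "\<dots> = integral ({..s} \<inter> {0..b}) (\<lambda>t. c' s *\<^sub>R W t)"
      unfolding integral_restrict_Int[symmetric] by (simp add: f_def)
    also have "{..s} \<inter> {0..b} = {0..s}" using s by auto
    also have "integral {0..s} (\<lambda>t. c' s *\<^sub>R W t) = c' s *\<^sub>R (Z s - Z 0)" using Z[OF s] by simp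
    finally show ?thesis .
  qed
  have i2: "integral\<^sup>L ?M (\<lambda>s. f t s) = (c b - c t) *\<^sub>R W t" if t: "t \<in> {0..b}" for t
  proof -
    have "integrable ?M (\<lambda>s. f t s)"
    proof (rule Bochner_Integration.integrable_bound[of _ "\<lambda>s. K * norm (W t)"])
      show "AE x in ?M. norm (f t x) \<le> norm (K * norm (W t))"
        by (rule AE_I2) (use K t in \<open>auto simp: f_def abs_mult intro!: mult_right_mono\<close>)
    qed (simp_all add: f_def)
    then have "integral\<^sup>L ?M (\<lambda>s. f t s) = integral {0..b} (\<lambda>s. f t s)"
      by (rule lebesgue_integral_eq_integral) simp
    also have "\<dots> = integral ({t..} \<inter> {0..b}) (\<lambda>s. c' s *\<^sub>R W t)"
      unfolding integral_restrict_Int[symmetric] by (simp add: f_def)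
    also have "{t..} \<inter> {0..b} = {t..b}" using t by auto
    also have "((\<lambda>s. c' s *\<^sub>R W t) has_integral (c b - c t) *\<^sub>R W t) {t..b}"
      by (intro has_integral_scaleR_left fundamental_theorem_of_calculus)
         (use t c in \<open>auto simp: has_real_derivative_iff_has_vector_derivative[symmetric] intro: has_field_derivative_at_within\<close>)
    then have "integral {t..b} (\<lambda>s. c' s *\<^sub>R W t) = (c b - c t) *\<^sub>R W t" by (rule integral_unique)
    finally show ?thesis .
  qed
  have Zc: "continuous_on {0..b} Z"
  proof (rule continuous_on_eq)
    show "continuous_on {0..b} (\<lambda>x. Z 0 + integral {0..x} W)"
      using W by (intro continuous_intros indefinite_integral_continuous_1) (auto simp: absolutely_integrable_on_def)
  qed (rule Z[symmetric])
  have c'on: "continuous_on {0..b} c'" by (rule continuous_on_subset[OF c']) simp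
  have "(\<integral>s. (\<integral>t. f t s \<partial>?M) \<partial>?M) = (\<integral>t. (\<integral>s. f t s \<partial>?M) \<partial>?M)"
    by (rule Fubini_integral[OF fint])
  moreover have "(\<integral>s. (\<integral>t. f t s \<partial>?M) \<partial>?M) = (\<integral>s. c' s *\<^sub>R (Z s - Z 0) \<partial>?M)"
    by (rule Bochner_Integration.integral_cong) (use i1 in auto)
  moreover have "\<dots> = integral {0..b} (\<lambda>s. c' s *\<^sub>R (Z s - Z 0))"
  proof (rule lebesgue_integral_eq_integral)
    have "continuous_on {0..b} (\<lambda>s. c' s *\<^sub>R (Z s - Z 0))" by (intro continuous_intros c'on Zc)
    then show "integrable ?M (\<lambda>s. c' s *\<^sub>R (Z s - Z 0))"
      by (intro absolutely_integrable_imp_integrable absolutely_integrable_continuous_real) auto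
  qed simp
  moreover have "(\<integral>t. (\<integral>s. f t s \<partial>?M) \<partial>?M) = (\<integral>t. (c b - c t) *\<^sub>R W t \<partial>?M)"
    by (rule Bochner_Integration.integral_cong) (use i2 in auto)
  moreover have "\<dots> = integral {0..b} (\<lambda>t. (c b - c t) *\<^sub>R W t)"
  proof (rule lebesgue_integral_eq_integral)
    have "integrable ?M (\<lambda>t. c b *\<^sub>R W t - c t *\<^sub>R W t)"
      using Wint absolutely_integrable_imp_integrable[OF cW] by simp
    then show "integrable ?M (\<lambda>t. (c b - c t) *\<^sub>R W t)" by (simp add: scaleR_diff_left)
  qed simp
  ultimately have main: "integral {0..b} (\<lambda>s. c' s *\<^sub>R (Z s - Z 0)) = integral {0..b} (\<lambda>t. (c b - c t) *\<^sub>R W t)"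
    by simp
  have "((\<lambda>s. c' s *\<^sub>R Z 0) has_integral (c b - c 0) *\<^sub>R Z 0) {0..b}"
    by (intro has_integral_scaleR_left fundamental_theorem_of_calculus)
       (use b c in \<open>auto simp: has_real_derivative_iff_has_vector_derivative[symmetric] intro: has_field_derivative_at_within\<close>)
  moreover have "((\<lambda>s. c' s *\<^sub>R Z s) has_integral integral {0..b} (\<lambda>s. c' s *\<^sub>R Z s)) {0..b}"
    by (intro integrable_integral integrable_continuous_real continuous_intros c'on Zc)
  ultimately have "((\<lambda>s. c' s *\<^sub>R Z s - c' s *\<^sub>R Z 0) has_integral
      integral {0..b} (\<lambda>s. c' s *\<^sub>R Z s) - (c b - c 0) *\<^sub>R Z 0) {0..b}"
    by (rule has_integral_diff[rotated])
  then have l: "integral {0..b} (\<lambda>s. c' s *\<^sub>R (Z s - Z 0))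
      = integral {0..b} (\<lambda>s. c' s *\<^sub>R Z s) - (c b - c 0) *\<^sub>R Z 0"
    by (simp add: scaleR_diff_right integral_unique)
  have Wi: "W integrable_on {0..b}" using W by (simp add: absolutely_integrable_on_def)
  have cWi: "(\<lambda>t. c t *\<^sub>R W t) integrable_on {0..b}" using cW by (simp add: absolutely_integrable_on_def)
  have "integral {0..b} (\<lambda>t. c b *\<^sub>R W t - c t *\<^sub>R W t)
      = integral {0..b} (\<lambda>t. c b *\<^sub>R W t) - integral {0..b} (\<lambda>t. c t *\<^sub>R W t)"
    by (rule Henstock_Kurzweil_Integration.integral_diff) (use Wi cWi in \<open>auto intro: integrable_cmul\<close>)
  also have "integral {0..b} (\<lambda>t. c b *\<^sub>R W t) = c b *\<^sub>R (Z b - Z 0)" using Z[of b] b by simp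
  finally have r: "integral {0..b} (\<lambda>t. (c b - c t) *\<^sub>R W t)
      = c b *\<^sub>R (Z b - Z 0) - integral {0..b} (\<lambda>t. c t *\<^sub>R W t)" by (simp add: scaleR_diff_left)
  show "integral {0..b} (\<lambda>t. c t *\<^sub>R W t) = c b *\<^sub>R Z b - c 0 *\<^sub>R Z 0 - integral {0..b} (\<lambda>t. c' t *\<^sub>R Z t)"
    using main unfolding l r by (simp add: algebra_simps)
qed

subsection \<open>Solutions of the scalar equation\<close>

text \<open>Together with \<open>sinl\<close> the fundamental system at 0 of
  \<open>- y'' = \<mu> y\<close>. Real-valued forms for both signs of \<mu> keep the complex square
  root out of all estimates.\<close>

definition cosl :: "real \<Rightarrow> real \<Rightarrow> real" where
  "cosl \<mu> x = (if \<mu> \<ge> 0 then cos (sqrt \<mu> * x) else cosh (sqrt (- \<mu>) * x))"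

text \<open>The value at \<open>\<mu> = 0\<close> is the limit of both other branches, so that
  \<open>sinl\<close> is the primitive of \<open>cosl\<close> for every \<mu>.\<close>

definition sinl :: "real \<Rightarrow> real \<Rightarrow> real" where
  "sinl \<mu> x = (if \<mu> > 0 then sin (sqrt \<mu> * x) / sqrt \<mu>
     else if \<mu> = 0 then x else sinh (sqrt (- \<mu>) * x) / sqrt (- \<mu>))"

lemma cosl_0 [simp]: "cosl \<mu> 0 = 1" by (simp add: cosl_def)

lemma sinl_0 [simp]: "sinl \<mu> 0 = 0" by (simp add: sinl_def)

lemma cosl_minus [simp]: "cosl \<mu> (- x) = cosl \<mu> x" by (simp add: cosl_def)

lemma sinl_minus [simp]: "sinl \<mu> (- x) = - sinl \<mu> x" by (simp add: sinl_def)

lemma DERIV_sinl: "(sinl \<mu> has_real_derivative cosl \<mu> x) (at x)"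
proof -
  consider "\<mu> > 0" | "\<mu> = 0" | "\<mu> < 0" by linarith
  then show ?thesis
  proof cases
    case 1
    then have "((\<lambda>x. sin (sqrt \<mu> * x) / sqrt \<mu>) has_real_derivative cos (sqrt \<mu> * x)) (at x)"
      by (auto intro!: derivative_eq_intros simp: mult.assoc)
    with 1 show ?thesis by (simp add: sinl_def[abs_def] cosl_def)
  next
    case 2
    then show ?thesis by (simp add: sinl_def[abs_def] cosl_def)
  next
    case 3
    then have "((\<lambda>x. sinh (sqrt (-\<mu>) * x) / sqrt (-\<mu>)) has_real_derivative cosh (sqrt (-\<mu>) * x)) (at x)"
      by (auto intro!: derivative_eq_intros simp: mult.assoc)
    with 3 show ?thesis by (simp add: sinl_def[abs_def] cosl_def)
  qed
qed

lemma DERIV_cosl: "(cosl \<mu> has_real_derivative - (\<mu> * sinl \<mu> x)) (at x)"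
proof -
  consider "\<mu> > 0" | "\<mu> = 0" | "\<mu> < 0" by linarith
  then show ?thesis
  proof cases
    case 1
    have "((\<lambda>x. cos (sqrt \<mu> * x)) has_real_derivative - (sin (sqrt \<mu> * x) * sqrt \<mu>)) (at x)"
      by (auto intro!: derivative_eq_intros)
    moreover have "\<mu> * (y / sqrt \<mu>) = y * sqrt \<mu>" for y
      using real_div_sqrt[of \<mu>] 1 by (simp add: field_simps)
    ultimately show ?thesis using 1 by (simp add: sinl_def cosl_def[abs_def])
  next
    case 2
    then show ?thesis by (simp add: sinl_def cosl_def[abs_def])
  next
    case 3
    have "((\<lambda>x. cosh (sqrt (-\<mu>) * x)) has_real_derivative (sinh (sqrt (-\<mu>) * x) * sqrt (-\<mu>))) (at x)"
      by (auto intro!: derivative_eq_intros)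
    moreover have "- (\<mu> * (y / sqrt (-\<mu>))) = y * sqrt (-\<mu>)" for y
      using real_div_sqrt[of "-\<mu>"] 3 by (simp add: field_simps)
    ultimately show ?thesis using 3 by (simp add: sinl_def cosl_def[abs_def])
  qed
qed

lemma continuous_on_cosl [continuous_intros]:
  "continuous_on S f \<Longrightarrow> continuous_on S (\<lambda>x. cosl \<mu> (f x))"
  by (rule continuous_on_compose2[of UNIV "cosl \<mu>"])
     (auto intro!: DERIV_continuous_on[OF DERIV_cosl[THEN has_field_derivative_at_within]])

lemma continuous_on_sinl [continuous_intros]:
  "continuous_on S f \<Longrightarrow> continuous_on S (\<lambda>x. sinl \<mu> (f x))"
  by (rule continuous_on_compose2[of UNIV "sinl \<mu>"])
     (auto intro!: DERIV_continuous_on[OF DERIV_sinl[THEN has_field_derivative_at_within]])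

text \<open>The source of d'Alembert's formula: a product with a cosine becomes a pair of
  translations that do not involve \<mu>, so they act at once on sums over different \<mu>.\<close>

lemma cosl_mult_cosl: "cosl \<mu> x * cosl \<mu> t = (cosl \<mu> (x + t) + cosl \<mu> (x - t)) / 2"
  by (simp add: cosl_def distrib_left right_diff_distrib cos_add cos_diff cosh_add cosh_diff)

lemma sinl_mult_cosl: "sinl \<mu> x * cosl \<mu> t = (sinl \<mu> (x + t) + sinl \<mu> (x - t)) / 2"
  by (simp add: cosl_def sinl_def distrib_left right_diff_distrib sin_add sin_diff sinh_add sinh_diff add_divide_distrib diff_divide_distrib)

lemma cos_csqrt: "cos (csqrt (complex_of_real \<mu>) * complex_of_real x) = complex_of_real (cosl \<mu> x)"
proof (cases "\<mu> \<ge> 0")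
  case True
  then show ?thesis by (simp add: cosl_def flip: cos_of_real)
next
  case False
  then have "cos (csqrt (complex_of_real \<mu>) * complex_of_real x) = cos (\<i> * complex_of_real (sqrt (- \<mu>) * x))"
    by (simp add: mult.assoc)
  also have "\<dots> = cosh (complex_of_real (sqrt (- \<mu>) * x))" by (simp add: cosh_conv_cos)
  also have "\<dots> = complex_of_real (cosh (sqrt (- \<mu>) * x))" by (simp add: cosh_field_def exp_of_real flip: of_real_minus of_real_mult)
  finally show ?thesis using False by (simp add: cosl_def)
qed

lemma vector_scalar_mult_of_real: "complex_of_real r *s v = r *\<^sub>R (v :: complex^'n)"
  by (simp add: vec_eq_iff scaleR_conv_of_real[where 'a = complex])

lemma cos_system_eq: "cos_system lam v u = (\<lambda>x. cosl (lam u) x *\<^sub>R v u)"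
  by (simp add: cos_system_def rho_def cos_csqrt vector_scalar_mult_of_real)

subsection \<open>The boundary value problem\<close>

lemma norm_matrix_vector_mult_le: "norm (A *v x) \<le> norm A * norm (x :: complex^'n)" for A :: "complex^'n^'n"
proof -
  have "norm ((A *v x) $ i) \<le> norm (A $ i) * norm x" for i
  proof -
    have "norm ((A *v x) $ i) \<le> (\<Sum>j\<in>UNIV. \<bar>cmod (A $ i $ j)\<bar> * \<bar>cmod (x $ j)\<bar>)"
      unfolding matrix_vector_mult_def by (simp add: order_trans[OF norm_sum] norm_mult)
    also have "\<dots> \<le> norm (A $ i) * norm x" unfolding norm_vec_def by (rule L2_set_mult_ineq)
    finally show ?thesis .
  qed
  then have "norm (A *v x) \<le> L2_set (\<lambda>i. norm (A $ i) * norm x) UNIV"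
    unfolding norm_vec_def[of "A *v x"] by (intro L2_set_mono) auto
  also have "\<dots> = norm A * norm x"
    unfolding norm_vec_def[of A] by (rule L2_set_left_distrib[symmetric]) simp
  finally show ?thesis .
qed

lemma norm_matrix_vector_op_norm: "norm (A *v x) \<le> op_norm A * norm (x :: complex^'n)"
  unfolding op_norm_def by (rule onorm) simp

lemma op_norm_nonneg: "0 \<le> op_norm (A :: complex^'n^'n)"
  unfolding op_norm_def by (rule onorm_pos_le) simp

lemma matrix_vector_mult_scaleR: "A *v (c *\<^sub>R x) = c *\<^sub>R (A *v (x :: complex^'n))" for A :: "complex^'n^'n"
  using linear_scale[OF bounded_linear.linear[OF matrix_vector_mul_bounded_linear[of A]]] .

lemma matrix_vector_mult_scale: "A *v (c *s x) = c *s (A *v (x :: complex^'n))" for A :: "complex^'n^'n"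
  by (simp add: vec_eq_iff matrix_vector_mult_def sum_distrib_left mult_ac)

lemma bounded_bilinear_matrix_vector: "bounded_bilinear (\<lambda>(A :: complex^'n^'n) x. A *v x)"
proof
  show "(a + a') *v b = a *v b + a' *v b" for a a' :: "complex^'n^'n" and b
    by (simp add: matrix_vector_mult_add_rdistrib)
  show "a *v (b + b') = a *v b + a *v b'" for a :: "complex^'n^'n" and b b'
    by (simp add: matrix_vector_right_distrib)
  show "(r *\<^sub>R a) *v b = r *\<^sub>R (a *v b)" for r and a :: "complex^'n^'n" and b
    by (simp add: vec_eq_iff matrix_vector_mult_def scaleR_sum_right)
  show "a *v (r *\<^sub>R b) = r *\<^sub>R (a *v b)" for r and a :: "complex^'n^'n" and b
    by (rule matrix_vector_mult_scaleR)
  show "\<exists>K. \<forall>a b. norm ((a :: complex^'n^'n) *v b) \<le> norm a * norm b * K"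
    by (rule exI[of _ 1]) (simp add: norm_matrix_vector_mult_le)
qed

lemma norm_axis [simp]: "norm (axis i (x :: 'a::real_normed_vector) :: 'a^'n) = norm x"
  by (simp add: norm_vec_def L2_set_def axis_def if_distrib[of norm] if_distrib[of "\<lambda>x. x\<^sup>2"] cong: if_cong)

lemma bounded_linear_axis: "bounded_linear (axis i :: 'a::real_normed_vector \<Rightarrow> 'a^'n)"
  by (rule bounded_linear_intro[where K = 1]) ((simp add: vec_eq_iff axis_def; fail) | simp)+

lemma in_L2_axis:
  fixes f :: "real \<Rightarrow> 'a::euclidean_space"
  assumes "in_L2 f"
  shows "in_L2 (\<lambda>x. axis i (f x) :: 'a^'n)" "L2_norm (\<lambda>x. axis i (f x) :: 'a^'n) = L2_norm f"
proof -
  have "(axis i :: 'a \<Rightarrow> 'a^'n) \<in> borel_measurable borel"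
    by (intro borel_measurable_continuous_onI linear_continuous_on bounded_linear_axis)
  then have "(\<lambda>x. axis i (f x) :: 'a^'n) \<in> borel_measurable M_pi"
    by (rule measurable_compose[OF in_L2_measurable[OF assms]])
  then show "in_L2 (\<lambda>x. axis i (f x) :: 'a^'n)" using assms by (simp add: in_L2_def)
  show "L2_norm (\<lambda>x. axis i (f x) :: 'a^'n) = L2_norm f" by (simp add: L2_norm_def)
qed

text \<open>On matrices \<open>norm\<close> is the Euclidean norm. The class is bounded in the sum
  of the norms of the entries, which dominates it.\<close>

lemma in_L2_matrix:
  fixes A :: "real \<Rightarrow> complex^'n^'n"
  assumes "\<And>j k. in_L2 (\<lambda>x. A x $ j $ k)"
  shows "in_L2 A" "L2_norm A \<le> L2_mat_norm A"
proof -
  have sum_axis: "(\<Sum>k\<in>UNIV. axis k (v $ k)) = v" for v :: "'b::real_normed_vector^'n"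
    by (simp add: vec_eq_iff axis_def)
  have eq: "A = (\<lambda>x. \<Sum>j\<in>UNIV. axis j (\<Sum>k\<in>UNIV. axis k (A x $ j $ k)))"
    unfolding sum_axis ..
  note ax = in_L2_axis[OF assms]
  have row: "in_L2 (\<lambda>x. \<Sum>k\<in>UNIV. axis k (A x $ j $ k) :: complex^'n)" for j
    by (intro in_L2_sum ax)
  show "in_L2 A" by (subst eq) (intro in_L2_sum in_L2_axis row)
  have "L2_norm A \<le> (\<Sum>j\<in>UNIV. L2_norm (\<lambda>x. axis j (\<Sum>k\<in>UNIV. axis k (A x $ j $ k)) :: complex^'n^'n))"
    by (subst eq) (intro L2_norm_sum_le in_L2_axis row)
  also have "\<dots> = (\<Sum>j\<in>UNIV. L2_norm (\<lambda>x. \<Sum>k\<in>UNIV. axis k (A x $ j $ k) :: complex^'n))"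
    by (simp only: in_L2_axis(2)[OF row])
  also have "\<dots> \<le> (\<Sum>j\<in>UNIV. \<Sum>k\<in>UNIV. L2_norm (\<lambda>x. axis k (A x $ j $ k) :: complex^'n))"
    by (intro sum_mono L2_norm_sum_le ax)
  also have "\<dots> = L2_mat_norm A" unfolding L2_mat_norm_def by (simp add: ax)
  finally show "L2_norm A \<le> L2_mat_norm A" .
qed

lemma L2_mat_norm_nonneg: "0 \<le> L2_mat_norm A"
  unfolding L2_mat_norm_def by (intro sum_nonneg) auto

text \<open>The end points are moved into the exceptional set; this passes from the open interval of
  \<open>M_pi\<close> to integrals over the closed one.\<close>

lemma AE_M_pi_negligible:
  assumes "AE x in M_pi. P x"
  obtains N where "negligible N" "\<And>x. x \<in> {0..pi} \<Longrightarrow> x \<notin> N \<Longrightarrow> P x"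
proof -
  have "AE x in lebesgue. x \<in> {0<..<pi} \<longrightarrow> P x"
    using assms by (subst (asm) AE_restrict_space_iff) auto
  then obtain N where N: "N \<in> null_sets lebesgue" "{x \<in> space lebesgue. \<not> (x \<in> {0<..<pi} \<longrightarrow> P x)} \<subseteq> N"
    unfolding eventually_ae_filter by blast
  have "negligible (N \<union> {0, pi})"
    using N(1) by (simp add: negligible_iff_null_sets negligible_Un negligible_insert)
  moreover have "P x" if "x \<in> {0..pi}" "x \<notin> N \<union> {0, pi}" for x
    using that N(2) by (auto simp: less_le)
  ultimately show ?thesis using that by blast
qed

section \<open>Estimates for the class, Green's formula and the Volterra equation\<close>

locale problem =
  fixes R :: real and Q :: "real \<Rightarrow> complex^'n^'n" and h H :: "complex^'n^'n"
  assumes PR: "(Q, h, H) \<in> class_PR R"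
begin

lemma Q_L2: "in_L2 Q"
  using PR by (intro in_L2_matrix(1)) (auto simp: class_PR_def class_P_def)

lemma norms_le: "L2_norm Q \<le> R" "op_norm h \<le> R" "op_norm H \<le> R" "0 \<le> R"
proof -
  have "in_L2 (\<lambda>x. Q x $ j $ k)" for j k using PR by (auto simp: class_PR_def class_P_def)
  then have "L2_norm Q \<le> L2_mat_norm Q" by (rule in_L2_matrix(2))
  moreover have "L2_mat_norm Q + op_norm h + op_norm H \<le> R" using PR by (auto simp: class_PR_def)
  ultimately show "L2_norm Q \<le> R" "op_norm h \<le> R" "op_norm H \<le> R" "0 \<le> R"
    using op_norm_nonneg[of h] op_norm_nonneg[of H] L2_mat_norm_nonneg[of Q] by linarith+
qed

lemma norm_h: "norm (h *v x) \<le> R * norm x"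
  using norm_matrix_vector_op_norm[of h x] mult_right_mono[OF norms_le(2) norm_ge_zero[of x]] by linarith

lemma norm_H: "norm (H *v x) \<le> R * norm x"
  using norm_matrix_vector_op_norm[of H x] mult_right_mono[OF norms_le(3) norm_ge_zero[of x]] by linarith

lemma Q_abs_int: "Q absolutely_integrable_on {0..pi}"
  using absolutely_integrable_M_pi(1)[OF in_L2_integrable_M[OF Q_L2]] .

lemma mean_zero: "h + H + (1/2) *\<^sub>R integral {0..pi} Q = 0"
  using PR absolutely_integrable_M_pi(2)[OF in_L2_integrable_M[OF Q_L2]]
  by (auto simp: class_PR_def class_P_def)

lemma Q_mult_abs_int:
  assumes "continuous_on {0..x} y" "x \<le> pi"
  shows "(\<lambda>t. Q t *v (y t :: complex^'n)) absolutely_integrable_on {0..x}"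
proof (rule absolutely_integrable_bounded_measurable_product[where h = "\<lambda>x A. A *v x"])
  show "bilinear (\<lambda>x (A :: complex^'n^'n). A *v x)"
    by (rule bilinear_conv_bounded_bilinear[THEN iffD2])
       (rule bounded_bilinear.flip[OF bounded_bilinear_matrix_vector])
  show "y \<in> borel_measurable (lebesgue_on {0..x})"
    using assms by (intro continuous_imp_measurable_on_sets_lebesgue) auto
  show "bounded (y ` {0..x})" using assms by (intro compact_imp_bounded compact_continuous_image) auto
  show "Q absolutely_integrable_on {0..x}" by (rule integrable_on_subinterval_pi[OF Q_abs_int assms(2)])
qed simp

text \<open>Only the square norm of \<open>Q\<close> is bounded by \<open>R\<close>, so the majorant
  of \<open>y\<close> has to enter through its square integral as well. This is the form in which
  the energy estimates below can be closed.\<close>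

lemma norm_integral_Q_le:
  assumes y: "continuous_on {0..x} y" and g: "continuous_on {0..x} g"
    and le: "\<And>t. t \<in> {0..x} \<Longrightarrow> norm (y t :: complex^'n) \<le> g t" and x: "x \<le> pi"
  shows "norm (integral {0..x} (\<lambda>t. Q t *v y t)) \<le> R * sqrt (integral {0..x} (\<lambda>t. (g t)\<^sup>2))"
proof -
  have g0: "0 \<le> g t" if "t \<in> {0..x}" for t using le[OF that] norm_ge_zero[of "y t"] by linarith
  note CS = L2_Cauchy_Schwarz_interval[OF Q_L2 g g0 x]
  have "norm (integral {0..x} (\<lambda>t. Q t *v y t)) \<le> integral {0..x} (\<lambda>t. norm (Q t) * g t)"
  proof (rule integral_norm_bound_integral)
    show "(\<lambda>t. Q t *v y t) integrable_on {0..x}"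
      using Q_mult_abs_int[OF y x] by (simp add: absolutely_integrable_on_def)
    show "(\<lambda>t. norm (Q t) * g t) integrable_on {0..x}" by (rule CS(1))
    show "norm (Q t *v y t) \<le> norm (Q t) * g t" if "t \<in> {0..x}" for t
      using norm_matrix_vector_mult_le[of "Q t" "y t"] mult_left_mono[OF le[OF that] norm_ge_zero[of "Q t"]]
      by linarith
  qed
  also have "\<dots> \<le> L2_norm Q * sqrt (integral {0..x} (\<lambda>t. (g t)\<^sup>2))" by (rule CS(2))
  also have "\<dots> \<le> R * sqrt (integral {0..x} (\<lambda>t. (g t)\<^sup>2))"
    by (intro mult_right_mono norms_le) (auto intro!: integral_nonneg integrable_continuous_real continuous_intros g)
  finally show ?thesis .
qed

text \<open>Two integrations by parts move both derivatives to the test function. The upper limit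
  stays free: with \<open>c t = sinl \<mu> (x - t)\<close> this becomes the Volterra equation, with
  \<open>x = pi\<close> the moment identities. Here \<open>Z\<close> is \<open>Y'\<close>, its end
  values being given by the boundary conditions.\<close>

lemma green_identity:
  assumes sol: "bvp_solution Q h H (complex_of_real \<mu>) Y"
  obtains Z where "continuous_on {0..pi} Y" "Z 0 = h *v Y 0" "Z pi = - (H *v Y pi)"
    "\<And>x c c' c''. x \<in> {0..pi} \<Longrightarrow> (\<And>t. (c has_real_derivative c' t) (at t))
      \<Longrightarrow> (\<And>t. (c' has_real_derivative c'' t) (at t)) \<Longrightarrow> continuous_on UNIV c''
      \<Longrightarrow> ((\<lambda>t. Q t *v (c t *\<^sub>R Y t)) has_integral
            (c x *\<^sub>R Z x - c 0 *\<^sub>R Z 0 - c' x *\<^sub>R Y x + c' 0 *\<^sub>R Y 0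
             + integral {0..x} (\<lambda>t. (c'' t + \<mu> * c t) *\<^sub>R Y t))) {0..x}"
proof -
  obtain Z W where Y': "\<And>x. x \<in> {0..pi} \<Longrightarrow> (Y has_vector_derivative Z x) (at x within {0..pi})"
    and ZW: "has_L2_derivative Z W"
    and ae: "AE x in M_pi. - W x + Q x *v Y x = complex_of_real \<mu> *s Y x"
    and bc: "Z 0 - h *v Y 0 = 0" "Z pi + H *v Y pi = 0"
    using sol unfolding bvp_solution_def by blast
  have Yc: "continuous_on {0..pi} Y"
    using Y' by (meson continuous_on_eq_continuous_within has_vector_derivative_continuous)
  have Wabs: "W absolutely_integrable_on {0..pi}"
    using ZW by (intro absolutely_integrable_M_pi(1) in_L2_integrable_M) (simp add: has_L2_derivative_def)
  have Zint: "Z x = Z 0 + integral {0..x} W" if x: "x \<in> {0..pi}" for x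
  proof -
    have "W absolutely_integrable_on {0<..<x}"
      by (rule set_integrable_subset[OF Wabs]) (use x in auto)
    then have "integrable (lebesgue_on {0<..<x}) W" by (rule absolutely_integrable_imp_integrable) simp
    then have "integral\<^sup>L (lebesgue_on {0<..<x}) W = integral {0..x} W"
      by (simp add: lebesgue_integral_eq_integral integral_open_interval_real)
    then show ?thesis using ZW x unfolding has_L2_derivative_def by metis
  qed
  obtain N where N: "negligible N"
    "\<And>x. x \<in> {0..pi} \<Longrightarrow> x \<notin> N \<Longrightarrow> - W x + Q x *v Y x = complex_of_real \<mu> *s Y x"
    using AE_M_pi_negligible[OF ae] by blast
  have Zc: "continuous_on {0..pi} Z"
  proof (rule continuous_on_eq)
    show "continuous_on {0..pi} (\<lambda>x. Z 0 + integral {0..x} W)"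
      using Wabs by (intro continuous_intros indefinite_integral_continuous_1) (auto simp: absolutely_integrable_on_def)
  qed (rule Zint[symmetric])
  show ?thesis
  proof (rule that[OF Yc])
    show "Z 0 = h *v Y 0" "Z pi = - (H *v Y pi)" using bc by (simp_all add: add_eq_0_iff2)
    fix x :: real and c c' c'' :: "real \<Rightarrow> real"
    assume x: "x \<in> {0..pi}" and c: "\<And>t. (c has_real_derivative c' t) (at t)"
      and c': "\<And>t. (c' has_real_derivative c'' t) (at t)" and c'': "continuous_on UNIV c''"
    have cont: "continuous_on S c" "continuous_on S c'" "continuous_on S c''" for S
      using c c' continuous_on_subset[OF c'']
      by (auto intro!: continuous_at_imp_continuous_on DERIV_isCont)
    have sub: "{0..x} \<subseteq> {0..pi}" using x by auto
    have Yx: "continuous_on {0..x} Y" by (rule continuous_on_subset[OF Yc sub])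
    have Zx: "continuous_on {0..x} Z" by (rule continuous_on_subset[OF Zc sub])
    have cW: "(\<lambda>t. c t *\<^sub>R W t) absolutely_integrable_on {0..x}"
      "integral {0..x} (\<lambda>t. c t *\<^sub>R W t) = c x *\<^sub>R Z x - c 0 *\<^sub>R Z 0 - integral {0..x} (\<lambda>t. c' t *\<^sub>R Z t)"
    proof -
      have Wx: "W absolutely_integrable_on {0..x}" by (rule set_integrable_subset[OF Wabs _ sub]) simp
      have x0: "0 \<le> x" using x by simp
      have Zx': "Z y = Z 0 + integral {0..y} W" if "y \<in> {0..x}" for y
        by (rule Zint) (use that sub in blast)
      show "(\<lambda>t. c t *\<^sub>R W t) absolutely_integrable_on {0..x}"
        by (rule primitive_by_parts(1)[OF Wx x0 Zx' c cont(2)])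
      show "integral {0..x} (\<lambda>t. c t *\<^sub>R W t) = c x *\<^sub>R Z x - c 0 *\<^sub>R Z 0 - integral {0..x} (\<lambda>t. c' t *\<^sub>R Z t)"
        by (rule primitive_by_parts(2)[OF Wx x0 Zx' c cont(2)])
    qed
    have c'Z: "((\<lambda>t. c' t *\<^sub>R Z t) has_integral (c' x *\<^sub>R Y x - c' 0 *\<^sub>R Y 0 - integral {0..x} (\<lambda>t. c'' t *\<^sub>R Y t))) {0..x}"
    proof -
      have "((\<lambda>t. c' t *\<^sub>R Z t + c'' t *\<^sub>R Y t) has_integral (c' x *\<^sub>R Y x - c' 0 *\<^sub>R Y 0)) {0..x}"
      proof (rule fundamental_theorem_of_calculus)
        fix t assume t: "t \<in> {0..x}"
        have "(Y has_vector_derivative Z t) (at t within {0..x})"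
          using Y'[of t] t sub by (auto intro: has_vector_derivative_within_subset)
        moreover have "(c' has_real_derivative c'' t) (at t within {0..x})"
          using c' by (rule has_field_derivative_at_within)
        ultimately show "((\<lambda>t. c' t *\<^sub>R Y t) has_vector_derivative c' t *\<^sub>R Z t + c'' t *\<^sub>R Y t) (at t within {0..x})"
          by (intro has_vector_derivative_scaleR)
      qed (use x in auto)
      moreover have "((\<lambda>t. c'' t *\<^sub>R Y t) has_integral integral {0..x} (\<lambda>t. c'' t *\<^sub>R Y t)) {0..x}"
        by (intro integrable_integral integrable_continuous_real continuous_intros cont Yx)
      ultimately have "((\<lambda>t. (c' t *\<^sub>R Z t + c'' t *\<^sub>R Y t) - c'' t *\<^sub>R Y t) has_integral
          (c' x *\<^sub>R Y x - c' 0 *\<^sub>R Y 0 - integral {0..x} (\<lambda>t. c'' t *\<^sub>R Y t))) {0..x}"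
        by (rule has_integral_diff)
      then show ?thesis by simp
    qed
    let ?V = "c x *\<^sub>R Z x - c 0 *\<^sub>R Z 0 - (c' x *\<^sub>R Y x - c' 0 *\<^sub>R Y 0 - integral {0..x} (\<lambda>t. c'' t *\<^sub>R Y t))"
    have "((\<lambda>t. c t *\<^sub>R W t) has_integral ?V) {0..x}"
    proof -
      have "(\<lambda>t. c t *\<^sub>R W t) integrable_on {0..x}" using cW(1) by (simp only: absolutely_integrable_on_def)
      then have "((\<lambda>t. c t *\<^sub>R W t) has_integral integral {0..x} (\<lambda>t. c t *\<^sub>R W t)) {0..x}"
        by (rule integrable_integral)
      then show ?thesis unfolding cW(2) integral_unique[OF c'Z] .
    qed
    moreover have "((\<lambda>t. (\<mu> * c t) *\<^sub>R Y t) has_integral integral {0..x} (\<lambda>t. (\<mu> * c t) *\<^sub>R Y t)) {0..x}"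
      by (intro integrable_integral integrable_continuous_real continuous_intros cont Yx)
    ultimately have sum: "((\<lambda>t. c t *\<^sub>R W t + (\<mu> * c t) *\<^sub>R Y t) has_integral
        ?V + integral {0..x} (\<lambda>t. (\<mu> * c t) *\<^sub>R Y t)) {0..x}" by (rule has_integral_add)
    have "((\<lambda>t. Q t *v (c t *\<^sub>R Y t)) has_integral ?V + integral {0..x} (\<lambda>t. (\<mu> * c t) *\<^sub>R Y t)) {0..x}"
    proof (rule has_integral_spike[OF N(1) _ sum])
      fix t assume t: "t \<in> {0..x} - N"
      then have "Q t *v Y t = W t + \<mu> *\<^sub>R Y t"
        using N(2)[of t] sub by (auto simp: vector_scalar_mult_of_real algebra_simps add_eq_0_iff)
      then show "Q t *v (c t *\<^sub>R Y t) = c t *\<^sub>R W t + (\<mu> * c t) *\<^sub>R Y t"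
        by (simp add: matrix_vector_mult_scaleR algebra_simps)
    qed
    moreover have "integral {0..x} (\<lambda>t. c'' t *\<^sub>R Y t) + integral {0..x} (\<lambda>t. (\<mu> * c t) *\<^sub>R Y t)
        = integral {0..x} (\<lambda>t. (c'' t + \<mu> * c t) *\<^sub>R Y t)"
      unfolding scaleR_add_left
      by (rule Henstock_Kurzweil_Integration.integral_add[symmetric])
         (intro integrable_continuous_real continuous_intros cont Yx)+
    then have "?V + integral {0..x} (\<lambda>t. (\<mu> * c t) *\<^sub>R Y t) = c x *\<^sub>R Z x - c 0 *\<^sub>R Z 0 - c' x *\<^sub>R Y x + c' 0 *\<^sub>R Y 0
             + integral {0..x} (\<lambda>t. (c'' t + \<mu> * c t) *\<^sub>R Y t)" by (simp add: algebra_simps)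
    ultimately show "((\<lambda>t. Q t *v (c t *\<^sub>R Y t)) has_integral
            (c x *\<^sub>R Z x - c 0 *\<^sub>R Z 0 - c' x *\<^sub>R Y x + c' 0 *\<^sub>R Y 0
             + integral {0..x} (\<lambda>t. (c'' t + \<mu> * c t) *\<^sub>R Y t))) {0..x}" by simp
  qed
qed

text \<open>Variation of constants from the left end point. The relation is linear in
  \<open>Y\<close> for fixed \<mu>, so it admits the multiples of eigenfunctions that occur in
  finite combinations.\<close>

definition Volterra_solution :: "real \<Rightarrow> (real \<Rightarrow> complex^'n) \<Rightarrow> bool" where
  "Volterra_solution \<mu> Y \<longleftrightarrow> continuous_on {0..pi} Y \<and> (\<forall>x\<in>{0..pi}.
     ((\<lambda>t. Q t *v (sinl \<mu> (x - t) *\<^sub>R Y t)) has_integral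
        (Y x - cosl \<mu> x *\<^sub>R Y 0 - sinl \<mu> x *\<^sub>R (h *v Y 0))) {0..x})"

lemma bvp_imp_Volterra:
  assumes "bvp_solution Q h H (complex_of_real \<mu>) Y"
  shows "Volterra_solution \<mu> Y"
proof (rule green_identity[OF assms])
  fix Z assume Yc: "continuous_on {0..pi} Y" and Z0: "Z 0 = h *v Y 0"
    and green: "\<And>x c c' c''. x \<in> {0..pi} \<Longrightarrow> (\<And>t. (c has_real_derivative c' t) (at t))
      \<Longrightarrow> (\<And>t. (c' has_real_derivative c'' t) (at t)) \<Longrightarrow> continuous_on UNIV c''
      \<Longrightarrow> ((\<lambda>t. Q t *v (c t *\<^sub>R Y t)) has_integral
            (c x *\<^sub>R Z x - c 0 *\<^sub>R Z 0 - c' x *\<^sub>R Y x + c' 0 *\<^sub>R Y 0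
             + integral {0..x} (\<lambda>t. (c'' t + \<mu> * c t) *\<^sub>R Y t))) {0..x}"
  have "((\<lambda>t. Q t *v (sinl \<mu> (x - t) *\<^sub>R Y t)) has_integral
        (Y x - cosl \<mu> x *\<^sub>R Y 0 - sinl \<mu> x *\<^sub>R (h *v Y 0))) {0..x}" if x: "x \<in> {0..pi}" for x
  proof -
    have "((\<lambda>t. sinl \<mu> (x - t)) has_real_derivative - cosl \<mu> (x - t)) (at t)" for t
    proof -
      have "((\<lambda>t. x - t) has_real_derivative -1) (at t)" by (auto intro!: derivative_eq_intros)
      from DERIV_chain2[OF DERIV_sinl this] show ?thesis by simp
    qed
    moreover have "((\<lambda>t. - cosl \<mu> (x - t)) has_real_derivative - (\<mu> * sinl \<mu> (x - t))) (at t)" for t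
    proof -
      have "((\<lambda>t. x - t) has_real_derivative -1) (at t)" by (auto intro!: derivative_eq_intros)
      from DERIV_minus[OF DERIV_chain2[OF DERIV_cosl this]] show ?thesis by simp
    qed
    moreover have "continuous_on UNIV (\<lambda>t. - (\<mu> * sinl \<mu> (x - t)))" by (intro continuous_intros)
    \<comment> \<open>The test function solves \<open>c'' + \<mu> c = 0\<close> and vanishes at
      \<open>t = x\<close>, where its derivative is \<open>- 1\<close>; only \<open>Y x\<close> and
      the initial data remain.\<close>
    ultimately have "((\<lambda>t. Q t *v (sinl \<mu> (x - t) *\<^sub>R Y t)) has_integral
      (sinl \<mu> (x - x) *\<^sub>R Z x - sinl \<mu> (x - 0) *\<^sub>R Z 0 - (- cosl \<mu> (x - x)) *\<^sub>R Y x + (- cosl \<mu> (x - 0)) *\<^sub>R Y 0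
             + integral {0..x} (\<lambda>t. (- (\<mu> * sinl \<mu> (x - t)) + \<mu> * sinl \<mu> (x - t)) *\<^sub>R Y t))) {0..x}"
      by (rule green[OF x])
    then show ?thesis by (simp add: Z0 algebra_simps)
  qed
  then show ?thesis using Yc by (simp add: Volterra_solution_def)
qed

lemma Volterra_solution_scale:
  assumes "Volterra_solution \<mu> Y"
  shows "Volterra_solution \<mu> (\<lambda>x. a *s Y x)"
  unfolding Volterra_solution_def
proof (intro conjI ballI)
  show "continuous_on {0..pi} (\<lambda>x. a *s Y x)"
    using assms by (intro bounded_linear.continuous_on[OF bounded_linear_vector_scalar_mult])
      (simp add: Volterra_solution_def)
  fix x assume "x \<in> {0..pi}"
  then have "((\<lambda>t. Q t *v (sinl \<mu> (x - t) *\<^sub>R Y t)) has_integral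
        (Y x - cosl \<mu> x *\<^sub>R Y 0 - sinl \<mu> x *\<^sub>R (h *v Y 0))) {0..x}"
    using assms by (simp add: Volterra_solution_def)
  from has_integral_linear[OF this bounded_linear_vector_scalar_mult[of a]]
  have "((\<lambda>t. a *s (Q t *v (sinl \<mu> (x - t) *\<^sub>R Y t))) has_integral
        a *s (Y x - cosl \<mu> x *\<^sub>R Y 0 - sinl \<mu> x *\<^sub>R (h *v Y 0))) {0..x}" by (simp add: o_def)
  moreover have scale: "a *s (r *\<^sub>R v) = r *\<^sub>R (a *s v)" for r and v :: "complex^'n"
    by (simp add: vec_eq_iff)
  ultimately show "((\<lambda>t. Q t *v (sinl \<mu> (x - t) *\<^sub>R (a *s Y t))) has_integral
        (a *s Y x - cosl \<mu> x *\<^sub>R (a *s Y 0) - sinl \<mu> x *\<^sub>R (h *v (a *s Y 0)))) {0..x}"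
    by (simp add: matrix_vector_mult_scaleR matrix_vector_mult_scale vec.scale_right_diff_distrib)
qed

end

subsection \<open>Comparison of solutions with cosines\<close>

lemma square_sum3_le: "(a + b + c)\<^sup>2 \<le> 3 * (a\<^sup>2 + b\<^sup>2 + c\<^sup>2)" for a b c :: real
  using sum_squares_bound[of a b] sum_squares_bound[of a c] sum_squares_bound[of b c]
  by (simp add: power2_eq_square algebra_simps)

lemma matrix_vector_mult_sum: "A *v (\<Sum>i\<in>F. f i) = (\<Sum>i\<in>F. A *v (f i :: complex^'n))" for A :: "complex^'n^'n"
  by (rule linear_sum[OF bounded_linear.linear[OF matrix_vector_mul_bounded_linear]])

lemma L2_norm_one: "L2_norm (\<lambda>_. 1 :: real) = sqrt pi"
proof -
  have "(L2_norm (\<lambda>_. 1 :: real))\<^sup>2 = pi" using continuous_L2(2)[of "\<lambda>_. 1 :: real"] by simp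
  then show ?thesis by (metis L2_norm_nonneg real_sqrt_unique)
qed

text \<open>The constants \<open>kA\<close>, \<open>kB\<close>, ... and \<open>cw\<close> depend only on the bound \<open>R\<close> of the class.\<close>

definition kA :: "real \<Rightarrow> real" where
  "kA R = (6 + 3 * pi\<^sup>2 * R\<^sup>2) * exp (3 * pi\<^sup>2 * R\<^sup>2 * pi)"

definition kB :: "real \<Rightarrow> real" where
  "kB R = R * sqrt pi * (1 + sqrt (pi * kA R))"

definition kC :: "real \<Rightarrow> real" where
  "kC R = kB R * sqrt (2 * exp (2 * (kB R)\<^sup>2 * pi))"

lemma kA_nonneg: "0 \<le> kA R" by (simp add: kA_def)

lemma kB_nonneg: "0 \<le> R \<Longrightarrow> 0 \<le> kB R" by (simp add: kB_def kA_nonneg)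

lemma kC_nonneg: "0 \<le> R \<Longrightarrow> 0 \<le> kC R" by (simp add: kC_def kB_nonneg)

text \<open>
  The function \<open>u x t\<close> below solves the wave equation with \<open>x\<close> in the role of time: its data at
  \<open>x = 0\<close> are the cosine sum, and its values at \<open>t = 0\<close> are the sum of the solutions \<open>y i\<close>. By
  finite propagation speed, the triangle with base \<open>[0, X]\<close> depends on the data on \<open>[- X, X]\<close>
  only, and this turns Gronwall's inequality into Volterra bounds between the two sums.
\<close>

locale solution_family = problem R Q h H
  for R :: real and Q :: "real \<Rightarrow> complex^'n^'n" and h H :: "complex^'n^'n" +
  fixes F :: "'i set" and \<mu> :: "'i \<Rightarrow> real" and y :: "'i \<Rightarrow> real \<Rightarrow> complex^'n"
  assumes F: "finite F" and sol: "i \<in> F \<Longrightarrow> Volterra_solution (\<mu> i) (y i)"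
begin

definition u :: "real \<Rightarrow> real \<Rightarrow> complex^'n" where
  "u x t = (\<Sum>i\<in>F. cosl (\<mu> i) t *\<^sub>R y i x)"

text \<open>The odd primitive of \<open>u x\<close> in its second variable. The kernel
  \<open>sinl\<close> produces it in place of \<open>u\<close>, and it is controlled by the square
  integral of \<open>u x\<close>.\<close>

definition U :: "real \<Rightarrow> real \<Rightarrow> complex^'n" where
  "U x t = (\<Sum>i\<in>F. sinl (\<mu> i) t *\<^sub>R y i x)"

lemma y_cont: "i \<in> F \<Longrightarrow> continuous_on {0..pi} (y i)"
  using sol by (simp add: Volterra_solution_def)

lemma u_cont: "continuous_on S (u x)"
  unfolding u_def by (intro continuous_intros)

lemma U_cont: "continuous_on S f \<Longrightarrow> S \<subseteq> {0..pi} \<Longrightarrow> continuous_on S (\<lambda>s. U s (f s))"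
  unfolding U_def by (intro continuous_intros continuous_on_subset[OF y_cont])

lemma u_minus: "u x (- t) = u x t" by (simp add: u_def)

lemma U_minus: "U x (- t) = - U x t" by (simp add: U_def sum_negf)

text \<open>The Volterra equation of each \<open>y i\<close>, multiplied by
  \<open>cosl (\<mu> i) t\<close>. The product formulas remove the individual \<open>\<mu> i\<close>
  and leave an equation for the sums \<open>u\<close> and \<open>U\<close> alone: d'Alembert's
  formula with the potential as a source term.\<close>

lemma wave_equation:
  assumes x: "x \<in> {0..pi}"
  shows "((\<lambda>s. Q s *v ((1/2) *\<^sub>R (U s (x - s + t) + U s (x - s - t)))) has_integral
      (u x t - (1/2) *\<^sub>R (u 0 (x + t) + u 0 (x - t)) - h *v ((1/2) *\<^sub>R (U 0 (x + t) + U 0 (x - t))))) {0..x}"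
proof -
  have "((\<lambda>s. \<Sum>i\<in>F. cosl (\<mu> i) t *\<^sub>R (Q s *v (sinl (\<mu> i) (x - s) *\<^sub>R y i s))) has_integral
     (\<Sum>i\<in>F. cosl (\<mu> i) t *\<^sub>R (y i x - cosl (\<mu> i) x *\<^sub>R y i 0 - sinl (\<mu> i) x *\<^sub>R (h *v y i 0)))) {0..x}"
    by (intro has_integral_sum F has_integral_cmul) (use sol x in \<open>auto simp: Volterra_solution_def\<close>)
  moreover have "(\<Sum>i\<in>F. cosl (\<mu> i) t *\<^sub>R (Q s *v (sinl (\<mu> i) (x - s) *\<^sub>R y i s)))
      = Q s *v ((1/2) *\<^sub>R (U s (x - s + t) + U s (x - s - t)))" for s
  proof -
    have "(1/2) *\<^sub>R (U s (x - s + t) + U s (x - s - t))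
        = (\<Sum>i\<in>F. (sinl (\<mu> i) (x - s) * cosl (\<mu> i) t) *\<^sub>R y i s)"
      by (simp add: U_def scaleR_sum_right sinl_mult_cosl flip: sum.distrib scaleR_add_left)
    then show ?thesis by (simp add: matrix_vector_mult_sum matrix_vector_mult_scaleR mult.commute)
  qed
  moreover have "(\<Sum>i\<in>F. cosl (\<mu> i) t *\<^sub>R (y i x - cosl (\<mu> i) x *\<^sub>R y i 0 - sinl (\<mu> i) x *\<^sub>R (h *v y i 0)))
      = u x t - (1/2) *\<^sub>R (u 0 (x + t) + u 0 (x - t)) - h *v ((1/2) *\<^sub>R (U 0 (x + t) + U 0 (x - t)))"
  proof -
    have 1: "(1/2) *\<^sub>R (U 0 (x + t) + U 0 (x - t)) = (\<Sum>i\<in>F. (sinl (\<mu> i) x * cosl (\<mu> i) t) *\<^sub>R y i 0)"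
      by (simp add: U_def scaleR_sum_right sinl_mult_cosl flip: sum.distrib scaleR_add_left)
    have 2: "(1/2) *\<^sub>R (u 0 (x + t) + u 0 (x - t)) = (\<Sum>i\<in>F. (cosl (\<mu> i) x * cosl (\<mu> i) t) *\<^sub>R y i 0)"
      by (simp add: u_def scaleR_sum_right cosl_mult_cosl flip: sum.distrib scaleR_add_left)
    show ?thesis unfolding 1 2
      by (simp add: u_def matrix_vector_mult_sum matrix_vector_mult_scaleR scaleR_diff_right mult.commute flip: sum_subtractf)
  qed
  ultimately show ?thesis by simp
qed

lemma U_bound:
  assumes a: "\<bar>a\<bar> \<le> b" and b: "b \<le> pi"
  shows "norm (U x a) \<le> sqrt pi * sqrt (integral {0..b} (\<lambda>t. (norm (u x t))\<^sup>2))"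
proof -
  have nc: "continuous_on S (\<lambda>t. norm (u x t))" for S by (intro continuous_intros u_cont)
  have nc2: "continuous_on S (\<lambda>t. (norm (u x t))\<^sup>2)" for S by (intro continuous_intros u_cont)
  have "norm (U x \<bar>a\<bar>) \<le> sqrt pi * sqrt (integral {0..b} (\<lambda>t. (norm (u x t))\<^sup>2))"
  proof -
    have "(u x has_integral (U x \<bar>a\<bar> - U x 0)) {0..\<bar>a\<bar>}"
    proof (rule fundamental_theorem_of_calculus)
      fix t assume "t \<in> {0..\<bar>a\<bar>}"
      show "(U x has_vector_derivative u x t) (at t within {0..\<bar>a\<bar>})"
        unfolding U_def u_def
        by (intro has_vector_derivative_sum)
          (auto intro!: derivative_eq_intros has_field_derivative_at_within[OF DERIV_sinl])
    qed simp
    then have "integral {0..\<bar>a\<bar>} (u x) = U x \<bar>a\<bar>" by (simp add: U_def integral_unique)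
    then have "norm (U x \<bar>a\<bar>) = norm (integral {0..\<bar>a\<bar>} (u x))" by simp
    also have "\<dots> \<le> integral {0..\<bar>a\<bar>} (\<lambda>t. norm (u x t))"
      by (intro integral_norm_bound_integral integrable_continuous_real u_cont nc) auto
    also have "\<dots> \<le> sqrt pi * sqrt (integral {0..\<bar>a\<bar>} (\<lambda>t. (norm (u x t))\<^sup>2))"
      using L2_Cauchy_Schwarz_interval(2)[of "\<lambda>_. 1 :: real", OF _ nc] a b
      by (simp add: L2_norm_one continuous_L2(1))
    also have "\<dots> \<le> sqrt pi * sqrt (integral {0..b} (\<lambda>t. (norm (u x t))\<^sup>2))"
      using a by (intro mult_left_mono real_sqrt_le_mono integral_subset_le integrable_continuous_real nc2) auto
    finally show ?thesis .
  qed
  moreover have "norm (U x a) = norm (U x \<bar>a\<bar>)" by (simp add: abs_if U_minus)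
  ultimately show ?thesis by simp
qed

text \<open>Both the window and the integrand move with \<open>x\<close>. Expanding the square over
  the finite set \<open>F\<close> separates the two dependences.\<close>

lemma triangle_energy_continuous:
  assumes X: "X \<in> {0..pi}"
  shows "continuous_on {0..X} (\<lambda>x. integral {0..X - x} (\<lambda>t. (norm (u x t))\<^sup>2))"
proof (rule continuous_on_eq)
  let ?p = "\<lambda>i j t. cosl (\<mu> i) t * cosl (\<mu> j) t"
  have pc: "continuous_on S (?p i j)" for S i j by (intro continuous_intros)
  show "continuous_on {0..X} (\<lambda>x. \<Sum>i\<in>F. \<Sum>j\<in>F. integral {0..X - x} (?p i j) * (y i x \<bullet> y j x))"
  proof (intro continuous_intros)
    fix i j assume ij: "i \<in> F" "j \<in> F"
    show "continuous_on {0..X} (y i)" "continuous_on {0..X} (y j)"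
      using y_cont[OF ij(1)] y_cont[OF ij(2)] X by (auto intro: continuous_on_subset)
    have "continuous_on {0..X} (\<lambda>b. integral {0..b} (?p i j))"
      by (intro indefinite_integral_continuous_1 integrable_continuous_real pc)
    then show "continuous_on {0..X} (\<lambda>x. integral {0..X - x} (?p i j))"
      by (rule continuous_on_compose2) (auto intro!: continuous_intros)
  qed
  fix x assume "x \<in> {0..X}"
  have eq: "(norm (u x t))\<^sup>2 = (\<Sum>i\<in>F. \<Sum>j\<in>F. ?p i j t * (y i x \<bullet> y j x))" for t
    by (simp add: power2_norm_eq_inner u_def inner_sum_left inner_sum_right sum_distrib_left mult_ac
        inner_commute)
  have "((\<lambda>t. \<Sum>i\<in>F. \<Sum>j\<in>F. ?p i j t * (y i x \<bullet> y j x)) has_integral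
      (\<Sum>i\<in>F. \<Sum>j\<in>F. integral {0..X - x} (?p i j) * (y i x \<bullet> y j x))) {0..X - x}"
    by (intro has_integral_sum F has_integral_mult_left integrable_integral integrable_continuous_real pc)
  then show "(\<Sum>i\<in>F. \<Sum>j\<in>F. integral {0..X - x} (?p i j) * (y i x \<bullet> y j x))
      = integral {0..X - x} (\<lambda>t. (norm (u x t))\<^sup>2)"
    unfolding eq by (simp add: integral_unique)
qed

text \<open>The shifted window stays inside \<open>{- X..X}\<close>, and evenness of
  \<open>u 0\<close> folds it onto \<open>{0..X}\<close>; hence the factor 2.\<close>

lemma initial_shift_bound:
  assumes x: "x \<in> {0..X}" and c: "\<bar>c\<bar> \<le> x"
  shows "integral {0..X - x} (\<lambda>t. (norm (u 0 (t + c)))\<^sup>2) \<le> 2 * integral {0..X} (\<lambda>t. (norm (u 0 t))\<^sup>2)"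
proof -
  let ?\<phi> = "\<lambda>t. (norm (u 0 t))\<^sup>2"
  have nc: "continuous_on S ?\<phi>" for S by (intro continuous_intros u_cont)
  have int: "?\<phi> integrable_on {a..b}" for a b by (intro integrable_continuous_real nc)
  have "integral {0..X - x} (\<lambda>t. ?\<phi> (t + c)) = integral {0 + c..X - x + c} ?\<phi>"
    using integral_shift[of 0 c "X - x" ?\<phi>, OF nc] by (simp add: o_def)
  also have "\<dots> \<le> integral {- X..X} ?\<phi>"
    using x c by (intro integral_subset_le int) auto
  also have "\<dots> = integral {- X..0} ?\<phi> + integral {0..X} ?\<phi>"
    using x by (intro Henstock_Kurzweil_Integration.integral_combine[symmetric] int) auto
  also have "integral {- X..0} ?\<phi> = integral {0..X} ?\<phi>"
    using Henstock_Kurzweil_Integration.integral_reflect_real[of X 0 ?\<phi>] by (simp add: u_minus)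
  finally show ?thesis by simp
qed

text \<open>An energy estimate on a backward light cone. The points \<open>x - s + t\<close> and
  \<open>x - s - t\<close> in the source term have absolute value at most \<open>X - s\<close>, so
  \<open>U s\<close> is controlled by the energy at time \<open>s\<close> on its own window, and
  Gronwall's inequality applies.\<close>

lemma triangle_energy_bound:
  assumes X: "X \<in> {0..pi}" and x: "x \<in> {0..X}"
  shows "integral {0..X - x} (\<lambda>t. (norm (u x t))\<^sup>2) \<le> kA R * integral {0..X} (\<lambda>t. (norm (u 0 t))\<^sup>2)"
proof -
  define E where "E x = integral {0..X - x} (\<lambda>t. (norm (u x t))\<^sup>2)" for x
  define A where "A = integral {0..X} (\<lambda>t. (norm (u 0 t))\<^sup>2)"
  have nc: "continuous_on S (\<lambda>t. (norm (u x t))\<^sup>2)" for S x by (intro continuous_intros u_cont)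
  have A0: "0 \<le> A" unfolding A_def by (intro integral_nonneg integrable_continuous_real nc) auto
  have E0: "0 \<le> E x" for x unfolding E_def by (intro integral_nonneg integrable_continuous_real nc) auto
  have Ec: "continuous_on {0..X} E" unfolding E_def by (rule triangle_energy_continuous[OF X])
  have le: "E x \<le> (6 + 3 * pi\<^sup>2 * R\<^sup>2) * A + 3 * pi\<^sup>2 * R\<^sup>2 * integral {0..x} E" if x: "x \<in> {0..X}" for x
  proof -
    define I where "I = integral {0..x} E"
    have Ecx: "continuous_on {0..x} E" by (rule continuous_on_subset[OF Ec]) (use x in auto)
    have I0: "0 \<le> I" unfolding I_def by (intro integral_nonneg integrable_continuous_real Ecx) (simp add: E0)
    have pt: "(norm (u x t))\<^sup>2 \<le> 3/2 * (norm (u 0 (t + x)))\<^sup>2 + 3/2 * (norm (u 0 (t + - x)))\<^sup>2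
         + (3 * R\<^sup>2 * pi * A + 3 * R\<^sup>2 * pi * I)" if t: "t \<in> {0..X - x}" for t
    proof -
      let ?y = "\<lambda>s. (1/2) *\<^sub>R (U s (x - s + t) + U s (x - s - t))"
      have xpi: "x \<in> {0..pi}" using x X by auto
      have "norm (integral {0..x} (\<lambda>s. Q s *v ?y s)) \<le> R * sqrt (integral {0..x} (\<lambda>s. (sqrt pi * sqrt (E s))\<^sup>2))"
      proof (rule norm_integral_Q_le)
        show "continuous_on {0..x} ?y"
          by (intro continuous_intros U_cont) (use xpi in auto)
        show "continuous_on {0..x} (\<lambda>s. sqrt pi * sqrt (E s))" by (intro continuous_intros Ecx)
        fix s assume s: "s \<in> {0..x}"
        have "norm (U s (x - s + t)) \<le> sqrt pi * sqrt (E s)" "norm (U s (x - s - t)) \<le> sqrt pi * sqrt (E s)"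
          unfolding E_def by (intro U_bound; use s t x X in auto)+
        then show "norm (?y s) \<le> sqrt pi * sqrt (E s)"
          using norm_triangle_ineq[of "U s (x - s + t)" "U s (x - s - t)"] by simp
      qed (use xpi in auto)
      also have "integral {0..x} (\<lambda>s. (sqrt pi * sqrt (E s))\<^sup>2) = pi * I"
        unfolding I_def by (simp add: power_mult_distrib E0)
      finally have q: "norm (integral {0..x} (\<lambda>s. Q s *v ?y s)) \<le> R * sqrt (pi * I)" .
      have p: "norm (h *v ((1/2) *\<^sub>R (U 0 (x + t) + U 0 (x - t)))) \<le> R * sqrt (pi * A)"
      proof -
        have "norm (U 0 (x + t)) \<le> sqrt pi * sqrt A" "norm (U 0 (x - t)) \<le> sqrt pi * sqrt A"
          unfolding A_def by (intro U_bound; use t x X in auto)+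
        then have "norm ((1/2) *\<^sub>R (U 0 (x + t) + U 0 (x - t))) \<le> sqrt (pi * A)"
          using norm_triangle_ineq[of "U 0 (x + t)" "U 0 (x - t)"] by (simp add: real_sqrt_mult)
        then show ?thesis using norm_h norms_le(4) by (meson mult_left_mono order_trans)
      qed
      let ?a = "norm (u 0 (t + x))" and ?b = "norm (u 0 (t + - x))"
      have "u x t = (1/2) *\<^sub>R (u 0 (x + t) + u 0 (x - t)) + h *v ((1/2) *\<^sub>R (U 0 (x + t) + U 0 (x - t)))
          + integral {0..x} (\<lambda>s. Q s *v ?y s)"
        using integral_unique[OF wave_equation[OF xpi, of t]] by (simp add: algebra_simps)
      moreover have "norm ((1/2) *\<^sub>R (u 0 (x + t) + u 0 (x - t))) \<le> 1/2 * (?a + ?b)"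
        using norm_triangle_ineq[of "u 0 (x + t)" "u 0 (x - t)"] u_minus[of 0 "x - t"] by (simp add: add.commute)
      ultimately have "norm (u x t) \<le> 1/2 * (?a + ?b) + R * sqrt (pi * A) + R * sqrt (pi * I)"
        using p q by (smt (verit) norm_triangle_ineq)
      then have "(norm (u x t))\<^sup>2 \<le> (1/2 * (?a + ?b) + R * sqrt (pi * A) + R * sqrt (pi * I))\<^sup>2"
        by (intro power_mono) auto
      also have "\<dots> \<le> 3 * ((1/2 * (?a + ?b))\<^sup>2 + (R * sqrt (pi * A))\<^sup>2 + (R * sqrt (pi * I))\<^sup>2)"
        by (rule square_sum3_le)
      also have "\<dots> \<le> 3/2 * ?a\<^sup>2 + 3/2 * ?b\<^sup>2 + (3 * R\<^sup>2 * pi * A + 3 * R\<^sup>2 * pi * I)"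
        using sum_squares_bound[of ?a ?b] A0 I0 by (simp add: power_mult_distrib power2_sum power_divide algebra_simps)
      finally show ?thesis .
    qed
    have "E x \<le> integral {0..X - x} (\<lambda>t. 3/2 * (norm (u 0 (t + x)))\<^sup>2 + 3/2 * (norm (u 0 (t + - x)))\<^sup>2
         + (3 * R\<^sup>2 * pi * A + 3 * R\<^sup>2 * pi * I))"
      unfolding E_def
      by (intro integral_le integrable_continuous_real nc pt continuous_intros continuous_on_compose2[OF u_cont[of UNIV]]) auto
    also have "\<dots> = 3/2 * integral {0..X - x} (\<lambda>t. (norm (u 0 (t + x)))\<^sup>2)
        + 3/2 * integral {0..X - x} (\<lambda>t. (norm (u 0 (t + - x)))\<^sup>2) + (X - x) * (3 * R\<^sup>2 * pi * A + 3 * R\<^sup>2 * pi * I)"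
    proof (rule integral_unique, intro has_integral_add has_integral_mult_right)
      show "((\<lambda>t. (norm (u 0 (t + x)))\<^sup>2) has_integral integral {0..X - x} (\<lambda>t. (norm (u 0 (t + x)))\<^sup>2)) {0..X - x}"
        by (intro integrable_integral integrable_continuous_real continuous_intros continuous_on_compose2[OF u_cont[of UNIV]]) auto
      show "((\<lambda>t. (norm (u 0 (t + - x)))\<^sup>2) has_integral integral {0..X - x} (\<lambda>t. (norm (u 0 (t + - x)))\<^sup>2)) {0..X - x}"
        by (intro integrable_integral integrable_continuous_real continuous_intros continuous_on_compose2[OF u_cont[of UNIV]]) auto
      show "((\<lambda>t. 3 * R\<^sup>2 * pi * A + 3 * R\<^sup>2 * pi * I) has_integral (X - x) * (3 * R\<^sup>2 * pi * A + 3 * R\<^sup>2 * pi * I)) {0..X - x}"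
        using has_integral_const_real[of "3 * R\<^sup>2 * pi * A + 3 * R\<^sup>2 * pi * I" 0 "X - x"] x by simp
    qed
    \<comment> \<open>The two translated data terms give \<open>3 * A\<close> each, hence the 6 in
      \<open>kA\<close>; the remaining terms carry the length of the window, at most
      \<open>pi\<close>.\<close>
    also have "\<dots> \<le> 3/2 * (2 * A) + 3/2 * (2 * A) + pi * (3 * R\<^sup>2 * pi * A + 3 * R\<^sup>2 * pi * I)"
    proof (intro add_mono mult_left_mono mult_right_mono)
      show "integral {0..X - x} (\<lambda>t. (norm (u 0 (t + x)))\<^sup>2) \<le> 2 * A"
        "integral {0..X - x} (\<lambda>t. (norm (u 0 (t + - x)))\<^sup>2) \<le> 2 * A"
        unfolding A_def using x by (intro initial_shift_bound; auto)+
      show "X - x \<le> pi" using x X by auto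
      show "0 \<le> 3 * R\<^sup>2 * pi * A + 3 * R\<^sup>2 * pi * I" using A0 I0 by simp
    qed auto
    finally show ?thesis unfolding I_def by (simp add: power2_eq_square algebra_simps)
  qed
  have "E x \<le> ((6 + 3 * pi\<^sup>2 * R\<^sup>2) * A) * exp (3 * pi\<^sup>2 * R\<^sup>2 * x)"
    by (rule Gronwall[OF Ec _ le x]) auto
  also have "\<dots> \<le> ((6 + 3 * pi\<^sup>2 * R\<^sup>2) * A) * exp (3 * pi\<^sup>2 * R\<^sup>2 * pi)"
    using x X A0 by (intro mult_left_mono) (auto intro!: mult_left_mono)
  finally show ?thesis by (simp add: E_def A_def kA_def mult_ac)
qed

text \<open>The apex \<open>t = 0\<close> of the triangle: \<open>u X 0\<close> is the sum of the
  solutions at \<open>X\<close> and \<open>u 0 X\<close> the cosine sum. The right side involves the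
  cosine sum on \<open>{0..X}\<close> only.\<close>

lemma compare_cos:
  assumes X: "X \<in> {0..pi}"
  shows "norm (u X 0 - u 0 X) \<le> kB R * sqrt (integral {0..X} (\<lambda>t. (norm (u 0 t))\<^sup>2))"
proof -
  define A where "A = integral {0..X} (\<lambda>t. (norm (u 0 t))\<^sup>2)"
  define E where "E x = integral {0..X - x} (\<lambda>t. (norm (u x t))\<^sup>2)" for x
  have nc: "continuous_on S (\<lambda>t. (norm (u x t))\<^sup>2)" for S x by (intro continuous_intros u_cont)
  have A0: "0 \<le> A" unfolding A_def by (intro integral_nonneg integrable_continuous_real nc) auto
  have E0: "0 \<le> E x" for x unfolding E_def by (intro integral_nonneg integrable_continuous_real nc) auto
  have Ec: "continuous_on {0..X} E" unfolding E_def by (rule triangle_energy_continuous[OF X])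
  let ?y = "\<lambda>s. (1/2) *\<^sub>R (U s (X - s + 0) + U s (X - s - 0))"
  have "norm (integral {0..X} (\<lambda>s. Q s *v ?y s)) \<le> R * sqrt (integral {0..X} (\<lambda>s. (sqrt pi * sqrt (E s))\<^sup>2))"
  proof (rule norm_integral_Q_le)
    show "continuous_on {0..X} ?y" by (intro continuous_intros U_cont) (use X in auto)
    show "continuous_on {0..X} (\<lambda>s. sqrt pi * sqrt (E s))" by (intro continuous_intros Ec)
    fix s assume s: "s \<in> {0..X}"
    have "norm (U s (X - s)) \<le> sqrt pi * sqrt (E s)"
      unfolding E_def by (intro U_bound) (use s X in auto)
    then show "norm (?y s) \<le> sqrt pi * sqrt (E s)" by (simp flip: scaleR_2)
  qed (use X in auto)
  also have "integral {0..X} (\<lambda>s. (sqrt pi * sqrt (E s))\<^sup>2) = pi * integral {0..X} E"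
    by (simp add: power_mult_distrib E0)
  also have "R * sqrt (pi * integral {0..X} E) \<le> R * sqrt (pi * (pi * (kA R * A)))"
  proof (intro mult_left_mono real_sqrt_le_mono norms_le)
    have "integral {0..X} E \<le> integral {0..X} (\<lambda>_. kA R * A)"
      by (intro integral_le integrable_continuous_real Ec) (auto simp: E_def A_def intro!: triangle_energy_bound[OF X])
    also have "\<dots> = X * (kA R * A)" using X by simp
    also have "\<dots> \<le> pi * (kA R * A)" using X A0 kA_nonneg[of R] by (intro mult_right_mono) auto
    finally show "integral {0..X} E \<le> pi * (kA R * A)" .
  qed auto
  finally have q: "norm (integral {0..X} (\<lambda>s. Q s *v ?y s)) \<le> R * sqrt (pi * (pi * (kA R * A)))" .
  have p: "norm (h *v U 0 X) \<le> R * (sqrt pi * sqrt A)"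
  proof -
    have "norm (U 0 X) \<le> sqrt pi * sqrt A" unfolding A_def by (intro U_bound) (use X in auto)
    then show ?thesis using norm_h[of "U 0 X"] norms_le(4) by (meson mult_left_mono order_trans)
  qed
  have "u X 0 - u 0 X = h *v U 0 X + integral {0..X} (\<lambda>s. Q s *v ?y s)"
    using integral_unique[OF wave_equation[OF X, of 0]] by (simp add: algebra_simps flip: scaleR_2)
  then have "norm (u X 0 - u 0 X) \<le> R * (sqrt pi * sqrt A) + R * sqrt (pi * (pi * (kA R * A)))"
    using p q norm_triangle_ineq[of "h *v U 0 X" "integral {0..X} (\<lambda>s. Q s *v ?y s)"] by simp
  also have "\<dots> = kB R * sqrt A" by (simp add: kB_def real_sqrt_mult algebra_simps)
  finally show ?thesis by (simp add: A_def)
qed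

text \<open>To have the solutions on the right, \<open>compare_cos\<close> is read as an integral
  inequality for the square integral of the cosine sum, and Gronwall's inequality bounds the latter
  by that of the solution sum.\<close>

lemma compare_cos':
  assumes X: "X \<in> {0..pi}"
  shows "norm (u X 0 - u 0 X) \<le> kC R * sqrt (integral {0..X} (\<lambda>x. (norm (u x 0))\<^sup>2))"
proof -
  define B where "B x = integral {0..x} (\<lambda>t. (norm (u 0 t))\<^sup>2)" for x
  define P where "P = integral {0..X} (\<lambda>x. (norm (u x 0))\<^sup>2)"
  have nc: "continuous_on S (\<lambda>t. (norm (u 0 t))\<^sup>2)" for S by (intro continuous_intros u_cont)
  have uc: "continuous_on {0..X} (\<lambda>x. (norm (u x 0))\<^sup>2)"
    unfolding u_def by (intro continuous_intros continuous_on_subset[OF y_cont]) (use X in auto)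
  have Bc: "continuous_on {0..X} B" unfolding B_def
    by (intro indefinite_integral_continuous_1 integrable_continuous_real nc)
  have B0: "0 \<le> B x" for x unfolding B_def by (intro integral_nonneg integrable_continuous_real nc) auto
  have le: "B x \<le> 2 * P + 2 * (kB R)\<^sup>2 * integral {0..x} B" if x: "x \<in> {0..X}" for x
  proof -
    have sub: "{0..x} \<subseteq> {0..X}" using x by auto
    have "(norm (u 0 s))\<^sup>2 \<le> 2 * (norm (u s 0))\<^sup>2 + 2 * (kB R)\<^sup>2 * B s" if s: "s \<in> {0..x}" for s
    proof -
      have "norm (u 0 s) \<le> norm (u s 0) + kB R * sqrt (B s)"
        using compare_cos[of s] s x X norm_triangle_ineq3[of "u 0 s" "u s 0"]
        by (auto simp: B_def norm_minus_commute)
      then have "(norm (u 0 s))\<^sup>2 \<le> (norm (u s 0) + kB R * sqrt (B s))\<^sup>2" by (intro power_mono) auto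
      also have "\<dots> \<le> 2 * (norm (u s 0))\<^sup>2 + 2 * (kB R * sqrt (B s))\<^sup>2"
        using sum_squares_bound[of "norm (u s 0)" "kB R * sqrt (B s)"] by (simp add: power2_sum)
      finally show ?thesis using B0[of s] by (simp add: power_mult_distrib)
    qed
    then have "B x \<le> integral {0..x} (\<lambda>s. 2 * (norm (u s 0))\<^sup>2 + 2 * (kB R)\<^sup>2 * B s)"
      unfolding B_def[of x]
      by (intro integral_le integrable_continuous_real nc continuous_intros
          continuous_on_subset[OF uc sub] continuous_on_subset[OF Bc sub])
    also have "\<dots> = 2 * integral {0..x} (\<lambda>s. (norm (u s 0))\<^sup>2) + 2 * (kB R)\<^sup>2 * integral {0..x} B"
      by (rule integral_unique, intro has_integral_add has_integral_mult_right integrable_integral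
          integrable_continuous_real continuous_on_subset[OF uc sub] continuous_on_subset[OF Bc sub])
    also have "integral {0..x} (\<lambda>s. (norm (u s 0))\<^sup>2) \<le> P"
      unfolding P_def by (intro integral_subset_le sub integrable_continuous_real uc continuous_on_subset[OF uc sub]) auto
    finally show ?thesis by simp
  qed
  have "B X \<le> (2 * P) * exp (2 * (kB R)\<^sup>2 * X)"
    by (rule Gronwall[OF Bc _ le]) (use X in auto)
  also have "\<dots> \<le> (2 * P) * exp (2 * (kB R)\<^sup>2 * pi)"
  proof (rule mult_left_mono)
    show "0 \<le> 2 * P" unfolding P_def using integral_nonneg[OF integrable_continuous_real[OF uc]] by simp
  qed (use X in \<open>auto intro!: mult_left_mono\<close>)
  finally have "sqrt (B X) \<le> sqrt (2 * exp (2 * (kB R)\<^sup>2 * pi) * P)" by (simp add: mult_ac)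
  then have "kB R * sqrt (B X) \<le> kB R * (sqrt (2 * exp (2 * (kB R)\<^sup>2 * pi)) * sqrt P)"
    using kB_nonneg[OF norms_le(4)] by (intro mult_left_mono) (simp_all add: real_sqrt_mult)
  then show ?thesis using compare_cos[OF X] by (simp add: B_def P_def kC_def)
qed

end

text \<open>Integrating the derivative of \<open>exp (- (c * x)) * integral {0..x} f\<close> shows
  that, under the weight, taking a primitive gains the factor \<open>1 / c\<close>.\<close>

lemma weighted_Volterra_bound:
  fixes f :: "real \<Rightarrow> real"
  assumes f: "continuous_on {0..pi} f" and c: "0 < c"
  shows "integral {0..pi} (\<lambda>x. exp (- (c * x)) * integral {0..x} f)
       \<le> 1 / c * (integral {0..pi} (\<lambda>x. exp (- (c * x)) * f x) - exp (- (c * pi)) * integral {0..pi} f)"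
proof -
  let ?P = "\<lambda>x. integral {0..x} f"
  have Pc: "continuous_on {0..pi} ?P" by (intro indefinite_integral_continuous_1 integrable_continuous_real f)
  have "((\<lambda>x. exp (- (c * x)) * f x - c * (exp (- (c * x)) * ?P x)) has_integral
      (exp (- (c * pi)) * ?P pi - exp (- (c * 0)) * ?P 0)) {0..pi}"
  proof (rule fundamental_theorem_of_calculus)
    fix x assume x: "x \<in> {0..pi}"
    have "((\<lambda>x. integral {0..x} f) has_real_derivative f x) (at x within {0..pi})"
      using integral_has_vector_derivative[OF f x] by (simp add: has_real_derivative_iff_has_vector_derivative)
    then have "((\<lambda>x. exp (- (c * x)) * ?P x) has_real_derivative
        (exp (- (c * x)) * f x - c * (exp (- (c * x)) * ?P x))) (at x within {0..pi})"
      by (auto intro!: derivative_eq_intros)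
    then show "((\<lambda>x. exp (- (c * x)) * ?P x) has_vector_derivative
        (exp (- (c * x)) * f x - c * (exp (- (c * x)) * ?P x))) (at x within {0..pi})"
      by (simp add: has_real_derivative_iff_has_vector_derivative)
  qed simp
  moreover have "((\<lambda>x. exp (- (c * x)) * f x - c * (exp (- (c * x)) * ?P x)) has_integral
      (integral {0..pi} (\<lambda>x. exp (- (c * x)) * f x) - c * integral {0..pi} (\<lambda>x. exp (- (c * x)) * ?P x))) {0..pi}"
    by (intro has_integral_diff has_integral_mult_right integrable_integral integrable_continuous_real
        continuous_intros f Pc)
  ultimately have "exp (- (c * pi)) * ?P pi - exp (- (c * 0)) * ?P 0
      = integral {0..pi} (\<lambda>x. exp (- (c * x)) * f x) - c * integral {0..pi} (\<lambda>x. exp (- (c * x)) * ?P x)"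
    by (rule has_integral_unique)
  then show ?thesis using c by (simp add: field_simps)
qed

text \<open>Chosen so that \<open>(kC R)\<^sup>2 / (2 * cw R)\<close> is at most \<open>1/4\<close>,
  the square of the factor \<open>1/2\<close> required of close systems; the summand 1 keeps it
  positive.\<close>

definition cw :: "real \<Rightarrow> real" where
  "cw R = 2 * (kC R)\<^sup>2 + 1"

lemma cw_pos: "0 < cw R"
  unfolding cw_def by (intro add_nonneg_pos) auto

context problem
begin

text \<open>By \<open>compare_cos'\<close> the squared difference is at most a primitive of the
  squared solution sum, which is exactly what the weight makes small. The squared weight decays at
  the rate \<open>2 * cw R\<close>.\<close>

lemma cosine_system_close:
  fixes I :: "'i set"
  assumes onb: "L2_orthonormal_basis Y I"
    and sol: "\<And>i. i \<in> I \<Longrightarrow> Volterra_solution (lam i) (Y i)"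
  shows "weighted_close_systems I Y (\<lambda>i x. cosl (lam i) x *\<^sub>R Y i 0) (\<lambda>x. exp (- (cw R * x))) (exp (- (cw R * pi)))"
proof
  show "L2_orthonormal_basis Y I" by (rule onb)
  show "in_L2 (\<lambda>x. cosl (lam i) x *\<^sub>R Y i 0)" for i
    by (intro continuous_L2 continuous_intros)
  show "(\<lambda>x. exp (- (cw R * x))) \<in> borel_measurable M_pi"
    by (intro continuous_imp_measurable_on_sets_lebesgue continuous_intros) auto
  show "exp (- (cw R * pi)) \<le> exp (- (cw R * x))" "exp (- (cw R * x)) \<le> 1" if "x \<in> {0<..<pi}" for x
    using that cw_pos[of R] by auto
  fix F :: "'i set" and a :: "'i \<Rightarrow> complex" assume F: "finite F" "F \<subseteq> I"
  \<comment> \<open>The coefficients are absorbed into the solutions, so that a finite combination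
    becomes a plain sum.\<close>
  interpret sf: solution_family R Q h H F lam "\<lambda>i x. a i *s Y i x"
    by unfold_locales (use F sol in \<open>auto intro: Volterra_solution_scale\<close>)
  let ?g = "\<lambda>x. sf.u x 0" and ?f = "\<lambda>x. sf.u 0 x" and ?w = "\<lambda>x. exp (- (cw R * x))"
  have g: "?g x = (\<Sum>i\<in>F. a i *s Y i x)" for x by (simp add: sf.u_def)
  have f: "?f x = (\<Sum>i\<in>F. a i *s (cosl (lam i) x *\<^sub>R Y i 0))" for x
    by (auto simp: sf.u_def vec_eq_iff intro!: sum.cong)
  have diff: "(\<Sum>i\<in>F. a i *s (Y i x - cosl (lam i) x *\<^sub>R Y i 0)) = ?g x - ?f x" for x
    unfolding f g by (simp add: vec.scale_right_diff_distrib sum_subtractf)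
  have gc: "continuous_on S ?g" if "S \<subseteq> {0..pi}" for S
    unfolding sf.u_def by (intro continuous_intros continuous_on_subset[OF sf.y_cont that])
  have fc: "continuous_on S ?f" for S by (rule sf.u_cont)
  have wsq: "(norm (?w x *\<^sub>R v))\<^sup>2 = exp (- (2 * cw R * x)) * (norm v)\<^sup>2" for x and v :: "complex^'n"
    by (simp add: power_mult_distrib flip: exp_of_nat_mult)
  have gc2: "continuous_on {0..pi} (\<lambda>x. (norm (?g x))\<^sup>2)" by (intro continuous_intros gc) auto
  define P where "P x = integral {0..x} (\<lambda>x. (norm (?g x))\<^sup>2)" for x
  have Pc: "continuous_on {0..pi} P" unfolding P_def
    by (intro indefinite_integral_continuous_1 integrable_continuous_real gc2)
  have P0: "0 \<le> P x" if "x \<le> pi" for x unfolding P_def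
    using that by (intro integral_nonneg integrable_continuous_real continuous_on_subset[OF gc2]) auto
  have "(L2_norm (\<lambda>x. ?w x *\<^sub>R (?g x - ?f x)))\<^sup>2
      = integral {0..pi} (\<lambda>x. exp (- (2 * cw R * x)) * (norm (?g x - ?f x))\<^sup>2)"
    unfolding wsq[symmetric] by (intro continuous_L2(2) continuous_intros gc fc) auto
  also have "\<dots> \<le> integral {0..pi} (\<lambda>x. (kC R)\<^sup>2 * (exp (- (2 * cw R * x)) * P x))"
  proof (intro integral_le integrable_continuous_real continuous_intros gc fc Pc)
    fix x assume x: "x \<in> {0..pi}"
    have "(norm (?g x - ?f x))\<^sup>2 \<le> (kC R * sqrt (P x))\<^sup>2"
      unfolding P_def by (intro power_mono sf.compare_cos' x) auto
    also have "\<dots> = (kC R)\<^sup>2 * P x" using P0[of x] x by (simp add: power_mult_distrib)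
    finally show "exp (- (2 * cw R * x)) * (norm (?g x - ?f x))\<^sup>2 \<le> (kC R)\<^sup>2 * (exp (- (2 * cw R * x)) * P x)"
      by (simp add: mult.left_commute)
  qed auto
  also have "\<dots> = (kC R)\<^sup>2 * integral {0..pi} (\<lambda>x. exp (- (2 * cw R * x)) * P x)" by simp
  also have "\<dots> \<le> (kC R)\<^sup>2 * (1 / (2 * cw R) * integral {0..pi} (\<lambda>x. exp (- (2 * cw R * x)) * (norm (?g x))\<^sup>2))"
  proof (rule mult_left_mono)
    have "integral {0..pi} (\<lambda>x. exp (- (2 * cw R * x)) * P x)
        \<le> 1 / (2 * cw R) * (integral {0..pi} (\<lambda>x. exp (- (2 * cw R * x)) * (norm (?g x))\<^sup>2) - exp (- (2 * cw R * pi)) * P pi)"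
      unfolding P_def by (rule weighted_Volterra_bound[OF gc2]) (simp add: cw_pos)
    also have "\<dots> \<le> 1 / (2 * cw R) * integral {0..pi} (\<lambda>x. exp (- (2 * cw R * x)) * (norm (?g x))\<^sup>2)"
      using cw_pos[of R] P0[of pi] by (intro mult_left_mono) auto
    finally show "integral {0..pi} (\<lambda>x. exp (- (2 * cw R * x)) * P x)
        \<le> 1 / (2 * cw R) * integral {0..pi} (\<lambda>x. exp (- (2 * cw R * x)) * (norm (?g x))\<^sup>2)" .
  qed simp
  also have "integral {0..pi} (\<lambda>x. exp (- (2 * cw R * x)) * (norm (?g x))\<^sup>2) = (L2_norm (\<lambda>x. ?w x *\<^sub>R ?g x))\<^sup>2"
    unfolding wsq[symmetric] by (intro continuous_L2(2)[symmetric] continuous_intros gc) auto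
  also have "(kC R)\<^sup>2 * (1 / (2 * cw R) * (L2_norm (\<lambda>x. ?w x *\<^sub>R ?g x))\<^sup>2) \<le> 1/4 * (L2_norm (\<lambda>x. ?w x *\<^sub>R ?g x))\<^sup>2"
  proof -
    have "(kC R)\<^sup>2 * (1 / (2 * cw R)) \<le> 1/4"
      using cw_pos[of R] by (simp add: cw_def field_simps)
    from mult_right_mono[OF this, of "(L2_norm (\<lambda>x. ?w x *\<^sub>R ?g x))\<^sup>2"] show ?thesis by simp
  qed
  also have "\<dots> = (1/2 * L2_norm (\<lambda>x. ?w x *\<^sub>R ?g x))\<^sup>2" by (simp add: power_divide)
  finally have "L2_norm (\<lambda>x. ?w x *\<^sub>R (?g x - ?f x)) \<le> 1/2 * L2_norm (\<lambda>x. ?w x *\<^sub>R ?g x)"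
    by (rule power2_le_imp_le) simp
  then show "L2_norm (\<lambda>x. ?w x *\<^sub>R (\<Sum>i\<in>F. a i *s (Y i x - cosl (lam i) x *\<^sub>R Y i 0)))
      \<le> 1 / 2 * L2_norm (\<lambda>x. ?w x *\<^sub>R (\<Sum>i\<in>F. a i *s Y i x))"
    unfolding diff by (simp only: g)
qed (simp_all)

lemma compare_cos_single:
  assumes sol: "Volterra_solution \<mu> Y" and X: "X \<in> {0..pi}"
  shows "norm (Y X - cosl \<mu> X *\<^sub>R Y 0) \<le> kB R * sqrt (integral {0..X} (\<lambda>t. (norm (cosl \<mu> t *\<^sub>R Y 0))\<^sup>2))"
    "norm (Y X - cosl \<mu> X *\<^sub>R Y 0) \<le> kC R * sqrt (integral {0..X} (\<lambda>t. (norm (Y t))\<^sup>2))"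
proof -
  interpret sf: solution_family R Q h H "{()}" "\<lambda>_. \<mu>" "\<lambda>_. Y"
    by unfold_locales (use sol in auto)
  show "norm (Y X - cosl \<mu> X *\<^sub>R Y 0) \<le> kB R * sqrt (integral {0..X} (\<lambda>t. (norm (cosl \<mu> t *\<^sub>R Y 0))\<^sup>2))"
    using sf.compare_cos[OF X] by (simp add: sf.u_def)
  show "norm (Y X - cosl \<mu> X *\<^sub>R Y 0) \<le> kC R * sqrt (integral {0..X} (\<lambda>t. (norm (Y t))\<^sup>2))"
    using sf.compare_cos'[OF X] by (simp add: sf.u_def)
qed

end

subsection \<open>A priori bounds for normalized eigenfunctions\<close>

lemma has_integral_cos_mult:
  assumes "a \<noteq> 0"
  shows "((\<lambda>x. cos (a * x)) has_integral sin (a * pi) / a) {0..pi}"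
proof -
  have "((\<lambda>x. cos (a * x)) has_integral (sin (a * pi) / a - sin (a * 0) / a)) {0..pi}"
    by (rule fundamental_theorem_of_calculus)
       (use assms in \<open>auto intro!: derivative_eq_intros simp: has_real_derivative_iff_has_vector_derivative[symmetric]\<close>)
  then show ?thesis by simp
qed

text \<open>A bound uniform in \<mu>. For positive \<mu> with root \<open>r\<close> the integral is
  \<open>pi / 2 + sin (2 * r * pi) / (4 * r)\<close>, whose second term is nonnegative if
  \<open>2 * r \<le> 1\<close> and at least \<open>- 1/2\<close> otherwise.\<close>

lemma integral_cosl_square_ge: "1 \<le> integral {0..pi} (\<lambda>x. (cosl \<mu> x)\<^sup>2)"
proof -
  have pi3: "pi \<ge> 3" using pi_gt3 by simp
  consider "\<mu> = 0" | "\<mu> < 0" | "\<mu> > 0" by linarith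
  then show ?thesis
  proof cases
    case 1
    then show ?thesis using pi3 by (simp add: cosl_def)
  next
    case 2
    have "integral {0..pi} (\<lambda>x. 1) \<le> integral {0..pi} (\<lambda>x. (cosl \<mu> x)\<^sup>2)"
    proof (intro integral_le integrable_continuous_real continuous_intros)
      fix x :: real
      show "1 \<le> (cosl \<mu> x)\<^sup>2" using 2 by (simp add: cosl_def cosh_real_ge_1)
    qed
    then show ?thesis using pi3 by simp
  next
    case 3
    let ?r = "sqrt \<mu>"
    have r: "?r > 0" using 3 by simp
    have "((\<lambda>x. 1/2 + 1/2 * cos ((2 * ?r) * x)) has_integral (pi * (1/2) + 1/2 * (sin ((2 * ?r) * pi) / (2 * ?r)))) {0..pi}"
      using has_integral_const_real[of "1/2 :: real" 0 pi]
      by (intro has_integral_add has_integral_mult_right has_integral_cos_mult) (use r in auto)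
    moreover have "(cosl \<mu> x)\<^sup>2 = 1/2 + 1/2 * cos ((2 * ?r) * x)" for x
      using 3 cos_double_cos[of "?r * x"] by (simp add: cosl_def mult.assoc diff_divide_distrib)
    ultimately have I: "integral {0..pi} (\<lambda>x. (cosl \<mu> x)\<^sup>2) = pi / 2 + sin ((2 * ?r) * pi) / (4 * ?r)"
      by (simp add: integral_unique)
    have "sin ((2 * ?r) * pi) / (4 * ?r) \<ge> - (1/2)"
    proof (cases "2 * ?r \<le> 1")
      case True
      then have "sin ((2 * ?r) * pi) \<ge> 0" using r by (intro sin_ge_zero) (auto simp: mult_le_cancel_right1)
      then have "sin ((2 * ?r) * pi) / (4 * ?r) \<ge> 0" using r by simp
      then show ?thesis by simp
    next
      case False
      have "- 1 \<le> sin ((2 * ?r) * pi)" by simp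
      then have "- 1 / (4 * ?r) \<le> sin ((2 * ?r) * pi) / (4 * ?r)" using r by (intro divide_right_mono) auto
      moreover have "- 1 / (4 * ?r) \<ge> - (1/2)" using False r by (simp add: field_simps)
      ultimately show ?thesis by linarith
    qed
    then show ?thesis using I pi3 by linarith
  qed
qed

text \<open>For normalized solutions: \<open>kV\<close> bounds the initial value, \<open>kY\<close>
  the supremum when \<open>0 \<le> \<mu>\<close>, and \<open>kE\<close> divided by
  \<open>sqrt \<mu>\<close> the distance to the cosine when \<open>0 < \<mu>\<close>.\<close>

definition kV :: "real \<Rightarrow> real" where "kV R = 1 + kC R * sqrt pi"
definition kY :: "real \<Rightarrow> real" where "kY R = kV R + kC R"
definition kE :: "real \<Rightarrow> real" where "kE R = R * kV R + R * sqrt pi * kY R"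

lemma abs_cosl_le_1: "0 \<le> \<mu> \<Longrightarrow> \<bar>cosl \<mu> x\<bar> \<le> 1" by (simp add: cosl_def)

lemma abs_sinl_le: "0 < \<mu> \<Longrightarrow> \<bar>sinl \<mu> x\<bar> \<le> 1 / sqrt \<mu>"
  by (simp add: sinl_def abs_divide divide_right_mono)

lemma sqrt_integral_le_const:
  fixes g :: "real \<Rightarrow> real"
  assumes g: "continuous_on {0..x} g" and le: "\<And>t. t \<in> {0..x} \<Longrightarrow> \<bar>g t\<bar> \<le> b" and x: "0 \<le> x" "x \<le> pi"
  shows "sqrt (integral {0..x} (\<lambda>t. (g t)\<^sup>2)) \<le> sqrt pi * b"
proof -
  have b: "0 \<le> b" using le[of 0] x by simp
  have "integral {0..x} (\<lambda>t. (g t)\<^sup>2) \<le> integral {0..x} (\<lambda>t. b\<^sup>2)"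
    by (intro integral_le integrable_continuous_real continuous_intros g) (use le in \<open>simp add: abs_le_square_iff[symmetric] b\<close>)
  also have "\<dots> \<le> pi * b\<^sup>2" using x by (simp add: mult_right_mono)
  finally have "sqrt (integral {0..x} (\<lambda>t. (g t)\<^sup>2)) \<le> sqrt (pi * b\<^sup>2)" by (rule real_sqrt_le_mono)
  then show ?thesis using b by (simp add: real_sqrt_mult)
qed

context problem
begin

lemma kC0: "0 \<le> kC R" by (rule kC_nonneg[OF norms_le(4)])
lemma kB0: "0 \<le> kB R" by (rule kB_nonneg[OF norms_le(4)])
lemma kV1: "1 \<le> kV R" using kC0 by (simp add: kV_def)
lemma kY1: "1 \<le> kY R" using kV1 kC0 by (simp add: kY_def)
lemma kE0: "0 \<le> kE R" using kV1 kY1 norms_le(4) by (simp add: kE_def)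

lemma Volterra_diff_le:
  assumes sol: "Volterra_solution \<mu> Y" and norm: "L2_norm Y = 1" and x: "x \<in> {0..pi}"
  shows "norm (Y x - cosl \<mu> x *\<^sub>R Y 0) \<le> kC R"
proof -
  have Yc: "continuous_on {0..pi} Y" using sol by (simp add: Volterra_solution_def)
  have c2: "continuous_on S (\<lambda>t. (norm (Y t))\<^sup>2)" if "S \<subseteq> {0..pi}" for S
    by (intro continuous_intros continuous_on_subset[OF Yc that])
  have "integral {0..x} (\<lambda>t. (norm (Y t))\<^sup>2) \<le> integral {0..pi} (\<lambda>t. (norm (Y t))\<^sup>2)"
    by (intro integral_subset_le integrable_continuous_real c2) (use x in auto)
  also have "\<dots> = 1" using continuous_L2(2)[OF Yc] norm by simp
  finally have "sqrt (integral {0..x} (\<lambda>t. (norm (Y t))\<^sup>2)) \<le> 1" by simp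
  from mult_left_mono[OF this kC0] compare_cos_single(2)[OF sol x] show ?thesis by simp
qed

text \<open>The initial value is read off from the cosine with the same initial value, whose norm is
  at least \<open>norm (Y 0)\<close> and which differs from \<open>Y\<close> by at most
  \<open>kC R\<close> at every point.\<close>

lemma norm_initial_le:
  assumes sol: "Volterra_solution \<mu> Y" and norm: "L2_norm Y = 1"
  shows "norm (Y 0) \<le> kV R"
proof -
  have Yc: "continuous_on {0..pi} Y" using sol by (simp add: Volterra_solution_def)
  let ?W = "\<lambda>x. cosl \<mu> x *\<^sub>R Y 0"
  have Wc: "continuous_on {0..pi} ?W" by (intro continuous_intros)
  have "(norm (Y 0))\<^sup>2 * 1 \<le> (norm (Y 0))\<^sup>2 * integral {0..pi} (\<lambda>x. (cosl \<mu> x)\<^sup>2)"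
    by (intro mult_left_mono integral_cosl_square_ge) auto
  also have "\<dots> = (L2_norm ?W)\<^sup>2"
    unfolding continuous_L2(2)[OF Wc] by (simp add: power_mult_distrib mult.commute)
  finally have "norm (Y 0) \<le> L2_norm ?W" by (simp add: power2_le_iff_abs_le)
  also have "\<dots> \<le> L2_norm Y + L2_norm (\<lambda>x. ?W x - Y x)"
    by (intro L2_norm_triangle_diff2 continuous_L2 Wc Yc)
  also have "L2_norm (\<lambda>x. ?W x - Y x) \<le> kC R * sqrt pi"
  proof -
    have "L2_norm (\<lambda>x. ?W x - Y x) \<le> L2_norm (\<lambda>x. kC R *\<^sub>R (1 :: real))"
    proof (rule L2_norm_mono)
      fix x assume "x \<in> {0<..<pi}"
      then show "norm (?W x - Y x) \<le> norm (kC R *\<^sub>R (1 :: real))"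
        using Volterra_diff_le[OF sol norm, of x] kC0 by (simp add: norm_minus_commute)
    qed (intro continuous_L2 continuous_intros Wc Yc)+
    then show ?thesis using kC0 unfolding L2_norm_scaleR by (simp add: L2_norm_one)
  qed
  finally show ?thesis using norm by (simp add: kV_def)
qed

lemma norm_le_kY:
  assumes sol: "Volterra_solution \<mu> Y" and norm: "L2_norm Y = 1" and \<mu>: "0 \<le> \<mu>" and x: "x \<in> {0..pi}"
  shows "norm (Y x) \<le> kY R"
proof -
  have "norm (cosl \<mu> x *\<^sub>R Y 0) \<le> 1 * norm (Y 0)"
    unfolding norm_scaleR by (intro mult_right_mono) (use abs_cosl_le_1[OF \<mu>] in auto)
  then show ?thesis
    using Volterra_diff_le[OF sol norm x] norm_initial_le[OF sol norm] norm_triangle_sub[of "Y x" "cosl \<mu> x *\<^sub>R Y 0"]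
    by (simp add: kY_def)
qed

text \<open>The gain \<open>1 / sqrt \<mu>\<close> is the size of the kernel \<open>sinl\<close>,
  used once \<open>Y\<close> itself is known to be bounded.\<close>

lemma norm_diff_cosl_le:
  assumes sol: "Volterra_solution \<mu> Y" and norm: "L2_norm Y = 1" and \<mu>: "0 < \<mu>" and x: "x \<in> {0..pi}"
  shows "norm (Y x - cosl \<mu> x *\<^sub>R Y 0) \<le> kE R / sqrt \<mu>"
proof -
  let ?y = "\<lambda>t. sinl \<mu> (x - t) *\<^sub>R Y t"
  have Yc: "continuous_on {0..x} Y"
    using sol x by (auto simp: Volterra_solution_def intro: continuous_on_subset)
  have "norm (integral {0..x} (\<lambda>t. Q t *v ?y t)) \<le> R * sqrt (integral {0..x} (\<lambda>t. (kY R / sqrt \<mu>)\<^sup>2))"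
  proof (rule norm_integral_Q_le)
    fix t assume t: "t \<in> {0..x}"
    have "norm (?y t) \<le> 1 / sqrt \<mu> * kY R"
      unfolding norm_scaleR using t x \<mu>
      by (intro mult_mono abs_sinl_le norm_le_kY[OF sol norm]) auto
    then show "norm (?y t) \<le> kY R / sqrt \<mu>" by simp
  qed (use x in \<open>auto intro!: continuous_intros Yc\<close>)
  also have "\<dots> \<le> R * (sqrt pi * (kY R / sqrt \<mu>))"
    by (intro mult_left_mono sqrt_integral_le_const) (use x kY1 \<mu> norms_le(4) in auto)
  finally have 1: "norm (integral {0..x} (\<lambda>t. Q t *v ?y t)) \<le> R * (sqrt pi * (kY R / sqrt \<mu>))" .
  have 2: "norm (sinl \<mu> x *\<^sub>R (h *v Y 0)) \<le> 1 / sqrt \<mu> * (R * kV R)"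
    unfolding norm_scaleR
    by (intro mult_mono abs_sinl_le \<mu> order_trans[OF norm_h] mult_left_mono norm_initial_le[OF sol norm] norms_le) (use \<mu> in auto)
  have "integral {0..x} (\<lambda>t. Q t *v ?y t) = Y x - cosl \<mu> x *\<^sub>R Y 0 - sinl \<mu> x *\<^sub>R (h *v Y 0)"
    using sol x by (intro integral_unique) (simp add: Volterra_solution_def)
  then have "Y x - cosl \<mu> x *\<^sub>R Y 0 = sinl \<mu> x *\<^sub>R (h *v Y 0) + integral {0..x} (\<lambda>t. Q t *v ?y t)" by simp
  then have "norm (Y x - cosl \<mu> x *\<^sub>R Y 0) \<le> 1 / sqrt \<mu> * (R * kV R) + R * (sqrt pi * (kY R / sqrt \<mu>))"
    using norm_triangle_le[OF add_mono[OF 2 1]] by simp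
  then show ?thesis by (simp add: kE_def add_divide_distrib)
qed

end

text \<open>The constants \<open>a\<close>, \<open>b\<close>, \<open>d\<close> belong to
  \<open>eigenvalue_lower_bound\<close>: size of the solution, distance to the hyperbolic cosine,
  and integral of the solution.\<close>

definition kL :: "real \<Rightarrow> real" where
  "kL R = (let a = 1 + kB R * sqrt pi; b = R + R * (sqrt pi * a); d = R * (sqrt pi * a) + R * a + R
     in 1 + 4 * (b + d)\<^sup>2)"

lemma cosh_mono_nonneg: "0 \<le> x \<Longrightarrow> x \<le> y \<Longrightarrow> cosh x \<le> cosh (y :: real)"
  using cosh_real_nonneg_le_iff[of x y] by simp

text \<open>For \<open>\<mu> = - \<tau>\<^sup>2\<close> the solution grows like
  \<open>cosh (\<tau> * x)\<close>. Testing the equation with the constant 1 makes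
  \<open>\<tau>\<^sup>2\<close> times the integral of \<open>Y\<close> at most of order
  \<open>cosh (\<tau> * pi)\<close>. Closeness to the hyperbolic cosine makes the same quantity of
  order \<open>\<tau> * sinh (\<tau> * pi)\<close>, with an error of order
  \<open>cosh (\<tau> * pi)\<close>. Hence \<tau> is bounded.\<close>

lemma (in problem) eigenvalue_lower_bound:
  assumes bvp: "bvp_solution Q h H (complex_of_real \<mu>) Y" and norm: "L2_norm Y = 1"
  shows "- kL R \<le> \<mu>"
proof (cases "\<mu> \<ge> -1")
  case True
  have "kL R \<ge> 1" by (simp add: kL_def Let_def)
  then show ?thesis using True by simp
next
  case False
  have sol: "Volterra_solution \<mu> Y" by (rule bvp_imp_Volterra[OF bvp])
  define \<tau> where "\<tau> = sqrt (- \<mu>)"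
  have \<tau>: "\<tau> > 1" "\<mu> = - \<tau>\<^sup>2" using False by (simp_all add: \<tau>_def)
  have C: "cosl \<mu> x = cosh (\<tau> * x)" and S: "sinl \<mu> x = sinh (\<tau> * x) / \<tau>" for x
    using False by (simp_all add: cosl_def sinl_def \<tau>_def)
  have Yc: "continuous_on {0..pi} Y" using sol by (simp add: Volterra_solution_def)
  define v where "v = norm (Y 0)"
  define a where "a = 1 + kB R * sqrt pi"
  define b where "b = R + R * (sqrt pi * a)"
  define d where "d = R * (sqrt pi * a) + R * a + R"
  have a1: "1 \<le> a" using kB0 by (simp add: a_def)
  have R0: "0 \<le> R" by (rule norms_le(4))
  have b0: "0 \<le> b" and d0: "0 \<le> d" using R0 a1 by (simp_all add: b_def d_def)
  have v0: "0 \<le> v" by (simp add: v_def)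
  have Cmono: "cosh (\<tau> * s) \<le> cosh (\<tau> * t)" if "0 \<le> s" "s \<le> t" for s t
    using that \<tau> by (intro cosh_mono_nonneg) auto
  have Ybound: "norm (Y x) \<le> a * v * cosh (\<tau> * x)" if x: "x \<in> {0..pi}" for x
  proof -
    have "sqrt (integral {0..x} (\<lambda>t. (norm (cosl \<mu> t *\<^sub>R Y 0))\<^sup>2)) \<le> sqrt pi * (cosh (\<tau> * x) * v)"
      by (intro sqrt_integral_le_const continuous_intros) (use x in \<open>auto simp: C v_def intro!: mult_right_mono Cmono\<close>)
    from mult_left_mono[OF this kB0] compare_cos_single(1)[OF sol x]
    have "norm (Y x - cosl \<mu> x *\<^sub>R Y 0) \<le> kB R * (sqrt pi * (cosh (\<tau> * x) * v))" by linarith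
    moreover have "norm (cosl \<mu> x *\<^sub>R Y 0) = cosh (\<tau> * x) * v" by (simp add: C v_def)
    ultimately show ?thesis
      using norm_triangle_sub[of "Y x" "cosl \<mu> x *\<^sub>R Y 0"] by (simp add: a_def algebra_simps)
  qed
  have vpos: "v > 0"
  proof (rule ccontr)
    assume "\<not> v > 0"
    then have "v = 0" using v0 by simp
    then have "norm (Y x) \<le> norm (0::real)" if "x \<in> {0<..<pi}" for x using Ybound[of x] that by simp
    then have "L2_norm Y \<le> L2_norm (\<lambda>_. 0 :: real)"
      by (intro L2_norm_mono continuous_L2 Yc continuous_intros) auto
    then show False using norm by simp
  qed
  have diff: "norm (Y x - cosl \<mu> x *\<^sub>R Y 0) \<le> b * v * sinl \<mu> x" if x: "x \<in> {0..pi}" for x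
  proof -
    let ?y = "\<lambda>t. sinl \<mu> (x - t) *\<^sub>R Y t"
    have Sx: "0 \<le> sinl \<mu> x" using x \<tau>(1) by (simp add: S)
    have "norm (integral {0..x} (\<lambda>t. Q t *v ?y t)) \<le> R * sqrt (integral {0..x} (\<lambda>t. (a * v * sinl \<mu> x)\<^sup>2))"
    proof (rule norm_integral_Q_le)
      fix t assume t: "t \<in> {0..x}"
      \<comment> \<open>The growth of the kernel and that of the solution combine into
        \<open>sinl \<mu> x\<close>, which no longer depends on \<open>t\<close>.\<close>
      have "sinh (\<tau> * (x - t)) * cosh (\<tau> * t) \<le> sinh (\<tau> * (x - t) + \<tau> * t)"
        using t \<tau> by (simp add: sinh_add)
      then have "sinh (\<tau> * (x - t)) / \<tau> * cosh (\<tau> * t) \<le> sinh (\<tau> * x) / \<tau>"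
        using \<tau> by (simp add: divide_right_mono algebra_simps)
      then have le: "sinl \<mu> (x - t) * cosh (\<tau> * t) \<le> sinl \<mu> x" by (simp add: S)
      have "norm (?y t) = sinl \<mu> (x - t) * norm (Y t)" using t \<tau>(1) by (simp add: S)
      also have "\<dots> \<le> sinl \<mu> (x - t) * (a * v * cosh (\<tau> * t))"
        using t x \<tau>(1) by (intro mult_left_mono Ybound) (auto simp: S)
      also have "\<dots> = a * v * (sinl \<mu> (x - t) * cosh (\<tau> * t))" by simp
      also have "\<dots> \<le> a * v * sinl \<mu> x" using le a1 v0 by (intro mult_left_mono) auto
      finally show "norm (?y t) \<le> a * v * sinl \<mu> x" .
    qed (use x in \<open>auto intro!: continuous_intros continuous_on_subset[OF Yc]\<close>)
    also have "\<dots> \<le> R * (sqrt pi * (a * v * sinl \<mu> x))"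
      by (intro mult_left_mono sqrt_integral_le_const) (use x Sx a1 v0 R0 in \<open>auto intro!: continuous_intros\<close>)
    finally have 1: "norm (integral {0..x} (\<lambda>t. Q t *v ?y t)) \<le> R * (sqrt pi * (a * v * sinl \<mu> x))" .
    have 2: "norm (sinl \<mu> x *\<^sub>R (h *v Y 0)) \<le> sinl \<mu> x * (R * v)"
      using mult_left_mono[OF norm_h[of "Y 0"] Sx] Sx by (simp add: v_def)
    have "integral {0..x} (\<lambda>t. Q t *v ?y t) = Y x - cosl \<mu> x *\<^sub>R Y 0 - sinl \<mu> x *\<^sub>R (h *v Y 0)"
      using sol x by (intro integral_unique) (simp add: Volterra_solution_def)
    then have "Y x - cosl \<mu> x *\<^sub>R Y 0 = sinl \<mu> x *\<^sub>R (h *v Y 0) + integral {0..x} (\<lambda>t. Q t *v ?y t)" by simp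
    then have "norm (Y x - cosl \<mu> x *\<^sub>R Y 0) \<le> sinl \<mu> x * (R * v) + R * (sqrt pi * (a * v * sinl \<mu> x))"
      using norm_triangle_le[OF add_mono[OF 2 1]] by simp
    then show ?thesis by (simp add: b_def algebra_simps)
  qed
  define Cp where "Cp = cosh (\<tau> * pi)"
  have Cp1: "1 \<le> Cp" by (simp add: Cp_def cosh_real_ge_1)
  have upper: "\<tau>\<^sup>2 * norm (integral {0..pi} Y) \<le> d * v * Cp"
  proof (rule green_identity[OF bvp])
    fix Z assume Z0: "Z 0 = h *v Y 0" and Zpi: "Z pi = - (H *v Y pi)"
      and green: "\<And>x c c' c''. x \<in> {0..pi} \<Longrightarrow> (\<And>t. (c has_real_derivative c' t) (at t))
      \<Longrightarrow> (\<And>t. (c' has_real_derivative c'' t) (at t)) \<Longrightarrow> continuous_on UNIV c''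
      \<Longrightarrow> ((\<lambda>t. Q t *v (c t *\<^sub>R Y t)) has_integral
            (c x *\<^sub>R Z x - c 0 *\<^sub>R Z 0 - c' x *\<^sub>R Y x + c' 0 *\<^sub>R Y 0
             + integral {0..x} (\<lambda>t. (c'' t + \<mu> * c t) *\<^sub>R Y t))) {0..x}"
    have "((\<lambda>t. Q t *v (1 *\<^sub>R Y t)) has_integral
            (1 *\<^sub>R Z pi - 1 *\<^sub>R Z 0 - 0 *\<^sub>R Y pi + 0 *\<^sub>R Y 0
             + integral {0..pi} (\<lambda>t. (0 + \<mu> * 1) *\<^sub>R Y t))) {0..pi}"
      by (rule green) auto
    then have "integral {0..pi} (\<lambda>t. Q t *v Y t) = - (H *v Y pi) - h *v Y 0 + \<mu> *\<^sub>R integral {0..pi} Y"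
      by (simp add: integral_unique Z0 Zpi)
    then have "(- \<mu>) *\<^sub>R integral {0..pi} Y = - (integral {0..pi} (\<lambda>t. Q t *v Y t) + H *v Y pi + h *v Y 0)"
      by (simp add: algebra_simps)
    then have "norm ((- \<mu>) *\<^sub>R integral {0..pi} Y) = norm (integral {0..pi} (\<lambda>t. Q t *v Y t) + H *v Y pi + h *v Y 0)"
      by (simp only: norm_minus_cancel)
    moreover have "norm ((- \<mu>) *\<^sub>R integral {0..pi} Y) = \<tau>\<^sup>2 * norm (integral {0..pi} Y)"
      unfolding norm_scaleR using \<tau>(2) by simp
    ultimately have "\<tau>\<^sup>2 * norm (integral {0..pi} Y) = norm (integral {0..pi} (\<lambda>t. Q t *v Y t) + H *v Y pi + h *v Y 0)"
      by (simp only:)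
    also have "\<dots> \<le> R * (sqrt pi * (a * v * Cp)) + R * (a * v * Cp) + R * (v * Cp)"
    proof (intro norm_triangle_mono)
      have "norm (integral {0..pi} (\<lambda>t. Q t *v Y t)) \<le> R * sqrt (integral {0..pi} (\<lambda>t. (a * v * Cp)\<^sup>2))"
      proof (rule norm_integral_Q_le)
        fix t assume t: "t \<in> {0..pi}"
        have "a * v * cosh (\<tau> * t) \<le> a * v * Cp"
          unfolding Cp_def using t a1 v0 by (intro mult_left_mono Cmono) auto
        with Ybound[OF t] show "norm (Y t) \<le> a * v * Cp" by linarith
      qed (auto intro: Yc)
      also have "\<dots> \<le> R * (sqrt pi * (a * v * Cp))"
        by (intro mult_left_mono sqrt_integral_le_const) (use a1 v0 Cp1 R0 in \<open>auto\<close>)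
      finally show "norm (integral {0..pi} (\<lambda>t. Q t *v Y t)) \<le> R * (sqrt pi * (a * v * Cp))" .
      show "norm (H *v Y pi) \<le> R * (a * v * Cp)"
        using Ybound[of pi] R0 by (intro order_trans[OF norm_H] mult_left_mono) (auto simp: Cp_def)
      show "norm (h *v Y 0) \<le> R * (v * Cp)"
        using v0 Cp1 R0 by (intro order_trans[OF norm_h] mult_left_mono) (auto simp: v_def mult_le_cancel_left1)
    qed
    also have "\<dots> = d * v * Cp" by (simp add: d_def algebra_simps)
    finally show ?thesis .
  qed
  have "((cosl \<mu>) has_integral (sinl \<mu> pi - sinl \<mu> 0)) {0..pi}"
    by (intro fundamental_theorem_of_calculus)
       (auto simp: has_real_derivative_iff_has_vector_derivative[symmetric] intro!: has_field_derivative_at_within[OF DERIV_sinl])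
  then have intC: "((\<lambda>t. cosl \<mu> t *\<^sub>R Y 0) has_integral sinl \<mu> pi *\<^sub>R Y 0) {0..pi}"
    by (intro has_integral_scaleR_left) simp
  have "((\<lambda>x. - (\<mu> * sinl \<mu> x)) has_integral (cosl \<mu> pi - cosl \<mu> 0)) {0..pi}"
    by (intro fundamental_theorem_of_calculus)
       (auto simp: has_real_derivative_iff_has_vector_derivative[symmetric] intro!: has_field_derivative_at_within[OF DERIV_cosl])
  from has_integral_mult_right[OF this, of "1 / \<tau>\<^sup>2"]
  have intS: "(sinl \<mu> has_integral (cosl \<mu> pi - 1) / \<tau>\<^sup>2) {0..pi}"
    using \<tau> by simp
  have "norm (integral {0..pi} (\<lambda>t. Y t - cosl \<mu> t *\<^sub>R Y 0)) \<le> integral {0..pi} (\<lambda>t. b * v * sinl \<mu> t)"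
    by (intro integral_norm_bound_integral integrable_continuous_real continuous_intros Yc diff) auto
  also have "\<dots> = b * v * ((Cp - 1) / \<tau>\<^sup>2)"
    using integral_unique[OF intS] by (simp add: C Cp_def)
  also have "\<dots> \<le> b * v * (Cp / \<tau>\<^sup>2)"
    using b0 v0 by (intro mult_left_mono divide_right_mono) auto
  finally have A: "norm (integral {0..pi} (\<lambda>t. Y t - cosl \<mu> t *\<^sub>R Y 0)) \<le> b * v * (Cp / \<tau>\<^sup>2)" .
  have "integral {0..pi} (\<lambda>t. Y t - cosl \<mu> t *\<^sub>R Y 0) = integral {0..pi} Y - sinl \<mu> pi *\<^sub>R Y 0"
    using intC by (subst Henstock_Kurzweil_Integration.integral_diff)
      (auto intro!: integrable_continuous_real Yc continuous_intros simp: integral_unique)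
  then have "norm (sinl \<mu> pi *\<^sub>R Y 0) \<le> norm (integral {0..pi} Y) + b * v * (Cp / \<tau>\<^sup>2)"
    using A norm_triangle_sub[of "sinl \<mu> pi *\<^sub>R Y 0" "integral {0..pi} Y"] by (simp add: norm_minus_commute)
  moreover have "norm (sinl \<mu> pi *\<^sub>R Y 0) = sinh (\<tau> * pi) / \<tau> * v"
    using \<tau>(1) by (simp add: S v_def)
  ultimately have "sinh (\<tau> * pi) / \<tau> * v \<le> norm (integral {0..pi} Y) + b * v * (Cp / \<tau>\<^sup>2)"
    by (simp only:)
  then have "\<tau>\<^sup>2 * (sinh (\<tau> * pi) / \<tau> * v) \<le> \<tau>\<^sup>2 * (norm (integral {0..pi} Y) + b * v * (Cp / \<tau>\<^sup>2))"
    by (rule mult_left_mono) simp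
  also have "\<dots> = \<tau>\<^sup>2 * norm (integral {0..pi} Y) + b * v * Cp" using \<tau> by (simp add: distrib_left)
  also have "\<dots> \<le> d * v * Cp + b * v * Cp" using upper by simp
  finally have "(\<tau> * sinh (\<tau> * pi)) * v \<le> ((b + d) * Cp) * v"
    using \<tau> by (simp add: power2_eq_square algebra_simps)
  then have 1: "\<tau> * sinh (\<tau> * pi) \<le> (b + d) * Cp" using vpos by simp
  have "sinh (\<tau> * pi) \<ge> Cp / 2"
  proof -
    let ?x = "\<tau> * pi"
    have x2: "?x \<ge> 2" using \<tau> pi_gt3 mult_mono[of 1 \<tau> 2 pi] by simp
    have "exp ?x \<ge> 1 + ?x" by (rule exp_ge_add_one_self)
    with x2 have e: "exp ?x \<ge> 3" by linarith
    have "exp (- ?x) \<le> 1" using x2 by simp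
    then have "3 * exp (- ?x) \<le> exp ?x" using e by linarith
    then show ?thesis by (simp add: Cp_def sinh_field_def cosh_field_def)
  qed
  then have "\<tau> * (Cp / 2) \<le> (b + d) * Cp" using 1 \<tau> by (smt (verit) mult_left_mono)
  then have "\<tau> * Cp \<le> (2 * (b + d)) * Cp" by (simp add: algebra_simps)
  then have "\<tau> \<le> 2 * (b + d)" using Cp1 by simp
  then have "\<tau>\<^sup>2 \<le> (2 * (b + d))\<^sup>2" using \<tau> by (intro power_mono) auto
  moreover have "kL R = 1 + 4 * (b + d)\<^sup>2" by (simp only: kL_def Let_def a_def b_def d_def)
  moreover have "(2 * (b + d))\<^sup>2 = 4 * (b + d)\<^sup>2" by (simp only: power_mult_distrib) simp
  ultimately show ?thesis using \<tau>(2) by linarith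
qed

subsection \<open>Cosine series\<close>

lemma has_integral_cos_int:
  "((\<lambda>x. cos (of_int i * x)) has_integral (if i = 0 then pi else 0)) {0..pi}" for i :: int
proof (cases "i = 0")
  case True
  then show ?thesis using has_integral_const_real[of "1::real" 0 pi] by simp
next
  case False
  then show ?thesis
    using has_integral_cos_mult[of "of_int i"] by (simp add: sin_int_times_real sin_zero_iff_int2 mult.commute)
qed

lemma integral_cos_nat_cos_nat:
  "((\<lambda>x. cos (real j * x) * cos (real k * x)) has_integral
     (if j = k then if j = 0 then pi else pi / 2 else 0)) {0..pi}"
proof -
  have "((\<lambda>x. 1/2 * cos (of_int (int j - int k) * x) + 1/2 * cos (of_int (int j + int k) * x)) has_integral
      (1/2 * (if int j - int k = 0 then pi else 0) + 1/2 * (if int j + int k = 0 then pi else 0))) {0..pi}"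
    by (intro has_integral_add has_integral_mult_right has_integral_cos_int)
  moreover have "1/2 * cos (of_int (int j - int k) * x) + 1/2 * cos (of_int (int j + int k) * x)
      = cos (real j * x) * cos (real k * x)" for x
    by (simp add: cos_times_cos left_diff_distrib distrib_right add_divide_distrib)
  ultimately have "((\<lambda>x. cos (real j * x) * cos (real k * x)) has_integral
      (1/2 * (if int j - int k = 0 then pi else 0) + 1/2 * (if int j + int k = 0 then pi else 0))) {0..pi}"
    by simp
  moreover have "1/2 * (if int j - int k = 0 then pi else 0) + 1/2 * (if int j + int k = 0 then pi else 0)
      = (if j = k then if j = 0 then pi else pi / 2 else 0)" by auto
  ultimately show ?thesis by (simp only:)
qed

section \<open>Density of cosine polynomials and Parseval's inequality\<close>

definition cos_poly :: "nat \<Rightarrow> (real \<Rightarrow> real) \<Rightarrow> bool" where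
  "cos_poly M f \<longleftrightarrow> (\<exists>w. \<forall>x. f x = (\<Sum>j\<le>M. w j * cos (real j * x)))"

lemma cos_poly_mono:
  assumes "cos_poly M f" "M \<le> M'"
  shows "cos_poly M' f"
proof -
  from assms obtain w where w: "\<And>x. f x = (\<Sum>j\<le>M. w j * cos (real j * x))" by (auto simp: cos_poly_def)
  have "f x = (\<Sum>j\<le>M'. (if j \<le> M then w j else 0) * cos (real j * x))" for x
    unfolding w by (rule sum.mono_neutral_cong_left) (use assms(2) in auto)
  then show ?thesis unfolding cos_poly_def by (intro exI allI)
qed

lemma cos_poly_cos: "cos_poly j (\<lambda>x. cos (real j * x))"
  unfolding cos_poly_def by (rule exI[of _ "\<lambda>i. if i = j then 1 else 0"]) (simp add: if_distrib[of "\<lambda>w. w * _"] cong: if_cong)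

lemma cos_poly_add: "cos_poly M f \<Longrightarrow> cos_poly M g \<Longrightarrow> cos_poly M (\<lambda>x. f x + g x)"
  unfolding cos_poly_def
proof (elim exE)
  fix w w' assume "\<forall>x. f x = (\<Sum>j\<le>M. w j * cos (real j * x))" "\<forall>x. g x = (\<Sum>j\<le>M. w' j * cos (real j * x))"
  then show "\<exists>w. \<forall>x. f x + g x = (\<Sum>j\<le>M. w j * cos (real j * x))"
    by (intro exI[of _ "\<lambda>j. w j + w' j"]) (simp add: distrib_right sum.distrib)
qed

lemma cos_poly_scale: "cos_poly M f \<Longrightarrow> cos_poly M (\<lambda>x. c * f x)"
  unfolding cos_poly_def
proof (elim exE)
  fix w assume "\<forall>x. f x = (\<Sum>j\<le>M. w j * cos (real j * x))"
  then show "\<exists>w. \<forall>x. c * f x = (\<Sum>j\<le>M. w j * cos (real j * x))"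
    by (intro exI[of _ "\<lambda>j. c * w j"]) (simp add: sum_distrib_left mult.assoc)
qed

lemma cos_poly_sum: "(\<And>i. i \<in> A \<Longrightarrow> cos_poly M (f i)) \<Longrightarrow> cos_poly M (\<lambda>x. \<Sum>i\<in>A. f i x)"
proof (induction A rule: infinite_finite_induct)
  case (insert a A)
  then show ?case by (simp add: cos_poly_add)
qed (use cos_poly_scale[OF cos_poly_mono[OF cos_poly_cos[of 0]], of M 0] in simp_all)

lemma cos_poly_mult_cos:
  assumes "cos_poly M f"
  shows "cos_poly (Suc M) (\<lambda>x. cos x * f x)"
proof -
  from assms obtain w where w: "\<And>x. f x = (\<Sum>j\<le>M. w j * cos (real j * x))" by (auto simp: cos_poly_def)
  have prod: "cos_poly (Suc M) (\<lambda>x. cos x * cos (real j * x))" if j: "j \<le> M" for j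
  proof (cases j)
    case 0
    then show ?thesis using cos_poly_mono[OF cos_poly_cos[of 1], of "Suc M"] by simp
  next
    case (Suc i)
    have "cos_poly (Suc M) (\<lambda>x. 1/2 * cos (real (Suc j) * x) + 1/2 * cos (real i * x))"
      by (intro cos_poly_add cos_poly_scale cos_poly_mono[OF cos_poly_cos]) (use j Suc in auto)
    moreover have "1/2 * cos (real (Suc j) * x) + 1/2 * cos (real i * x) = cos x * cos (real j * x)" for x
    proof -
      have "cos (real j * x) * cos x = (cos (real j * x - x) + cos (real j * x + x)) / 2" by (rule cos_times_cos)
      moreover have "real j * x - x = real i * x" "real j * x + x = real (Suc j) * x"
        using Suc by (simp_all add: algebra_simps)
      ultimately show ?thesis by (simp add: field_simps)
    qed
    ultimately show ?thesis by simp
  qed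
  have "cos_poly (Suc M) (\<lambda>x. \<Sum>j\<le>M. w j * (cos x * cos (real j * x)))"
    by (intro cos_poly_sum cos_poly_scale prod) simp
  moreover have "(\<Sum>j\<le>M. w j * (cos x * cos (real j * x))) = cos x * f x" for x
    unfolding w by (simp add: sum_distrib_left mult.left_commute)
  ultimately show ?thesis by simp
qed

lemma cos_poly_power: "cos_poly k (\<lambda>x. cos x ^ k)"
proof (induction k)
  case 0
  then show ?case using cos_poly_cos[of 0] by simp
next
  case (Suc k)
  then show ?case using cos_poly_mult_cos[of k] by simp
qed

text \<open>Polynomial approximation of \<open>f (arccos t)\<close> on \<open>{-1..1}\<close>;
  powers of the cosine are cosine polynomials.\<close>

lemma cos_poly_dense:
  fixes f :: "real \<Rightarrow> real"
  assumes f: "continuous_on {0..pi} f" and e: "0 < e"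
  obtains M p where "cos_poly M p" "\<And>x. x \<in> {0..pi} \<Longrightarrow> \<bar>f x - p x\<bar> < e"
proof -
  have "continuous_on {-1..1} (\<lambda>t. f (arccos t))"
    by (rule continuous_on_compose2[OF f]) (auto intro!: continuous_intros arccos_lbound arccos_ubound)
  then obtain g where g: "real_polynomial_function g" "\<And>t. t \<in> {-1..1} \<Longrightarrow> \<bar>f (arccos t) - g t\<bar> < e"
    using Stone_Weierstrass_real_polynomial_function[of "{-1..1::real}" "\<lambda>t. f (arccos t)" e] e by auto
  obtain a n where a: "g = (\<lambda>t. \<Sum>i\<le>n. a i * t ^ i)"
    using real_polynomial_function_imp_sum[OF g(1)] by blast
  show ?thesis
  proof (rule that)
    show "cos_poly n (\<lambda>x. \<Sum>i\<le>n. a i * cos x ^ i)"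
      by (intro cos_poly_sum cos_poly_scale cos_poly_mono[OF cos_poly_power]) simp
    fix x assume x: "x \<in> {0..pi}"
    then show "\<bar>f x - (\<Sum>i\<le>n. a i * cos x ^ i)\<bar> < e"
      using g(2)[of "cos x"] by (simp add: arccos_cos a)
  qed
qed

lemma has_integral_cos_sum_square:
  "((\<lambda>x. (\<Sum>j\<le>M. w j * cos (real j * x))\<^sup>2) has_integral (\<Sum>j\<le>M. (w j)\<^sup>2 * (if j = 0 then pi else pi / 2))) {0..pi}"
proof -
  have "((\<lambda>x. \<Sum>j\<le>M. \<Sum>k\<le>M. (w j * w k) * (cos (real j * x) * cos (real k * x))) has_integral
      (\<Sum>j\<le>M. \<Sum>k\<le>M. (w j * w k) * (if j = k then if j = 0 then pi else pi / 2 else 0))) {0..pi}"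
    by (intro has_integral_sum has_integral_mult_right integral_cos_nat_cos_nat) auto
  moreover have "(\<Sum>k\<le>M. (w j * w k) * (if j = k then if j = 0 then pi else pi / 2 else 0))
      = (w j)\<^sup>2 * (if j = 0 then pi else pi / 2)" if "j \<in> {..M}" for j
    using that by (simp add: power2_eq_square if_distrib[of "\<lambda>x. _ * x"] cong: if_cong)
  moreover have "(\<Sum>j\<le>M. \<Sum>k\<le>M. (w j * w k) * (cos (real j * x) * cos (real k * x)))
      = (\<Sum>j\<le>M. w j * cos (real j * x))\<^sup>2" for x
    by (simp add: power2_eq_square sum_product mult_ac)
  ultimately show ?thesis by simp
qed

text \<open>Obtained by expanding the square integral of \<open>f - p\<close> for an approximating
  cosine polynomial. The bound is stated for all \<open>M'\<close> from \<open>M\<close> on, so that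
  the components of a vector function can share one cutoff.\<close>

lemma cosine_Parseval_real:
  fixes f :: "real \<Rightarrow> real"
  assumes f: "continuous_on {0..pi} f"
    and zero: "\<And>j. j \<le> N \<Longrightarrow> integral {0..pi} (\<lambda>x. cos (real j * x) * f x) = 0" and e: "0 < e"
  shows "\<exists>M. \<forall>M'\<ge>M. integral {0..pi} (\<lambda>x. (f x)\<^sup>2)
       \<le> 2 / pi * (\<Sum>j\<in>{N<..M'}. (integral {0..pi} (\<lambda>x. cos (real j * x) * f x))\<^sup>2) + e"
proof -
  define m where "m j = integral {0..pi} (\<lambda>x. cos (real j * x) * f x)" for j
  have "0 < sqrt (e / pi)" using e by simp
  from cos_poly_dense[OF f this] obtain M p where p: "cos_poly M p"
    and close: "\<And>x. x \<in> {0..pi} \<Longrightarrow> \<bar>f x - p x\<bar> < sqrt (e / pi)" by blast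
  have "integral {0..pi} (\<lambda>x. (f x)\<^sup>2) \<le> 2 / pi * (\<Sum>j\<in>{N<..M'}. (m j)\<^sup>2) + e" if M': "M \<le> M'" for M'
  proof -
    obtain w where w: "\<And>x. p x = (\<Sum>j\<le>M'. w j * cos (real j * x))"
      using cos_poly_mono[OF p M'] by (auto simp: cos_poly_def)
    have pc: "continuous_on S p" for S unfolding w by (intro continuous_intros)
    have "((\<lambda>x. \<Sum>j\<le>M'. w j * (cos (real j * x) * f x)) has_integral (\<Sum>j\<le>M'. w j * m j)) {0..pi}"
      unfolding m_def
      by (intro has_integral_sum has_integral_mult_right integrable_integral integrable_continuous_real continuous_intros f) auto
    moreover have "(\<Sum>j\<le>M'. w j * (cos (real j * x) * f x)) = f x * p x" for x
      unfolding w by (simp add: sum_distrib_left mult_ac)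
    ultimately have fp: "((\<lambda>x. f x * p x) has_integral (\<Sum>j\<le>M'. w j * m j)) {0..pi}" by simp
    have pp: "((\<lambda>x. (p x)\<^sup>2) has_integral (\<Sum>j\<le>M'. (w j)\<^sup>2 * (if j = 0 then pi else pi / 2))) {0..pi}"
      unfolding w by (rule has_integral_cos_sum_square)
    have ff: "((\<lambda>x. (f x)\<^sup>2) has_integral integral {0..pi} (\<lambda>x. (f x)\<^sup>2)) {0..pi}"
      by (intro integrable_integral integrable_continuous_real continuous_intros f)
    have "((\<lambda>x. (f x)\<^sup>2 + (p x)\<^sup>2 - 2 * (f x * p x)) has_integral
        (integral {0..pi} (\<lambda>x. (f x)\<^sup>2) + (\<Sum>j\<le>M'. (w j)\<^sup>2 * (if j = 0 then pi else pi / 2)) - 2 * (\<Sum>j\<le>M'. w j * m j))) {0..pi}"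
      by (intro has_integral_add has_integral_diff has_integral_mult_right ff pp fp)
    then have I: "integral {0..pi} (\<lambda>x. (f x - p x)\<^sup>2)
        = integral {0..pi} (\<lambda>x. (f x)\<^sup>2) + (\<Sum>j\<le>M'. (w j)\<^sup>2 * (if j = 0 then pi else pi / 2) - 2 * (w j * m j))"
      by (simp add: power2_diff integral_unique sum_subtractf sum_distrib_left mult.assoc)
    have "integral {0..pi} (\<lambda>x. (f x - p x)\<^sup>2) \<le> integral {0..pi} (\<lambda>x. e / pi)"
    proof (intro integral_le integrable_continuous_real continuous_intros f pc)
      fix x assume "x \<in> {0..pi}"
      then have "\<bar>f x - p x\<bar>\<^sup>2 \<le> (sqrt (e / pi))\<^sup>2"
        by (rule power_mono[OF less_imp_le[OF close] abs_ge_zero])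
      then show "(f x - p x)\<^sup>2 \<le> e / pi" using e by simp
    qed
    also have "\<dots> = e" by simp
    finally have "integral {0..pi} (\<lambda>x. (f x)\<^sup>2)
        \<le> e - (\<Sum>j\<le>M'. (w j)\<^sup>2 * (if j = 0 then pi else pi / 2) - 2 * (w j * m j))" unfolding I by simp
    also have "\<dots> = e + (\<Sum>j\<le>M'. 2 * (w j * m j) - (w j)\<^sup>2 * (if j = 0 then pi else pi / 2))"
      by (simp add: sum_subtractf)
    also have "(\<Sum>j\<le>M'. 2 * (w j * m j) - (w j)\<^sup>2 * (if j = 0 then pi else pi / 2))
        \<le> (\<Sum>j\<le>M'. if j \<in> {N<..M'} then 2 / pi * (m j)\<^sup>2 else 0)"
    proof (rule sum_mono)
      fix j assume j: "j \<in> {..M'}"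
      show "2 * (w j * m j) - (w j)\<^sup>2 * (if j = 0 then pi else pi / 2) \<le> (if j \<in> {N<..M'} then 2 / pi * (m j)\<^sup>2 else 0)"
      proof (cases "j \<le> N")
        case True
        then show ?thesis using zero[OF True] j by (auto simp: m_def)
      next
        case False
        \<comment> \<open>Completing the square around the true coefficient
          \<open>2 / pi * m j\<close>, so that the coefficients of the approximant drop out.\<close>
        have "0 \<le> pi / 2 * (w j - 2 / pi * m j)\<^sup>2" by simp
        also have "\<dots> = pi / 2 * (w j)\<^sup>2 - 2 * (w j * m j) + 2 / pi * (m j)\<^sup>2"
          by (simp add: power2_eq_square field_simps)
        finally show ?thesis using False j by (simp add: mult.commute)
      qed
    qed
    also have "\<dots> = 2 / pi * (\<Sum>j\<in>{N<..M'}. (m j)\<^sup>2)"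
    proof -
      have "(\<Sum>j\<le>M'. if j \<in> {N<..M'} then 2 / pi * (m j)\<^sup>2 else 0) = (\<Sum>j\<in>{..M'} \<inter> {N<..M'}. 2 / pi * (m j)\<^sup>2)"
        by (rule sum.inter_restrict[symmetric]) simp
      also have "{..M'} \<inter> {N<..M'} = {N<..M'}" by auto
      finally show ?thesis by (simp add: sum_distrib_left)
    qed
    finally show ?thesis by simp
  qed
  then show ?thesis unfolding m_def by blast
qed

definition cmom :: "nat \<Rightarrow> (real \<Rightarrow> 'a::euclidean_space) \<Rightarrow> 'a" where
  "cmom j f = integral {0..pi} (\<lambda>x. cos (real j * x) *\<^sub>R f x)"

lemma cosine_Parseval_le:
  fixes f :: "real \<Rightarrow> 'a::euclidean_space"
  assumes f: "continuous_on {0..pi} f" and zero: "\<And>j. j \<le> N \<Longrightarrow> cmom j f = 0"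
    and B: "\<And>M. (\<Sum>j\<in>{N<..M}. (norm (cmom j f))\<^sup>2) \<le> B"
  shows "integral {0..pi} (\<lambda>x. (norm (f x))\<^sup>2) \<le> 2 / pi * B"
proof (rule field_le_epsilon)
  fix e :: real assume e: "0 < e"
  define d where "d = e / real DIM('a)"
  have d: "0 < d" using e by (simp add: d_def)
  have comp: "integral {0..pi} (\<lambda>x. cos (real j * x) * (f x \<bullet> b)) = cmom j f \<bullet> b" for j b
  proof -
    have "((\<lambda>x. cos (real j * x) *\<^sub>R f x) has_integral cmom j f) {0..pi}"
      unfolding cmom_def by (intro integrable_integral integrable_continuous_real continuous_intros f)
    from has_integral_linear[OF this bounded_linear_inner_left[of b]]
    show ?thesis by (simp add: o_def integral_unique)
  qed
  have "\<forall>b\<in>(Basis::'a set). \<exists>M. \<forall>M'\<ge>M. integral {0..pi} (\<lambda>x. (f x \<bullet> b)\<^sup>2)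
       \<le> 2 / pi * (\<Sum>j\<in>{N<..M'}. (integral {0..pi} (\<lambda>x. cos (real j * x) * (f x \<bullet> b)))\<^sup>2) + d"
    by (intro ballI cosine_Parseval_real continuous_intros f d) (simp add: comp zero)
  then obtain Mb where Mb: "\<And>b M'. b \<in> (Basis::'a set) \<Longrightarrow> Mb b \<le> M' \<Longrightarrow> integral {0..pi} (\<lambda>x. (f x \<bullet> b)\<^sup>2)
       \<le> 2 / pi * (\<Sum>j\<in>{N<..M'}. (cmom j f \<bullet> b)\<^sup>2) + d" unfolding comp by metis
  define M where "M = Max (Mb ` (Basis::'a set))"
  have M: "Mb b \<le> M" if "b \<in> Basis" for b unfolding M_def using that by (intro Max_ge) auto
  have nsq: "(norm x)\<^sup>2 = (\<Sum>b\<in>Basis. (x \<bullet> b)\<^sup>2)" for x :: 'a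
    by (subst power2_norm_eq_inner, subst euclidean_inner, simp add: power2_eq_square)
  have "integral {0..pi} (\<lambda>x. (norm (f x))\<^sup>2) = (\<Sum>b\<in>Basis. integral {0..pi} (\<lambda>x. (f x \<bullet> b)\<^sup>2))"
    unfolding nsq by (intro integral_sum integrable_continuous_real continuous_intros f) auto
  also have "\<dots> \<le> (\<Sum>b\<in>(Basis::'a set). 2 / pi * (\<Sum>j\<in>{N<..M}. (cmom j f \<bullet> b)\<^sup>2) + d)"
    by (intro sum_mono Mb M)
  also have "\<dots> = 2 / pi * (\<Sum>b\<in>(Basis::'a set). \<Sum>j\<in>{N<..M}. (cmom j f \<bullet> b)\<^sup>2) + e"
    by (simp add: sum.distrib sum_distrib_left d_def)
  also have "(\<Sum>b\<in>(Basis::'a set). \<Sum>j\<in>{N<..M}. (cmom j f \<bullet> b)\<^sup>2) = (\<Sum>j\<in>{N<..M}. (norm (cmom j f))\<^sup>2)"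
    unfolding nsq by (rule sum.swap)
  also have "2 / pi * (\<Sum>j\<in>{N<..M}. (norm (cmom j f))\<^sup>2) + e \<le> 2 / pi * B + e"
    using mult_left_mono[OF B[of M], of "2 / pi"] by simp
  finally show "integral {0..pi} (\<lambda>x. (norm (f x))\<^sup>2) \<le> 2 / pi * B + e" .
qed

text \<open>Comparison with a telescoping sum; \<open>max N M\<close> covers the upper limits below
  \<open>N\<close>, where the sum is empty.\<close>

lemma sum_inverse_squares_tail:
  assumes "0 < N"
  shows "(\<Sum>k\<in>{N<..M}. 1 / (real k)\<^sup>2) \<le> 1 / real N"
proof -
  have "(\<Sum>k\<in>{N<..M}. 1 / (real k)\<^sup>2) \<le> 1 / real N - 1 / real (max N M)"
  proof (induction M)
    case (Suc M)
    show ?case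
    proof (cases "N \<le> M")
      case True
      then have "{N<..Suc M} = insert (Suc M) {N<..M}" by auto
      then have "(\<Sum>k\<in>{N<..Suc M}. 1 / (real k)\<^sup>2) = 1 / (real (Suc M))\<^sup>2 + (\<Sum>k\<in>{N<..M}. 1 / (real k)\<^sup>2)" by simp
      also have "\<dots> \<le> 1 / (real (Suc M))\<^sup>2 + (1 / real N - 1 / real M)"
        using Suc True by (simp add: max_def)
      also have "1 / (real (Suc M))\<^sup>2 \<le> 1 / real M - 1 / real (Suc M)"
      proof -
        have M: "0 < real M" using True assms by simp
        then have "1 / real M - 1 / real (Suc M) = 1 / (real M * real (Suc M))" by (simp add: field_simps)
        moreover have "1 / (real (Suc M))\<^sup>2 \<le> 1 / (real M * real (Suc M))"
          unfolding power2_eq_square using M by (intro divide_left_mono mult_right_mono) auto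
        ultimately show ?thesis by simp
      qed
      finally show ?thesis using True by (simp add: max_def)
    next
      case False
      then have "{N<..Suc M} = {}" by auto
      then show ?thesis using False by (auto simp: max_def le_Suc_eq)
    qed
  qed (use assms in simp)
  also have "\<dots> \<le> 1 / real N" by simp
  finally show ?thesis .
qed

lemma sum_inverse_squares_le_2: "(\<Sum>k=1..M. 1 / (real k)\<^sup>2) \<le> 2"
proof (cases "M = 0")
  case False
  then have "{1..M} = insert 1 {1<..M}" by auto
  then show ?thesis using sum_inverse_squares_tail[of 1 M] by simp
qed simp

text \<open>Elimination with a pivot \<open>p\<close> removes one equation and one unknown. Both
  dimension counts rest on this.\<close>

lemma homogeneous_system_solution:
  fixes A :: "'e \<Rightarrow> 'u \<Rightarrow> 'a::field"
  assumes "finite E" "finite F" "card E < card F"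
  shows "\<exists>a. (\<exists>u\<in>F. a u \<noteq> 0) \<and> (\<forall>e\<in>E. (\<Sum>u\<in>F. a u * A e u) = 0)"
  using assms
proof (induction E arbitrary: F A rule: finite_induct)
  case empty
  then obtain u where "u \<in> F" by fastforce
  then show ?case by (intro exI[of _ "\<lambda>_. 1"]) auto
next
  case (insert e E)
  show ?case
  proof (cases "\<forall>u\<in>F. A e u = 0")
    case True
    have "card E < card F" using insert by simp
    from insert.IH[OF insert.prems(1) this, of A] True show ?thesis by auto
  next
    case False
    then obtain p where p: "p \<in> F" "A e p \<noteq> 0" by blast
    let ?F = "F - {p}"
    define B where "B e' u = A e' u - A e u / A e p * A e' p" for e' u
    have "finite ?F" "card E < card ?F" using insert p by auto
    from insert.IH[OF this, of B] obtain a where a: "\<exists>u\<in>?F. a u \<noteq> 0" "\<And>e'. e' \<in> E \<Longrightarrow> (\<Sum>u\<in>?F. a u * B e' u) = 0"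
      by blast
    define c where "c = - (\<Sum>u\<in>?F. a u * A e u) / A e p"
    define a' where "a' u = (if u = p then c else a u)" for u
    have split: "(\<Sum>u\<in>F. a' u * A e' u) = c * A e' p + (\<Sum>u\<in>?F. a u * A e' u)" for e'
      using p(1) insert.prems(1) by (simp add: sum.remove[of F p] a'_def)
    have "(\<Sum>u\<in>F. a' u * A e u) = 0" unfolding split using p(2) by (simp add: c_def)
    moreover have "(\<Sum>u\<in>F. a' u * A e' u) = 0" if "e' \<in> E" for e'
    proof -
      have "0 = (\<Sum>u\<in>?F. a u * A e' u) - (\<Sum>u\<in>?F. a u * A e u) / A e p * A e' p"
        using a(2)[OF that] by (simp add: B_def algebra_simps sum_subtractf sum_distrib_left sum_divide_distrib)
      then show ?thesis unfolding split by (simp add: c_def)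
    qed
    moreover have "\<exists>u\<in>F. a' u \<noteq> 0" using a(1) by (auto simp: a'_def)
    ultimately show ?thesis by (intro exI[of _ a']) auto
  qed
qed

subsection \<open>Moments of eigenfunctions against trigonometric functions\<close>

definition wmom :: "(real \<Rightarrow> real) \<Rightarrow> (real \<Rightarrow> complex^'n) \<Rightarrow> complex^'n" where
  "wmom c f = integral {0..pi} (\<lambda>t. c t *\<^sub>R f t)"

lemma cmom_wmom: "cmom j f = wmom (\<lambda>t. cos (real j * t)) f"
  by (simp add: cmom_def wmom_def)

lemma scaleR_scale_commute: "r *\<^sub>R (a *s v) = a *s (r *\<^sub>R (v :: complex^'n))"
  by (simp add: vec_eq_iff)

lemma wmom_sum:
  assumes c: "continuous_on {0..pi} c" and F: "finite F" and y: "\<And>i. i \<in> F \<Longrightarrow> continuous_on {0..pi} (y i)"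
  shows "wmom c (\<lambda>t. \<Sum>i\<in>F. a i *s y i t) = (\<Sum>i\<in>F. a i *s wmom c (y i))"
proof -
  have "((\<lambda>t. \<Sum>i\<in>F. a i *s (c t *\<^sub>R y i t)) has_integral (\<Sum>i\<in>F. a i *s wmom c (y i))) {0..pi}"
  proof (rule has_integral_sum[OF F])
    fix i assume "i \<in> F"
    then have "((\<lambda>t. c t *\<^sub>R y i t) has_integral wmom c (y i)) {0..pi}"
      unfolding wmom_def by (intro integrable_integral integrable_continuous_real continuous_intros c y)
    from has_integral_linear[OF this bounded_linear_vector_scalar_mult[of "a i"]]
    show "((\<lambda>t. a i *s (c t *\<^sub>R y i t)) has_integral a i *s wmom c (y i)) {0..pi}" by (simp add: o_def)
  qed
  then show ?thesis
    unfolding wmom_def[of c "\<lambda>t. \<Sum>i\<in>F. a i *s y i t"]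
    by (intro integral_unique) (simp add: scaleR_sum_right scaleR_scale_commute)
qed

lemma norm_wmom_le:
  assumes c: "continuous_on {0..pi} c" and K: "\<And>t. t \<in> {0..pi} \<Longrightarrow> \<bar>c t\<bar> \<le> K"
    and f: "continuous_on {0..pi} f"
  shows "norm (wmom c f) \<le> K * sqrt pi * L2_norm f"
proof -
  have K0: "0 \<le> K" using K[of 0] by simp
  have nf: "continuous_on {0..pi} (\<lambda>t. norm (f t))" by (intro continuous_intros f)
  have "norm (wmom c f) \<le> integral {0..pi} (\<lambda>t. K * norm (f t))"
    unfolding wmom_def
    by (intro integral_norm_bound_integral integrable_continuous_real continuous_intros c f) (simp add: K mult_right_mono)
  also have "\<dots> = K * integral {0..pi} (\<lambda>t. norm (1 :: real) * norm (f t))" by simp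
  also have "\<dots> \<le> K * (L2_norm (\<lambda>_. 1 :: real) * sqrt (integral {0..pi} (\<lambda>t. (norm (f t))\<^sup>2)))"
    by (intro mult_left_mono K0 L2_Cauchy_Schwarz_interval(2) continuous_L2 nf continuous_intros) auto
  also have "sqrt (integral {0..pi} (\<lambda>t. (norm (f t))\<^sup>2)) = L2_norm f"
    using arg_cong[OF continuous_L2(2)[OF f], of sqrt] by simp
  finally show ?thesis by (simp add: L2_norm_one mult.assoc)
qed

text \<open>The four terms of \<open>resid\<close> contribute \<open>R\<close>,
  \<open>R\<^sup>2\<close>, \<open>2 * R\<^sup>2\<close> and \<open>4 * R\<close>.\<close>

definition kR :: "real \<Rightarrow> real" where "kR R = 5 * R + 3 * R\<^sup>2"

context problem
begin

definition qmom :: "(real \<Rightarrow> real) \<Rightarrow> (real \<Rightarrow> complex^'n) \<Rightarrow> complex^'n" where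
  "qmom c f = integral {0..pi} (\<lambda>t. Q t *v (c t *\<^sub>R f t))"

lemma qmom_sum:
  assumes c: "continuous_on {0..pi} c" and F: "finite F" and y: "\<And>i. i \<in> F \<Longrightarrow> continuous_on {0..pi} (y i)"
  shows "qmom c (\<lambda>t. \<Sum>i\<in>F. a i *s y i t) = (\<Sum>i\<in>F. a i *s qmom c (y i))"
proof -
  have "((\<lambda>t. \<Sum>i\<in>F. a i *s (Q t *v (c t *\<^sub>R y i t))) has_integral (\<Sum>i\<in>F. a i *s qmom c (y i))) {0..pi}"
  proof (rule has_integral_sum[OF F])
    fix i assume i: "i \<in> F"
    have "(\<lambda>t. Q t *v (c t *\<^sub>R y i t)) absolutely_integrable_on {0..pi}"
      by (intro Q_mult_abs_int continuous_intros c y i) simp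
    then have "((\<lambda>t. Q t *v (c t *\<^sub>R y i t)) has_integral qmom c (y i)) {0..pi}"
      unfolding qmom_def by (intro integrable_integral) (simp add: absolutely_integrable_on_def)
    from has_integral_linear[OF this bounded_linear_vector_scalar_mult[of "a i"]]
    show "((\<lambda>t. a i *s (Q t *v (c t *\<^sub>R y i t))) has_integral a i *s qmom c (y i)) {0..pi}" by (simp add: o_def)
  qed
  then show ?thesis
    unfolding qmom_def[of c "\<lambda>t. \<Sum>i\<in>F. a i *s y i t"]
    by (intro integral_unique)
      (simp add: scaleR_sum_right scaleR_scale_commute matrix_vector_mult_sum matrix_vector_mult_scale)
qed

lemma norm_qmom_le:
  assumes c: "continuous_on {0..pi} c" and K: "\<And>t. t \<in> {0..pi} \<Longrightarrow> \<bar>c t\<bar> \<le> K"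
    and f: "continuous_on {0..pi} f"
  shows "norm (qmom c f) \<le> R * (K * L2_norm f)"
proof -
  have K0: "0 \<le> K" using K[of 0] by simp
  have "norm (qmom c f) \<le> R * sqrt (integral {0..pi} (\<lambda>t. (K * norm (f t))\<^sup>2))"
    unfolding qmom_def by (intro norm_integral_Q_le continuous_intros c f) (simp_all add: K mult_right_mono)
  also have "integral {0..pi} (\<lambda>t. (K * norm (f t))\<^sup>2) = (K * L2_norm f)\<^sup>2"
    by (simp add: power_mult_distrib continuous_L2(2)[OF f])
  finally show ?thesis using K0 by simp
qed

lemma norm_hH: "norm ((h + H) *v x) \<le> 2 * R * norm x"
  using norm_triangle_le[OF add_mono[OF norm_h[of x] norm_H[of x]]] by (simp add: matrix_vector_mult_add_rdistrib)

text \<open>The derivative of the cosine vanishes at both ends, so the boundary conditions supply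
  all end terms. The sine functions vanish at both ends, so \<open>Y'\<close> drops out; the factor
  \<open>t\<close> isolates \<open>Y pi\<close>, at the price of a cosine moment coming from the
  second derivative.\<close>

lemma cos_moment_identity:
  assumes bvp: "bvp_solution Q h H (complex_of_real \<mu>) Y"
  shows "(\<mu> - (real j)\<^sup>2) *\<^sub>R cmom j Y
      = qmom (\<lambda>t. cos (real j * t)) Y + (-1) ^ j *\<^sub>R (H *v Y pi) + h *v Y 0" (is ?cos)
    and "(\<mu> - (real j)\<^sup>2) *\<^sub>R wmom (\<lambda>t. sin (real j * t)) Y
      = qmom (\<lambda>t. sin (real j * t)) Y + (real j * (-1) ^ j) *\<^sub>R Y pi - real j *\<^sub>R Y 0" (is ?sin)
    and "(\<mu> - (real j)\<^sup>2) *\<^sub>R wmom (\<lambda>t. t * sin (real j * t)) Y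
      = qmom (\<lambda>t. t * sin (real j * t)) Y + (real j * pi * (-1) ^ j) *\<^sub>R Y pi - (2 * real j) *\<^sub>R cmom j Y" (is ?xsin)
proof -
  have "?cos \<and> ?sin \<and> ?xsin"
  proof (rule green_identity[OF bvp])
    fix Z assume Yc: "continuous_on {0..pi} Y" and Z0: "Z 0 = h *v Y 0" and Zpi: "Z pi = - (H *v Y pi)"
      and green: "\<And>x c c' c''. x \<in> {0..pi} \<Longrightarrow> (\<And>t. (c has_real_derivative c' t) (at t))
      \<Longrightarrow> (\<And>t. (c' has_real_derivative c'' t) (at t)) \<Longrightarrow> continuous_on UNIV c''
      \<Longrightarrow> ((\<lambda>t. Q t *v (c t *\<^sub>R Y t)) has_integral
            (c x *\<^sub>R Z x - c 0 *\<^sub>R Z 0 - c' x *\<^sub>R Y x + c' 0 *\<^sub>R Y 0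
             + integral {0..x} (\<lambda>t. (c'' t + \<mu> * c t) *\<^sub>R Y t))) {0..x}"
  have cs: "cos (real j * pi) = (-1) ^ j" "sin (real j * pi) = 0"
    by (simp_all add: cos_npi sin_npi)
  have "qmom (\<lambda>t. cos (real j * t)) Y = cos (real j * pi) *\<^sub>R Z pi - cos (real j * 0) *\<^sub>R Z 0
      - (- (real j * sin (real j * pi))) *\<^sub>R Y pi + (- (real j * sin (real j * 0))) *\<^sub>R Y 0
      + integral {0..pi} (\<lambda>t. (- ((real j)\<^sup>2 * cos (real j * t)) + \<mu> * cos (real j * t)) *\<^sub>R Y t)"
    unfolding qmom_def
    by (intro integral_unique green) (auto intro!: derivative_eq_intros continuous_intros simp: power2_eq_square)
  also have "(\<lambda>t. (- ((real j)\<^sup>2 * cos (real j * t)) + \<mu> * cos (real j * t)) *\<^sub>R Y t)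
      = (\<lambda>t. (\<mu> - (real j)\<^sup>2) *\<^sub>R (cos (real j * t) *\<^sub>R Y t))"
    by (auto simp: algebra_simps)
  finally have ?cos by (simp add: cs Z0 Zpi cmom_def del: scaleR_scaleR)
  have "qmom (\<lambda>t. sin (real j * t)) Y = sin (real j * pi) *\<^sub>R Z pi - sin (real j * 0) *\<^sub>R Z 0
      - (real j * cos (real j * pi)) *\<^sub>R Y pi + (real j * cos (real j * 0)) *\<^sub>R Y 0
      + integral {0..pi} (\<lambda>t. (- ((real j)\<^sup>2 * sin (real j * t)) + \<mu> * sin (real j * t)) *\<^sub>R Y t)"
    unfolding qmom_def
    by (intro integral_unique green) (auto intro!: derivative_eq_intros continuous_intros simp: power2_eq_square)
  also have "(\<lambda>t. (- ((real j)\<^sup>2 * sin (real j * t)) + \<mu> * sin (real j * t)) *\<^sub>R Y t)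
      = (\<lambda>t. (\<mu> - (real j)\<^sup>2) *\<^sub>R (sin (real j * t) *\<^sub>R Y t))"
    by (auto simp: algebra_simps)
  finally have ?sin by (simp add: cs wmom_def del: scaleR_scaleR)
  have "qmom (\<lambda>t. t * sin (real j * t)) Y = (pi * sin (real j * pi)) *\<^sub>R Z pi - (0 * sin (real j * 0)) *\<^sub>R Z 0
      - (sin (real j * pi) + pi * (real j * cos (real j * pi))) *\<^sub>R Y pi
      + (sin (real j * 0) + 0 * (real j * cos (real j * 0))) *\<^sub>R Y 0
      + integral {0..pi} (\<lambda>t. ((2 * real j * cos (real j * t) - (real j)\<^sup>2 * (t * sin (real j * t))) + \<mu> * (t * sin (real j * t))) *\<^sub>R Y t)"
    unfolding qmom_def
    by (intro integral_unique green)
       (auto intro!: derivative_eq_intros continuous_intros simp: power2_eq_square algebra_simps)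
  also have "(\<lambda>t. ((2 * real j * cos (real j * t) - (real j)\<^sup>2 * (t * sin (real j * t))) + \<mu> * (t * sin (real j * t))) *\<^sub>R Y t)
      = (\<lambda>t. (2 * real j) *\<^sub>R (cos (real j * t) *\<^sub>R Y t) + (\<mu> - (real j)\<^sup>2) *\<^sub>R ((t * sin (real j * t)) *\<^sub>R Y t))"
    by (auto simp: algebra_simps)
  also have "integral {0..pi} \<dots> = (2 * real j) *\<^sub>R cmom j Y + (\<mu> - (real j)\<^sup>2) *\<^sub>R wmom (\<lambda>t. t * sin (real j * t)) Y"
    unfolding cmom_def wmom_def
    by (subst Henstock_Kurzweil_Integration.integral_add)
       (auto intro!: integrable_continuous_real continuous_intros Yc simp del: scaleR_scaleR)
  finally have ?xsin by (simp add: cs algebra_simps)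
  with \<open>?cos\<close> \<open>?sin\<close> show "?cos \<and> ?sin \<and> ?xsin" by blast
  qed
  then show ?cos ?sin ?xsin by blast+
qed

text \<open>
  Subtracting these multiples of the sine moments makes the boundary terms of the three identities
  above cancel: the test function satisfies the boundary conditions.
\<close>

definition corr :: "nat \<Rightarrow> (real \<Rightarrow> complex^'n) \<Rightarrow> complex^'n" where
  "corr j f = cmom j f + h *v ((1 / real j) *\<^sub>R wmom (\<lambda>t. sin (real j * t)) f)
     - (h + H) *v ((1 / (real j * pi)) *\<^sub>R wmom (\<lambda>t. t * sin (real j * t)) f)"

definition resid :: "nat \<Rightarrow> (real \<Rightarrow> complex^'n) \<Rightarrow> complex^'n" where
  "resid j f = qmom (\<lambda>t. cos (real j * t)) f + h *v ((1 / real j) *\<^sub>R qmom (\<lambda>t. sin (real j * t)) f)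
     - (h + H) *v ((1 / (real j * pi)) *\<^sub>R qmom (\<lambda>t. t * sin (real j * t)) f) + (h + H) *v ((2 / pi) *\<^sub>R cmom j f)"

text \<open>End values of a combination of eigenfunctions are not bounded by its
  \<open>L2_norm\<close>. With them eliminated, \<open>corr\<close> and \<open>resid\<close> are
  bounded linear functionals and the eigenvalue occurs only in the factor, so the identity can be
  divided term by term and summed over eigenfunctions.\<close>

lemma corr_identity:
  assumes bvp: "bvp_solution Q h H (complex_of_real \<mu>) Y" and j: "0 < j"
  shows "(\<mu> - (real j)\<^sup>2) *\<^sub>R corr j Y = resid j Y"
proof -
  note id = cos_moment_identity[OF bvp, of j]
  let ?m = "\<mu> - (real j)\<^sup>2"
  have "?m *\<^sub>R corr j Y = ?m *\<^sub>R cmom j Y + h *v ((1 / real j) *\<^sub>R (?m *\<^sub>R wmom (\<lambda>t. sin (real j * t)) Y))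
     - (h + H) *v ((1 / (real j * pi)) *\<^sub>R (?m *\<^sub>R wmom (\<lambda>t. t * sin (real j * t)) Y))"
    by (simp add: corr_def scaleR_add_right scaleR_diff_right matrix_vector_mult_scaleR mult.commute)
  also have "\<dots> = resid j Y"
    unfolding id resid_def using j
    by (simp add: scaleR_add_right scaleR_diff_right matrix_vector_mult_scaleR matrix_vector_mult_add_rdistrib
        matrix_vector_mult_diff_distrib matrix_vector_right_distrib algebra_simps)
  finally show ?thesis .
qed

lemma trig_cont:
  "continuous_on {0..pi} (\<lambda>t. cos (real j * t))" "continuous_on {0..pi} (\<lambda>t. sin (real j * t))"
  "continuous_on {0..pi} (\<lambda>t. t * sin (real j * t))"
  by (intro continuous_intros)+

lemma x_sin_le: "t \<in> {0..pi} \<Longrightarrow> \<bar>t * sin (real j * t)\<bar> \<le> pi"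
  using mult_mono[of "\<bar>t\<bar>" pi "\<bar>sin (real j * t)\<bar>" 1] by (simp add: abs_mult)

lemma corr_resid_sum:
  assumes F: "finite F" and y: "\<And>i. i \<in> F \<Longrightarrow> continuous_on {0..pi} (y i)"
  shows "corr j (\<lambda>t. \<Sum>i\<in>F. a i *s y i t) = (\<Sum>i\<in>F. a i *s corr j (y i))"
    and "resid j (\<lambda>t. \<Sum>i\<in>F. a i *s y i t) = (\<Sum>i\<in>F. a i *s resid j (y i))"
proof -
  note ws = wmom_sum[OF trig_cont(1) F y] wmom_sum[OF trig_cont(2) F y] wmom_sum[OF trig_cont(3) F y]
    qmom_sum[OF trig_cont(1) F y] qmom_sum[OF trig_cont(2) F y] qmom_sum[OF trig_cont(3) F y]
  note lin = matrix_vector_mult_sum scaleR_sum_right scaleR_scale_commute matrix_vector_mult_scale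
    vec.scale_right_distrib vec.scale_right_diff_distrib
  show "corr j (\<lambda>t. \<Sum>i\<in>F. a i *s y i t) = (\<Sum>i\<in>F. a i *s corr j (y i))"
    unfolding corr_def cmom_wmom by (simp only: ws lin sum.distrib sum_subtractf)
  show "resid j (\<lambda>t. \<Sum>i\<in>F. a i *s y i t) = (\<Sum>i\<in>F. a i *s resid j (y i))"
    unfolding resid_def cmom_wmom by (simp only: ws lin sum.distrib sum_subtractf)
qed

lemma sqrt_pi_le: "sqrt pi \<le> 2"
  using pi_less_4 by (intro real_le_lsqrt) auto

lemma norm_resid_le:
  assumes f: "continuous_on {0..pi} f" and j: "0 < j"
  shows "norm (resid j f) \<le> kR R * L2_norm f"
proof -
  have j1: "1 / real j \<le> 1" using j by simp
  have R0: "0 \<le> R" by (rule norms_le(4))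
  let ?f = "L2_norm f"
  have 1: "norm (qmom (\<lambda>t. cos (real j * t)) f) \<le> R * (1 * ?f)"
    by (rule norm_qmom_le[OF trig_cont(1) _ f]) simp
  have 2: "norm (h *v ((1 / real j) *\<^sub>R qmom (\<lambda>t. sin (real j * t)) f)) \<le> R * (1 * (R * (1 * ?f)))"
  proof (rule order_trans[OF norm_h mult_left_mono[OF _ R0]])
    show "norm ((1 / real j) *\<^sub>R qmom (\<lambda>t. sin (real j * t)) f) \<le> 1 * (R * (1 * ?f))"
      unfolding norm_scaleR by (intro mult_mono norm_qmom_le[OF trig_cont(2) _ f]) (use j1 R0 in auto)
  qed
  have 3: "norm ((h + H) *v ((1 / (real j * pi)) *\<^sub>R qmom (\<lambda>t. t * sin (real j * t)) f)) \<le> 2 * R * (1 / pi * (R * (pi * ?f)))"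
  proof (rule order_trans[OF norm_hH mult_left_mono])
    have "1 / (real j * pi) \<le> 1 / pi" using j by (simp add: field_simps)
    then show "norm ((1 / (real j * pi)) *\<^sub>R qmom (\<lambda>t. t * sin (real j * t)) f) \<le> 1 / pi * (R * (pi * ?f))"
      unfolding norm_scaleR by (intro mult_mono norm_qmom_le[OF trig_cont(3) x_sin_le f]) (use R0 in auto)
  qed (use R0 in auto)
  have 4: "norm ((h + H) *v ((2 / pi) *\<^sub>R cmom j f)) \<le> 2 * R * (2 * ?f)"
  proof (rule order_trans[OF norm_hH mult_left_mono])
    have "norm (cmom j f) \<le> 1 * sqrt pi * ?f"
      unfolding cmom_wmom by (rule norm_wmom_le[OF trig_cont(1) _ f]) simp
    also have "\<dots> \<le> pi * ?f"
    proof -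
      have "sqrt pi \<le> pi" using sqrt_pi_le pi_gt3 by linarith
      then show ?thesis by (simp add: mult_right_mono)
    qed
    finally have "2 / pi * norm (cmom j f) \<le> 2 / pi * (pi * ?f)" by (intro mult_left_mono) auto
    then show "norm ((2 / pi) *\<^sub>R cmom j f) \<le> 2 * ?f" by simp
  qed (use R0 in auto)
  have "norm (resid j f) \<le> R * (1 * ?f) + R * (1 * (R * (1 * ?f))) + 2 * R * (1 / pi * (R * (pi * ?f))) + 2 * R * (2 * ?f)"
  proof -
    have "norm (a + b - c + d) \<le> norm a + norm b + norm c + norm d" for a b c d :: "complex^'n"
      using norm_triangle_ineq[of "a + b - c" d] norm_triangle_ineq4[of "a + b" c] norm_triangle_ineq[of a b] by linarith
    then show ?thesis unfolding resid_def
      by (rule order_trans) (intro add_mono 1 2 3 4)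
  qed
  also have "\<dots> = kR R * ?f" by (simp add: kR_def power2_eq_square algebra_simps)
  finally show ?thesis .
qed

text \<open>The correction terms carry \<open>1 / j\<close>, so decay of this order passes from
  \<open>corr\<close> to \<open>cmom\<close>. Of the constant 6, 2 stems from \<open>h\<close> and 4
  from \<open>h + H\<close>.\<close>

lemma norm_cmom_le_corr:
  assumes f: "continuous_on {0..pi} f" and j: "0 < j"
  shows "norm (cmom j f) \<le> norm (corr j f) + 6 * R / real j * L2_norm f"
proof -
  have R0: "0 \<le> R" by (rule norms_le(4))
  let ?f = "L2_norm f"
  have 2: "norm (h *v ((1 / real j) *\<^sub>R wmom (\<lambda>t. sin (real j * t)) f)) \<le> R * (1 / real j * (2 * ?f))"
  proof (rule order_trans[OF norm_h mult_left_mono[OF _ R0]])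
    have "norm (wmom (\<lambda>t. sin (real j * t)) f) \<le> 1 * sqrt pi * ?f"
      by (rule norm_wmom_le[OF trig_cont(2) _ f]) simp
    also have "\<dots> \<le> 2 * ?f" using sqrt_pi_le by (simp add: mult_right_mono)
    finally show "norm ((1 / real j) *\<^sub>R wmom (\<lambda>t. sin (real j * t)) f) \<le> 1 / real j * (2 * ?f)"
      unfolding norm_scaleR by (intro mult_mono) auto
  qed
  have 3: "norm ((h + H) *v ((1 / (real j * pi)) *\<^sub>R wmom (\<lambda>t. t * sin (real j * t)) f)) \<le> 2 * R * (1 / (real j * pi) * (pi * 2 * ?f))"
  proof (rule order_trans[OF norm_hH mult_left_mono])
    have "norm (wmom (\<lambda>t. t * sin (real j * t)) f) \<le> pi * sqrt pi * ?f"
      by (rule norm_wmom_le[OF trig_cont(3) x_sin_le f])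
    also have "\<dots> \<le> pi * 2 * ?f" using sqrt_pi_le by (simp add: mult_right_mono)
    finally show "norm ((1 / (real j * pi)) *\<^sub>R wmom (\<lambda>t. t * sin (real j * t)) f) \<le> 1 / (real j * pi) * (pi * 2 * ?f)"
      unfolding norm_scaleR by (intro mult_mono) auto
  qed (use R0 in auto)
  have "cmom j f = corr j f - h *v ((1 / real j) *\<^sub>R wmom (\<lambda>t. sin (real j * t)) f)
      + (h + H) *v ((1 / (real j * pi)) *\<^sub>R wmom (\<lambda>t. t * sin (real j * t)) f)"
    by (simp add: corr_def)
  moreover have "norm (a - b + c) \<le> norm a + norm b + norm c" for a b c :: "complex^'n"
    using norm_triangle_ineq[of "a - b" c] norm_triangle_ineq4[of a b] by linarith
  ultimately have "norm (cmom j f) \<le> norm (corr j f) + norm (h *v ((1 / real j) *\<^sub>R wmom (\<lambda>t. sin (real j * t)) f))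
      + norm ((h + H) *v ((1 / (real j * pi)) *\<^sub>R wmom (\<lambda>t. t * sin (real j * t)) f))" by simp
  also have "\<dots> \<le> norm (corr j f) + R * (1 / real j * (2 * ?f)) + 2 * R * (1 / (real j * pi) * (pi * 2 * ?f))"
    by (intro add_mono 2 3 order_refl)
  also have "\<dots> = norm (corr j f) + 6 * R / real j * L2_norm f" using j by (simp add: field_simps)
  finally show ?thesis .
qed

end

subsection \<open>Counting eigenvalues\<close>

lemma L2_inner_scaleR_const:
  assumes c: "continuous_on {0..pi} c" and g: "continuous_on {0..pi} g"
  shows "L2_inner (\<lambda>x. c x *\<^sub>R w) g = cdot w (wmom c g)"
proof -
  have int: "((\<lambda>t. c t *\<^sub>R g t) has_integral wmom c g) {0..pi}"
    unfolding wmom_def by (intro integrable_integral integrable_continuous_real continuous_intros c g)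
  from has_integral_linear[OF int bounded_linear_cdot_right[of w]]
  have i: "((\<lambda>t. cdot w (c t *\<^sub>R g t)) has_integral cdot w (wmom c g)) {0..pi}" by (simp add: o_def)
  have "integrable M_pi (\<lambda>x. cdot (c x *\<^sub>R w) (g x))"
    by (intro integrable_cdot continuous_L2 continuous_intros c g)
  then have "L2_inner (\<lambda>x. c x *\<^sub>R w) g = integral {0..pi} (\<lambda>x. cdot (c x *\<^sub>R w) (g x))"
    unfolding L2_inner_cdot by (rule absolutely_integrable_M_pi(2))
  also have "\<dots> = cdot w (wmom c g)"
    using integral_unique[OF i] by (simp add: cdot_scaleR_left cdot_scaleR_right)
  finally show ?thesis .
qed

lemma cdot_axis: "cdot (axis l 1) v = v $ l"
  by (simp add: cdot_def axis_def if_distrib[of "\<lambda>z. cnj z * _"] cong: if_cong)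

lemma norm_vec_sum: "(norm (v :: complex^'n))\<^sup>2 = (\<Sum>l\<in>UNIV. (cmod (v $ l))\<^sup>2)"
  by (simp add: norm_vec_def L2_set_def sum_nonneg)

text \<open>The product is the mean of cosines with the frequencies \<open>k - r\<close> and
  \<open>k + r\<close>. The first has integral at least 2, attained at the edge of the window, and
  the second at least \<open>- 1\<close>.\<close>

lemma window_overlap:
  assumes r: "\<bar>r - real k\<bar> \<le> 1/2" and k: "1 \<le> k"
  shows "1/2 \<le> integral {0..pi} (\<lambda>x. cos (real k * x) * cos (r * x))"
proof -
  define \<theta> where "\<theta> = real k - r"
  have "1 \<le> real k" using k by simp
  with r have s: "real k + r \<ge> 3/2" by linarith
  have "integral {0..pi} (\<lambda>x. cos (1/2 * x)) \<le> integral {0..pi} (\<lambda>x. cos (\<theta> * x))"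
  proof (intro integral_le integrable_continuous_real continuous_intros)
    fix x assume x: "x \<in> {0..pi}"
    have "\<bar>\<theta> * x\<bar> \<le> 1/2 * x" unfolding abs_mult using r x by (intro mult_mono) (auto simp: \<theta>_def abs_minus_commute)
    then have "cos (1/2 * x) \<le> cos \<bar>\<theta> * x\<bar>" using x by (intro cos_monotone_0_pi_le) auto
    then show "cos (1/2 * x) \<le> cos (\<theta> * x)" by simp
  qed
  moreover have "integral {0..pi} (\<lambda>x. cos (1/2 * x)) = 2"
    using integral_unique[OF has_integral_cos_mult[of "1/2"]] by simp
  ultimately have 1: "2 \<le> integral {0..pi} (\<lambda>x. cos (\<theta> * x))" by simp
  have 2: "integral {0..pi} (\<lambda>x. cos ((real k + r) * x)) \<ge> - 1"
  proof -
    have "- (real k + r) \<le> sin ((real k + r) * pi)" using s sin_ge_minus_one[of "(real k + r) * pi"] by linarith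
    then have "- 1 \<le> sin ((real k + r) * pi) / (real k + r)" using s by (simp add: field_simps)
    then show ?thesis using integral_unique[OF has_integral_cos_mult[of "real k + r"]] s by simp
  qed
  have "((\<lambda>x. 1/2 * cos (\<theta> * x) + 1/2 * cos ((real k + r) * x)) has_integral
      (1/2 * integral {0..pi} (\<lambda>x. cos (\<theta> * x)) + 1/2 * integral {0..pi} (\<lambda>x. cos ((real k + r) * x)))) {0..pi}"
    by (intro has_integral_add has_integral_mult_right integrable_integral integrable_continuous_real continuous_intros)
  moreover have "1/2 * cos (\<theta> * x) + 1/2 * cos ((real k + r) * x) = cos (real k * x) * cos (r * x)" for x
    by (simp add: cos_times_cos \<theta>_def left_diff_distrib distrib_right add_divide_distrib)
  ultimately have "integral {0..pi} (\<lambda>x. cos (real k * x) * cos (r * x))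
      = 1/2 * integral {0..pi} (\<lambda>x. cos (\<theta> * x)) + 1/2 * integral {0..pi} (\<lambda>x. cos ((real k + r) * x))"
    by (simp add: integral_unique)
  with 1 2 show ?thesis by simp
qed

definition kQ :: "real \<Rightarrow> real" where "kQ R = 2 * kR R + 6 * R"
definition kT :: "real \<Rightarrow> real" where "kT R = R + R * kY R + R * kV R"

locale spectral_problem = problem R Q h H
  for R :: real and Q :: "real \<Rightarrow> complex^'n^'n" and h H :: "complex^'n^'n" +
  fixes I :: "'i set" and lam :: "'i \<Rightarrow> real" and Y :: "'i \<Rightarrow> real \<Rightarrow> complex^'n"
  assumes onb: "L2_orthonormal_basis Y I"
    and bvp: "i \<in> I \<Longrightarrow> bvp_solution Q h H (complex_of_real (lam i)) (Y i)"
begin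

lemma orth: "L2_orthonormal Y I" using onb by (rule L2_orthonormal_basis_imp)

lemma Y_norm: "i \<in> I \<Longrightarrow> L2_norm (Y i) = 1" by (rule L2_orthonormal_norm[OF orth])

lemma Y_sol: "i \<in> I \<Longrightarrow> Volterra_solution (lam i) (Y i)" by (rule bvp_imp_Volterra[OF bvp])

lemma Y_cont: "i \<in> I \<Longrightarrow> continuous_on {0..pi} (Y i)"
  using Y_sol by (simp add: Volterra_solution_def)

text \<open>Dividing \<open>corr_identity\<close> by the gaps turns \<open>corr j\<close> of the sum
  into \<open>resid j\<close> of a sum whose coefficients are divided by the gaps. By orthonormality
  the new sum is smaller by the factor \<open>2 / j\<close>, however many terms there are.\<close>

lemma cmom_span_le:
  assumes F: "finite F" "F \<subseteq> I" and less: "\<And>i. i \<in> F \<Longrightarrow> lam i < (real N + 1/2)\<^sup>2" and j: "N < j"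
  shows "norm (cmom j (\<lambda>x. \<Sum>i\<in>F. a i *s Y i x)) \<le> kQ R / real j * L2_norm (\<lambda>x. \<Sum>i\<in>F. a i *s Y i x)"
proof -
  let ?f = "\<lambda>x. \<Sum>i\<in>F. a i *s Y i x"
  let ?b = "\<lambda>i. a i / complex_of_real (lam i - (real j)\<^sup>2)"
  let ?g = "\<lambda>x. \<Sum>i\<in>F. ?b i *s Y i x"
  have Yc: "continuous_on {0..pi} (Y i)" if "i \<in> F" for i using Y_cont F that by blast
  have cont: "continuous_on {0..pi} (\<lambda>x. \<Sum>i\<in>F. c i *s Y i x)" for c
    by (intro continuous_on_sum bounded_linear.continuous_on[OF bounded_linear_vector_scalar_mult] Yc)
  \<comment> \<open>The half-integer cutoff stays at distance at least \<open>1/2\<close> from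
    \<open>j\<close>; the other factor of the difference of squares is at least
    \<open>j\<close>.\<close>
  have gap: "(real j)\<^sup>2 - lam i \<ge> real j / 2" if "i \<in> F" for i
  proof -
    have "real N + 1 \<le> real j" using j by simp
    then have "(real j - (real N + 1/2)) * (real j + (real N + 1/2)) \<ge> 1/2 * real j"
      by (intro mult_mono) auto
    then have "(real j)\<^sup>2 - (real N + 1/2)\<^sup>2 \<ge> real j / 2"
      by (simp add: power2_eq_square algebra_simps)
    with less[OF that] show ?thesis by linarith
  qed
  have j0: "0 < real j" using j by simp
  have nz: "lam i - (real j)\<^sup>2 \<noteq> 0" if "i \<in> F" for i using gap[OF that] j0 by auto
  have "corr j ?f = (\<Sum>i\<in>F. a i *s corr j (Y i))" by (rule corr_resid_sum(1)[OF F(1) Yc])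
  also have "\<dots> = (\<Sum>i\<in>F. ?b i *s resid j (Y i))"
  proof (rule sum.cong[OF refl])
    fix i assume i: "i \<in> F"
    have "resid j (Y i) = complex_of_real (lam i - (real j)\<^sup>2) *s corr j (Y i)"
    proof -
      have "i \<in> I" "0 < j" using i F j by auto
      then show ?thesis unfolding vector_scalar_mult_of_real by (intro corr_identity[OF bvp, symmetric])
    qed
    then show "a i *s corr j (Y i) = ?b i *s resid j (Y i)"
      using nz[OF i] by (simp add: vec.scale_scale del: of_real_diff)
  qed
  also have "\<dots> = resid j ?g" by (rule corr_resid_sum(2)[OF F(1) Yc, symmetric])
  finally have eq: "corr j ?f = resid j ?g" .
  have gf: "L2_norm ?g \<le> 2 / real j * L2_norm ?f"
  proof (rule power2_le_imp_le)
    have "(L2_norm ?g)\<^sup>2 = (\<Sum>i\<in>F. (cmod (?b i))\<^sup>2)" by (rule L2_norm_sum_orthonormal[OF orth F])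
    also have "\<dots> \<le> (\<Sum>i\<in>F. (2 / real j)\<^sup>2 * (cmod (a i))\<^sup>2)"
    proof (rule sum_mono)
      fix i assume i: "i \<in> F"
      have g: "\<bar>lam i - (real j)\<^sup>2\<bar> \<ge> real j / 2" using gap[OF i] by linarith
      have "cmod (?b i) = cmod (a i) / \<bar>lam i - (real j)\<^sup>2\<bar>" by (simp only: norm_divide norm_of_real)
      also have "\<dots> \<le> cmod (a i) / (real j / 2)" using g j0 nz[OF i] by (intro divide_left_mono mult_pos_pos) auto
      finally have "cmod (?b i) \<le> 2 / real j * cmod (a i)" by (simp add: mult.commute)
      then have "(cmod (?b i))\<^sup>2 \<le> (2 / real j * cmod (a i))\<^sup>2" by (rule power_mono) simp
      then show "(cmod (?b i))\<^sup>2 \<le> (2 / real j)\<^sup>2 * (cmod (a i))\<^sup>2" by (simp only: power_mult_distrib)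
    qed
    also have "\<dots> = (2 / real j * L2_norm ?f)\<^sup>2"
      by (simp only: L2_norm_sum_orthonormal[OF orth F] power_mult_distrib sum_distrib_left)
    finally show "(L2_norm ?g)\<^sup>2 \<le> (2 / real j * L2_norm ?f)\<^sup>2" .
  qed simp
  have kR0: "0 \<le> kR R" using norms_le(4) by (simp add: kR_def)
  have "norm (corr j ?f) \<le> kR R * L2_norm ?g" unfolding eq by (rule norm_resid_le[OF cont]) (use j in simp)
  also have "\<dots> \<le> kR R * (2 / real j * L2_norm ?f)" by (rule mult_left_mono[OF gf kR0])
  finally have "norm (cmom j ?f) \<le> kR R * (2 / real j * L2_norm ?f) + 6 * R / real j * L2_norm ?f"
    using norm_cmom_le_corr[OF cont[of a], of j] j by simp
  also have "\<dots> = kQ R / real j * L2_norm ?f" by (simp add: kQ_def add_divide_distrib algebra_simps)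
  finally show ?thesis .
qed

text \<open>The squares of the moments \<open>kQ R / j\<close> with \<open>j > N\<close> account for
  at most the fraction \<open>(kQ R)\<^sup>2 / N\<close> of the squared norm, which is less than one
  beyond the threshold.\<close>

lemma count_le:
  assumes F: "finite F" "F \<subseteq> I" and less: "\<And>i. i \<in> F \<Longrightarrow> lam i < (real N + 1/2)\<^sup>2"
    and N: "(kQ R)\<^sup>2 < real N"
  shows "card F \<le> CARD('n) * (N + 1)"
proof (rule ccontr)
  assume "\<not> card F \<le> CARD('n) * (N + 1)"
  then have "card ({..N} \<times> (UNIV :: 'n set)) < card F" by (simp add: card_cartesian_product mult.commute)
  from homogeneous_system_solution[OF _ F(1) this, of "\<lambda>e i. cmom (fst e) (Y i) $ snd e"]
  obtain a where a: "\<exists>u\<in>F. a u \<noteq> 0"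
    "\<And>j l. j \<le> N \<Longrightarrow> (\<Sum>i\<in>F. a i * cmom j (Y i) $ l) = 0" by fastforce
  let ?f = "\<lambda>x. \<Sum>i\<in>F. a i *s Y i x"
  have Yc: "continuous_on {0..pi} (Y i)" if "i \<in> F" for i using Y_cont F that by blast
  have fc: "continuous_on {0..pi} ?f"
    by (intro continuous_on_sum bounded_linear.continuous_on[OF bounded_linear_vector_scalar_mult] Yc)
  have zero: "cmom j ?f = 0" if "j \<le> N" for j
  proof -
    have "cmom j ?f = (\<Sum>i\<in>F. a i *s cmom j (Y i))"
      unfolding cmom_wmom by (rule wmom_sum[OF trig_cont(1) F(1) Yc])
    then show ?thesis using a(2)[OF that] by (simp add: vec_eq_iff)
  qed
  have N0: "0 < N" using N by (metis gr0I of_nat_0 not_less zero_le_power2)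
  have B: "(\<Sum>j\<in>{N<..M}. (norm (cmom j ?f))\<^sup>2) \<le> (kQ R)\<^sup>2 * (L2_norm ?f)\<^sup>2 * (1 / real N)" for M
  proof -
    have "(\<Sum>j\<in>{N<..M}. (norm (cmom j ?f))\<^sup>2) \<le> (\<Sum>j\<in>{N<..M}. (kQ R)\<^sup>2 * (L2_norm ?f)\<^sup>2 * (1 / (real j)\<^sup>2))"
    proof (rule sum_mono)
      fix j assume "j \<in> {N<..M}"
      then have "norm (cmom j ?f) \<le> kQ R / real j * L2_norm ?f" by (intro cmom_span_le[OF F less]) auto
      then have "(norm (cmom j ?f))\<^sup>2 \<le> (kQ R / real j * L2_norm ?f)\<^sup>2" by (rule power_mono) simp
      then show "(norm (cmom j ?f))\<^sup>2 \<le> (kQ R)\<^sup>2 * (L2_norm ?f)\<^sup>2 * (1 / (real j)\<^sup>2)"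
        by (simp add: power_mult_distrib power_divide)
    qed
    also have "\<dots> = (kQ R)\<^sup>2 * (L2_norm ?f)\<^sup>2 * (\<Sum>j\<in>{N<..M}. 1 / (real j)\<^sup>2)" by (simp only: sum_distrib_left)
    also have "\<dots> \<le> (kQ R)\<^sup>2 * (L2_norm ?f)\<^sup>2 * (1 / real N)"
      by (intro mult_left_mono sum_inverse_squares_tail N0) simp
    finally show ?thesis .
  qed
  have "(L2_norm ?f)\<^sup>2 \<le> 2 / pi * ((kQ R)\<^sup>2 * (L2_norm ?f)\<^sup>2 * (1 / real N))"
    unfolding continuous_L2(2)[OF fc] by (rule cosine_Parseval_le[OF fc zero B[unfolded continuous_L2(2)[OF fc]]])
  also have "\<dots> \<le> 1 * ((kQ R)\<^sup>2 * (L2_norm ?f)\<^sup>2 * (1 / real N))"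
    using pi_gt3 by (intro mult_right_mono) auto
  finally have 1: "(L2_norm ?f)\<^sup>2 * real N \<le> (L2_norm ?f)\<^sup>2 * (kQ R)\<^sup>2" using N0 by (simp add: field_simps)
  have "(L2_norm ?f)\<^sup>2 > 0"
    unfolding L2_norm_sum_orthonormal[OF orth F] using a(1) F(1) by (auto intro!: sum_pos2)
  with 1 N show False by simp
qed

section \<open>Cosine moments of single eigenfunctions and the lower count\<close>

lemma cmom_upper:
  assumes i: "i \<in> I" and l0: "0 \<le> lam i"
  shows "\<bar>lam i - (real j)\<^sup>2\<bar> * norm (cmom j (Y i)) \<le> kT R"
proof -
  have R0: "0 \<le> R" by (rule norms_le(4))
  have "\<bar>lam i - (real j)\<^sup>2\<bar> * norm (cmom j (Y i)) = norm ((lam i - (real j)\<^sup>2) *\<^sub>R cmom j (Y i))" by simp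
  also have "\<dots> \<le> norm (qmom (\<lambda>t. cos (real j * t)) (Y i)) + norm ((-1) ^ j *\<^sub>R (H *v Y i pi)) + norm (h *v Y i 0)"
    unfolding cos_moment_identity(1)[OF bvp[OF i]] by (intro norm_triangle_mono order_refl)
  also have "\<dots> \<le> R * (1 * L2_norm (Y i)) + R * kY R + R * kV R"
  proof (intro add_mono)
    show "norm (qmom (\<lambda>t. cos (real j * t)) (Y i)) \<le> R * (1 * L2_norm (Y i))"
      by (rule norm_qmom_le[OF trig_cont(1) _ Y_cont[OF i]]) simp
    have "norm (H *v Y i pi) \<le> R * kY R"
      using norm_le_kY[OF Y_sol[OF i] Y_norm[OF i] l0, of pi] R0 by (intro order_trans[OF norm_H] mult_left_mono) auto
    then show "norm ((-1) ^ j *\<^sub>R (H *v Y i pi)) \<le> R * kY R" by (simp add: power_abs)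
    show "norm (h *v Y i 0) \<le> R * kV R"
      using norm_initial_le[OF Y_sol[OF i] Y_norm[OF i]] R0 by (intro order_trans[OF norm_h] mult_left_mono) auto
  qed
  also have "\<dots> = kT R" by (simp add: kT_def Y_norm[OF i])
  finally show ?thesis .
qed

text \<open>Here the eigenfunction is within \<open>1/16\<close> of its cosine at every point, so
  normalization keeps the initial value away from zero.\<close>

lemma norm_initial_ge:
  assumes i: "i \<in> I" and l0: "0 < lam i" and big: "16 * kE R \<le> sqrt (lam i)"
  shows "1/4 \<le> norm (Y i 0)"
proof -
  let ?W = "\<lambda>x. cosl (lam i) x *\<^sub>R Y i 0"
  have s: "0 < sqrt (lam i)" using l0 by simp
  have Wc: "continuous_on {0..pi} ?W" by (intro continuous_intros)
  have d: "L2_norm (\<lambda>x. Y i x - ?W x) \<le> 1/16 * sqrt pi"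
  proof -
    have "L2_norm (\<lambda>x. Y i x - ?W x) \<le> L2_norm (\<lambda>x. (1/16) *\<^sub>R (1 :: real))"
    proof (rule L2_norm_mono)
      fix x assume "x \<in> {0<..<pi}"
      then have "norm (Y i x - ?W x) \<le> kE R / sqrt (lam i)"
        using norm_diff_cosl_le[OF Y_sol[OF i] Y_norm[OF i] l0, of x] by simp
      also have "\<dots> \<le> 1/16" using big s by (simp add: field_simps)
      finally show "norm (Y i x - ?W x) \<le> norm ((1/16) *\<^sub>R (1 :: real))" by simp
    qed (intro continuous_L2 continuous_intros Wc Y_cont[OF i])+
    then show ?thesis unfolding L2_norm_scaleR by (simp add: L2_norm_one)
  qed
  have w: "L2_norm ?W \<le> norm (Y i 0) * sqrt pi"
  proof -
    have "L2_norm ?W \<le> L2_norm (\<lambda>x. norm (Y i 0) *\<^sub>R (1 :: real))"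
    proof (rule L2_norm_mono)
      fix x :: real
      show "norm (?W x) \<le> norm (norm (Y i 0) *\<^sub>R (1 :: real))"
        using abs_cosl_le_1[of "lam i" x] l0 by (simp add: mult_left_le_one_le)
    qed (intro continuous_L2 continuous_intros Wc)+
    then show ?thesis unfolding L2_norm_scaleR by (simp add: L2_norm_one)
  qed
  have "1 \<le> L2_norm ?W + L2_norm (\<lambda>x. Y i x - ?W x)"
    using L2_norm_triangle_diff2[OF continuous_L2(1)[OF Y_cont[OF i]] continuous_L2(1)[OF Wc]] Y_norm[OF i] by simp
  also have "\<dots> \<le> (norm (Y i 0) + 1/16) * sqrt pi" using d w by (simp add: algebra_simps)
  also have "\<dots> \<le> (norm (Y i 0) + 1/16) * 2" by (intro mult_left_mono sqrt_pi_le) auto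
  finally show ?thesis by simp
qed

text \<open>Overlap \<open>1/2\<close> times initial value \<open>1/4\<close>, minus an error
  \<open>pi / 64\<close>, which is below \<open>1/16\<close>.\<close>

lemma cmom_lower:
  assumes i: "i \<in> I" and l0: "0 < lam i" and k: "1 \<le> k" and close: "\<bar>sqrt (lam i) - real k\<bar> \<le> 1/2"
    and big: "64 * kE R \<le> sqrt (lam i)"
  shows "1/16 \<le> norm (cmom k (Y i))"
proof -
  have s: "0 < sqrt (lam i)" using l0 by simp
  let ?c = "\<lambda>x. cos (real k * x)"
  let ?I = "integral {0..pi} (\<lambda>x. ?c x * cosl (lam i) x)"
  have c: "cosl (lam i) x = cos (sqrt (lam i) * x)" for x using l0 by (simp add: cosl_def)
  have I: "1/2 \<le> ?I" unfolding c by (rule window_overlap[OF close k])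
  have v: "1/4 \<le> norm (Y i 0)" by (rule norm_initial_ge[OF i l0]) (use big kE0 in linarith)
  have "((\<lambda>x. (?c x * cosl (lam i) x) *\<^sub>R Y i 0) has_integral ?I *\<^sub>R Y i 0) {0..pi}"
    by (intro has_integral_scaleR_left integrable_integral integrable_continuous_real continuous_intros)
  moreover have "((\<lambda>x. ?c x *\<^sub>R Y i x) has_integral cmom k (Y i)) {0..pi}"
    unfolding cmom_def by (intro integrable_integral integrable_continuous_real continuous_intros Y_cont[OF i])
  ultimately have "((\<lambda>x. ?c x *\<^sub>R Y i x - (?c x * cosl (lam i) x) *\<^sub>R Y i 0) has_integral cmom k (Y i) - ?I *\<^sub>R Y i 0) {0..pi}"
    by (rule has_integral_diff[rotated])
  then have "cmom k (Y i) - ?I *\<^sub>R Y i 0 = integral {0..pi} (\<lambda>x. ?c x *\<^sub>R (Y i x - cosl (lam i) x *\<^sub>R Y i 0))"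
    by (simp add: scaleR_diff_right integral_unique)
  also have "norm \<dots> \<le> integral {0..pi} (\<lambda>x. 1/64)"
  proof (intro integral_norm_bound_integral integrable_continuous_real continuous_intros Y_cont[OF i])
    fix x assume x: "x \<in> {0..pi}"
    have "norm (?c x *\<^sub>R (Y i x - cosl (lam i) x *\<^sub>R Y i 0)) \<le> 1 * (kE R / sqrt (lam i))"
      unfolding norm_scaleR using norm_diff_cosl_le[OF Y_sol[OF i] Y_norm[OF i] l0 x] by (intro mult_mono) auto
    also have "\<dots> \<le> 1/64" using big s by (simp add: field_simps)
    finally show "norm (?c x *\<^sub>R (Y i x - cosl (lam i) x *\<^sub>R Y i 0)) \<le> 1/64" .
  qed
  also have "\<dots> \<le> 1/16" using pi_less_4 by simp
  finally have "norm (cmom k (Y i) - ?I *\<^sub>R Y i 0) \<le> 1/16" .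
  moreover have "1/8 \<le> norm (?I *\<^sub>R Y i 0)"
    unfolding norm_scaleR using mult_mono[OF I v] I by simp
  ultimately show ?thesis
    using norm_triangle_ineq4[of "cmom k (Y i)" "cmom k (Y i) - ?I *\<^sub>R Y i 0"] by simp
qed

text \<open>Bessel's inequality for \<open>cos (k * x)\<close> times a unit vector: every
  eigenfunction in the window contributes at least \<open>1/256\<close> in total, and each of the
  unit vectors offers at most 4. This crude multiple of the dimension is available before the exact
  count, and \<open>tail_sum_le\<close> depends on it.\<close>

lemma window_count:
  assumes F: "finite F" "F \<subseteq> I" and k: "128 * kE R + 1 \<le> real k"
    and close: "\<And>i. i \<in> F \<Longrightarrow> 0 < lam i \<and> \<bar>sqrt (lam i) - real k\<bar> \<le> 1/2"
  shows "real (card F) \<le> 1024 * real CARD('n)"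
proof -
  let ?c = "\<lambda>x. cos (real k * x)"
  have k1: "1 \<le> k" using k kE0 by simp
  have low: "1/256 \<le> (norm (cmom k (Y i)))\<^sup>2" if i: "i \<in> F" for i
  proof -
    have "64 * kE R \<le> sqrt (lam i)" using conjunct2[OF close[OF i]] k kE0 by linarith
    then have "1/16 \<le> norm (cmom k (Y i))" using close[OF i] i F by (intro cmom_lower k1) auto
    from power_mono[OF this, of 2] show ?thesis by (simp add: power_divide)
  qed
  have comp: "(cmod (cmom k (Y i) $ l))\<^sup>2 = (cmod (L2_inner (Y i) (\<lambda>x. ?c x *\<^sub>R axis l 1)))\<^sup>2" if "i \<in> F" for i l
  proof -
    have "L2_inner (\<lambda>x. ?c x *\<^sub>R axis l 1) (Y i) = cmom k (Y i) $ l"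
      using L2_inner_scaleR_const[OF trig_cont(1) Y_cont, of i k "axis l 1"] that F
      by (auto simp: cdot_axis cmom_wmom)
    then show ?thesis by (metis L2_inner_cnj complex_mod_cnj)
  qed
  have bess: "(\<Sum>i\<in>F. (cmod (L2_inner (Y i) (\<lambda>x. ?c x *\<^sub>R axis l 1)))\<^sup>2) \<le> 4" for l
  proof -
    let ?g = "\<lambda>x. ?c x *\<^sub>R axis l (1 :: complex)"
    have gc: "continuous_on {0..pi} ?g" by (intro continuous_intros)
    have "(\<Sum>i\<in>F. (cmod (L2_inner (Y i) ?g))\<^sup>2) \<le> (L2_norm ?g)\<^sup>2"
      by (rule L2_Bessel[OF orth F continuous_L2(1)[OF gc]])
    also have "\<dots> \<le> (sqrt pi)\<^sup>2"
    proof (rule power_mono)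
      show "L2_norm ?g \<le> sqrt pi" unfolding L2_norm_one[symmetric]
        by (rule L2_norm_mono) (auto intro!: continuous_L2 gc continuous_intros)
    qed simp
    finally show ?thesis using pi_less_4 by simp
  qed
  have "real (card F) * (1/256) \<le> (\<Sum>i\<in>F. (norm (cmom k (Y i)))\<^sup>2)"
    using sum_mono[of F "\<lambda>_. 1/256" "\<lambda>i. (norm (cmom k (Y i)))\<^sup>2", OF low] by simp
  also have "\<dots> = (\<Sum>l\<in>UNIV. \<Sum>i\<in>F. (cmod (cmom k (Y i) $ l))\<^sup>2)"
    unfolding norm_vec_sum by (rule sum.swap)
  also have "\<dots> \<le> (\<Sum>l\<in>(UNIV :: 'n set). 4)"
    using comp bess by (intro sum_mono) simp
  finally show ?thesis by simp
qed

end

text \<open>A sum that dominates the requirements of both counts; the 1 makes the inequalities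
  strict. The factor 32768 is \<open>32 * 1024\<close>, from \<open>sum_cmom_square_le\<close> and
  \<open>window_count\<close>.\<close>

definition count_threshold :: "real \<Rightarrow> real \<Rightarrow> real" where
  "count_threshold R m = 1 + (kQ R)\<^sup>2 + 128 * kE R + 32768 * m * (kT R)\<^sup>2"

context spectral_problem
begin

text \<open>For \<open>j \<le> N < k\<close> the gap \<open>lam i - j\<^sup>2\<close> is at least
  \<open>(k - j) * k / 4\<close>. The inverse squares of \<open>k - j\<close> have a bounded sum,
  and the decay \<open>1 / k\<^sup>2\<close> is left for the sum over the eigenfunctions.\<close>

lemma sum_cmom_square_le:
  assumes i: "i \<in> I" and k: "N < k" and close: "\<bar>sqrt (lam i) - real k\<bar> \<le> 1/2" and l0: "0 < lam i"
  shows "(\<Sum>j\<le>N. (norm (cmom j (Y i)))\<^sup>2) \<le> 32 * (kT R)\<^sup>2 / (real k)\<^sup>2"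
proof -
  define r where "r = sqrt (lam i)"
  have rsq: "lam i = r\<^sup>2" using l0 by (simp add: r_def)
  have k0: "0 < real k" using k by simp
  have kT0: "0 \<le> kT R" using norms_le(4) kY1 kV1 by (simp add: kT_def)
  have each: "(norm (cmom j (Y i)))\<^sup>2 \<le> 16 * (kT R)\<^sup>2 / (real k)\<^sup>2 * (1 / (real (k - j))\<^sup>2)" if j: "j \<le> N" for j
  proof -
    have kj: "real (k - j) = real k - real j" "1 \<le> real k - real j" using j k by auto
    have r: "real k - 1/2 \<le> r" unfolding r_def using close by linarith
    have "((real k - real j) / 2) * (real k / 2) \<le> (r - real j) * (r + real j)"
      using kj r k0 by (intro mult_mono) auto
    then have gap: "(real k - real j) * real k / 4 \<le> lam i - (real j)\<^sup>2"
      unfolding rsq by (simp add: power2_eq_square algebra_simps)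
    have "(real k - real j) * real k / 4 * norm (cmom j (Y i)) \<le> \<bar>lam i - (real j)\<^sup>2\<bar> * norm (cmom j (Y i))"
      by (rule mult_right_mono[OF order_trans[OF gap abs_ge_self] norm_ge_zero])
    also have "\<dots> \<le> kT R" by (rule cmom_upper[OF i]) (use l0 in simp)
    finally have "norm (cmom j (Y i)) \<le> 4 * kT R / ((real k - real j) * real k)"
      using kj k0 by (simp add: field_simps)
    then have "(norm (cmom j (Y i)))\<^sup>2 \<le> (4 * kT R / ((real k - real j) * real k))\<^sup>2" by (rule power_mono) simp
    then show ?thesis unfolding kj(1) by (simp add: power_mult_distrib power_divide mult.commute)
  qed
  have "(\<Sum>j\<le>N. (norm (cmom j (Y i)))\<^sup>2) \<le> (\<Sum>j\<le>N. 16 * (kT R)\<^sup>2 / (real k)\<^sup>2 * (1 / (real (k - j))\<^sup>2))"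
    by (intro sum_mono each) simp
  also have "\<dots> = 16 * (kT R)\<^sup>2 / (real k)\<^sup>2 * (\<Sum>j\<le>N. 1 / (real (k - j))\<^sup>2)" by (simp only: sum_distrib_left)
  also have "\<dots> \<le> 16 * (kT R)\<^sup>2 / (real k)\<^sup>2 * 2"
  proof (rule mult_left_mono)
    have "inj_on (\<lambda>j. k - j) {..N}" using k by (auto simp: inj_on_def)
    then have "(\<Sum>j\<le>N. 1 / (real (k - j))\<^sup>2) = (\<Sum>d\<in>(\<lambda>j. k - j) ` {..N}. 1 / (real d)\<^sup>2)"
      by (simp add: sum.reindex)
    also have "\<dots> \<le> (\<Sum>d=1..k. 1 / (real d)\<^sup>2)" using k by (intro sum_mono2) auto
    also have "\<dots> \<le> 2" by (rule sum_inverse_squares_le_2)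
    finally show "(\<Sum>j\<le>N. 1 / (real (k - j))\<^sup>2) \<le> 2" .
  qed simp
  finally show ?thesis by simp
qed

text \<open>Grouping by the integer nearest to \<open>sqrt (lam i)\<close>: the groups have bounded
  size, and the sum of inverse squares beyond \<open>N\<close> yields \<open>1 / N\<close>.\<close>

lemma tail_sum_le:
  assumes F: "finite F" "F \<subseteq> I" and ge: "\<And>i. i \<in> F \<Longrightarrow> (real N + 1/2)\<^sup>2 \<le> lam i"
    and N: "128 * kE R \<le> real N" "0 < N"
  shows "(\<Sum>i\<in>F. \<Sum>j\<le>N. (norm (cmom j (Y i)))\<^sup>2) \<le> 32768 * real CARD('n) * (kT R)\<^sup>2 / real N"
proof -
  define \<kappa> where "\<kappa> i = nat \<lfloor>sqrt (lam i) + 1/2\<rfloor>" for i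
  have lpos: "0 < lam i" if "i \<in> F" for i
    using ge[OF that] by (rule less_le_trans[rotated]) (simp add: add_nonneg_pos)
  have win: "N < \<kappa> i" "\<bar>sqrt (lam i) - real (\<kappa> i)\<bar> \<le> 1/2" if i: "i \<in> F" for i
  proof -
    have "sqrt ((real N + 1/2)\<^sup>2) \<le> sqrt (lam i)" by (rule real_sqrt_le_mono[OF ge[OF i]])
    then have r: "real N + 1/2 \<le> sqrt (lam i)" by simp
    then have "int N + 1 \<le> \<lfloor>sqrt (lam i) + 1/2\<rfloor>" by (simp add: le_floor_iff)
    then show "N < \<kappa> i" by (simp add: \<kappa>_def)
    have "real (\<kappa> i) = of_int \<lfloor>sqrt (lam i) + 1/2\<rfloor>" using \<open>int N + 1 \<le> \<lfloor>sqrt (lam i) + 1/2\<rfloor>\<close> by (simp add: \<kappa>_def)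
    then show "\<bar>sqrt (lam i) - real (\<kappa> i)\<bar> \<le> 1/2"
      using of_int_floor_le[of "sqrt (lam i) + 1/2"] real_of_int_floor_add_one_gt[of "sqrt (lam i) + 1/2"] by linarith
  qed
  have "(\<Sum>i\<in>F. \<Sum>j\<le>N. (norm (cmom j (Y i)))\<^sup>2) \<le> (\<Sum>i\<in>F. 32 * (kT R)\<^sup>2 / (real (\<kappa> i))\<^sup>2)"
    using F win lpos by (intro sum_mono sum_cmom_square_le) auto
  also have "\<dots> = (\<Sum>k\<in>\<kappa> ` F. \<Sum>i\<in>{i\<in>F. \<kappa> i = k}. 32 * (kT R)\<^sup>2 / (real (\<kappa> i))\<^sup>2)"
    by (rule sum.image_gen[OF F(1)])
  also have "\<dots> \<le> (\<Sum>k\<in>\<kappa> ` F. 32768 * real CARD('n) * (kT R)\<^sup>2 * (1 / (real k)\<^sup>2))"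
  proof (rule sum_mono)
    fix k assume "k \<in> \<kappa> ` F"
    then have k: "N < k" using win by auto
    have "real (card {i\<in>F. \<kappa> i = k}) \<le> 1024 * real CARD('n)"
    proof (rule window_count)
      have "real N + 1 \<le> real k" using k by simp
      then show "128 * kE R + 1 \<le> real k" using N by linarith
      show "0 < lam i \<and> \<bar>sqrt (lam i) - real k\<bar> \<le> 1/2" if "i \<in> {i \<in> F. \<kappa> i = k}" for i
        using that win lpos by auto
    qed (use F in auto)
    then have "real (card {i\<in>F. \<kappa> i = k}) * (32 * (kT R)\<^sup>2 / (real k)\<^sup>2) \<le> 1024 * real CARD('n) * (32 * (kT R)\<^sup>2 / (real k)\<^sup>2)"
      by (rule mult_right_mono) simp
    then show "(\<Sum>i\<in>{i\<in>F. \<kappa> i = k}. 32 * (kT R)\<^sup>2 / (real (\<kappa> i))\<^sup>2) \<le> 32768 * real CARD('n) * (kT R)\<^sup>2 * (1 / (real k)\<^sup>2)"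
      by simp
  qed
  also have "\<dots> = 32768 * real CARD('n) * (kT R)\<^sup>2 * (\<Sum>k\<in>\<kappa> ` F. 1 / (real k)\<^sup>2)" by (simp only: sum_distrib_left)
  also have "\<dots> \<le> 32768 * real CARD('n) * (kT R)\<^sup>2 * (1 / real N)"
  proof (rule mult_left_mono)
    have "(\<Sum>k\<in>\<kappa> ` F. 1 / (real k)\<^sup>2) \<le> (\<Sum>k\<in>{N<..Max (\<kappa> ` F)}. 1 / (real k)\<^sup>2)"
      using F(1) win(1) by (intro sum_mono2) auto
    also have "\<dots> \<le> 1 / real N" by (rule sum_inverse_squares_tail[OF N(2)])
    finally show "(\<Sum>k\<in>\<kappa> ` F. 1 / (real k)\<^sup>2) \<le> 1 / real N" .
  qed simp
  finally show ?thesis by simp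
qed

text \<open>Everything is compared with \<open>B\<close>, the square sum of the coefficients of the
  cosine polynomial: Cauchy-Schwarz in the coefficients bounds its components along the
  eigenfunctions, and orthogonality of the cosines bounds its norm from below. Finiteness is a
  hypothesis because \<open>card\<close> of an infinite set is 0.\<close>

lemma count_ge:
  assumes fin: "finite {i \<in> I. lam i < (real N + 1/2)\<^sup>2}"
    and N: "128 * kE R \<le> real N" "0 < N" "32768 * real CARD('n) * (kT R)\<^sup>2 < real N"
  shows "CARD('n) * (N + 1) \<le> card {i \<in> I. lam i < (real N + 1/2)\<^sup>2}"
proof (rule ccontr)
  define S where "S = {i \<in> I. lam i < (real N + 1/2)\<^sup>2}"
  assume "\<not> CARD('n) * (N + 1) \<le> card {i \<in> I. lam i < (real N + 1/2)\<^sup>2}"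
  then have "card S < card ({..N} \<times> (UNIV :: 'n set))" by (simp add: S_def card_cartesian_product mult.commute)
  from homogeneous_system_solution[OF fin[folded S_def] _ this, of "\<lambda>i e. cmom (fst e) (Y i) $ snd e"]
  obtain a where a: "\<exists>e\<in>{..N} \<times> (UNIV :: 'n set). a e \<noteq> 0"
    "\<And>i. i \<in> S \<Longrightarrow> (\<Sum>e\<in>{..N} \<times> UNIV. a e * cmom (fst e) (Y i) $ snd e) = 0" by auto
  \<comment> \<open>Conjugated because the polynomial is placed in the first argument of
    \<open>L2_inner\<close>, which is conjugate linear.\<close>
  define w :: "nat \<Rightarrow> complex^'n" where "w j = (\<chi> l. cnj (a (j, l)))" for j
  define f where "f x = (\<Sum>j\<le>N. cos (real j * x) *\<^sub>R w j)" for x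
  define B where "B = (\<Sum>j\<le>N. (norm (w j))\<^sup>2)"
  have fc: "continuous_on {0..pi} f" unfolding f_def by (intro continuous_intros)
  have fL2: "in_L2 f" by (rule continuous_L2[OF fc])
  have Bpos: "0 < B"
  proof -
    obtain j l where jl: "j \<le> N" "a (j, l) \<noteq> 0" using a(1) by auto
    then have "w j \<noteq> 0" by (auto simp: w_def vec_eq_iff)
    then have "0 < (norm (w j))\<^sup>2" by simp
    then show ?thesis unfolding B_def using jl(1) by (intro sum_pos2[of _ j]) auto
  qed
  have inner: "L2_inner f (Y i) = (\<Sum>j\<le>N. cdot (w j) (cmom j (Y i)))" if i: "i \<in> I" for i
  proof -
    have "L2_inner f (Y i) = (\<Sum>j\<le>N. L2_inner (\<lambda>x. cos (real j * x) *\<^sub>R w j) (Y i))"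
      unfolding f_def by (intro L2_inner_sum_left continuous_L2 Y_cont i continuous_intros)
    then show ?thesis by (simp add: L2_inner_scaleR_const[OF trig_cont(1) Y_cont[OF i]] cmom_wmom)
  qed
  have zero: "L2_inner (Y i) f = 0" if i: "i \<in> S" for i
  proof -
    have "(\<Sum>j\<le>N. cdot (w j) (cmom j (Y i))) = (\<Sum>j\<le>N. \<Sum>l\<in>UNIV. a (j, l) * cmom j (Y i) $ l)"
      by (simp add: cdot_def w_def)
    also have "\<dots> = (\<Sum>e\<in>{..N} \<times> UNIV. a e * cmom (fst e) (Y i) $ snd e)"
      by (simp add: sum.cartesian_product case_prod_beta)
    also have "\<dots> = 0" by (rule a(2)[OF i])
    finally have "L2_inner f (Y i) = 0" using inner i by (auto simp: S_def)
    then show ?thesis by (metis L2_inner_cnj complex_cnj_zero)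
  qed
  have coeff: "(cmod (L2_inner (Y i) f))\<^sup>2 \<le> B * (\<Sum>j\<le>N. (norm (cmom j (Y i)))\<^sup>2)" if i: "i \<in> I" for i
  proof -
    have "cmod (L2_inner (Y i) f) = cmod (\<Sum>j\<le>N. cdot (w j) (cmom j (Y i)))"
      unfolding inner[OF i, symmetric] by (metis L2_inner_cnj complex_mod_cnj)
    also have "\<dots> \<le> (\<Sum>j\<le>N. \<bar>norm (w j)\<bar> * \<bar>norm (cmom j (Y i))\<bar>)"
      by (rule order_trans[OF norm_sum]) (auto intro!: sum_mono norm_cdot_le)
    also have "\<dots> \<le> L2_set (\<lambda>j. norm (w j)) {..N} * L2_set (\<lambda>j. norm (cmom j (Y i))) {..N}"
      by (rule L2_set_mult_ineq)
    finally have "(cmod (L2_inner (Y i) f))\<^sup>2 \<le> (L2_set (\<lambda>j. norm (w j)) {..N} * L2_set (\<lambda>j. norm (cmom j (Y i))) {..N})\<^sup>2"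
      by (rule power_mono) simp
    then show ?thesis by (simp add: power_mult_distrib L2_set_def B_def sum_nonneg)
  qed
  have part: "(\<Sum>i\<in>F. (cmod (L2_inner (Y i) f))\<^sup>2) \<le> B * (32768 * real CARD('n) * (kT R)\<^sup>2 / real N)"
    if F: "finite F" "F \<subseteq> I" for F
  proof -
    have "(\<Sum>i\<in>F. (cmod (L2_inner (Y i) f))\<^sup>2) = (\<Sum>i\<in>F - S. (cmod (L2_inner (Y i) f))\<^sup>2)"
      using F zero by (intro sum.mono_neutral_right) auto
    also have "\<dots> \<le> (\<Sum>i\<in>F - S. B * (\<Sum>j\<le>N. (norm (cmom j (Y i)))\<^sup>2))"
      using F by (intro sum_mono coeff) auto
    also have "\<dots> = B * (\<Sum>i\<in>F - S. \<Sum>j\<le>N. (norm (cmom j (Y i)))\<^sup>2)" by (simp only: sum_distrib_left)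
    also have "\<dots> \<le> B * (32768 * real CARD('n) * (kT R)\<^sup>2 / real N)"
      using F Bpos by (intro mult_left_mono tail_sum_le N) (auto simp: S_def)
    finally show ?thesis .
  qed
  have "(L2_norm f)\<^sup>2 \<le> B * (32768 * real CARD('n) * (kT R)\<^sup>2 / real N)"
  proof (rule tendsto_upperbound)
    show "((\<lambda>F. \<Sum>i\<in>F. (cmod (L2_inner (Y i) f))\<^sup>2) \<longlongrightarrow> (L2_norm f)\<^sup>2) (finite_subsets_at_top I)"
      using L2_Parseval[OF onb fL2] by (simp add: has_sum_def)
    show "\<forall>\<^sub>F F in finite_subsets_at_top I. (\<Sum>i\<in>F. (cmod (L2_inner (Y i) f))\<^sup>2) \<le> B * (32768 * real CARD('n) * (kT R)\<^sup>2 / real N)"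
      by (intro eventually_finite_subsets_at_top_weakI part)
  qed simp
  moreover have "B \<le> (L2_norm f)\<^sup>2"
  proof -
    have nsq: "(norm (f x))\<^sup>2 = (\<Sum>j\<le>N. \<Sum>k\<le>N. (w j \<bullet> w k) * (cos (real j * x) * cos (real k * x)))" for x
      by (simp add: power2_norm_eq_inner f_def inner_sum_left inner_sum_right sum_distrib_left mult_ac inner_commute)
    have "((\<lambda>x. \<Sum>j\<le>N. \<Sum>k\<le>N. (w j \<bullet> w k) * (cos (real j * x) * cos (real k * x))) has_integral
      (\<Sum>j\<le>N. \<Sum>k\<le>N. (w j \<bullet> w k) * (if j = k then if j = 0 then pi else pi / 2 else 0))) {0..pi}"
      by (intro has_integral_sum has_integral_mult_right integral_cos_nat_cos_nat) auto
    then have "(L2_norm f)\<^sup>2 = (\<Sum>j\<le>N. \<Sum>k\<le>N. (w j \<bullet> w k) * (if j = k then if j = 0 then pi else pi / 2 else 0))"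
      unfolding continuous_L2(2)[OF fc] nsq by (rule integral_unique)
    also have "\<dots> = (\<Sum>j\<le>N. (norm (w j))\<^sup>2 * (if j = 0 then pi else pi / 2))"
      by (intro sum.cong refl) (simp add: power2_norm_eq_inner if_distrib[of "\<lambda>x. _ * x"] cong: if_cong)
    also have "\<dots> \<ge> (\<Sum>j\<le>N. (norm (w j))\<^sup>2 * 1)"
      using pi_gt3 by (intro sum_mono mult_left_mono) auto
    finally show ?thesis by (simp add: B_def)
  qed
  ultimately have "B \<le> B * (32768 * real CARD('n) * (kT R)\<^sup>2 / real N)" by linarith
  then have "B * real N \<le> B * (32768 * real CARD('n) * (kT R)\<^sup>2)"
    using N(2) by (simp add: field_simps)
  then show False using Bpos N(3) by simp
qed

text \<open>The upper bound for all finite subsets excludes an infinite set; only then can the lower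
  count be applied.\<close>

lemma eigenvalue_count:
  assumes N: "count_threshold R (real CARD('n)) \<le> real N"
  shows "finite {i \<in> I. lam i < (real N + 1/2)\<^sup>2}"
    "card {i \<in> I. lam i < (real N + 1/2)\<^sup>2} = CARD('n) * (N + 1)"
proof -
  let ?S = "{i \<in> I. lam i < (real N + 1/2)\<^sup>2}"
  have p: "0 \<le> (kQ R)\<^sup>2" "0 \<le> 128 * kE R" "0 \<le> 32768 * real CARD('n) * (kT R)\<^sup>2" using kE0 by simp_all
  have N1: "(kQ R)\<^sup>2 < real N" "128 * kE R \<le> real N" "32768 * real CARD('n) * (kT R)\<^sup>2 < real N" "0 < real N"
    using N p unfolding count_threshold_def by linarith+
  have le: "card F \<le> CARD('n) * (N + 1)" if "finite F" "F \<subseteq> ?S" for F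
    by (rule count_le[OF that(1) _ _ N1(1)]) (use that(2) in auto)
  show fin: "finite ?S"
  proof (rule ccontr)
    assume "infinite ?S"
    from infinite_arbitrarily_large[OF this, of "Suc (CARD('n) * (N + 1))"] le show False by fastforce
  qed
  have "card ?S \<le> CARD('n) * (N + 1)" by (rule le[OF fin]) simp
  moreover have "CARD('n) * (N + 1) \<le> card ?S" using N1 by (intro count_ge fin) auto
  ultimately show "card ?S = CARD('n) * (N + 1)" by simp
qed

end

subsection \<open>Bessel's inequality for the coefficients of the potential\<close>

text \<open>The squared distance of \<open>f\<close> to its partial sum, with coefficients
  \<open>2 / pi * m j\<close>, has a nonnegative integral. The factor 2 replaces
  \<open>pi / 2\<close>.\<close>

lemma Bessel_interval:
  fixes f :: "real \<Rightarrow> 'a::euclidean_space" and \<phi> :: "nat \<Rightarrow> real \<Rightarrow> real"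
  assumes f: "in_L2 f" and \<phi>: "\<And>j. continuous_on {0..pi} (\<phi> j)" and F: "finite F"
    and ort: "\<And>j k. j \<in> F \<Longrightarrow> k \<in> F \<Longrightarrow> ((\<lambda>x. \<phi> j x * \<phi> k x) has_integral (if j = k then pi / 2 else 0)) {0..pi}"
  shows "(\<Sum>j\<in>F. (norm (integral {0..pi} (\<lambda>x. \<phi> j x *\<^sub>R f x)))\<^sup>2) \<le> 2 * (L2_norm f)\<^sup>2"
proof -
  define m where "m j = integral {0..pi} (\<lambda>x. \<phi> j x *\<^sub>R f x)" for j
  define S where "S = (\<Sum>j\<in>F. (norm (m j))\<^sup>2)"
  have fabs: "f absolutely_integrable_on {0..pi}" by (rule absolutely_integrable_M_pi(1)[OF in_L2_integrable_M[OF f]])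
  have fi: "((\<lambda>x. \<phi> j x *\<^sub>R f x) has_integral m j) {0..pi}" for j
  proof -
    have "(\<lambda>x. \<phi> j x *\<^sub>R f x) absolutely_integrable_on {0..pi}"
    proof (rule absolutely_integrable_bounded_measurable_product[where h = "(*\<^sub>R)" and f = "\<phi> j", OF _ _ _ _ fabs])
      show "bilinear ((*\<^sub>R) :: real \<Rightarrow> 'a \<Rightarrow> 'a)"
        by (rule bilinear_conv_bounded_bilinear[THEN iffD2]) (rule bounded_bilinear_scaleR)
      show "\<phi> j \<in> borel_measurable (lebesgue_on {0..pi})"
        by (intro continuous_imp_measurable_on_sets_lebesgue \<phi>) simp
      show "bounded (\<phi> j ` {0..pi})" by (intro compact_imp_bounded compact_continuous_image \<phi>) simp
    qed simp
    then show ?thesis unfolding m_def by (intro integrable_integral) (simp add: absolutely_integrable_on_def)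
  qed
  have ff: "((\<lambda>x. (norm (f x))\<^sup>2) has_integral (L2_norm f)\<^sup>2) {0..pi}"
    using absolutely_integrable_M_pi[OF in_L2_integrable[OF f]]
    by (auto simp: L2_norm_power2 absolutely_integrable_on_def intro: integrable_integral)
  have fp: "((\<lambda>x. \<Sum>j\<in>F. (\<phi> j x *\<^sub>R f x) \<bullet> m j) has_integral S) {0..pi}"
  proof -
    have "((\<lambda>x. \<Sum>j\<in>F. (\<phi> j x *\<^sub>R f x) \<bullet> m j) has_integral (\<Sum>j\<in>F. m j \<bullet> m j)) {0..pi}"
    proof (rule has_integral_sum[OF F])
      fix j
      from has_integral_linear[OF fi bounded_linear_inner_left[of "m j"]]
      show "((\<lambda>x. (\<phi> j x *\<^sub>R f x) \<bullet> m j) has_integral m j \<bullet> m j) {0..pi}" by (simp add: o_def)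
    qed
    then show ?thesis by (simp add: S_def power2_norm_eq_inner)
  qed
  have pp: "((\<lambda>x. \<Sum>j\<in>F. \<Sum>k\<in>F. (m j \<bullet> m k) * (\<phi> j x * \<phi> k x)) has_integral (pi / 2 * S)) {0..pi}"
  proof -
    have "((\<lambda>x. \<Sum>j\<in>F. \<Sum>k\<in>F. (m j \<bullet> m k) * (\<phi> j x * \<phi> k x)) has_integral
        (\<Sum>j\<in>F. \<Sum>k\<in>F. (m j \<bullet> m k) * (if j = k then pi / 2 else 0))) {0..pi}"
      by (intro has_integral_sum F has_integral_mult_right ort)
    moreover have "(\<Sum>j\<in>F. \<Sum>k\<in>F. (m j \<bullet> m k) * (if j = k then pi / 2 else 0)) = pi / 2 * S"
      using F by (simp add: S_def power2_norm_eq_inner if_distrib[of "\<lambda>x. _ * x"] sum_distrib_left mult.commute cong: if_cong)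
    ultimately show ?thesis by (simp only:)
  qed
  have "((\<lambda>x. (norm (f x))\<^sup>2 - 4 / pi * (\<Sum>j\<in>F. (\<phi> j x *\<^sub>R f x) \<bullet> m j)
      + 4 / pi\<^sup>2 * (\<Sum>j\<in>F. \<Sum>k\<in>F. (m j \<bullet> m k) * (\<phi> j x * \<phi> k x)))
      has_integral ((L2_norm f)\<^sup>2 - 4 / pi * S + 4 / pi\<^sup>2 * (pi / 2 * S))) {0..pi}"
    by (intro has_integral_add has_integral_diff has_integral_mult_right ff fp pp)
  moreover have "(norm (f x))\<^sup>2 - 4 / pi * (\<Sum>j\<in>F. (\<phi> j x *\<^sub>R f x) \<bullet> m j)
      + 4 / pi\<^sup>2 * (\<Sum>j\<in>F. \<Sum>k\<in>F. (m j \<bullet> m k) * (\<phi> j x * \<phi> k x)) \<ge> 0" for x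
  proof -
    let ?p = "\<Sum>j\<in>F. \<phi> j x *\<^sub>R m j"
    have 1: "(\<Sum>j\<in>F. (\<phi> j x *\<^sub>R f x) \<bullet> m j) = f x \<bullet> ?p" by (simp add: inner_sum_right)
    have 2: "(\<Sum>j\<in>F. \<Sum>k\<in>F. (m j \<bullet> m k) * (\<phi> j x * \<phi> k x)) = ?p \<bullet> ?p"
      by (simp add: inner_sum_left inner_sum_right sum_distrib_left mult_ac inner_commute)
    have "0 \<le> (f x - (2 / pi) *\<^sub>R ?p) \<bullet> (f x - (2 / pi) *\<^sub>R ?p)" by simp
    also have "\<dots> = f x \<bullet> f x - 4 / pi * (f x \<bullet> ?p) + 4 / pi\<^sup>2 * (?p \<bullet> ?p)"
      unfolding inner_diff_left inner_diff_right inner_scaleR_left inner_scaleR_right inner_commute[of ?p "f x"]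
      by (simp add: power2_eq_square diff_divide_distrib)
    finally show ?thesis unfolding 1 2 power2_norm_eq_inner .
  qed
  ultimately have "0 \<le> (L2_norm f)\<^sup>2 - 4 / pi * S + 4 / pi\<^sup>2 * (pi / 2 * S)"
    by (rule has_integral_nonneg)
  also have "\<dots> = (L2_norm f)\<^sup>2 - 2 / pi * S" by (simp add: power2_eq_square)
  finally have "2 / pi * S \<le> (L2_norm f)\<^sup>2" by simp
  then have "S \<le> pi / 2 * (L2_norm f)\<^sup>2" by (simp add: field_simps)
  also have "\<dots> \<le> 2 * (L2_norm f)\<^sup>2" using pi_less_4 by (intro mult_right_mono) auto
  finally show ?thesis by (simp add: S_def m_def)
qed

lemma integral_sin_nat_sin_nat:
  assumes "0 < j" "0 < k"
  shows "((\<lambda>x. sin (real j * x) * sin (real k * x)) has_integral (if j = k then pi / 2 else 0)) {0..pi}"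
proof -
  have "((\<lambda>x. 1/2 * cos (of_int (int j - int k) * x) - 1/2 * cos (of_int (int j + int k) * x)) has_integral
      (1/2 * (if int j - int k = 0 then pi else 0) - 1/2 * (if int j + int k = 0 then pi else 0))) {0..pi}"
    by (intro has_integral_diff has_integral_mult_right has_integral_cos_int)
  moreover have "1/2 * cos (of_int (int j - int k) * x) - 1/2 * cos (of_int (int j + int k) * x)
      = sin (real j * x) * sin (real k * x)" for x
    by (simp add: sin_times_sin left_diff_distrib distrib_right diff_divide_distrib)
  ultimately have "((\<lambda>x. sin (real j * x) * sin (real k * x)) has_integral
      (1/2 * (if int j - int k = 0 then pi else 0) - 1/2 * (if int j + int k = 0 then pi else 0))) {0..pi}"
    by simp
  moreover have "1/2 * (if int j - int k = 0 then pi else 0) - 1/2 * (if int j + int k = 0 then pi else 0)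
      = (if j = k then pi / 2 else 0)" using assms by auto
  ultimately show ?thesis by (simp only:)
qed

context problem
begin

text \<open>The frequency \<open>2 * j\<close> in \<open>Qcos\<close> and \<open>Qsin\<close> is the
  double angle in the square of the cosine and in the product of sine and cosine; the factor
  \<open>x - pi\<close> of \<open>Qsin\<close> comes from the test function.\<close>

definition Qcos :: "nat \<Rightarrow> complex^'n^'n" where
  "Qcos j = integral {0..pi} (\<lambda>x. cos (real (2 * j) * x) *\<^sub>R Q x)"

definition Qsin :: "nat \<Rightarrow> complex^'n^'n" where
  "Qsin j = integral {0..pi} (\<lambda>x. sin (real (2 * j) * x) *\<^sub>R ((x - pi) *\<^sub>R Q x))"

text \<open>One square-summable majorant for all remainders; the last summand absorbs every error of
  order \<open>1 / j\<close>.\<close>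

definition ss :: "nat \<Rightarrow> real" where
  "ss j = norm (Qcos j) + norm (Qsin j) + 1 / real j"

lemma Qcos_Bessel:
  assumes "finite F" "F \<subseteq> {1..}"
  shows "(\<Sum>j\<in>F. (norm (Qcos j))\<^sup>2) \<le> 2 * R\<^sup>2"
proof -
  have "(\<Sum>j\<in>F. (norm (Qcos j))\<^sup>2) \<le> 2 * (L2_norm Q)\<^sup>2"
    unfolding Qcos_def
  proof (rule Bessel_interval[OF Q_L2 _ assms(1)])
    fix j k assume "j \<in> F" "k \<in> F"
    then have "1 \<le> j" "1 \<le> k" using assms(2) by auto
    then show "((\<lambda>x. cos (real (2 * j) * x) * cos (real (2 * k) * x)) has_integral (if j = k then pi / 2 else 0)) {0..pi}"
      using integral_cos_nat_cos_nat[of "2 * j" "2 * k"] by (auto split: if_splits)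
  qed (intro continuous_intros)
  also have "\<dots> \<le> 2 * R\<^sup>2" using norms_le(1) by (intro mult_left_mono power_mono) auto
  finally show ?thesis .
qed

lemma Qsin_Bessel:
  assumes "finite F" "F \<subseteq> {1..}"
  shows "(\<Sum>j\<in>F. (norm (Qsin j))\<^sup>2) \<le> 32 * R\<^sup>2"
proof -
  have fL2: "in_L2 (\<lambda>x. (x - pi) *\<^sub>R Q x)" and fn: "L2_norm (\<lambda>x. (x - pi) *\<^sub>R Q x) \<le> 4 * R"
  proof -
    have m: "(\<lambda>x. x - pi) \<in> borel_measurable M_pi"
      by (intro continuous_imp_measurable_on_sets_lebesgue continuous_intros) auto
    have meas: "(\<lambda>x. (x - pi) *\<^sub>R Q x) \<in> borel_measurable M_pi"
      by (intro borel_measurable_scaleR m in_L2_measurable[OF Q_L2])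
    have le: "norm ((x - pi) *\<^sub>R Q x) \<le> norm (4 *\<^sub>R Q x)" if "x \<in> {0<..<pi}" for x
      using that pi_less_4 by (simp add: mult_right_mono)
    show L: "in_L2 (\<lambda>x. (x - pi) *\<^sub>R Q x)" by (rule in_L2_mono[OF in_L2_scaleR[OF Q_L2] meas le])
    have "L2_norm (\<lambda>x. (x - pi) *\<^sub>R Q x) \<le> L2_norm (\<lambda>x. 4 *\<^sub>R Q x)"
      by (rule L2_norm_mono[OF in_L2_scaleR[OF Q_L2] L le])
    then show "L2_norm (\<lambda>x. (x - pi) *\<^sub>R Q x) \<le> 4 * R" using norms_le(1) unfolding L2_norm_scaleR by simp
  qed
  have "(\<Sum>j\<in>F. (norm (Qsin j))\<^sup>2) \<le> 2 * (L2_norm (\<lambda>x. (x - pi) *\<^sub>R Q x))\<^sup>2"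
    unfolding Qsin_def
  proof (rule Bessel_interval[OF fL2 _ assms(1)])
    fix j k assume "j \<in> F" "k \<in> F"
    then have "0 < 2 * j" "0 < 2 * k" using assms(2) by auto
    then show "((\<lambda>x. sin (real (2 * j) * x) * sin (real (2 * k) * x)) has_integral (if j = k then pi / 2 else 0)) {0..pi}"
      using integral_sin_nat_sin_nat[of "2 * j" "2 * k"] by simp
  qed (intro continuous_intros)
  also have "\<dots> \<le> 2 * (4 * R)\<^sup>2" by (intro mult_left_mono power_mono fn) auto
  finally show ?thesis by (simp add: power_mult_distrib)
qed

end

subsection \<open>Asymptotics\<close>

text \<open>Distance of an eigenfunction to \<open>cos (j * x)\<close>, times \<open>j\<close>:
  \<open>2 * kE\<close> for passing to \<open>cosl\<close>, and \<open>64 = 16 * 4\<close> for the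
  frequency shift on an interval shorter than 4.\<close>

definition kZ :: "real \<Rightarrow> real" where "kZ R = 2 * kE R + 64 * kT R * kV R"
text \<open>Both summands carry the factor 16, the inverse of the lower bound for the cosine
  moment.\<close>

definition kD :: "real \<Rightarrow> real" where "kD R = 8 * kV R + 48 * R * kZ R"
definition kU :: "real \<Rightarrow> real" where "kU R = kV R + 8 * R * kZ R + 8 * kD R"

context problem
begin

lemma kT0: "0 \<le> kT R" using norms_le(4) kY1 kV1 by (simp add: kT_def)
lemma kZ0: "0 \<le> kZ R" using kE0 kT0 kV1 by (simp add: kZ_def)
lemma kD0: "0 \<le> kD R" using norms_le(4) kZ0 kV1 by (simp add: kD_def)
lemma kU0: "0 \<le> kU R" using norms_le(4) kZ0 kV1 kD0 by (simp add: kU_def)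

lemma Q_weighted_integral:
  assumes c: "continuous_on {0..pi} c"
  shows "((\<lambda>x. Q x *v (c x *\<^sub>R v)) has_integral (integral {0..pi} (\<lambda>x. c x *\<^sub>R Q x)) *v v) {0..pi}"
proof -
  have "(\<lambda>x. c x *\<^sub>R Q x) absolutely_integrable_on {0..pi}"
  proof (rule absolutely_integrable_bounded_measurable_product[where h = "(*\<^sub>R)" and f = c, OF _ _ _ _ Q_abs_int])
    show "bilinear ((*\<^sub>R) :: real \<Rightarrow> complex^'n^'n \<Rightarrow> complex^'n^'n)"
      by (rule bilinear_conv_bounded_bilinear[THEN iffD2]) (rule bounded_bilinear_scaleR)
    show "c \<in> borel_measurable (lebesgue_on {0..pi})"
      by (intro continuous_imp_measurable_on_sets_lebesgue c) simp
    show "bounded (c ` {0..pi})" by (intro compact_imp_bounded compact_continuous_image c) simp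
  qed simp
  then have "((\<lambda>x. c x *\<^sub>R Q x) has_integral integral {0..pi} (\<lambda>x. c x *\<^sub>R Q x)) {0..pi}"
    by (intro integrable_integral) (simp add: absolutely_integrable_on_def)
  from has_integral_linear[OF this bounded_bilinear.bounded_linear_left[OF bounded_bilinear_matrix_vector, of v]]
  show ?thesis
    by (simp add: o_def bounded_bilinear.scaleR_left[OF bounded_bilinear_matrix_vector] matrix_vector_mult_scaleR)
qed

text \<open>With trigonometric \<open>c\<close> and \<open>d\<close> the first term is a Fourier
  coefficient of \<open>Q\<close> acting on a vector; the second is as small as the error of
  approximating \<open>y\<close>.\<close>

lemma qmom_split:
  assumes c: "continuous_on {0..pi} c" and d: "continuous_on {0..pi} d" and y: "continuous_on {0..pi} y"
  shows "qmom c y = (integral {0..pi} (\<lambda>x. (c x * d x) *\<^sub>R Q x)) *v v + qmom c (\<lambda>x. y x - d x *\<^sub>R v)"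
proof -
  have "(\<lambda>t. Q t *v (c t *\<^sub>R (y t - d t *\<^sub>R v))) absolutely_integrable_on {0..pi}"
    by (intro Q_mult_abs_int continuous_intros c d y) simp
  then have "((\<lambda>t. Q t *v (c t *\<^sub>R (y t - d t *\<^sub>R v))) has_integral qmom c (\<lambda>x. y x - d x *\<^sub>R v)) {0..pi}"
    unfolding qmom_def by (intro integrable_integral) (simp add: absolutely_integrable_on_def)
  from has_integral_add[OF Q_weighted_integral[of "\<lambda>x. c x * d x" v] this]
  show ?thesis unfolding qmom_def[of c y]
    by (intro integral_unique)
       (simp add: c d continuous_on_mult scaleR_diff_right matrix_vector_mult_diff_distrib)
qed

end

lemma cos_diff_le: "\<bar>cos a - cos b\<bar> \<le> \<bar>a - b\<bar>" for a b :: real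
proof -
  have "norm (cos a - cos b) \<le> 1 * norm (a - b)"
    by (rule field_differentiable_bound[of UNIV cos "\<lambda>x. - sin x"])
       (auto intro!: derivative_eq_intros)
  then show ?thesis by simp
qed

section \<open>Eigenvalues whose root is within \<open>1/2\<close> of an integer\<close>

locale eigenvalue_near = spectral_problem R Q h H I lam Y
  for R :: real and Q :: "real \<Rightarrow> complex^'n^'n" and h H :: "complex^'n^'n"
    and I :: "'i set" and lam :: "'i \<Rightarrow> real" and Y :: "'i \<Rightarrow> real \<Rightarrow> complex^'n" +
  fixes j :: nat
  assumes j_large: "128 * kE R + 1 \<le> real j"
begin

definition near :: "'i \<Rightarrow> bool" where
  "near i \<longleftrightarrow> i \<in> I \<and> 0 < lam i \<and> \<bar>sqrt (lam i) - real j\<bar> \<le> 1/2"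

text \<open>The error against the integer frequency rather than \<open>sqrt (lam i)\<close>: integer
  frequencies lead to Fourier coefficients of \<open>Q\<close> and to orthogonal cosines.\<close>

definition E :: "'i \<Rightarrow> real \<Rightarrow> complex^'n" where
  "E i x = Y i x - cos (real j * x) *\<^sub>R Y i 0"

lemma j1: "1 \<le> real j" using j_large kE0 by linarith

lemma nearD:
  assumes "near i"
  shows "i \<in> I" "0 < lam i" "real j / 2 \<le> sqrt (lam i)" "1/16 \<le> norm (cmom j (Y i))"
proof -
  show i: "i \<in> I" "0 < lam i" using assms by (auto simp: near_def)
  have c: "\<bar>sqrt (lam i) - real j\<bar> \<le> 1/2" using assms by (simp add: near_def)
  then show "real j / 2 \<le> sqrt (lam i)" using j1 by linarith
  have "64 * kE R \<le> sqrt (lam i)" using c j_large kE0 by linarith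
  with i c j1 show "1/16 \<le> norm (cmom j (Y i))" by (intro cmom_lower) auto
qed

lemma near_diff_le:
  assumes "near i" "\<bar>lam i - (real j)\<^sup>2\<bar> \<le> b"
  shows "\<bar>sqrt (lam i) - real j\<bar> \<le> b / real j"
proof -
  have "lam i - (real j)\<^sup>2 = (sqrt (lam i) - real j) * (sqrt (lam i) + real j)"
    using nearD(2)[OF assms(1)] by (simp add: algebra_simps power2_eq_square)
  then have "\<bar>sqrt (lam i) - real j\<bar> * (sqrt (lam i) + real j) \<le> b"
    using assms(2) nearD(2)[OF assms(1)] by (simp add: abs_mult)
  moreover have "\<bar>sqrt (lam i) - real j\<bar> * real j \<le> \<bar>sqrt (lam i) - real j\<bar> * (sqrt (lam i) + real j)"
    using nearD(2)[OF assms(1)] by (intro mult_left_mono) auto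
  ultimately show ?thesis using j1 by (simp add: field_simps)
qed

text \<open>The cosine identity divided by the moment, which is at least \<open>1/16\<close>. The
  bounded error places \<open>sqrt (lam i)\<close> within order \<open>1 / j\<close> of
  \<open>j\<close>, as the estimate of \<open>E\<close> and then \<open>near_fine\<close>
  presuppose.\<close>

lemma near_rough:
  assumes "near i"
  shows "\<bar>lam i - (real j)\<^sup>2\<bar> \<le> 16 * kT R"
proof -
  have "\<bar>lam i - (real j)\<^sup>2\<bar> * (1/16) \<le> \<bar>lam i - (real j)\<^sup>2\<bar> * norm (cmom j (Y i))"
    by (intro mult_left_mono nearD(4)[OF assms]) simp
  also have "\<dots> \<le> kT R" using nearD[OF assms] by (intro cmom_upper) auto
  finally show ?thesis by simp
qed

lemma E_cont: "i \<in> I \<Longrightarrow> continuous_on {0..pi} (E i)"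
  unfolding E_def by (intro continuous_intros Y_cont)

lemma E_le:
  assumes n: "near i" and x: "x \<in> {0..pi}"
  shows "norm (E i x) \<le> kZ R / real j"
proof -
  let ?r = "sqrt (lam i)"
  have i: "i \<in> I" "0 < lam i" using nearD[OF n] by auto
  have "norm (Y i x - cosl (lam i) x *\<^sub>R Y i 0) \<le> kE R / ?r"
    by (rule norm_diff_cosl_le[OF Y_sol[OF i(1)] Y_norm[OF i(1)] i(2) x])
  also have "\<dots> \<le> kE R / (real j / 2)"
    using nearD(3)[OF n] j1 kE0 i(2) by (intro divide_left_mono mult_pos_pos) auto
  finally have 1: "norm (Y i x - cosl (lam i) x *\<^sub>R Y i 0) \<le> 2 * kE R / real j" by (simp add: mult.commute)
  have "\<bar>cosl (lam i) x - cos (real j * x)\<bar> \<le> \<bar>?r * x - real j * x\<bar>"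
    using i(2) cos_diff_le[of "?r * x" "real j * x"] by (simp add: cosl_def)
  also have "\<dots> = \<bar>?r - real j\<bar> * x" using x by (simp add: abs_mult flip: left_diff_distrib)
  also have "\<dots> \<le> 16 * kT R / real j * 4"
    using near_diff_le[OF n near_rough[OF n]] x pi_less_4 kT0 j1 by (intro mult_mono) auto
  finally have "\<bar>cosl (lam i) x - cos (real j * x)\<bar> * norm (Y i 0) \<le> 16 * kT R / real j * 4 * kV R"
    using norm_initial_le[OF Y_sol[OF i(1)] Y_norm[OF i(1)]] kT0 j1 by (intro mult_mono) auto
  then have 2: "norm ((cosl (lam i) x - cos (real j * x)) *\<^sub>R Y i 0) \<le> 64 * kT R * kV R / real j" by simp
  have "E i x = (Y i x - cosl (lam i) x *\<^sub>R Y i 0) + (cosl (lam i) x - cos (real j * x)) *\<^sub>R Y i 0"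
    by (simp add: E_def scaleR_diff_left)
  then have "norm (E i x) \<le> 2 * kE R / real j + 64 * kT R * kV R / real j"
    using norm_triangle_le[OF add_mono[OF 1 2]] by simp
  then show ?thesis by (simp add: kZ_def add_divide_distrib)
qed

lemma E_norm:
  assumes n: "near i"
  shows "L2_norm (E i) \<le> 2 * kZ R / real j"
proof -
  have b0: "0 \<le> kZ R / real j" using kZ0 j1 by simp
  have "L2_norm (E i) \<le> L2_norm (\<lambda>x. (kZ R / real j) *\<^sub>R (1 :: real))"
  proof (rule L2_norm_mono)
    fix x assume "x \<in> {0<..<pi}"
    then show "norm (E i x) \<le> norm ((kZ R / real j) *\<^sub>R (1 :: real))"
      using E_le[OF n, of x] kZ0 by simp
  qed (intro continuous_L2 continuous_intros E_cont nearD(1)[OF n])+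
  also have "\<dots> = kZ R / real j * sqrt pi" using kZ0 unfolding L2_norm_scaleR by (simp add: L2_norm_one)
  also have "\<dots> \<le> kZ R / real j * 2" by (intro mult_left_mono sqrt_pi_le b0)
  finally show ?thesis by (simp add: mult.commute)
qed

definition D :: real where "D = kD R * (norm (Qcos j) + 1 / real j)"

text \<open>The terms of order one cancel because \<open>h + H + 1/2 \<integral>Q = 0\<close>.\<close>

lemma near_fine:
  assumes n: "near i"
  shows "\<bar>lam i - (real j)\<^sup>2\<bar> \<le> D"
proof -
  have i: "i \<in> I" "0 < lam i" using nearD[OF n] by auto
  have R0: "0 \<le> R" by (rule norms_le(4))
  let ?v = "Y i 0"
  have v: "norm ?v \<le> kV R" by (rule norm_initial_le[OF Y_sol[OF i(1)] Y_norm[OF i(1)]])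
  let ?q = "qmom (\<lambda>x. cos (real j * x)) (E i)"
  \<comment> \<open>The double angle formula separates the mean of \<open>Q\<close> from the Fourier
    coefficient \<open>Qcos j\<close>.\<close>
  have "integral {0..pi} (\<lambda>x. (cos (real j * x) * cos (real j * x)) *\<^sub>R Q x)
      = (1/2) *\<^sub>R integral {0..pi} Q + (1/2) *\<^sub>R Qcos j"
  proof (rule integral_unique)
    have sq: "(cos (real j * x) * cos (real j * x)) *\<^sub>R Q x
        = (1/2) *\<^sub>R Q x + (1/2) *\<^sub>R (cos (real (2 * j) * x) *\<^sub>R Q x)" for x
    proof -
      have "cos (real j * x) * cos (real j * x) = 1/2 + 1/2 * cos (real (2 * j) * x)"
        using cos_double_cos[of "real j * x"] by (simp add: power2_eq_square mult.assoc diff_divide_distrib)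
      then show ?thesis by (simp add: scaleR_add_left)
    qed
    have "(\<lambda>x. cos (real (2 * j) * x) *\<^sub>R Q x) absolutely_integrable_on {0..pi}"
    proof (rule absolutely_integrable_bounded_measurable_product[where h = "(*\<^sub>R)" and f = "\<lambda>x. cos (real (2 * j) * x)", OF _ _ _ _ Q_abs_int])
      show "bilinear ((*\<^sub>R) :: real \<Rightarrow> complex^'n^'n \<Rightarrow> complex^'n^'n)"
        by (rule bilinear_conv_bounded_bilinear[THEN iffD2]) (rule bounded_bilinear_scaleR)
      show "(\<lambda>x. cos (real (2 * j) * x)) \<in> borel_measurable (lebesgue_on {0..pi})"
        by (intro continuous_imp_measurable_on_sets_lebesgue continuous_intros) simp
      show "bounded ((\<lambda>x. cos (real (2 * j) * x)) ` {0..pi})"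
        by (intro compact_imp_bounded compact_continuous_image continuous_intros) simp
    qed simp
    then have "((\<lambda>x. cos (real (2 * j) * x) *\<^sub>R Q x) has_integral Qcos j) {0..pi}"
      unfolding Qcos_def by (intro integrable_integral) (simp add: absolutely_integrable_on_def)
    moreover have "(Q has_integral integral {0..pi} Q) {0..pi}"
      using Q_abs_int by (intro integrable_integral) (simp add: absolutely_integrable_on_def)
    ultimately show "((\<lambda>x. (cos (real j * x) * cos (real j * x)) *\<^sub>R Q x) has_integral
        (1/2) *\<^sub>R integral {0..pi} Q + (1/2) *\<^sub>R Qcos j) {0..pi}"
      unfolding sq by (intro has_integral_add has_integral_cmul)
  qed
  then have q: "qmom (\<lambda>x. cos (real j * x)) (Y i)
      = ((1/2) *\<^sub>R integral {0..pi} Q) *v ?v + ((1/2) *\<^sub>R Qcos j) *v ?v + ?q"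
    using qmom_split[OF trig_cont(1) trig_cont(1) Y_cont[OF i(1)], of j j ?v]
    by (simp add: E_def[abs_def] matrix_vector_mult_add_rdistrib)
  have Ypi: "Y i pi = (-1) ^ j *\<^sub>R ?v + E i pi" by (simp add: E_def cos_npi)
  \<comment> \<open>The sign in \<open>Y i pi\<close> meets the sign of the boundary term, so
    \<open>H\<close> acts on the initial value with coefficient 1 whatever the parity of
    \<open>j\<close>.\<close>
  have sgn: "(-1) ^ j * (-1) ^ j = (1 :: real)" by (simp flip: power_mult_distrib)
  have mean: "((1/2) *\<^sub>R integral {0..pi} Q) *v ?v + H *v ?v + h *v ?v = 0"
    using arg_cong[OF mean_zero, of "\<lambda>A. A *v ?v"] by (simp add: matrix_vector_mult_add_rdistrib add_ac)
  have "(lam i - (real j)\<^sup>2) *\<^sub>R cmom j (Y i)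
      = (((1/2) *\<^sub>R integral {0..pi} Q) *v ?v + H *v ?v + h *v ?v)
        + (((1/2) *\<^sub>R Qcos j) *v ?v + ?q + (-1) ^ j *\<^sub>R (H *v E i pi))"
    unfolding cos_moment_identity(1)[OF bvp[OF i(1)]] q Ypi
    by (simp add: matrix_vector_right_distrib matrix_vector_mult_scaleR scaleR_add_right sgn)
  then have id: "(lam i - (real j)\<^sup>2) *\<^sub>R cmom j (Y i) = ((1/2) *\<^sub>R Qcos j) *v ?v + ?q + (-1) ^ j *\<^sub>R (H *v E i pi)"
    unfolding mean by simp
  have 1: "norm (((1/2) *\<^sub>R Qcos j) *v ?v) \<le> 1/2 * norm (Qcos j) * kV R"
    using norm_matrix_vector_mult_le[of "(1/2) *\<^sub>R Qcos j" ?v] mult_left_mono[OF v, of "1/2 * norm (Qcos j)"] by simp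
  have 2: "norm ?q \<le> R * (1 * (2 * kZ R / real j))"
    using norm_qmom_le[OF trig_cont(1) _ E_cont[OF i(1)], of j 1] mult_left_mono[OF E_norm[OF n] R0] by simp
  have 3: "norm ((-1) ^ j *\<^sub>R (H *v E i pi)) \<le> R * (kZ R / real j)"
    using norm_H[of "E i pi"] mult_left_mono[OF E_le[OF n, of pi] R0] by (simp add: power_abs)
  have "\<bar>lam i - (real j)\<^sup>2\<bar> * (1/16) \<le> \<bar>lam i - (real j)\<^sup>2\<bar> * norm (cmom j (Y i))"
    by (intro mult_left_mono nearD(4)[OF n]) simp
  also have "\<dots> = norm (((1/2) *\<^sub>R Qcos j) *v ?v + ?q + (-1) ^ j *\<^sub>R (H *v E i pi))"
    by (simp flip: id)
  also have "\<dots> \<le> 1/2 * norm (Qcos j) * kV R + R * (1 * (2 * kZ R / real j)) + R * (kZ R / real j)"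
    by (intro norm_triangle_mono 1 2 3)
  finally have "\<bar>lam i - (real j)\<^sup>2\<bar> \<le> 8 * kV R * norm (Qcos j) + 48 * R * kZ R * (1 / real j)" by simp
  also have "\<dots> \<le> kD R * norm (Qcos j) + kD R * (1 / real j)"
    using kV1 kZ0 R0 j1 by (intro add_mono mult_right_mono) (auto simp: kD_def)
  finally show ?thesis by (simp add: D_def distrib_left)
qed

abbreviation s :: real where "s \<equiv> ss j"

lemma D_le: "D \<le> kD R * s"
  unfolding D_def ss_def using kD0 by (intro mult_left_mono) auto

text \<open>
  The test function \<open>g x = (x - pi) * sin (j * x)\<close> satisfies \<open>- g'' - j\<^sup>2 g = - 2 j cos (j x)\<close>, so it
  gains a factor \<open>1 / j\<close> even when the eigenvalue coincides with \<open>j\<^sup>2\<close>.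
\<close>

lemma cmom_initial:
  assumes n: "near i"
  shows "norm (cmom j (Y i) - (pi / 2) *\<^sub>R Y i 0) \<le> kU R * s / real j"
proof -
  have i: "i \<in> I" "0 < lam i" using nearD[OF n] by auto
  have R0: "0 \<le> R" by (rule norms_le(4))
  let ?v = "Y i 0" and ?c = "\<lambda>x. (x - pi) * sin (real j * x)" and ?m = "lam i - (real j)\<^sup>2"
  have v: "norm ?v \<le> kV R" by (rule norm_initial_le[OF Y_sol[OF i(1)] Y_norm[OF i(1)]])
  have cc: "continuous_on {0..pi} ?c" by (intro continuous_intros)
  have cb: "\<bar>?c x\<bar> \<le> 4" if "x \<in> {0..pi}" for x
    unfolding abs_mult using that pi_less_4 mult_mono[of "\<bar>x - pi\<bar>" 4 "\<bar>sin (real j * x)\<bar>" 1] by auto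
  note Yc = Y_cont[OF i(1)]
  have ai: "(\<lambda>t. Q t *v (d t *\<^sub>R Y i t)) integrable_on {0..pi}" if "continuous_on {0..pi} d" for d
    using Q_mult_abs_int[of pi "\<lambda>t. d t *\<^sub>R Y i t"] that Yc by (auto simp: absolutely_integrable_on_def intro!: continuous_intros)
  have qc: "qmom ?c (Y i) = qmom (\<lambda>t. t * sin (real j * t)) (Y i) - pi *\<^sub>R qmom (\<lambda>t. sin (real j * t)) (Y i)"
  proof -
    have "((\<lambda>t. Q t *v ((t * sin (real j * t)) *\<^sub>R Y i t) - pi *\<^sub>R (Q t *v (sin (real j * t) *\<^sub>R Y i t)))
       has_integral (qmom (\<lambda>t. t * sin (real j * t)) (Y i) - pi *\<^sub>R qmom (\<lambda>t. sin (real j * t)) (Y i))) {0..pi}"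
      unfolding qmom_def by (intro has_integral_diff has_integral_cmul integrable_integral ai trig_cont)
    then show ?thesis unfolding qmom_def[of ?c]
      by (intro integral_unique) (simp add: matrix_vector_mult_scaleR matrix_vector_mult_diff_distrib left_diff_distrib scaleR_diff_left)
  qed
  have wc: "wmom ?c (Y i) = wmom (\<lambda>t. t * sin (real j * t)) (Y i) - pi *\<^sub>R wmom (\<lambda>t. sin (real j * t)) (Y i)"
  proof -
    have "((\<lambda>t. (t * sin (real j * t)) *\<^sub>R Y i t - pi *\<^sub>R (sin (real j * t) *\<^sub>R Y i t))
       has_integral (wmom (\<lambda>t. t * sin (real j * t)) (Y i) - pi *\<^sub>R wmom (\<lambda>t. sin (real j * t)) (Y i))) {0..pi}"
      unfolding wmom_def
      by (intro has_integral_diff has_integral_cmul integrable_integral integrable_continuous_real continuous_intros Yc)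
    then show ?thesis unfolding wmom_def[of ?c]
      by (intro integral_unique) (simp add: left_diff_distrib scaleR_diff_left)
  qed
  note id = cos_moment_identity(2,3)[OF bvp[OF i(1)], of j]
  \<comment> \<open>Subtracting \<open>pi\<close> times the sine identity cancels
    \<open>Y i pi\<close> and leaves the initial value against the cosine moment, both multiplied by
    \<open>j\<close>.\<close>
  have "?m *\<^sub>R wmom ?c (Y i) = qmom ?c (Y i) - (2 * real j) *\<^sub>R cmom j (Y i) + (real j * pi) *\<^sub>R ?v"
    unfolding wc qc scaleR_diff_right scaleR_left_commute[of ?m pi] id by (simp add: scaleR_diff_right scaleR_add_right mult_ac)
  then have "(2 * real j) *\<^sub>R (cmom j (Y i) - (pi / 2) *\<^sub>R ?v) = qmom ?c (Y i) - ?m *\<^sub>R wmom ?c (Y i)"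
    by (simp add: scaleR_diff_right mult_ac algebra_simps)
  then have "norm ((2 * real j) *\<^sub>R (cmom j (Y i) - (pi / 2) *\<^sub>R ?v)) = norm (qmom ?c (Y i) - ?m *\<^sub>R wmom ?c (Y i))"
    by (simp only:)
  then have "2 * real j * norm (cmom j (Y i) - (pi / 2) *\<^sub>R ?v) = norm (qmom ?c (Y i) - ?m *\<^sub>R wmom ?c (Y i))"
    by simp
  also have "\<dots> \<le> norm (qmom ?c (Y i)) + norm (?m *\<^sub>R wmom ?c (Y i))" by (rule norm_triangle_ineq4)
  also have "norm (?m *\<^sub>R wmom ?c (Y i)) \<le> D * 8"
  proof -
    have "norm (wmom ?c (Y i)) \<le> 4 * sqrt pi * L2_norm (Y i)" by (rule norm_wmom_le[OF cc cb Yc])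
    also have "\<dots> \<le> 8" using sqrt_pi_le by (simp add: Y_norm[OF i(1)])
    finally show ?thesis unfolding norm_scaleR using near_fine[OF n] by (intro mult_mono) auto
  qed
  also have "norm (qmom ?c (Y i)) \<le> 1/2 * norm (Qsin j) * kV R + R * (4 * (2 * kZ R / real j))"
  proof -
    have "(\<lambda>x. (?c x * cos (real j * x)) *\<^sub>R Q x) = (\<lambda>x. (1/2) *\<^sub>R (sin (real (2 * j) * x) *\<^sub>R ((x - pi) *\<^sub>R Q x)))"
    proof (intro ext)
      fix x
      have "sin (real (2 * j) * x) = 2 * sin (real j * x) * cos (real j * x)"
        using sin_double[of "real j * x"] by (simp add: mult.assoc)
      then show "(?c x * cos (real j * x)) *\<^sub>R Q x = (1/2) *\<^sub>R (sin (real (2 * j) * x) *\<^sub>R ((x - pi) *\<^sub>R Q x))"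
        by simp
    qed
    then have "integral {0..pi} (\<lambda>x. (?c x * cos (real j * x)) *\<^sub>R Q x) = (1/2) *\<^sub>R Qsin j"
      by (simp add: Qsin_def del: scaleR_scaleR)
    then have "qmom ?c (Y i) = ((1/2) *\<^sub>R Qsin j) *v ?v + qmom ?c (E i)"
      using qmom_split[OF cc trig_cont(1) Yc, of j ?v] by (simp add: E_def[abs_def])
    moreover have "norm (((1/2) *\<^sub>R Qsin j) *v ?v) \<le> 1/2 * norm (Qsin j) * kV R"
      using norm_matrix_vector_mult_le[of "(1/2) *\<^sub>R Qsin j" ?v] mult_left_mono[OF v, of "1/2 * norm (Qsin j)"] by simp
    moreover have "norm (qmom ?c (E i)) \<le> R * (4 * (2 * kZ R / real j))"
      using norm_qmom_le[OF cc cb E_cont[OF i(1)]] mult_left_mono[OF E_norm[OF n], of "R * 4"] R0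
      by (simp add: mult_ac)
    ultimately show ?thesis using norm_triangle_ineq[of "((1/2) *\<^sub>R Qsin j) *v ?v" "qmom ?c (E i)"] by simp
  qed
  finally have "2 * real j * norm (cmom j (Y i) - (pi / 2) *\<^sub>R ?v)
      \<le> 1/2 * kV R * norm (Qsin j) + 8 * R * kZ R * (1 / real j) + 8 * kD R * (norm (Qcos j) + 1 / real j)"
    by (simp add: D_def mult_ac)
  also have "\<dots> \<le> 2 * (kU R * s)"
  proof -
    define a b c where "a = norm (Qcos j)" and "b = norm (Qsin j)" and "c = 1 / real j"
    have p: "0 \<le> a" "0 \<le> b" "0 \<le> c" by (simp_all add: a_def b_def c_def)
    have "0 \<le> kV R * a" "0 \<le> kV R * b" "0 \<le> kV R * c" "0 \<le> (R * kZ R) * a" "0 \<le> (R * kZ R) * b" "0 \<le> (R * kZ R) * c"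
      "0 \<le> kD R * a" "0 \<le> kD R * b" "0 \<le> kD R * c"
      using p kV1 R0 kZ0 kD0 by simp_all
    then have "1/2 * kV R * b + 8 * R * kZ R * c + 8 * kD R * (a + c) \<le> 2 * (kU R * (a + b + c))"
      by (simp add: kU_def algebra_simps)
    then show ?thesis by (simp add: ss_def a_def b_def c_def)
  qed
  finally have "2 * real j * norm (cmom j (Y i) - (pi / 2) *\<^sub>R ?v) \<le> 2 * (kU R * s)" .
  then show ?thesis using j1 by (simp add: field_simps)
qed

text \<open>Each \<open>E\<close> is only of order \<open>1 / j\<close>. With \<open>W\<close> for
  the cosine part, the inner product of \<open>Y i\<close> and \<open>Y i'\<close> equals
  \<open>(W, Y i') + (Y i, W') - (W, W') + (E i, E i')\<close>, in which \<open>E\<close> occurs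
  explicitly only quadratically. The mixed terms are cosine moments, which
  \<open>cmom_initial\<close> gives up to order \<open>s / j\<close>.\<close>

lemma norming_products:
  assumes n: "near i" and n': "near i'"
  shows "cmod (cdot (Y i 0) (Y i' 0) - (if i = i' then 2 / pi else 0)) \<le> (2 * kV R * kU R + 4 * (kZ R)\<^sup>2) * s / real j"
proof -
  have i: "i \<in> I" "i' \<in> I" using nearD[OF n] nearD[OF n'] by auto
  let ?v = "Y i 0" and ?v' = "Y i' 0" and ?\<delta> = "if i = i' then 1 else 0 :: complex"
  have v: "norm ?v \<le> kV R" "norm ?v' \<le> kV R"
    by (rule norm_initial_le[OF Y_sol Y_norm]; fact i)+
  let ?W = "\<lambda>x. cos (real j * x) *\<^sub>R ?v" and ?W' = "\<lambda>x. cos (real j * x) *\<^sub>R ?v'"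
  have L: "in_L2 ?W" "in_L2 ?W'" "in_L2 (Y i)" "in_L2 (Y i')" "in_L2 (E i)" "in_L2 (E i')"
    by (intro continuous_L2 continuous_intros Y_cont E_cont i)+
  have YE: "Y i = (\<lambda>x. ?W x + E i x)" "Y i' = (\<lambda>x. ?W' x + E i' x)" by (auto simp: E_def)
  have WY: "L2_inner ?W (Y i') = cdot ?v (cmom j (Y i'))"
    unfolding cmom_wmom by (rule L2_inner_scaleR_const[OF trig_cont(1) Y_cont[OF i(2)]])
  have W'Y: "L2_inner ?W' (Y i) = cdot ?v' (cmom j (Y i))"
    unfolding cmom_wmom by (rule L2_inner_scaleR_const[OF trig_cont(1) Y_cont[OF i(1)]])
  have WW: "L2_inner ?W ?W' = (pi / 2) *\<^sub>R cdot ?v ?v'"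
  proof -
    have "((\<lambda>x. cos (real j * x) *\<^sub>R ?W' x) has_integral (pi / 2) *\<^sub>R ?v') {0..pi}"
      using has_integral_scaleR_left[OF integral_cos_nat_cos_nat[of j j], of ?v'] j1 by (auto split: if_splits)
    then have "wmom (\<lambda>x. cos (real j * x)) ?W' = (pi / 2) *\<^sub>R ?v'"
      unfolding wmom_def by (rule integral_unique)
    moreover have "L2_inner ?W ?W' = cdot ?v (wmom (\<lambda>x. cos (real j * x)) ?W')"
      by (rule L2_inner_scaleR_const[OF trig_cont(1)]) (intro continuous_intros)
    ultimately show ?thesis by (simp add: cdot_scaleR_right)
  qed
  have "L2_inner (Y i) (Y i') = L2_inner ?W (Y i') + L2_inner (E i) (Y i')"
    using L2_inner_add_left[OF L(4) L(1) L(5)] YE(1) by simp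
  moreover have "L2_inner (E i) (Y i') = L2_inner (E i) ?W' + L2_inner (E i) (E i')"
    using L2_inner_add_right[OF L(5) L(2) L(6)] YE(2) by simp
  moreover have "L2_inner (Y i) ?W' = L2_inner ?W ?W' + L2_inner (E i) ?W'"
    using L2_inner_add_left[OF L(2) L(1) L(5)] YE(1) by simp
  moreover have "L2_inner (Y i) ?W' = cnj (cdot ?v' (cmom j (Y i)))"
    unfolding W'Y[symmetric] by (simp add: L2_inner_cnj)
  moreover have "L2_inner (Y i) (Y i') = ?\<delta>" using orth i by (simp add: L2_orthonormal_def)
  ultimately have "?\<delta> = cdot ?v (cmom j (Y i')) + cnj (cdot ?v' (cmom j (Y i))) - (pi / 2) *\<^sub>R cdot ?v ?v' + L2_inner (E i) (E i')"
    by (simp add: WY WW)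
  moreover have "cdot ?v (cmom j (Y i')) = (pi / 2) *\<^sub>R cdot ?v ?v' + cdot ?v (cmom j (Y i') - (pi / 2) *\<^sub>R ?v')"
    by (simp add: cdot_diff_right cdot_scaleR_right)
  moreover have "cnj (cdot ?v' (cmom j (Y i))) = (pi / 2) *\<^sub>R cdot ?v ?v' + cnj (cdot ?v' (cmom j (Y i) - (pi / 2) *\<^sub>R ?v))"
    by (simp add: cdot_diff_right cdot_scaleR_right cdot_cnj)
  ultimately have id: "?\<delta> - (pi / 2) *\<^sub>R cdot ?v ?v' = cdot ?v (cmom j (Y i') - (pi / 2) *\<^sub>R ?v')
      + cnj (cdot ?v' (cmom j (Y i) - (pi / 2) *\<^sub>R ?v)) + L2_inner (E i) (E i')" by simp
  have s0: "0 \<le> s" by (simp add: ss_def)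
  have sj: "1 / real j \<le> s" by (simp add: ss_def)
  have b1: "cmod (cdot ?v (cmom j (Y i') - (pi / 2) *\<^sub>R ?v')) \<le> kV R * (kU R * s / real j)"
    by (rule order_trans[OF norm_cdot_le]) (intro mult_mono v cmom_initial[OF n'], use kV1 in auto)
  have b2: "cmod (cnj (cdot ?v' (cmom j (Y i) - (pi / 2) *\<^sub>R ?v))) \<le> kV R * (kU R * s / real j)"
    unfolding complex_mod_cnj
    by (rule order_trans[OF norm_cdot_le]) (intro mult_mono v cmom_initial[OF n], use kV1 in auto)
  have b3: "cmod (L2_inner (E i) (E i')) \<le> (2 * kZ R / real j) * (2 * kZ R / real j)"
    by (rule order_trans[OF norm_L2_inner_le[OF L(5,6)]]) (intro mult_mono E_norm n n', use kZ0 in auto)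
  have "cmod (?\<delta> - (pi / 2) *\<^sub>R cdot ?v ?v') \<le> kV R * (kU R * s / real j) + kV R * (kU R * s / real j) + (2 * kZ R / real j) * (2 * kZ R / real j)"
    unfolding id by (intro norm_triangle_mono b1 b2 b3)
  also have "(2 * kZ R / real j) * (2 * kZ R / real j) = 4 * (kZ R)\<^sup>2 * (1 / real j) / real j"
    by (simp add: power2_eq_square)
  also have "\<dots> \<le> 4 * (kZ R)\<^sup>2 * s / real j"
    using sj j1 by (intro divide_right_mono mult_left_mono) auto
  also have "kV R * (kU R * s / real j) + kV R * (kU R * s / real j) + 4 * (kZ R)\<^sup>2 * s / real j
      = (2 * kV R * kU R + 4 * (kZ R)\<^sup>2) * s / real j"
    by (simp add: add_divide_distrib distrib_right mult.assoc)
  finally have b: "cmod (?\<delta> - (pi / 2) *\<^sub>R cdot ?v ?v') \<le> (2 * kV R * kU R + 4 * (kZ R)\<^sup>2) * s / real j" by simp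
  have "cdot ?v ?v' - (if i = i' then 2 / pi else 0) = - ((2 / pi) *\<^sub>R (?\<delta> - (pi / 2) *\<^sub>R cdot ?v ?v'))"
    by (simp add: scaleR_diff_right scaleR_conv_of_real diff_divide_distrib)
  then have "cmod (cdot ?v ?v' - (if i = i' then 2 / pi else 0)) = 2 / pi * cmod (?\<delta> - (pi / 2) *\<^sub>R cdot ?v ?v')"
    by (simp only: norm_minus_cancel norm_scaleR) simp
  also have "\<dots> \<le> 1 * cmod (?\<delta> - (pi / 2) *\<^sub>R cdot ?v ?v')"
    using pi_gt3 by (intro mult_right_mono) auto
  finally show ?thesis using b by simp
qed

end

subsection \<open>Bounds in terms of \<open>R\<close> and the size of the problem\<close>

lemma l2_norm_le:
  assumes "\<And>F. finite F \<Longrightarrow> F \<subseteq> I \<Longrightarrow> (\<Sum>i\<in>F. (norm (a i))\<^sup>2) \<le> B"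
  shows "in_l2 a I" "l2_norm a I \<le> sqrt B"
proof -
  show s: "in_l2 a I" unfolding in_l2_def
  proof (rule nonneg_bdd_above_summable_on)
    show "bdd_above (sum (\<lambda>i. (norm (a i))\<^sup>2) ` {F. F \<subseteq> I \<and> finite F})"
      by (rule bdd_aboveI[of _ B]) (use assms in auto)
  qed simp
  show "l2_norm a I \<le> sqrt B"
    unfolding l2_norm_def
    by (intro real_sqrt_le_mono infsum_le_finite_sums) (use s assms in \<open>auto simp: in_l2_def\<close>)
qed

lemma norm_le_entries:
  fixes A :: "complex^'n^'n"
  assumes "\<And>k l. cmod (A $ k $ l) \<le> b"
  shows "norm A \<le> (real CARD('n))\<^sup>2 * b"
proof -
  have "norm A \<le> (\<Sum>k\<in>UNIV. norm (A $ k))"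
    unfolding norm_vec_def[of A] by (rule L2_set_le_sum) simp
  also have "\<dots> \<le> (\<Sum>k\<in>(UNIV :: 'n set). \<Sum>l\<in>(UNIV :: 'n set). cmod (A $ k $ l))"
    by (intro sum_mono) (simp add: norm_vec_def L2_set_le_sum)
  also have "\<dots> \<le> (\<Sum>k\<in>(UNIV :: 'n set). \<Sum>l\<in>(UNIV :: 'n set). b)" by (intro sum_mono assms)
  finally show ?thesis by (simp add: power2_eq_square mult.assoc)
qed

lemma op_norm_le_norm: "op_norm (A :: complex^'n^'n) \<le> norm A"
  unfolding op_norm_def by (rule onorm_bound) (simp_all add: norm_matrix_vector_mult_le)

text \<open>The constants are \<open>102 = 3 * (2 + 32)\<close> and \<open>6 = 3 * 2\<close>: the
  square of a three-term sum, the two Bessel bounds and the sum of inverse squares. The argument is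
  shifted because the index \<open>n\<close> belongs to the frequency \<open>n - 1\<close>.\<close>

lemma (in problem) sum_square_bound:
  assumes F: "finite F" "F \<subseteq> {1..}" and n0: "1 \<le> n0" and C1: "0 \<le> C1"
    and x0: "\<And>n. n \<in> F \<Longrightarrow> 0 \<le> x n"
    and small: "\<And>n. n \<in> F \<Longrightarrow> n \<le> n0 \<Longrightarrow> x n \<le> C0"
    and large: "\<And>n. n \<in> F \<Longrightarrow> n0 < n \<Longrightarrow> x n \<le> C1 * ss (n - 1)"
  shows "(\<Sum>n\<in>F. (x n)\<^sup>2) \<le> real n0 * C0\<^sup>2 + C1\<^sup>2 * (102 * R\<^sup>2 + 6)"
proof -
  let ?A = "{n\<in>F. n \<le> n0}" and ?B = "{n\<in>F. n0 < n}" and ?G = "(\<lambda>n. n - 1) ` {n\<in>F. n0 < n}"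
  have split: "F = ?A \<union> ?B" by auto
  have "(\<Sum>n\<in>F. (x n)\<^sup>2) = (\<Sum>n\<in>?A. (x n)\<^sup>2) + (\<Sum>n\<in>?B. (x n)\<^sup>2)"
    using F by (subst split, subst sum.union_disjoint) auto
  moreover have "(\<Sum>n\<in>?A. (x n)\<^sup>2) \<le> real n0 * C0\<^sup>2"
  proof -
    have "(\<Sum>n\<in>?A. (x n)\<^sup>2) \<le> (\<Sum>n\<in>?A. C0\<^sup>2)"
      using x0 small by (intro sum_mono power_mono) auto
    also have "\<dots> = real (card ?A) * C0\<^sup>2" by simp
    also have "card ?A \<le> card {1..n0}" using F by (intro card_mono) auto
    then have "real (card ?A) * C0\<^sup>2 \<le> real n0 * C0\<^sup>2" by (intro mult_right_mono) auto
    finally show ?thesis .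
  qed
  moreover have "(\<Sum>n\<in>?B. (x n)\<^sup>2) \<le> C1\<^sup>2 * (102 * R\<^sup>2 + 6)"
  proof -
    have G: "finite ?G" "?G \<subseteq> {1..}" using F n0 by auto
    have "(\<Sum>n\<in>?B. (x n)\<^sup>2) \<le> (\<Sum>n\<in>?B. C1\<^sup>2 * (ss (n - 1))\<^sup>2)"
    proof (rule sum_mono)
      fix n assume n: "n \<in> ?B"
      then have "(x n)\<^sup>2 \<le> (C1 * ss (n - 1))\<^sup>2" using x0 large by (intro power_mono) auto
      then show "(x n)\<^sup>2 \<le> C1\<^sup>2 * (ss (n - 1))\<^sup>2" by (simp add: power_mult_distrib)
    qed
    also have "\<dots> = (\<Sum>j\<in>?G. C1\<^sup>2 * (ss j)\<^sup>2)"
    proof -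
      have "inj_on (\<lambda>n. n - 1) ?B" by (auto simp: inj_on_def)
      then show ?thesis by (simp add: sum.reindex)
    qed
    also have "\<dots> = C1\<^sup>2 * (\<Sum>j\<in>?G. (ss j)\<^sup>2)" by (simp only: sum_distrib_left)
    also have "(\<Sum>j\<in>?G. (ss j)\<^sup>2) \<le> (\<Sum>j\<in>?G. 3 * ((norm (Qcos j))\<^sup>2 + (norm (Qsin j))\<^sup>2 + 1 / (real j)\<^sup>2))"
    proof (rule sum_mono)
      fix j
      from square_sum3_le[of "norm (Qcos j)" "norm (Qsin j)" "1 / real j"]
      show "(ss j)\<^sup>2 \<le> 3 * ((norm (Qcos j))\<^sup>2 + (norm (Qsin j))\<^sup>2 + 1 / (real j)\<^sup>2)"
        by (simp add: ss_def power_divide)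
    qed
    then have "C1\<^sup>2 * (\<Sum>j\<in>?G. (ss j)\<^sup>2)
        \<le> C1\<^sup>2 * (\<Sum>j\<in>?G. 3 * ((norm (Qcos j))\<^sup>2 + (norm (Qsin j))\<^sup>2 + 1 / (real j)\<^sup>2))"
      by (rule mult_left_mono) simp
    also have "(\<Sum>j\<in>?G. 3 * ((norm (Qcos j))\<^sup>2 + (norm (Qsin j))\<^sup>2 + 1 / (real j)\<^sup>2))
        = 3 * ((\<Sum>j\<in>?G. (norm (Qcos j))\<^sup>2) + (\<Sum>j\<in>?G. (norm (Qsin j))\<^sup>2) + (\<Sum>j\<in>?G. 1 / (real j)\<^sup>2))"
      by (simp only: sum_distrib_left[symmetric] sum.distrib)
    also have "\<dots> \<le> 3 * (2 * R\<^sup>2 + 32 * R\<^sup>2 + 2)"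
    proof (intro mult_left_mono add_mono Qcos_Bessel Qsin_Bessel G)
      have "(\<Sum>j\<in>?G. 1 / (real j)\<^sup>2) \<le> (\<Sum>j=1..Max ?G. 1 / (real j)\<^sup>2)"
        using G by (intro sum_mono2) auto
      also have "\<dots> \<le> 2" by (rule sum_inverse_squares_le_2)
      finally show "(\<Sum>j\<in>?G. 1 / (real j)\<^sup>2) \<le> 2" .
    qed simp
    finally show ?thesis by (simp add: mult_left_mono)
  qed
  ultimately show ?thesis by linarith
qed

definition N0 :: "real \<Rightarrow> real \<Rightarrow> nat" where
  "N0 R m = nat \<lceil>count_threshold R m\<rceil>"

text \<open>Bounds the first remainder for the indices up to \<open>N + 1\<close>, where only the
  size of the eigenvalues is used.\<close>

definition kP :: "real \<Rightarrow> nat \<Rightarrow> real" where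
  "kP R N = (real N + 1) * (2 + kL R + (real N + 1)\<^sup>2 + real N)"

definition kK :: "real \<Rightarrow> real" where "kK R = 2 * kV R * kU R + 4 * (kZ R)\<^sup>2"

section \<open>Blocks of eigenvalues and the square sums of the remainders\<close>

locale ordered_spectral_problem = spectral_problem R Q h H index_J lam Y
  for R :: real and Q :: "real \<Rightarrow> ('n::{finite,linorder}) cmat" and h H :: "'n cmat"
    and lam :: "nat \<times> 'n \<Rightarrow> real" and Y :: "nat \<times> 'n \<Rightarrow> real \<Rightarrow> 'n cvec" +
  fixes n1 :: nat
  assumes n1: "n1 = N0 R (real CARD('n))"
    and mono: "u \<in> index_J \<Longrightarrow> w \<in> index_J \<Longrightarrow> lex_less u w \<Longrightarrow> lam u \<le> lam w"
begin

text \<open>Both sets have the same finite cardinality. If the sublevel set left the block, the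
  ordering would put the whole block and one further index into it, against the count.\<close>

lemma eigenvalue_block:
  assumes N: "n1 \<le> N"
  shows "{u \<in> index_J. lam u < (real N + 1/2)\<^sup>2} = {1..N + 1} \<times> UNIV"
proof -
  let ?S = "{u \<in> index_J. lam u < (real N + 1/2)\<^sup>2}" and ?T = "{1..N + 1} \<times> (UNIV :: 'n set)"
  have "count_threshold R (real CARD('n)) \<le> real N" using N by (simp add: n1 N0_def nat_le_iff ceiling_le_iff)
  note cnt = eigenvalue_count[OF this]
  have card: "card ?S = card ?T" using cnt(2) by (simp add: card_cartesian_product mult.commute)
  show ?thesis
  proof (cases "?S \<subseteq> ?T")
    case True
    then show ?thesis using card by (intro card_subset_eq) auto
  next
    case False
    then obtain u where u: "u \<in> ?S" "u \<notin> ?T" by blast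
    have "?T \<subseteq> ?S"
    proof
      fix w assume w: "w \<in> ?T"
      then have wJ: "w \<in> index_J" by (auto simp: index_J_def)
      have "lex_less w u" using u w by (auto simp: lex_less_def index_J_def)
      then have "lam w \<le> lam u" using mono wJ u by auto
      then show "w \<in> ?S" using u wJ by auto
    qed
    then have "insert u ?T \<subseteq> ?S" using u by auto
    then have "card (insert u ?T) \<le> card ?S" by (rule card_mono[OF cnt(1)])
    then show ?thesis using u(2) card by simp
  qed
qed

lemma small_index_bound:
  assumes "n \<in> {1..n1 + 1}"
  shows "\<bar>lam (n, k)\<bar> \<le> kL R + (real n1 + 1)\<^sup>2"
proof -
  have "(n, k) \<in> {u \<in> index_J. lam u < (real n1 + 1/2)\<^sup>2}"
    unfolding eigenvalue_block[OF order_refl] using assms by simp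
  then have u: "(n, k) \<in> index_J" "lam (n, k) < (real n1 + 1/2)\<^sup>2" by simp_all
  have "(real n1 + 1/2)\<^sup>2 \<le> (real n1 + 1)\<^sup>2" by (intro power_mono) auto
  moreover have "- kL R \<le> lam (n, k)" by (rule eigenvalue_lower_bound[OF bvp[OF u(1)] Y_norm[OF u(1)]])
  moreover have "0 \<le> kL R" by (simp add: kL_def Let_def)
  moreover have "0 \<le> (real n1 + 1)\<^sup>2" by simp
  ultimately show ?thesis using u(2) unfolding abs_le_iff by linarith
qed

text \<open>The index \<open>n\<close> lies in the block for \<open>N = n - 1\<close> but not in the
  one for \<open>N = n - 2\<close>, and the half-integer cutoffs pin the root to within
  \<open>1/2\<close> of \<open>n - 1\<close>. The strict inequality in the hypothesis makes both
  blocks admissible.\<close>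

lemma large_index:
  assumes "n1 + 1 < n"
  shows "eigenvalue_near R Q h H index_J lam Y (n - 1)"
    and "eigenvalue_near.near index_J lam (n - 1) (n, k)"
proof -
  have "real n1 \<ge> count_threshold R (real CARD('n))" by (simp add: n1 N0_def) linarith
  moreover have "count_threshold R (real CARD('n)) \<ge> 1 + 128 * kE R"
    by (simp add: count_threshold_def)
  moreover have "real (n - 1) \<ge> real n1" using assms by simp
  ultimately show ev: "eigenvalue_near R Q h H index_J lam Y (n - 1)"
    by unfold_locales linarith
  have J: "(n, k) \<in> index_J" using assms by (auto simp: index_J_def)
  have N: "n1 \<le> n - 1" "n1 \<le> n - 2" using assms by auto
  have "(n, k) \<in> {u \<in> index_J. lam u < (real (n - 1) + 1/2)\<^sup>2}"
    unfolding eigenvalue_block[OF N(1)] using assms by simp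
  then have up: "lam (n, k) < (real (n - 1) + 1/2)\<^sup>2" by simp
  have "(n, k) \<notin> {u \<in> index_J. lam u < (real (n - 2) + 1/2)\<^sup>2}"
    unfolding eigenvalue_block[OF N(2)] using assms by simp
  then have lo: "(real (n - 2) + 1/2)\<^sup>2 \<le> lam (n, k)" using J by simp
  have r2: "real (n - 2) + 1/2 = real (n - 1) - 1/2" using assms by (auto simp: of_nat_diff)
  have pos: "0 < lam (n, k)" using lo by (rule less_le_trans[rotated]) (simp add: add_nonneg_pos)
  have "sqrt ((real (n - 2) + 1/2)\<^sup>2) \<le> sqrt (lam (n, k))" by (rule real_sqrt_le_mono[OF lo])
  then have 1: "real (n - 1) - 1/2 \<le> sqrt (lam (n, k))" by (simp add: r2[symmetric])
  have "sqrt (lam (n, k)) < sqrt ((real (n - 1) + 1/2)\<^sup>2)" by (rule real_sqrt_less_mono[OF up])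
  then have 2: "sqrt (lam (n, k)) < real (n - 1) + 1/2" by simp
  have "\<bar>sqrt (lam (n, k)) - real (n - 1)\<bar> \<le> 1/2" using 1 2 by linarith
  with J pos show "eigenvalue_near.near index_J lam (n - 1) (n, k)"
    unfolding eigenvalue_near.near_def[OF ev] by blast
qed

text \<open>The expansion is solved for its remainder, so only the size is left to prove. For small
  \<open>n\<close> the value may be complex.\<close>

definition kap :: "nat \<times> 'n \<Rightarrow> complex" where
  "kap u = of_nat (fst u) * (rho lam u - (of_nat (fst u) - 1))"

lemma kap_small:
  assumes n: "n \<in> {1..n1 + 1}"
  shows "cmod (kap (n, k)) \<le> (kP R n1)"
proof -
  let ?l = "lam (n, k)"
  have "cmod (rho lam (n, k)) = sqrt \<bar>?l\<bar>" by (simp add: rho_def norm_csqrt)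
  also have "\<dots> \<le> 1 + \<bar>?l\<bar>"
  proof (rule real_le_lsqrt)
    show "\<bar>?l\<bar> \<le> (1 + \<bar>?l\<bar>)\<^sup>2" by (simp add: power2_sum)
  qed simp_all
  also have "\<dots> \<le> 1 + (kL R + (real n1 + 1)\<^sup>2)" using small_index_bound[OF n] by simp
  finally have r: "cmod (rho lam (n, k)) \<le> 1 + (kL R + (real n1 + 1)\<^sup>2)" .
  have "cmod (of_nat n - 1 :: complex) = real n - 1"
  proof -
    have "(of_nat n - 1 :: complex) = of_nat (n - 1)" using n by (simp add: of_nat_diff)
    then have "cmod (of_nat n - 1 :: complex) = real (n - 1)" by (simp only: norm_of_nat)
    also have "\<dots> = real n - 1" using n by (simp add: of_nat_diff)
    finally show ?thesis .
  qed
  then have "cmod (rho lam (n, k) - (of_nat n - 1)) \<le> 1 + (kL R + (real n1 + 1)\<^sup>2) + real n1"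
    using norm_triangle_ineq4[of "rho lam (n, k)" "of_nat n - 1"] r n by simp
  then have "real n * cmod (rho lam (n, k) - (of_nat n - 1))
      \<le> (real n1 + 1) * (2 + kL R + (real n1 + 1)\<^sup>2 + real n1)"
    using n by (intro mult_mono) auto
  then show ?thesis by (simp add: kap_def kP_def norm_mult)
qed

lemma kap_large:
  assumes n: "n1 + 1 < n"
  shows "cmod (kap (n, k)) \<le> (2 * kD R) * ss (n - 1)"
proof -
  interpret ev: eigenvalue_near R Q h H index_J lam Y "n - 1" by (rule large_index(1)[OF n])
  have near: "ev.near (n, k)" by (rule large_index(2)[OF n])
  have pos: "0 < lam (n, k)" by (rule ev.nearD(2)[OF near])
  have j: "real (n - 1) = real n - 1" "1 \<le> real (n - 1)" using n by (auto simp: of_nat_diff)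
  have s0: "0 \<le> ss (n - 1)" by (simp add: ss_def)
  have "\<bar>sqrt (lam (n, k)) - real (n - 1)\<bar> \<le> kD R * ss (n - 1) / real (n - 1)"
    by (rule ev.near_diff_le[OF near order_trans[OF ev.near_fine[OF near] ev.D_le]])
  then have "real n * \<bar>sqrt (lam (n, k)) - real (n - 1)\<bar> \<le> real n * (kD R * ss (n - 1) / real (n - 1))"
    by (rule mult_left_mono) simp
  also have "\<dots> = (real n / real (n - 1)) * (kD R * ss (n - 1))" by simp
  \<comment> \<open>The expansion divides by \<open>n\<close>, the estimates by
    \<open>n - 1\<close>; as \<open>n \<ge> 2\<close>, the change costs a factor 2.\<close>
  also have "\<dots> \<le> 2 * (kD R * ss (n - 1))"
  proof (rule mult_right_mono)
    show "real n / real (n - 1) \<le> 2" using j by (simp add: divide_le_eq)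
  qed (use kD0 s0 in simp)
  finally have b: "real n * \<bar>sqrt (lam (n, k)) - real (n - 1)\<bar> \<le> 2 * (kD R * ss (n - 1))" .
  have "rho lam (n, k) - (of_nat n - 1) = complex_of_real (sqrt (lam (n, k)) - real (n - 1))"
    using pos j by (simp add: rho_def)
  then have "cmod (rho lam (n, k) - (of_nat n - 1)) = \<bar>sqrt (lam (n, k)) - real (n - 1)\<bar>" by (simp only: norm_of_real)
  then show ?thesis using b by (simp add: kap_def norm_mult)
qed

lemma kap_l2:
  assumes "finite F" "F \<subseteq> index_J"
  shows "(\<Sum>u\<in>F. (cmod (kap u))\<^sup>2)
    \<le> real CARD('n) * (real (n1 + 1) * (kP R n1)\<^sup>2 + (2 * kD R)\<^sup>2 * (102 * R\<^sup>2 + 6))"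
proof -
  define x where "x n = (if n \<le> n1 + 1 then (kP R n1) else (2 * kD R) * ss (n - 1))" for n
  have x: "cmod (kap (n, k)) \<le> x n" if "1 \<le> n" for n k
    using that kap_small[of n k] kap_large[of n k] by (auto simp: x_def)
  have x0: "0 \<le> x n" if "1 \<le> n" for n using x[OF that] norm_ge_zero order_trans by blast
  have fst: "finite (fst ` F)" "fst ` F \<subseteq> {1..}" using assms by (auto simp: index_J_def)
  have "(\<Sum>u\<in>F. (cmod (kap u))\<^sup>2) \<le> (\<Sum>u\<in>F. (x (fst u))\<^sup>2)"
  proof (intro sum_mono power_mono norm_ge_zero)
    fix u assume "u \<in> F"
    then have "1 \<le> fst u" using fst(2) by auto
    from x[OF this, of "snd u"] show "cmod (kap u) \<le> x (fst u)" by simp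
  qed
  \<comment> \<open>The majorant depends on the first component only; enlarging \<open>F\<close> to
    a product leaves a sum over \<open>n\<close> times the dimension.\<close>
  also have "\<dots> \<le> (\<Sum>u\<in>(fst ` F) \<times> (UNIV :: 'n set). (x (fst u))\<^sup>2)"
  proof (intro sum_mono2 finite_cartesian_product fst subsetI)
    show "u \<in> fst ` F \<times> UNIV" if "u \<in> F" for u using that by (simp add: mem_Times_iff)
  qed auto
  also have "\<dots> = (\<Sum>n\<in>fst ` F. \<Sum>k\<in>(UNIV :: 'n set). (x n)\<^sup>2)"
    by (simp only: sum.cartesian_product) (simp add: case_prod_beta)
  also have "\<dots> = real CARD('n) * (\<Sum>n\<in>fst ` F. (x n)\<^sup>2)" by (simp add: sum_distrib_left)
  also have "\<dots> \<le> real CARD('n) * (real (n1 + 1) * (kP R n1)\<^sup>2 + (2 * kD R)\<^sup>2 * (102 * R\<^sup>2 + 6))"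
  proof (intro mult_left_mono sum_square_bound fst)
    show "0 \<le> x n" if "n \<in> fst ` F" for n using that fst(2) by (intro x0) auto
  qed (use kD0 in \<open>auto simp: x_def\<close>)
  finally show ?thesis .
qed

definition Kmat :: "nat \<Rightarrow> 'n cmat" where
  "Kmat n = real n *\<^sub>R (adjoint_mat (V_mat (\<lambda>u. Y u 0) n) ** V_mat (\<lambda>u. Y u 0) n - (2 / pi) *\<^sub>R mat 1)"

lemma Kmat_entry:
  "Kmat n $ k $ l = real n *\<^sub>R (cdot (Y (n, k) 0) (Y (n, l) 0) - (if (n, k) = (n, l) then 2 / pi else 0))"
proof -
  have "(adjoint_mat (V_mat (\<lambda>u. Y u 0) n) ** V_mat (\<lambda>u. Y u 0) n) $ k $ l = cdot (Y (n, k) 0) (Y (n, l) 0)"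
    by (simp add: matrix_matrix_mult_def adjoint_mat_def V_mat_def transpose_def map_matrix_def cdot_def)
  moreover have "((2 / pi) *\<^sub>R mat 1 :: 'n cmat) $ k $ l = (if (n, k) = (n, l) then 2 / pi else 0)"
    by (simp add: mat_def scaleR_conv_of_real[where 'a = complex])
  ultimately show ?thesis unfolding Kmat_def by (simp del: prod.inject)
qed

lemma Kmat_small:
  assumes n: "n \<in> {1..n1 + 1}"
  shows "op_norm (Kmat n) \<le> (real CARD('n))\<^sup>2 * ((real n1 + 1) * ((kV R)\<^sup>2 + 1))"
proof (rule order_trans[OF op_norm_le_norm norm_le_entries])
  fix k l :: 'n
  have J: "(n, k) \<in> index_J" for k :: 'n using n by (auto simp: index_J_def)
  have v: "norm (Y (n, k) 0) \<le> kV R" for k by (rule norm_initial_le[OF Y_sol[OF J] Y_norm[OF J]])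
  have "cmod (cdot (Y (n, k) 0) (Y (n, l) 0)) \<le> kV R * kV R"
    by (rule order_trans[OF norm_cdot_le]) (intro mult_mono v, use kV1 in auto)
  moreover have "cmod (if (n, k) = (n, l) then 2 / pi else 0) \<le> 1" using pi_gt3 by (auto simp: norm_divide)
  ultimately have "cmod (cdot (Y (n, k) 0) (Y (n, l) 0) - (if (n, k) = (n, l) then 2 / pi else 0)) \<le> (kV R)\<^sup>2 + 1"
    unfolding power2_eq_square by (intro order_trans[OF norm_triangle_ineq4] add_mono)
  then have "real n * cmod (cdot (Y (n, k) 0) (Y (n, l) 0) - (if (n, k) = (n, l) then 2 / pi else 0))
      \<le> (real n1 + 1) * ((kV R)\<^sup>2 + 1)"
    using n by (intro mult_mono) auto
  then show "cmod (Kmat n $ k $ l) \<le> (real n1 + 1) * ((kV R)\<^sup>2 + 1)"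
    unfolding Kmat_entry norm_scaleR by simp
qed

lemma Kmat_large:
  assumes n: "n1 + 1 < n"
  shows "op_norm (Kmat n) \<le> ((real CARD('n))\<^sup>2 * (2 * kK R)) * ss (n - 1)"
proof -
  interpret ev: eigenvalue_near R Q h H index_J lam Y "n - 1" by (rule large_index(1)[OF n])
  have near: "ev.near (n, k)" for k by (rule large_index(2)[OF n])
  have j: "real (n - 1) = real n - 1" "1 \<le> real (n - 1)" using n by (auto simp: of_nat_diff)
  have s0: "0 \<le> ss (n - 1)" by (simp add: ss_def)
  have k0: "0 \<le> kK R" using kV1 kU0 by (simp add: kK_def)
  have "cmod (Kmat n $ k $ l) \<le> 2 * kK R * ss (n - 1)" for k l
  proof -
    have "cmod (Kmat n $ k $ l) \<le> real n * (kK R * ss (n - 1) / real (n - 1))"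
      unfolding Kmat_entry norm_scaleR abs_of_nat kK_def
      by (rule mult_left_mono[OF ev.norming_products[OF near near]]) simp
    also have "\<dots> = (real n / real (n - 1)) * (kK R * ss (n - 1))" by simp
    also have "\<dots> \<le> 2 * (kK R * ss (n - 1))"
    proof (rule mult_right_mono)
      show "real n / real (n - 1) \<le> 2" using j by (simp add: divide_le_eq)
    qed (use k0 s0 in simp)
    finally show ?thesis by simp
  qed
  from order_trans[OF op_norm_le_norm norm_le_entries[OF this]] show ?thesis by (simp add: mult.assoc)
qed

lemma Kmat_l2:
  assumes "finite F" "F \<subseteq> {1..}"
  shows "(\<Sum>n\<in>F. (norm (op_norm (Kmat n)))\<^sup>2) \<le> real (n1 + 1) * ((real CARD('n))\<^sup>2 * ((real n1 + 1) * ((kV R)\<^sup>2 + 1)))\<^sup>2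
      + ((real CARD('n))\<^sup>2 * (2 * kK R))\<^sup>2 * (102 * R\<^sup>2 + 6)"
proof -
  have "0 \<le> kK R" using kV1 kU0 by (simp add: kK_def)
  then have "(\<Sum>n\<in>F. (op_norm (Kmat n))\<^sup>2) \<le> real (n1 + 1) * ((real CARD('n))\<^sup>2 * ((real n1 + 1) * ((kV R)\<^sup>2 + 1)))\<^sup>2
      + ((real CARD('n))\<^sup>2 * (2 * kK R))\<^sup>2 * (102 * R\<^sup>2 + 6)"
  proof (intro sum_square_bound assms)
    fix n assume n: "n \<in> F"
    show "0 \<le> op_norm (Kmat n)" by (rule op_norm_nonneg)
    show "op_norm (Kmat n) \<le> (real CARD('n))\<^sup>2 * ((real n1 + 1) * ((kV R)\<^sup>2 + 1))" if "n \<le> n1 + 1"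
      by (rule Kmat_small) (use n that assms in auto)
    show "op_norm (Kmat n) \<le> ((real CARD('n))\<^sup>2 * (2 * kK R)) * ss (n - 1)" if "n1 + 1 < n"
      by (rule Kmat_large[OF that])
  qed auto
  then show ?thesis by simp
qed

end

lemma Riesz_basis_cong: "Riesz_basis f I \<Longrightarrow> (\<And>i. i \<in> I \<Longrightarrow> f i = g i) \<Longrightarrow> Riesz_basis g I"
  unfolding Riesz_basis_def by metis

theorem theorem3p1:
  fixes R :: real
  assumes "R > 0"
  shows "\<exists>\<Omega>>0. \<exists>\<epsilon>>0.
    \<forall>(Q :: real \<Rightarrow> 'n::{finite,linorder} cmat) h H lam v.
      (Q, h, H) \<in> class_PR R \<longrightarrow> spectral_data Q h H lam v \<longrightarrow>
      (\<exists>\<kappa> :: nat \<times> 'n \<Rightarrow> complex. \<exists>K :: nat \<Rightarrow> 'n cmat.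
         (\<forall>n\<ge>1. \<forall>k. rho lam (n, k) = of_nat n - 1 + \<kappa> (n, k) / of_nat n)
         \<and> (\<forall>n\<ge>1. adjoint_mat (V_mat v n) ** V_mat v n
                    = (2 / pi) *\<^sub>R mat 1 + (1 / real n) *\<^sub>R K n)
         \<and> in_l2 \<kappa> index_J \<and> l2_norm \<kappa> index_J \<le> \<Omega>
         \<and> in_l2 (\<lambda>n. op_norm (K n)) {1..} \<and> l2_norm (\<lambda>n. op_norm (K n)) {1..} \<le> \<Omega>)
      \<and> Riesz_basis (cos_system lam v) index_J
      \<and> (\<forall>a :: nat \<times> 'n \<Rightarrow> complex. in_l2 a index_J \<longrightarrow>
           (\<exists>S. L2_has_sum (\<lambda>u x. a u *s cos_system lam v u x) S index_J
                \<and> L2_norm S \<ge> \<epsilon> * l2_norm a index_J))"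
proof -
  \<comment> \<open>All constants are fixed before \<open>Q\<close>, \<open>h\<close>,
    \<open>H\<close> and the spectral data, so they depend only on \<open>R\<close> and the
    dimension.\<close>
  define N where "N = N0 R (real CARD('n))"
  define B1 where "B1 = real CARD('n) * (real (N + 1) * (kP R N)\<^sup>2 + (2 * kD R)\<^sup>2 * (102 * R\<^sup>2 + 6))"
  define B2 where "B2 = real (N + 1) * ((real CARD('n))\<^sup>2 * ((real N + 1) * ((kV R)\<^sup>2 + 1)))\<^sup>2
      + ((real CARD('n))\<^sup>2 * (2 * kK R))\<^sup>2 * (102 * R\<^sup>2 + 6)"
  define \<Omega> where "\<Omega> = 1 + sqrt B1 + sqrt B2"
  \<comment> \<open>The lower bound \<open>w0\<close> of the weight on the interval, halved as in
    \<open>W_sum_lower\<close>.\<close>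
  define \<epsilon> where "\<epsilon> = exp (- (cw R * pi)) / 2"
  have B: "0 \<le> B1" "0 \<le> B2" by (simp_all add: B1_def B2_def)
  have \<Omega>: "sqrt B1 \<le> \<Omega>" "sqrt B2 \<le> \<Omega>" "0 < \<Omega>" using B by (simp_all add: \<Omega>_def add_pos_nonneg)
  have main: "(\<exists>\<kappa> :: nat \<times> 'n \<Rightarrow> complex. \<exists>K :: nat \<Rightarrow> 'n cmat.
         (\<forall>n\<ge>1. \<forall>k. rho lam (n, k) = of_nat n - 1 + \<kappa> (n, k) / of_nat n)
         \<and> (\<forall>n\<ge>1. adjoint_mat (V_mat v n) ** V_mat v n
                    = (2 / pi) *\<^sub>R mat 1 + (1 / real n) *\<^sub>R K n)
         \<and> in_l2 \<kappa> index_J \<and> l2_norm \<kappa> index_J \<le> \<Omega>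
         \<and> in_l2 (\<lambda>n. op_norm (K n)) {1..} \<and> l2_norm (\<lambda>n. op_norm (K n)) {1..} \<le> \<Omega>)
      \<and> Riesz_basis (cos_system lam v) index_J
      \<and> (\<forall>a :: nat \<times> 'n \<Rightarrow> complex. in_l2 a index_J \<longrightarrow>
           (\<exists>S. L2_has_sum (\<lambda>u x. a u *s cos_system lam v u x) S index_J
                \<and> L2_norm S \<ge> \<epsilon> * l2_norm a index_J))"
    if P: "(Q, h, H) \<in> class_PR R" and sd: "spectral_data Q h H lam v"
    for Q :: "real \<Rightarrow> 'n cmat" and h H lam v
  proof -
    obtain Y where onb: "L2_orthonormal_basis Y index_J"
      and Y: "\<forall>u\<in>index_J. eigenfunction Q h H (complex_of_real (lam u)) (Y u) \<and> v u = Y u 0"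
      using sd unfolding spectral_data_def by blast
    interpret sp: ordered_spectral_problem R Q h H lam Y N
    proof
      show "(Q, h, H) \<in> class_PR R" by (rule P)
      show "L2_orthonormal_basis Y index_J" by (rule onb)
      show "bvp_solution Q h H (complex_of_real (lam u)) (Y u)" if "u \<in> index_J" for u
        using Y that by (simp add: eigenfunction_def)
      show "N = N0 R (real CARD('n))" by (rule N_def)
      show "lam u \<le> lam w" if "u \<in> index_J" "w \<in> index_J" "lex_less u w" for u w
        using sd that unfolding spectral_data_def eigenvalue_numbering_def by blast
    qed
    have V: "V_mat v n = V_mat (\<lambda>u. Y u 0) n" if "1 \<le> n" for n
      using Y that by (simp add: V_mat_def vec_eq_iff index_J_def)
    have "rho lam (n, k) = of_nat n - 1 + sp.kap (n, k) / of_nat n" if "1 \<le> n" for n k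
      using that by (simp add: sp.kap_def)
    moreover have "adjoint_mat (V_mat v n) ** V_mat v n = (2 / pi) *\<^sub>R mat 1 + (1 / real n) *\<^sub>R sp.Kmat n"
      if "1 \<le> n" for n
      using that by (simp add: V[OF that] sp.Kmat_def)
    moreover have "in_l2 sp.kap index_J" "l2_norm sp.kap index_J \<le> \<Omega>"
    proof -
      note l2 = l2_norm_le[of index_J sp.kap B1, OF sp.kap_l2[folded B1_def]]
      show "in_l2 sp.kap index_J" by (rule l2(1))
      show "l2_norm sp.kap index_J \<le> \<Omega>" by (rule order_trans[OF l2(2) \<Omega>(1)])
    qed
    moreover have "in_l2 (\<lambda>n. op_norm (sp.Kmat n)) {1..}" "l2_norm (\<lambda>n. op_norm (sp.Kmat n)) {1..} \<le> \<Omega>"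
    proof -
      note l2 = l2_norm_le[of "{1..}" "\<lambda>n. op_norm (sp.Kmat n)" B2, OF sp.Kmat_l2[folded B2_def]]
      show "in_l2 (\<lambda>n. op_norm (sp.Kmat n)) {1..}" by (rule l2(1))
      show "l2_norm (\<lambda>n. op_norm (sp.Kmat n)) {1..} \<le> \<Omega>" by (rule order_trans[OF l2(2) \<Omega>(2)])
    qed
    ultimately have part1: "\<exists>\<kappa> :: nat \<times> 'n \<Rightarrow> complex. \<exists>K :: nat \<Rightarrow> 'n cmat.
         (\<forall>n\<ge>1. \<forall>k. rho lam (n, k) = of_nat n - 1 + \<kappa> (n, k) / of_nat n)
         \<and> (\<forall>n\<ge>1. adjoint_mat (V_mat v n) ** V_mat v n
                    = (2 / pi) *\<^sub>R mat 1 + (1 / real n) *\<^sub>R K n)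
         \<and> in_l2 \<kappa> index_J \<and> l2_norm \<kappa> index_J \<le> \<Omega>
         \<and> in_l2 (\<lambda>n. op_norm (K n)) {1..} \<and> l2_norm (\<lambda>n. op_norm (K n)) {1..} \<le> \<Omega>"
      by blast
    interpret wc: weighted_close_systems index_J Y "\<lambda>u x. cosl (lam u) x *\<^sub>R Y u 0"
      "\<lambda>x. exp (- (cw R * x))" "exp (- (cw R * pi))"
      by (rule sp.cosine_system_close[OF onb sp.Y_sol])
    have cs: "(\<lambda>x. cosl (lam u) x *\<^sub>R Y u 0) = cos_system lam v u" if "u \<in> index_J" for u
      using Y that by (simp add: cos_system_eq)
    have part2: "Riesz_basis (cos_system lam v) index_J"
      by (rule Riesz_basis_cong[OF wc.W_Riesz_basis cs])
    have part3: "\<exists>S. L2_has_sum (\<lambda>u x. a u *s cos_system lam v u x) S index_J \<and> L2_norm S \<ge> \<epsilon> * l2_norm a index_J"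
      if a: "in_l2 a index_J" for a :: "nat \<times> 'n \<Rightarrow> complex"
    proof -
      obtain S where S: "L2_has_sum (\<lambda>u x. a u *s (cosl (lam u) x *\<^sub>R Y u 0)) S index_J"
        by (rule wc.W_has_sum[OF a])
      have "L2_has_sum (\<lambda>u x. a u *s cos_system lam v u x) S index_J"
        by (rule L2_has_sum_cong[OF S]) (simp add: cs[symmetric])
      moreover have "\<epsilon> * l2_norm a index_J \<le> L2_norm S"
        using wc.W_has_sum_lower[OF a S] by (simp add: \<epsilon>_def)
      ultimately show ?thesis by blast
    qed
    show ?thesis using part1 part2 part3 by blast
  qed
  have "0 < \<epsilon>" by (simp add: \<epsilon>_def)
  with \<Omega>(3) main show ?thesis by blast
qed

end
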